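(* The category $\langle\text{ModSch}\rangle$ is a bicomplete, locally small and abelian category. Moreover, $\langle\text{ModSch}\rangle$ is the smallest full subcategory of the category of $\mathcal R$-modules that contains $\mathcal R$ and is stable under kernels, cokernels, colimits, limits and isomorphisms (that is, if an $\mathcal R$-module is isomorphic to an object of the subcategory then it belongs to the subcategory).
   Context: $R$ is an associative ring with unit; "$R$-module" means left $R$-module. An $\mathcal R$-module is a covariant additive functor from the category of left $R$-modules to the category of abelian groups; morphisms are natural transformations. Kernels, cokernels, direct sums, limits and colimits (indexed by sets / small categories) of $\mathcal R$-modules, and exactness, are taken objectwise. The $\mathcal R$-module $\mathcal R$ is the functor $N\mapsto R\otimes_RN=N$. For an $R$-module $N$, the module scheme $\mathcal N^*$ is the $\mathcal R$-module $\mathrm{Hom}_R(N,-)$. $\langle\text{ModSch}\rangle$ is the full subcategory of the category of $\mathcal R$-modules whose objects are those $\mathcal R$-modules $\mathbb M$ for which there exist sets $I,J$, $R$-modules $N_i$ ($i\in I$), $N_j$ ($j\in J$) and an exact sequence of $\mathcal R$-module morphisms $\bigoplus_{i\in I}\mathcal N_i^*\to\bigoplus_{j\in J}\mathcal N_j^*\to\mathbb M\to0$. *)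

theory Defs
  imports "HOL-Algebra.Module" "HOL-Algebra.Product_Groups"
begin

unbundle cardinal_syntax

section \<open>Universes\<close>

text \<open>The category of all \<open>R\<close>-modules, and functors on it, are proper classes.  We work relative to
  a universe: a type \<open>'u\<close> whose cardinality \<open>\<kappa>\<close> is an infinite regular strong limit cardinal.
  A set is small if it has fewer than \<open>\<kappa>\<close> elements.  Up to bijection these are exactly the sets in
  the Grothendieck universe of sets of hereditary cardinality below \<open>\<kappa>\<close>, and each of them is in
  bijection with a subset of \<open>'u\<close>.  The usual case is \<open>\<kappa>\<close> uncountable, that is, strongly
  inaccessible; the countable case (small = finite) is not excluded.\<close>

definition small :: "'u itself \<Rightarrow> 'a set \<Rightarrow> bool" where
  "small u A \<longleftrightarrow> |A| <o |UNIV :: 'u set|"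

definition universe :: "'u itself \<Rightarrow> bool" where
  "universe u \<longleftrightarrow>
     infinite (UNIV :: 'u set) \<and>
     (\<forall>A :: 'u set. small u A \<longrightarrow> small u (Pow A)) \<and>
     (\<forall>(A :: 'u set) (F :: 'u \<Rightarrow> 'u set).
        small u A \<and> (\<forall>a\<in>A. small u (F a)) \<longrightarrow> small u (\<Union>a\<in>A. F a))"

lemma small_nat_iff: "small TYPE(nat) A \<longleftrightarrow> finite A"
  unfolding small_def finite_iff_ordLess_natLeq
  using card_of_nat ordIso_symmetric ordLess_ordIso_trans by blast

lemma universe_nat: "universe TYPE(nat)"
  unfolding universe_def small_nat_iff by simp


section \<open>Categories\<close>

text \<open>\<open>cmp C X Y Z g f\<close> is the composite of \<open>f : X \<rightarrow> Y\<close> followed by \<open>g : Y \<rightarrow> Z\<close>.\<close>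

record ('o, 'm) cat =
  objs :: "'o set"
  homs :: "'o \<Rightarrow> 'o \<Rightarrow> 'm set"
  ident :: "'o \<Rightarrow> 'm"
  cmp :: "'o \<Rightarrow> 'o \<Rightarrow> 'o \<Rightarrow> 'm \<Rightarrow> 'm \<Rightarrow> 'm"

definition category :: "('o, 'm) cat \<Rightarrow> bool" where
  "category C \<longleftrightarrow>
     (\<forall>X\<in>objs C. ident C X \<in> homs C X X) \<and>
     (\<forall>X\<in>objs C. \<forall>Y\<in>objs C. \<forall>Z\<in>objs C. \<forall>f\<in>homs C X Y. \<forall>g\<in>homs C Y Z.
        cmp C X Y Z g f \<in> homs C X Z) \<and>
     (\<forall>X\<in>objs C. \<forall>Y\<in>objs C. \<forall>f\<in>homs C X Y.
        cmp C X X Y f (ident C X) = f \<and> cmp C X Y Y (ident C Y) f = f) \<and>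
     (\<forall>W\<in>objs C. \<forall>X\<in>objs C. \<forall>Y\<in>objs C. \<forall>Z\<in>objs C.
        \<forall>f\<in>homs C W X. \<forall>g\<in>homs C X Y. \<forall>h\<in>homs C Y Z.
        cmp C W X Z (cmp C X Y Z h g) f = cmp C W Y Z h (cmp C W X Y g f))"

definition opposite :: "('o, 'm) cat \<Rightarrow> ('o, 'm) cat" where
  "opposite C = \<lparr>objs = objs C, homs = (\<lambda>X Y. homs C Y X), ident = ident C,
                 cmp = (\<lambda>X Y Z g f. cmp C Z Y X f g)\<rparr>"

definition full_subcat :: "('o, 'm) cat \<Rightarrow> 'o set \<Rightarrow> ('o, 'm) cat" where
  "full_subcat C P = C\<lparr>objs := P\<rparr>"

record ('o, 'm, 'p, 'n) ftr =
  on_obj :: "'o \<Rightarrow> 'p"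
  on_mor :: "'o \<Rightarrow> 'o \<Rightarrow> 'm \<Rightarrow> 'n"

definition is_functor :: "('o, 'm) cat \<Rightarrow> ('p, 'n) cat \<Rightarrow> ('o, 'm, 'p, 'n) ftr \<Rightarrow> bool" where
  "is_functor C D F \<longleftrightarrow>
     (\<forall>X\<in>objs C. on_obj F X \<in> objs D) \<and>
     (\<forall>X\<in>objs C. \<forall>Y\<in>objs C. \<forall>f\<in>homs C X Y. on_mor F X Y f \<in> homs D (on_obj F X) (on_obj F Y)) \<and>
     (\<forall>X\<in>objs C. on_mor F X X (ident C X) = ident D (on_obj F X)) \<and>
     (\<forall>X\<in>objs C. \<forall>Y\<in>objs C. \<forall>Z\<in>objs C. \<forall>f\<in>homs C X Y. \<forall>g\<in>homs C Y Z.
        on_mor F X Z (cmp C X Y Z g f) =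
        cmp D (on_obj F X) (on_obj F Y) (on_obj F Z) (on_mor F Y Z g) (on_mor F X Y f))"

definition op_ftr :: "('o, 'm, 'p, 'n) ftr \<Rightarrow> ('o, 'm, 'p, 'n) ftr" where
  "op_ftr F = \<lparr>on_obj = on_obj F, on_mor = (\<lambda>X Y. on_mor F Y X)\<rparr>"

definition isomorphic :: "('o, 'm) cat \<Rightarrow> 'o \<Rightarrow> 'o \<Rightarrow> bool" where
  "isomorphic C X Y \<longleftrightarrow>
     (\<exists>f\<in>homs C X Y. \<exists>g\<in>homs C Y X. cmp C X Y X g f = ident C X \<and> cmp C Y X Y f g = ident C Y)"

definition locally_small :: "'u itself \<Rightarrow> ('o, 'm) cat \<Rightarrow> bool" where
  "locally_small u C \<longleftrightarrow> (\<forall>X\<in>objs C. \<forall>Y\<in>objs C. small u (homs C X Y))"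

text \<open>Every small category is isomorphic to one whose objects and morphisms are taken from \<open>'u\<close>.\<close>

definition small_category :: "('u, 'u) cat \<Rightarrow> bool" where
  "small_category J \<longleftrightarrow> category J \<and> small TYPE('u) (objs J) \<and> locally_small TYPE('u) J"


subsection \<open>Limits and colimits\<close>

definition is_cone ::
    "('o, 'm) cat \<Rightarrow> ('j, 'k) cat \<Rightarrow> ('j, 'k, 'o, 'm) ftr \<Rightarrow> 'o \<Rightarrow> ('j \<Rightarrow> 'm) \<Rightarrow> bool" where
  "is_cone C J D L \<pi> \<longleftrightarrow>
     L \<in> objs C \<and>
     (\<forall>j\<in>objs J. \<pi> j \<in> homs C L (on_obj D j)) \<and>
     (\<forall>i\<in>objs J. \<forall>j\<in>objs J. \<forall>f\<in>homs J i j.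
        cmp C L (on_obj D i) (on_obj D j) (on_mor D i j f) (\<pi> i) = \<pi> j)"

definition is_limit ::
    "('o, 'm) cat \<Rightarrow> ('j, 'k) cat \<Rightarrow> ('j, 'k, 'o, 'm) ftr \<Rightarrow> 'o \<Rightarrow> ('j \<Rightarrow> 'm) \<Rightarrow> bool" where
  "is_limit C J D L \<pi> \<longleftrightarrow>
     is_cone C J D L \<pi> \<and>
     (\<forall>X \<xi>. is_cone C J D X \<xi> \<longrightarrow>
        (\<exists>!u. u \<in> homs C X L \<and> (\<forall>j\<in>objs J. cmp C X L (on_obj D j) (\<pi> j) u = \<xi> j)))"

definition is_cocone ::
    "('o, 'm) cat \<Rightarrow> ('j, 'k) cat \<Rightarrow> ('j, 'k, 'o, 'm) ftr \<Rightarrow> 'o \<Rightarrow> ('j \<Rightarrow> 'm) \<Rightarrow> bool" where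
  "is_cocone C J D = is_cone (opposite C) (opposite J) (op_ftr D)"

definition is_colimit ::
    "('o, 'm) cat \<Rightarrow> ('j, 'k) cat \<Rightarrow> ('j, 'k, 'o, 'm) ftr \<Rightarrow> 'o \<Rightarrow> ('j \<Rightarrow> 'm) \<Rightarrow> bool" where
  "is_colimit C J D = is_limit (opposite C) (opposite J) (op_ftr D)"

definition bicomplete :: "'u itself \<Rightarrow> ('o, 'm) cat \<Rightarrow> bool" where
  "bicomplete u C \<longleftrightarrow>
     (\<forall>(J :: ('u, 'u) cat) D. small_category J \<and> is_functor J C D \<longrightarrow>
        (\<exists>L \<pi>. is_limit C J D L \<pi>) \<and> (\<exists>L \<iota>. is_colimit C J D L \<iota>))"


subsection \<open>Abelian categories\<close>

definition zero_object :: "('o, 'm) cat \<Rightarrow> 'o \<Rightarrow> bool" where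
  "zero_object C Z \<longleftrightarrow>
     Z \<in> objs C \<and> (\<forall>X\<in>objs C. (\<exists>!f. f \<in> homs C X Z) \<and> (\<exists>!f. f \<in> homs C Z X))"

definition zero_mor :: "('o, 'm) cat \<Rightarrow> 'o \<Rightarrow> 'o \<Rightarrow> 'm \<Rightarrow> bool" where
  "zero_mor C X Y f \<longleftrightarrow>
     (\<exists>Z. zero_object C Z \<and> (\<exists>g\<in>homs C X Z. \<exists>h\<in>homs C Z Y. f = cmp C X Z Y h g))"

text \<open>\<open>k : K \<rightarrow> X\<close> is a kernel of \<open>f : X \<rightarrow> Y\<close>, respectively \<open>q : Y \<rightarrow> Q\<close> a cokernel.\<close>

definition is_kernel :: "('o, 'm) cat \<Rightarrow> 'o \<Rightarrow> 'o \<Rightarrow> 'm \<Rightarrow> 'o \<Rightarrow> 'm \<Rightarrow> bool" where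
  "is_kernel C X Y f K k \<longleftrightarrow>
     K \<in> objs C \<and> k \<in> homs C K X \<and> zero_mor C K Y (cmp C K X Y f k) \<and>
     (\<forall>T\<in>objs C. \<forall>t\<in>homs C T X. zero_mor C T Y (cmp C T X Y f t) \<longrightarrow>
        (\<exists>!u. u \<in> homs C T K \<and> cmp C T K X k u = t))"

definition is_cokernel :: "('o, 'm) cat \<Rightarrow> 'o \<Rightarrow> 'o \<Rightarrow> 'm \<Rightarrow> 'o \<Rightarrow> 'm \<Rightarrow> bool" where
  "is_cokernel C X Y f Q q \<longleftrightarrow> is_kernel (opposite C) Y X f Q q"

definition is_mono :: "('o, 'm) cat \<Rightarrow> 'o \<Rightarrow> 'o \<Rightarrow> 'm \<Rightarrow> bool" where
  "is_mono C X Y f \<longleftrightarrow>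
     f \<in> homs C X Y \<and>
     (\<forall>T\<in>objs C. \<forall>g\<in>homs C T X. \<forall>h\<in>homs C T X. cmp C T X Y f g = cmp C T X Y f h \<longrightarrow> g = h)"

definition is_epi :: "('o, 'm) cat \<Rightarrow> 'o \<Rightarrow> 'o \<Rightarrow> 'm \<Rightarrow> bool" where
  "is_epi C X Y f \<longleftrightarrow> is_mono (opposite C) Y X f"

definition preadditive :: "('o, 'm) cat \<Rightarrow> ('o \<Rightarrow> 'o \<Rightarrow> 'm monoid) \<Rightarrow> bool" where
  "preadditive C A \<longleftrightarrow>
     (\<forall>X\<in>objs C. \<forall>Y\<in>objs C. comm_group (A X Y) \<and> carrier (A X Y) = homs C X Y) \<and>
     (\<forall>X\<in>objs C. \<forall>Y\<in>objs C. \<forall>Z\<in>objs C.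
        \<forall>f\<in>homs C X Y. \<forall>f'\<in>homs C X Y. \<forall>g\<in>homs C Y Z. \<forall>g'\<in>homs C Y Z.
        cmp C X Y Z g (f \<otimes>\<^bsub>A X Y\<^esub> f') = cmp C X Y Z g f \<otimes>\<^bsub>A X Z\<^esub> cmp C X Y Z g f' \<and>
        cmp C X Y Z (g \<otimes>\<^bsub>A Y Z\<^esub> g') f = cmp C X Y Z g f \<otimes>\<^bsub>A X Z\<^esub> cmp C X Y Z g' f)"

definition has_biproduct :: "('o, 'm) cat \<Rightarrow> ('o \<Rightarrow> 'o \<Rightarrow> 'm monoid) \<Rightarrow> 'o \<Rightarrow> 'o \<Rightarrow> bool" where
  "has_biproduct C A X Y \<longleftrightarrow>
     (\<exists>B\<in>objs C. \<exists>i\<in>homs C X B. \<exists>j\<in>homs C Y B. \<exists>p\<in>homs C B X. \<exists>q\<in>homs C B Y.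
        cmp C X B X p i = ident C X \<and> cmp C Y B Y q j = ident C Y \<and>
        cmp C X B Y q i = \<one>\<^bsub>A X Y\<^esub> \<and> cmp C Y B X p j = \<one>\<^bsub>A Y X\<^esub> \<and>
        cmp C B X B i p \<otimes>\<^bsub>A B B\<^esub> cmp C B Y B j q = ident C B)"

definition additive_category :: "('o, 'm) cat \<Rightarrow> bool" where
  "additive_category C \<longleftrightarrow>
     category C \<and> (\<exists>Z. zero_object C Z) \<and>
     (\<exists>A. preadditive C A \<and> (\<forall>X\<in>objs C. \<forall>Y\<in>objs C. has_biproduct C A X Y))"

definition abelian_category :: "('o, 'm) cat \<Rightarrow> bool" where
  "abelian_category C \<longleftrightarrow>
     additive_category C \<and>
     (\<forall>X\<in>objs C. \<forall>Y\<in>objs C. \<forall>f\<in>homs C X Y.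
        (\<exists>K k. is_kernel C X Y f K k) \<and> (\<exists>Q q. is_cokernel C X Y f Q q)) \<and>
     (\<forall>X\<in>objs C. \<forall>Y\<in>objs C. \<forall>f. is_mono C X Y f \<longrightarrow>
        (\<exists>Z\<in>objs C. \<exists>g\<in>homs C Y Z. is_kernel C Y Z g X f)) \<and>
     (\<forall>X\<in>objs C. \<forall>Y\<in>objs C. \<forall>f. is_epi C X Y f \<longrightarrow>
        (\<exists>W\<in>objs C. \<exists>g\<in>homs C W X. is_cokernel C W X g Y f))"


section \<open>Abelian groups and left modules\<close>

text \<open>Homomorphisms are taken extensional (\<open>undefined\<close> off the carrier), so that equality of
  morphisms is equality on the carrier.\<close>

definition group_homs :: "('a, 'c) monoid_scheme \<Rightarrow> ('b, 'd) monoid_scheme \<Rightarrow> ('a \<Rightarrow> 'b) set" where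
  "group_homs G H = hom G H \<inter> extensional (carrier G)"

definition Ab :: "('u monoid, 'u \<Rightarrow> 'u) cat" where
  "Ab = \<lparr>objs = {G. comm_group G \<and> small TYPE('u) (carrier G)},
         homs = group_homs,
         ident = (\<lambda>G. \<lambda>x\<in>carrier G. x),
         cmp = (\<lambda>G H K g f. compose (carrier G) g f)\<rparr>"

text \<open>The locale \<open>module\<close> of HOL-Algebra requires a commutative base ring.  The fields
  \<open>mult\<close> and \<open>one\<close> of the module record play no role.\<close>

locale left_module = R?: ring R + M?: abelian_group M
  for R :: "('r, 'b) ring_scheme" (structure) and M :: "('r, 'a) module" (structure) +
  assumes smult_closed:
      "\<lbrakk>a \<in> carrier R; x \<in> carrier M\<rbrakk> \<Longrightarrow> a \<odot>\<^bsub>M\<^esub> x \<in> carrier M"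
    and smult_l_distr:
      "\<lbrakk>a \<in> carrier R; b \<in> carrier R; x \<in> carrier M\<rbrakk> \<Longrightarrow>
       (a \<oplus>\<^bsub>R\<^esub> b) \<odot>\<^bsub>M\<^esub> x = a \<odot>\<^bsub>M\<^esub> x \<oplus>\<^bsub>M\<^esub> b \<odot>\<^bsub>M\<^esub> x"
    and smult_r_distr:
      "\<lbrakk>a \<in> carrier R; x \<in> carrier M; y \<in> carrier M\<rbrakk> \<Longrightarrow>
       a \<odot>\<^bsub>M\<^esub> (x \<oplus>\<^bsub>M\<^esub> y) = a \<odot>\<^bsub>M\<^esub> x \<oplus>\<^bsub>M\<^esub> a \<odot>\<^bsub>M\<^esub> y"
    and smult_assoc:
      "\<lbrakk>a \<in> carrier R; b \<in> carrier R; x \<in> carrier M\<rbrakk> \<Longrightarrow>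
       (a \<otimes>\<^bsub>R\<^esub> b) \<odot>\<^bsub>M\<^esub> x = a \<odot>\<^bsub>M\<^esub> (b \<odot>\<^bsub>M\<^esub> x)"
    and smult_one:
      "x \<in> carrier M \<Longrightarrow> \<one>\<^bsub>R\<^esub> \<odot>\<^bsub>M\<^esub> x = x"

definition module_homs ::
    "('r, 'b) ring_scheme \<Rightarrow> ('r, 'u) module \<Rightarrow> ('r, 'u) module \<Rightarrow> ('u \<Rightarrow> 'u) set" where
  "module_homs R M N =
     {f \<in> group_homs (add_monoid M) (add_monoid N).
        \<forall>a\<in>carrier R. \<forall>x\<in>carrier M. f (a \<odot>\<^bsub>M\<^esub> x) = a \<odot>\<^bsub>N\<^esub> f x}"

definition RMod :: "('r, 'b) ring_scheme \<Rightarrow> (('r, 'u) module, 'u \<Rightarrow> 'u) cat" where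
  "RMod R = \<lparr>objs = {M. left_module R M \<and> small TYPE('u) (carrier M)},
             homs = module_homs R,
             ident = (\<lambda>M. \<lambda>x\<in>carrier M. x),
             cmp = (\<lambda>L M N g f. compose (carrier L) g f)\<rparr>"


section \<open>\<open>\<R>\<close>-modules\<close>

text \<open>Functors from left \<open>R\<close>-modules to groups with elements of type \<open>'g\<close>.  Objects of the
  category of \<open>\<R>\<close>-modules have \<open>'g = 'u\<close>.  The functors \<open>Hom(N, -)\<close> and their direct sums have
  function spaces as \<open>'g\<close>, so morphisms are defined for arbitrary source and target \<open>'g\<close>, \<open>'h\<close>.\<close>

type_synonym ('r, 'u, 'g) group_ftr = "(('r, 'u) module, 'u \<Rightarrow> 'u, 'g monoid, 'g \<Rightarrow> 'g) ftr"

type_synonym ('r, 'u) ftr_cat =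
  "(('r, 'u, 'u) group_ftr, ('r, 'u) module \<Rightarrow> 'u \<Rightarrow> 'u) cat"

definition additive_ftr :: "('r, 'b) ring_scheme \<Rightarrow> ('r, 'u, 'g) group_ftr \<Rightarrow> bool" where
  "additive_ftr R F \<longleftrightarrow>
     (\<forall>S\<in>objs (RMod R). \<forall>T\<in>objs (RMod R). \<forall>f\<in>homs (RMod R) S T. \<forall>g\<in>homs (RMod R) S T.
        \<forall>x\<in>carrier (on_obj F S).
        on_mor F S T (\<lambda>s\<in>carrier S. f s \<oplus>\<^bsub>T\<^esub> g s) x =
        on_mor F S T f x \<otimes>\<^bsub>on_obj F T\<^esub> on_mor F S T g x)"

definition nat_trans ::
    "('r, 'b) ring_scheme \<Rightarrow> ('r, 'u, 'g) group_ftr \<Rightarrow> ('r, 'u, 'h) group_ftr \<Rightarrow>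
     (('r, 'u) module \<Rightarrow> 'g \<Rightarrow> 'h) set" where
  "nat_trans R F G =
     {\<alpha> \<in> extensional (objs (RMod R)).
        (\<forall>S\<in>objs (RMod R). \<alpha> S \<in> group_homs (on_obj F S) (on_obj G S)) \<and>
        (\<forall>S\<in>objs (RMod R). \<forall>T\<in>objs (RMod R). \<forall>f\<in>homs (RMod R) S T. \<forall>x\<in>carrier (on_obj F S).
           \<alpha> T (on_mor F S T f x) = on_mor G S T f (\<alpha> S x))}"

definition RR_Mod :: "('r, 'b) ring_scheme \<Rightarrow> ('r, 'u) ftr_cat" where
  "RR_Mod R = \<lparr>objs = {F. is_functor (RMod R) Ab F \<and> additive_ftr R F},
               homs = nat_trans R,
               ident = (\<lambda>F. \<lambda>S\<in>objs (RMod R). \<lambda>x\<in>carrier (on_obj F S). x),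
               cmp = (\<lambda>F G H \<beta> \<alpha>. \<lambda>S\<in>objs (RMod R). compose (carrier (on_obj F S)) (\<beta> S) (\<alpha> S))\<rparr>"

text \<open>The \<open>\<R>\<close>-module \<open>\<R>\<close>, i.e. \<open>N \<mapsto> R \<otimes>\<^sub>R N = N\<close>.\<close>

definition RR :: "('r, 'u, 'u) group_ftr" where
  "RR = \<lparr>on_obj = (\<lambda>S. monoid.truncate (add_monoid S)), on_mor = (\<lambda>S T f. f)\<rparr>"

text \<open>The module scheme \<open>Hom\<^sub>R(N, -)\<close>.\<close>

definition mod_scheme ::
    "('r, 'b) ring_scheme \<Rightarrow> ('r, 'u) module \<Rightarrow> ('r, 'u, 'u \<Rightarrow> 'u) group_ftr" where
  "mod_scheme R N =
     \<lparr>on_obj = (\<lambda>S. \<lparr>carrier = homs (RMod R) N S,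
                     monoid.mult = (\<lambda>f g. \<lambda>x\<in>carrier N. f x \<oplus>\<^bsub>S\<^esub> g x),
                     one = (\<lambda>x\<in>carrier N. \<zero>\<^bsub>S\<^esub>)\<rparr>),
      on_mor = (\<lambda>S T f. \<lambda>h\<in>homs (RMod R) N S. cmp (RMod R) N S T f h)\<rparr>"

definition direct_sum :: "'i set \<Rightarrow> ('i \<Rightarrow> ('r, 'u, 'g) group_ftr) \<Rightarrow> ('r, 'u, 'i \<Rightarrow> 'g) group_ftr" where
  "direct_sum I F =
     \<lparr>on_obj = (\<lambda>S. sum_group I (\<lambda>i. on_obj (F i) S)),
      on_mor = (\<lambda>S T f. \<lambda>x\<in>carrier (sum_group I (\<lambda>i. on_obj (F i) S)).
                  \<lambda>i\<in>I. on_mor (F i) S T f (x i))\<rparr>"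

text \<open>Exactness of \<open>F \<rightarrow> G \<rightarrow> H \<rightarrow> 0\<close>, objectwise.\<close>

definition right_exact_seq ::
    "('r, 'b) ring_scheme \<Rightarrow> ('r, 'u, 'f) group_ftr \<Rightarrow> ('r, 'u, 'g) group_ftr \<Rightarrow>
     ('r, 'u, 'h) group_ftr \<Rightarrow> (('r, 'u) module \<Rightarrow> 'f \<Rightarrow> 'g) \<Rightarrow>
     (('r, 'u) module \<Rightarrow> 'g \<Rightarrow> 'h) \<Rightarrow> bool" where
  "right_exact_seq R F G H \<alpha> \<beta> \<longleftrightarrow>
     \<alpha> \<in> nat_trans R F G \<and> \<beta> \<in> nat_trans R G H \<and>
     (\<forall>S\<in>objs (RMod R).
        \<alpha> S ` carrier (on_obj F S) = kernel (on_obj G S) (on_obj H S) (\<beta> S) \<and>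
        \<beta> S ` carrier (on_obj G S) = carrier (on_obj H S))"

definition presentable :: "('r, 'b) ring_scheme \<Rightarrow> ('r, 'u, 'u) group_ftr \<Rightarrow> bool" where
  "presentable R M \<longleftrightarrow>
     (\<exists>(I :: 'u set) (J :: 'u set) N N' \<alpha> \<beta>.
        small TYPE('u) I \<and> small TYPE('u) J \<and>
        (\<forall>i\<in>I. N i \<in> objs (RMod R)) \<and> (\<forall>j\<in>J. N' j \<in> objs (RMod R)) \<and>
        right_exact_seq R (direct_sum I (\<lambda>i. mod_scheme R (N i)))
                          (direct_sum J (\<lambda>j. mod_scheme R (N' j))) M \<alpha> \<beta>)"

definition ModSch :: "('r, 'b) ring_scheme \<Rightarrow> ('r, 'u) ftr_cat" where
  "ModSch R = full_subcat (RR_Mod R) {M \<in> objs (RR_Mod R). presentable R M}"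


section \<open>Stability of full subcategories of \<open>\<R>\<close>-modules\<close>

text \<open>Full subcategories are given by their sets of objects \<open>P\<close>.  Kernels, cokernels, limits and
  colimits of \<open>\<R>\<close>-modules are taken objectwise, i.e. they are cones (cocones) of \<open>\<R>\<close>-modules
  which become kernels, cokernels, limits, colimits in \<open>Ab\<close> after evaluation at every module \<open>S\<close>.\<close>

definition eval_at ::
    "('r, 'u) module \<Rightarrow> ('j, 'k, ('r, 'u, 'u) group_ftr, ('r, 'u) module \<Rightarrow> 'u \<Rightarrow> 'u) ftr \<Rightarrow>
     ('j, 'k, 'u monoid, 'u \<Rightarrow> 'u) ftr" where
  "eval_at S D = \<lparr>on_obj = (\<lambda>j. on_obj (on_obj D j) S), on_mor = (\<lambda>i j f. on_mor D i j f S)\<rparr>"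

definition stable_kernels :: "('r, 'b) ring_scheme \<Rightarrow> ('r, 'u, 'u) group_ftr set \<Rightarrow> bool" where
  "stable_kernels R P \<longleftrightarrow>
     (\<forall>F\<in>P. \<forall>G\<in>P. \<forall>f\<in>homs (RR_Mod R) F G. \<forall>K\<in>objs (RR_Mod R). \<forall>k\<in>homs (RR_Mod R) K F.
        (\<forall>S\<in>objs (RMod R). is_kernel Ab (on_obj F S) (on_obj G S) (f S) (on_obj K S) (k S))
        \<longrightarrow> K \<in> P)"

definition stable_cokernels :: "('r, 'b) ring_scheme \<Rightarrow> ('r, 'u, 'u) group_ftr set \<Rightarrow> bool" where
  "stable_cokernels R P \<longleftrightarrow>
     (\<forall>F\<in>P. \<forall>G\<in>P. \<forall>f\<in>homs (RR_Mod R) F G. \<forall>Q\<in>objs (RR_Mod R). \<forall>q\<in>homs (RR_Mod R) G Q.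
        (\<forall>S\<in>objs (RMod R). is_cokernel Ab (on_obj F S) (on_obj G S) (f S) (on_obj Q S) (q S))
        \<longrightarrow> Q \<in> P)"

definition stable_limits :: "('r, 'b) ring_scheme \<Rightarrow> ('r, 'u, 'u) group_ftr set \<Rightarrow> bool" where
  "stable_limits R P \<longleftrightarrow>
     (\<forall>(J :: ('u, 'u) cat) D L \<pi>.
        small_category J \<and> is_functor J (full_subcat (RR_Mod R) P) D \<and>
        is_cone (RR_Mod R) J D L \<pi> \<and>
        (\<forall>S\<in>objs (RMod R). is_limit Ab J (eval_at S D) (on_obj L S) (\<lambda>j. \<pi> j S))
        \<longrightarrow> L \<in> P)"

definition stable_colimits :: "('r, 'b) ring_scheme \<Rightarrow> ('r, 'u, 'u) group_ftr set \<Rightarrow> bool" where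
  "stable_colimits R P \<longleftrightarrow>
     (\<forall>(J :: ('u, 'u) cat) D L \<iota>.
        small_category J \<and> is_functor J (full_subcat (RR_Mod R) P) D \<and>
        is_cocone (RR_Mod R) J D L \<iota> \<and>
        (\<forall>S\<in>objs (RMod R). is_colimit Ab J (eval_at S D) (on_obj L S) (\<lambda>j. \<iota> j S))
        \<longrightarrow> L \<in> P)"

definition stable_isos :: "('r, 'b) ring_scheme \<Rightarrow> ('r, 'u, 'u) group_ftr set \<Rightarrow> bool" where
  "stable_isos R P \<longleftrightarrow> (\<forall>F\<in>P. \<forall>G\<in>objs (RR_Mod R). isomorphic (RR_Mod R) F G \<longrightarrow> G \<in> P)"

definition stable_containing_RR :: "('r, 'b) ring_scheme \<Rightarrow> ('r, 'u, 'u) group_ftr set \<Rightarrow> bool" where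
  "stable_containing_RR R P \<longleftrightarrow>
     P \<subseteq> objs (RR_Mod R) \<and> RR \<in> P \<and>
     stable_kernels R P \<and> stable_cokernels R P \<and> stable_colimits R P \<and> stable_limits R P \<and>
     stable_isos R P"

end

theory Submission
  imports Defs "HOL-Algebra.Free_Abelian_Groups"
begin

text \<open>The proof replaces presentability by a condition on elements.  Call a functor \<open>F\<close> accessible if
  every element of \<open>F S\<close> comes from a submodule of \<open>S\<close> of bounded size, and if an element of \<open>F T\<close>,
  for a submodule \<open>T\<close> of bounded size, that vanishes in \<open>F S\<close> vanishes already in \<open>F T'\<close> for some
  larger submodule \<open>T'\<close> of bounded size.  The bounds are small and do not depend on \<open>S\<close>.

  The point of this condition is that its closure properties are easy: a small family of
  submodules of bounded sizes lies in a submodule of bounded size (\<open>join_bound\<close>), so a small number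
  of elements and of equations between them can be brought down to one submodule of bounded size.
  Kernels, cokernels, small direct sums and small limits of accessible functors are therefore
  accessible, and so are colimits, being cokernels of maps between direct sums.  The functors
  \<open>Hom(N, -)\<close> are accessible since the image of \<open>N\<close> spans a submodule of bounded size; hence
  presentable functors are accessible.

  Conversely, up to isomorphism there is only a small set of modules of bounded size.  By Yoneda's
  lemma the elements of \<open>F\<close> at these modules define a map from a direct sum of module schemes to
  \<open>F\<close>, and this map is surjective if \<open>F\<close> is accessible (\<open>cover_surj_ex\<close>).  Its kernel is accessible
  again and has such a cover as well, and the two covers form a presentation of \<open>F\<close>.  So the objects
  of \<open>ModSch\<close> are exactly the accessible functors (\<open>ModSch_objs_iff\<close>).

  Now everything can be done objectwise.  Kernels, cokernels, biproducts, limits and colimits of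
  functors are formed at each module separately and stay accessible; a monomorphism of \<open>ModSch\<close> has
  zero kernel and is injective at each module, hence is the kernel of its cokernel, and dually.  A
  natural transformation is determined by its values on the generating elements of a cover, which
  gives local smallness.

  For minimality, let \<open>P\<close> contain \<open>\<R>\<close> and be stable.  A map from \<open>N\<close> to \<open>S\<close> is linear if it satisfies
  one equation for each pair of elements of \<open>N\<close> and one for each scalar and element.  So \<open>Hom(N, -)\<close>
  is the kernel of a map between powers of \<open>\<R>\<close> and is isomorphic to an object of \<open>P\<close>
  (\<open>mod_scheme_in\<close>).  Direct sums and cokernels of these give all presentable functors.\<close>

section \<open>Small sets\<close>

lemma small_ordLeq: "|A| \<le>o |B| \<Longrightarrow> small u B \<Longrightarrow> small u A"
  unfolding small_def by (rule ordLeq_ordLess_trans)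

lemma small_subset: "small u B \<Longrightarrow> A \<subseteq> B \<Longrightarrow> small u A"
  using small_ordLeq card_of_mono1 by blast

lemma small_image: "small u A \<Longrightarrow> small u (f ` A)"
  using small_ordLeq card_of_image by blast

lemma small_inj: "inj_on f A \<Longrightarrow> f ` A \<subseteq> B \<Longrightarrow> small u B \<Longrightarrow> small u A"
  by (rule small_ordLeq) (auto simp: card_of_ordLeq[symmetric])

lemma small_embed:
  assumes "small TYPE('u) A" shows "\<exists>f :: 'a \<Rightarrow> 'u. inj_on f A"
  using ordLess_imp_ordLeq[OF assms[unfolded small_def]] unfolding card_of_ordLeq[symmetric] by blast

text \<open>Bounds and index sets of any type can therefore be taken to be subsets of \<open>'u\<close>.\<close>

lemma small_copy:
  fixes A :: "'a set"
  assumes "small TYPE('u) A"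
  shows "\<exists>(B :: 'u set) f. small TYPE('u) B \<and> bij_betw f A B \<and> |A| \<le>o |B|"
proof -
  obtain f :: "'a \<Rightarrow> 'u" where f: "inj_on f A" using small_embed[OF assms] by blast
  then have "|A| \<le>o |f ` A|" by (auto simp: card_of_ordLeq[symmetric])
  with f show ?thesis using small_image[OF assms] by (metis inj_on_imp_bij_betw)
qed

locale universe_type =
  fixes u :: "'u itself"
  assumes universe: "universe TYPE('u)"
begin

lemma small_finite: "finite A \<Longrightarrow> small TYPE('u) A"
  using universe finite_ordLess_infinite2 unfolding small_def universe_def by blast

lemma small_Pow:
  assumes "small TYPE('u) A" shows "small TYPE('u) (Pow A)"
proof -
  obtain f :: "'a \<Rightarrow> 'u" where f: "inj_on f A" using small_embed[OF assms] by blast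
  have "small TYPE('u) (Pow (f ` A))"
    using universe small_image[OF assms] unfolding universe_def by blast
  moreover have "inj_on ((`) f) (Pow A)" using f by (rule inj_on_image_Pow)
  moreover have "(`) f ` Pow A \<subseteq> Pow (f ` A)" by auto
  ultimately show ?thesis by (rule small_inj[rotated 2])
qed

text \<open>A universe is closed under unions of small families of subsets of \<open>'u\<close>.  Pairs are
  brought into \<open>'u\<close> by an injection of \<open>'u \<times> 'u\<close>, which exists because \<open>'u\<close> is infinite.\<close>

lemma small_Sigma:
  fixes F :: "'i \<Rightarrow> 'a set"
  assumes J: "small TYPE('u) J" and F: "\<And>j. j \<in> J \<Longrightarrow> small TYPE('u) (F j)"
  shows "small TYPE('u) (Sigma J F)"
proof -
  obtain g :: "'i \<Rightarrow> 'u" where g: "inj_on g J" using small_embed[OF J] by blast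
  have "\<forall>j\<in>J. \<exists>f :: 'a \<Rightarrow> 'u. inj_on f (F j)" using small_embed[OF F] by blast
  then obtain f :: "'i \<Rightarrow> 'a \<Rightarrow> 'u" where f: "\<And>j. j \<in> J \<Longrightarrow> inj_on (f j) (F j)" by metis
  have "infinite (UNIV :: 'u set)" using universe unfolding universe_def by blast
  then have "|(UNIV :: 'u set) \<times> (UNIV :: 'u set)| \<le>o |UNIV :: 'u set|"
    using card_of_Times_same_infinite ordIso_imp_ordLeq by blast
  then obtain p :: "'u \<times> 'u \<Rightarrow> 'u" where p: "inj p" unfolding card_of_ordLeq[symmetric] by auto
  define G where "G a = (\<lambda>x. p (a, f (inv_into J g a) x)) ` F (inv_into J g a)" for a
  have "small TYPE('u) (\<Union>a\<in>g ` J. G a)"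
  proof -
    have "small TYPE('u) (G a)" if "a \<in> g ` J" for a
      unfolding G_def by (intro small_image F inv_into_into that)
    then show ?thesis using universe small_image[OF J, of g] unfolding universe_def by blast
  qed
  moreover have "inj_on (\<lambda>(j, x). p (g j, f j x)) (Sigma J F)"
  proof (rule inj_onI, clarsimp)
    fix j x i y
    assume a: "j \<in> J" "x \<in> F j" "i \<in> J" "y \<in> F i" "p (g j, f j x) = p (g i, f i y)"
    then have e: "g j = g i" "f j x = f i y" using injD[OF p a(5)] by auto
    then have "j = i" using a g by (auto dest: inj_onD)
    then show "j = i \<and> x = y" using e a f[of i] by (auto dest: inj_onD)
  qed
  moreover have "(\<lambda>(j, x). p (g j, f j x)) ` Sigma J F \<subseteq> (\<Union>a\<in>g ` J. G a)"
    unfolding G_def using g by auto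
  ultimately show ?thesis by (rule small_inj[rotated 2])
qed

lemma small_UN:
  assumes "small TYPE('u) J" "\<And>j. j \<in> J \<Longrightarrow> small TYPE('u) (F j)"
  shows "small TYPE('u) (\<Union>j\<in>J. F j)"
proof -
  have "(\<Union>j\<in>J. F j) = snd ` Sigma J F" by force
  then show ?thesis using small_image small_Sigma assms by metis
qed

lemma small_Times: "small TYPE('u) A \<Longrightarrow> small TYPE('u) B \<Longrightarrow> small TYPE('u) (A \<times> B)"
  by (rule small_Sigma)

text \<open>A function is determined by its graph, a subset of the disjoint union.\<close>

lemma small_PiE:
  assumes "small TYPE('u) J" "\<And>j. j \<in> J \<Longrightarrow> small TYPE('u) (F j)"
  shows "small TYPE('u) (PiE J F)"
proof (rule small_inj)
  show "small TYPE('u) (Pow (Sigma J F))" using small_Pow small_Sigma assms by blast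
  show "inj_on (\<lambda>x. (\<lambda>j. (j, x j)) ` J) (PiE J F)"
  proof (rule inj_onI)
    fix x y assume xy: "x \<in> PiE J F" "y \<in> PiE J F" "(\<lambda>j. (j, x j)) ` J = (\<lambda>j. (j, y j)) ` J"
    show "x = y" by (rule PiE_ext[OF xy(1,2)]) (use xy(3) in auto)
  qed
qed auto

end

section \<open>Homomorphisms out of direct sums\<close>

lemma (in comm_group) hom_finprod:
  assumes H: "comm_group H" and k: "k \<in> hom G H" and "finite I" "f \<in> I \<rightarrow> carrier G"
  shows "k (finprod G f I) = finprod H (\<lambda>i. k (f i)) I"
proof -
  interpret H: comm_group H by fact
  show ?thesis using assms(3,4)
  proof (induction I rule: finite_induct)
    case empty
    then show ?case using hom_one[OF k] by simp
  next
    case (insert i I)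
    have "(\<lambda>i. k (f i)) \<in> I \<rightarrow> carrier H" "k (f i) \<in> carrier H"
      using insert.prems k by (auto simp: hom_def Pi_iff)
    then show ?case using insert k by (simp add: hom_mult Pi_iff)
  qed
qed

lemma (in comm_group) hom_gfinprod:
  assumes H: "comm_group H" and k: "k \<in> hom G H"
    and fin: "finite {i \<in> I. f i \<noteq> \<one>}" and f: "f \<in> I \<rightarrow> carrier G"
  shows "k (gfinprod G f I) = gfinprod H (\<lambda>i. k (f i)) I"
proof -
  interpret H: comm_group H by fact
  let ?I = "{i \<in> I. f i \<noteq> \<one>}"
  have kf: "(\<lambda>i. k (f i)) \<in> I \<rightarrow> carrier H" using f k by (auto simp: hom_def Pi_iff)
  have "k (gfinprod G f I) = k (finprod G f ?I)" using fin by (simp add: gfinprod_def)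
  also have "\<dots> = finprod H (\<lambda>i. k (f i)) ?I"
    by (rule hom_finprod[OF H k fin]) (use f in auto)
  also have "\<dots> = gfinprod H (\<lambda>i. k (f i)) ?I"
    using fin kf by (subst H.gfinprod_eq_finprod) auto
  also have "\<dots> = gfinprod H (\<lambda>i. k (f i)) I"
    by (rule H.gfinprod_mono_neutral_cong_left) (use kf hom_one[OF k] in auto)
  finally show ?thesis .
qed

text \<open>The map out of the direct sum that is induced by homomorphisms \<open>\<phi> i\<close> to \<open>H\<close>.  The operator
  \<open>gfinprod\<close> takes the product over the finite support.\<close>

definition copair :: "'i set \<Rightarrow> ('b, 'd) monoid_scheme \<Rightarrow> ('i \<Rightarrow> 'a \<Rightarrow> 'b) \<Rightarrow> ('i \<Rightarrow> 'a) \<Rightarrow> 'b" where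
  "copair I H \<phi> x = gfinprod H (\<lambda>i. \<phi> i (x i)) I"

definition single :: "'i set \<Rightarrow> ('i \<Rightarrow> ('a, 'd) monoid_scheme) \<Rightarrow> 'i \<Rightarrow> 'a \<Rightarrow> 'i \<Rightarrow> 'a" where
  "single I G i y = (\<lambda>j\<in>I. if j = i then y else \<one>\<^bsub>G j\<^esub>)"

lemma sum_group_support:
  assumes "\<And>i. i \<in> I \<Longrightarrow> group (G i)" "x \<in> carrier (sum_group I G)"
    "\<And>i. i \<in> I \<Longrightarrow> \<phi> i \<in> hom (G i) H" "group H"
  shows "finite {i \<in> I. \<phi> i (x i) \<noteq> \<one>\<^bsub>H\<^esub>}" "(\<lambda>i. \<phi> i (x i)) \<in> I \<rightarrow> carrier H"
proof -
  have "finite {i \<in> I. x i \<noteq> \<one>\<^bsub>G i\<^esub>}" using assms by (simp add: carrier_sum_group)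
  then show "finite {i \<in> I. \<phi> i (x i) \<noteq> \<one>\<^bsub>H\<^esub>}"
    by (rule rev_finite_subset) (auto simp: hom_one[OF assms(3) assms(1,4)])
  show "(\<lambda>i. \<phi> i (x i)) \<in> I \<rightarrow> carrier H"
    using assms by (auto simp: carrier_sum_group hom_def Pi_iff PiE_iff)
qed

lemma comm_group_sum_group [intro]:
  assumes "\<And>i. i \<in> I \<Longrightarrow> comm_group (G i)" shows "comm_group (sum_group I G)"
proof (rule group.group_comm_groupI)
  have G: "\<And>i. i \<in> I \<Longrightarrow> group (G i)" using assms by (simp add: comm_group.axioms(2))
  then show "group (sum_group I G)" by simp
  fix x y assume "x \<in> carrier (sum_group I G)" "y \<in> carrier (sum_group I G)"
  then show "x \<otimes>\<^bsub>sum_group I G\<^esub> y = y \<otimes>\<^bsub>sum_group I G\<^esub> x"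
    using assms by (auto simp: carrier_sum_group[OF G] PiE_iff comm_groupE(4) intro!: restrict_ext)
qed

lemma comm_group_product_group [intro]:
  assumes "\<And>i. i \<in> I \<Longrightarrow> comm_group (G i)" shows "comm_group (product_group I G)"
proof (rule group.group_comm_groupI)
  have G: "\<And>i. i \<in> I \<Longrightarrow> group (G i)" using assms by (simp add: comm_group.axioms(2))
  then show "group (product_group I G)" by simp
  fix x y assume "x \<in> carrier (product_group I G)" "y \<in> carrier (product_group I G)"
  then show "x \<otimes>\<^bsub>product_group I G\<^esub> y = y \<otimes>\<^bsub>product_group I G\<^esub> x"
    using assms by (auto simp: PiE_iff comm_groupE(4) intro!: restrict_ext)
qed

context
  fixes I :: "'i set" and G :: "'i \<Rightarrow> ('a, 'd) monoid_scheme"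
  assumes G: "\<And>i. i \<in> I \<Longrightarrow> comm_group (G i)"
begin

private lemma gG: "i \<in> I \<Longrightarrow> group (G i)" using G by (simp add: comm_group.axioms(2))

lemma copair_hom:
  assumes "comm_group H" "\<And>i. i \<in> I \<Longrightarrow> \<phi> i \<in> hom (G i) H"
  shows "copair I H \<phi> \<in> hom (sum_group I G) H"
  using comm_group.hom_group_sum[OF assms(1), of I \<phi> G] assms(2) gG unfolding copair_def[abs_def] by blast

lemma single_hom:
  assumes "i \<in> I" shows "single I G i \<in> hom (G i) (sum_group I G)"
proof (rule homI)
  fix y assume y: "y \<in> carrier (G i)"
  have "finite {j \<in> I. single I G i y j \<noteq> \<one>\<^bsub>G j\<^esub>}"
    by (rule finite_subset[of _ "{i}"]) (auto simp: single_def)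
  then show "single I G i y \<in> carrier (sum_group I G)"
    using y gG by (auto simp: carrier_sum_group single_def PiE_iff group.is_monoid)
next
  fix y z assume "y \<in> carrier (G i)" "z \<in> carrier (G i)"
  then show "single I G i (y \<otimes>\<^bsub>G i\<^esub> z) = single I G i y \<otimes>\<^bsub>sum_group I G\<^esub> single I G i z"
    using gG by (auto simp: single_def group.is_monoid intro!: restrict_ext)
qed

lemma single_closed: "i \<in> I \<Longrightarrow> y \<in> carrier (G i) \<Longrightarrow> single I G i y \<in> carrier (sum_group I G)"
  using single_hom by (auto simp: hom_def)

lemma copair_single:
  assumes "comm_group H" "\<And>i. i \<in> I \<Longrightarrow> \<phi> i \<in> hom (G i) H" "i \<in> I" "y \<in> carrier (G i)"
  shows "copair I H \<phi> (single I G i y) = \<phi> i y"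
proof -
  interpret H: comm_group H by fact
  have c: "(\<lambda>j. \<phi> j (single I G i y j)) \<in> I \<rightarrow> carrier H"
    using sum_group_support(2)[OF gG single_closed[OF assms(3,4)] assms(2)] H.is_group by blast
  have "copair I H \<phi> (single I G i y) = gfinprod H (\<lambda>j. \<phi> j (single I G i y j)) {i}"
    unfolding copair_def
    by (rule H.gfinprod_mono_neutral_cong_right)
       (use c assms gG in \<open>auto simp: single_def hom_one H.is_group\<close>)
  also have "\<dots> = \<phi> i y" using c assms(3,4) by (subst H.gfinprod_eq_finprod) (auto simp: single_def Pi_iff)
  finally show ?thesis .
qed

lemma hom_copair:
  assumes "comm_group H" "\<And>i. i \<in> I \<Longrightarrow> \<phi> i \<in> hom (G i) H" "comm_group K" "k \<in> hom H K"
    "x \<in> carrier (sum_group I G)"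
  shows "k (copair I H \<phi> x) = copair I K (\<lambda>i y. k (\<phi> i y)) x"
  unfolding copair_def
  by (rule comm_group.hom_gfinprod[OF assms(1,3,4)])
     (use sum_group_support[OF gG assms(5,2)] assms(1) in \<open>auto simp: comm_group.axioms(2)\<close>)

lemma copair_cong:
  assumes "comm_group H" "\<And>i. i \<in> I \<Longrightarrow> \<psi> i (y i) \<in> carrier H" "\<And>i. i \<in> I \<Longrightarrow> \<phi> i (x i) = \<psi> i (y i)"
  shows "copair I H \<phi> x = copair I H \<psi> y"
proof -
  interpret H: comm_group H by fact
  show ?thesis unfolding copair_def
    by (rule H.gfinprod_cong) (use assms in \<open>auto simp: simp_implies_def\<close>)
qed

text \<open>Evaluation at \<open>i\<close> is a homomorphism and so commutes with \<open>copair\<close>; only the summand at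
  \<open>i\<close> contributes to the result.\<close>

lemma sum_group_decomp:
  assumes x: "x \<in> carrier (sum_group I G)"
  shows "copair I (sum_group I G) (single I G) x = x"
proof -
  let ?S = "sum_group I G" and ?y = "copair I (sum_group I G) (single I G) x"
  interpret S: comm_group ?S using G by blast
  have y: "?y \<in> carrier ?S"
    using copair_hom[OF S.comm_group_axioms single_hom] x by (auto simp: hom_def)
  have "?y i = x i" if i: "i \<in> I" for i
  proof -
    have ev: "(\<lambda>z. z i) \<in> hom ?S (G i)"
      using i gG by (auto simp: hom_def carrier_sum_group PiE_iff)
    interpret Gi: comm_group "G i" using G i by blast
    have xi: "x i \<in> carrier (G i)" using x i gG by (auto simp: carrier_sum_group PiE_iff)
    have "?y i = copair I (G i) (\<lambda>j y. single I G j y i) x"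
      using hom_copair[OF S.comm_group_axioms single_hom Gi.comm_group_axioms ev x] by simp
    also have "\<dots> = gfinprod (G i) (\<lambda>j. single I G j (x j) i) {i}"
      unfolding copair_def
      by (rule Gi.gfinprod_mono_neutral_cong_right) (use i xi in \<open>auto simp: single_def\<close>)
    also have "\<dots> = x i" using xi i by (subst Gi.gfinprod_eq_finprod) (auto simp: single_def)
    finally show ?thesis .
  qed
  moreover have "x \<in> (\<Pi>\<^sub>E i\<in>I. carrier (G i))" "?y \<in> (\<Pi>\<^sub>E i\<in>I. carrier (G i))"
    using x y gG by (simp_all add: carrier_sum_group)
  ultimately show ?thesis by (intro PiE_ext)
qed

lemma copair_expand:
  assumes "comm_group H" "k \<in> hom (sum_group I G) H" "x \<in> carrier (sum_group I G)"
  shows "k x = copair I H (\<lambda>i y. k (single I G i y)) x"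
proof -
  have "comm_group (sum_group I G)" using G by blast
  from hom_copair[OF this single_hom assms] show ?thesis using sum_group_decomp[OF assms(3)] by simp
qed

lemma sum_group_hom_eq:
  assumes "comm_group H" "k \<in> hom (sum_group I G) H" "l \<in> hom (sum_group I G) H"
    "\<And>i y. i \<in> I \<Longrightarrow> y \<in> carrier (G i) \<Longrightarrow> k (single I G i y) = l (single I G i y)"
    "x \<in> carrier (sum_group I G)"
  shows "k x = l x"
proof -
  have "k (single I G i (x i)) = l (single I G i (x i))" "l (single I G i (x i)) \<in> carrier H"
    if "i \<in> I" for i
  proof -
    have xi: "x i \<in> carrier (G i)" using assms(5) gG that by (auto simp: carrier_sum_group PiE_iff)
    then show "k (single I G i (x i)) = l (single I G i (x i))" using assms(4) that by blast
    show "l (single I G i (x i)) \<in> carrier H"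
      using assms(3) single_closed[OF that xi] by (auto simp: hom_def)
  qed
  then have "copair I H (\<lambda>i y. k (single I G i y)) x = copair I H (\<lambda>i y. l (single I G i y)) x"
    by (intro copair_cong[OF assms(1)])
  then show ?thesis using copair_expand[OF assms(1,2,5)] copair_expand[OF assms(1,3,5)] by simp
qed

end

section \<open>Submodules\<close>

locale small_ring = universe_type u for u :: "'u itself" +
  fixes R :: "('r, 'b) ring_scheme"
  assumes ring_R: "ring R" and small_R: "small TYPE('u) (carrier R)"
begin

abbreviation Mods :: "('r, 'u) module set" where "Mods \<equiv> objs (RMod R)"

text \<open>A submodule is represented by its carrier \<open>T\<close>, and as a module by the record \<open>S\<close> with the
  carrier replaced by \<open>T\<close>.\<close>

definition submod :: "('r, 'u) module \<Rightarrow> 'u set \<Rightarrow> bool" where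
  "submod S T \<longleftrightarrow> T \<subseteq> carrier S \<and> \<zero>\<^bsub>S\<^esub> \<in> T \<and> (\<forall>x\<in>T. \<forall>y\<in>T. x \<oplus>\<^bsub>S\<^esub> y \<in> T) \<and>
     (\<forall>a\<in>carrier R. \<forall>x\<in>T. a \<odot>\<^bsub>S\<^esub> x \<in> T)"

lemma Mods_iff: "S \<in> Mods \<longleftrightarrow> left_module R S \<and> small TYPE('u) (carrier S)"
  by (simp add: RMod_def)

lemma Mods_comm_group: "S \<in> Mods \<Longrightarrow> comm_group (add_monoid S)"
  unfolding Mods_iff left_module_def by (blast intro: abelian_group.a_comm_group)

lemma zero_smult:
  assumes "S \<in> Mods" "x \<in> carrier S"
  shows "\<zero>\<^bsub>R\<^esub> \<odot>\<^bsub>S\<^esub> x = \<zero>\<^bsub>S\<^esub>"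
proof -
  interpret left_module R S using assms by (simp add: Mods_iff)
  have z: "\<zero>\<^bsub>R\<^esub> \<odot>\<^bsub>S\<^esub> x \<in> carrier S" using assms by (simp add: smult_closed)
  have "\<zero>\<^bsub>R\<^esub> \<odot>\<^bsub>S\<^esub> x = \<zero>\<^bsub>R\<^esub> \<odot>\<^bsub>S\<^esub> x \<oplus>\<^bsub>S\<^esub> \<zero>\<^bsub>R\<^esub> \<odot>\<^bsub>S\<^esub> x"
    using smult_l_distr[of "\<zero>\<^bsub>R\<^esub>" "\<zero>\<^bsub>R\<^esub>" x] assms by simp
  then show ?thesis using z M.add.l_cancel_one' by metis
qed

lemma submod_self: "S \<in> Mods \<Longrightarrow> submod S (carrier S)"
proof -
  assume "S \<in> Mods"
  then interpret left_module R S by (simp add: Mods_iff)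
  show ?thesis by (simp add: submod_def smult_closed)
qed

text \<open>Negatives are multiples by \<open>-1\<close>, so closure under scalars gives a subgroup.\<close>

lemma submod_Mods:
  assumes S: "S \<in> Mods" and T: "submod S T"
  shows "S\<lparr>carrier := T\<rparr> \<in> Mods"
proof -
  interpret left_module R S using S by (simp add: Mods_iff)
  have c: "x \<in> carrier S" if "x \<in> T" for x using T that by (auto simp: submod_def)
  have "abelian_group (S\<lparr>carrier := T\<rparr>)"
  proof (rule abelian_groupI; simp)
    fix x assume x: "x \<in> T"
    then have y: "(\<ominus>\<^bsub>R\<^esub> \<one>\<^bsub>R\<^esub>) \<odot>\<^bsub>S\<^esub> x \<in> T" using T by (simp add: submod_def)
    have "(\<ominus>\<^bsub>R\<^esub> \<one>\<^bsub>R\<^esub>) \<odot>\<^bsub>S\<^esub> x \<oplus>\<^bsub>S\<^esub> x = (\<ominus>\<^bsub>R\<^esub> \<one>\<^bsub>R\<^esub> \<oplus>\<^bsub>R\<^esub> \<one>\<^bsub>R\<^esub>) \<odot>\<^bsub>S\<^esub> x"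
      using x c smult_one smult_l_distr by simp
    also have "\<dots> = \<zero>\<^bsub>S\<^esub>" using zero_smult[OF S c[OF x]] by (simp add: R.l_neg)
    finally show "\<exists>y\<in>T. y \<oplus>\<^bsub>S\<^esub> x = \<zero>\<^bsub>S\<^esub>" using y by blast
  next
    fix x y z assume "x \<in> T" "y \<in> T" "z \<in> T"
    then show "x \<oplus>\<^bsub>S\<^esub> y \<oplus>\<^bsub>S\<^esub> z = x \<oplus>\<^bsub>S\<^esub> (y \<oplus>\<^bsub>S\<^esub> z)" using c M.a_assoc by blast
  next
    fix x y assume "x \<in> T" "y \<in> T"
    then show "x \<oplus>\<^bsub>S\<^esub> y = y \<oplus>\<^bsub>S\<^esub> x" using c M.a_comm by blast
  qed (use T c in \<open>auto simp: submod_def\<close>)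
  then have "left_module R (S\<lparr>carrier := T\<rparr>)"
    using T c unfolding left_module_def left_module_axioms_def
    by (auto simp: ring_R submod_def smult_l_distr smult_r_distr smult_assoc smult_one)
  moreover have "small TYPE('u) T"
    using S T small_subset unfolding Mods_iff submod_def by blast
  ultimately show ?thesis by (simp add: Mods_iff)
qed

text \<open>Morphisms of modules are extensional, so the inclusion is cut off outside \<open>T\<close>.\<close>

definition incl :: "'u set \<Rightarrow> 'u \<Rightarrow> 'u" where "incl T = (\<lambda>x\<in>T. x)"

lemma homs_RMod: "homs (RMod R) = module_homs R"
  by (simp add: RMod_def)

lemma module_homsD:
  assumes "f \<in> module_homs R M N"
  shows "\<And>x. x \<in> carrier M \<Longrightarrow> f x \<in> carrier N"
    "\<And>x y. x \<in> carrier M \<Longrightarrow> y \<in> carrier M \<Longrightarrow> f (x \<oplus>\<^bsub>M\<^esub> y) = f x \<oplus>\<^bsub>N\<^esub> f y"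
    "\<And>a x. a \<in> carrier R \<Longrightarrow> x \<in> carrier M \<Longrightarrow> f (a \<odot>\<^bsub>M\<^esub> x) = a \<odot>\<^bsub>N\<^esub> f x"
    "f \<in> extensional (carrier M)"
  using assms by (auto simp: module_homs_def group_homs_def hom_def)

lemma module_homsI:
  assumes "\<And>x. x \<in> carrier M \<Longrightarrow> f x \<in> carrier N"
    "\<And>x y. x \<in> carrier M \<Longrightarrow> y \<in> carrier M \<Longrightarrow> f (x \<oplus>\<^bsub>M\<^esub> y) = f x \<oplus>\<^bsub>N\<^esub> f y"
    "\<And>a x. a \<in> carrier R \<Longrightarrow> x \<in> carrier M \<Longrightarrow> f (a \<odot>\<^bsub>M\<^esub> x) = a \<odot>\<^bsub>N\<^esub> f x"
    "f \<in> extensional (carrier M)"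
  shows "f \<in> module_homs R M N"
  using assms by (auto simp: module_homs_def group_homs_def hom_def)

lemma incl_hom:
  assumes "S \<in> Mods" "submod S T" "T \<subseteq> T'"
  shows "incl T \<in> module_homs R (S\<lparr>carrier := T\<rparr>) (S\<lparr>carrier := T'\<rparr>)"
  by (rule module_homsI) (use assms in \<open>auto simp: incl_def submod_def\<close>)

lemma id_hom: "(\<lambda>x\<in>carrier M. x) \<in> module_homs R M M" if "M \<in> Mods"
proof -
  interpret left_module R M using that by (simp add: Mods_iff)
  show ?thesis by (rule module_homsI) (auto simp: smult_closed)
qed

lemma compose_hom:
  assumes "f \<in> module_homs R L M" "g \<in> module_homs R M N" "L \<in> Mods"
  shows "compose (carrier L) g f \<in> module_homs R L N"
proof -
  interpret left_module R L using assms by (simp add: Mods_iff)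
  show ?thesis
    by (rule module_homsI) (use module_homsD[OF assms(1)] module_homsD[OF assms(2)] in
        \<open>auto simp: compose_def smult_closed\<close>)
qed

text \<open>The span of \<open>A\<close> is the image of the group of finitely supported functions from \<open>A\<close>
  to \<open>R\<close>, and such a function is determined by its graph.\<close>

lemma span_bound:
  assumes S: "S \<in> Mods" and A: "A \<subseteq> carrier S"
  shows "\<exists>T. submod S T \<and> A \<subseteq> T \<and> |T| \<le>o |Pow (A \<times> carrier R)|"
proof -
  interpret left_module R S using S by (simp add: Mods_iff)
  let ?G = "sum_group A (\<lambda>_. add_monoid R)" and ?H = "add_monoid S"
  have G: "comm_group (add_monoid R)" by (rule R.a_comm_group)
  have H: "comm_group ?H" by (rule Mods_comm_group[OF S])
  interpret H: comm_group ?H by (rule H)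
  have gG: "group (add_monoid R)" using G by (simp add: comm_group.axioms(2))
  have carG: "carrier ?G = {x \<in> A \<rightarrow>\<^sub>E carrier R. finite {i \<in> A. x i \<noteq> \<zero>\<^bsub>R\<^esub>}}"
    using carrier_sum_group[of A "\<lambda>_. add_monoid R"] gG by simp
  let ?\<phi> = "\<lambda>a r. r \<odot>\<^bsub>S\<^esub> a"
  have \<phi>: "?\<phi> a \<in> hom (add_monoid R) ?H" if "a \<in> A" for a
    using that A by (auto simp: hom_def smult_closed smult_l_distr)
  define T where "T = copair A ?H ?\<phi> ` carrier ?G"
  have hom: "copair A ?H ?\<phi> \<in> hom ?G ?H"
    by (rule copair_hom[where G = "\<lambda>_. add_monoid R"]) (use G H \<phi> in auto)
  then have "subgroup T ?H"
    unfolding T_def using gG comm_group.axioms(2)[OF H]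
    by (intro group_hom.img_is_subgroup group_hom.intro group_hom_axioms.intro) auto
  then interpret T: subgroup T ?H .
  have smult: "a \<odot>\<^bsub>S\<^esub> x \<in> T" if a: "a \<in> carrier R" and "x \<in> T" for a x
  proof -
    obtain f where f: "f \<in> carrier ?G" "x = copair A ?H ?\<phi> f" using \<open>x \<in> T\<close> unfolding T_def by blast
    define g where "g = (\<lambda>i\<in>A. a \<otimes>\<^bsub>R\<^esub> f i)"
    have fc: "\<And>i. i \<in> A \<Longrightarrow> f i \<in> carrier R" using f carG by auto
    have "finite {i \<in> A. f i \<noteq> \<zero>\<^bsub>R\<^esub>}" using f carG by auto
    then have "finite {i \<in> A. g i \<noteq> \<zero>\<^bsub>R\<^esub>}"
      by (rule rev_finite_subset) (use a in \<open>auto simp: g_def\<close>)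
    then have g: "g \<in> carrier ?G" using fc a by (auto simp: carG g_def)
    have k: "(\<lambda>y. a \<odot>\<^bsub>S\<^esub> y) \<in> hom ?H ?H" using a by (auto simp: hom_def smult_closed smult_r_distr)
    have "a \<odot>\<^bsub>S\<^esub> x = copair A ?H (\<lambda>i y. a \<odot>\<^bsub>S\<^esub> ?\<phi> i y) f"
      unfolding f(2) by (rule hom_copair[where G = "\<lambda>_. add_monoid R", OF G H \<phi> H k f(1)])
    also have "\<dots> = copair A ?H ?\<phi> g"
      by (rule copair_cong[where G = "\<lambda>_. add_monoid R", OF G H])
         (use A a fc in \<open>auto simp: g_def smult_assoc smult_closed\<close>)
    finally show ?thesis using g unfolding T_def by blast
  qed
  have "submod S T"
    using T.one_closed T.m_closed T.subset smult by (auto simp: submod_def)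
  moreover have "A \<subseteq> T"
  proof
    fix a assume a: "a \<in> A"
    have "copair A ?H ?\<phi> (single A (\<lambda>_. add_monoid R) a \<one>\<^bsub>R\<^esub>) = \<one>\<^bsub>R\<^esub> \<odot>\<^bsub>S\<^esub> a"
      by (rule copair_single[where G = "\<lambda>_. add_monoid R", OF G H \<phi> a]) auto
    also have "\<dots> = a" using a A by (auto intro: smult_one)
    finally have "a = copair A ?H ?\<phi> (single A (\<lambda>_. add_monoid R) a \<one>\<^bsub>R\<^esub>)" ..
    moreover have "single A (\<lambda>_. add_monoid R) a \<one>\<^bsub>R\<^esub> \<in> carrier ?G"
      by (rule single_closed[where G = "\<lambda>_. add_monoid R", OF G a]) simp
    ultimately show "a \<in> T" unfolding T_def by (rule image_eqI)
  qed
  moreover have "|T| \<le>o |Pow (A \<times> carrier R)|"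
  proof -
    have "inj_on (\<lambda>x. (\<lambda>j. (j, x j)) ` A) (carrier ?G)"
    proof (rule inj_onI)
      fix x y assume "x \<in> carrier ?G" "y \<in> carrier ?G" and xy: "(\<lambda>j. (j, x j)) ` A = (\<lambda>j. (j, y j)) ` A"
      then have "x \<in> A \<rightarrow>\<^sub>E carrier R" "y \<in> A \<rightarrow>\<^sub>E carrier R" by (auto simp: carG)
      then show "x = y" by (rule PiE_ext) (use xy in auto)
    qed
    moreover have "(\<lambda>x. (\<lambda>j. (j, x j)) ` A) ` carrier ?G \<subseteq> Pow (A \<times> carrier R)"
      by (auto simp: carG)
    ultimately have "|carrier ?G| \<le>o |Pow (A \<times> carrier R)|"
      unfolding card_of_ordLeq[symmetric] by blast
    then show ?thesis unfolding T_def by (rule ordLeq_transitive[OF card_of_image])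
  qed
  ultimately show ?thesis by blast
qed

lemma Pow_mono_ordLeq: "|A| \<le>o |B| \<Longrightarrow> |Pow A| \<le>o |Pow B|"
proof -
  assume "|A| \<le>o |B|"
  then obtain f where f: "inj_on f A" "f ` A \<subseteq> B" unfolding card_of_ordLeq[symmetric] by blast
  have "inj_on ((`) f) (Pow A)" using f(1) by (rule inj_on_image_Pow)
  moreover have "(`) f ` Pow A \<subseteq> Pow B" using f(2) by auto
  ultimately show "|Pow A| \<le>o |Pow B|" unfolding card_of_ordLeq[symmetric] by blast
qed

text \<open>The bound \<open>K\<close> is found before \<open>S\<close> and the family are known: the union of the \<open>T j\<close> has at
  most as many elements as the disjoint union of the \<open>\<Lambda> j\<close>, and the size of its span is controlled
  by this and by the size of \<open>R\<close>.\<close>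

lemma join_bound:
  fixes J :: "'j set" and \<Lambda> :: "'j \<Rightarrow> 'k set"
  assumes J: "small TYPE('u) J" and \<Lambda>: "\<And>j. j \<in> J \<Longrightarrow> small TYPE('u) (\<Lambda> j)"
  shows "\<exists>K :: 'u set. small TYPE('u) K \<and>
    (\<forall>S\<in>Mods. \<forall>T. (\<forall>j\<in>J. T j \<subseteq> carrier S \<and> |T j| \<le>o |\<Lambda> j| ) \<longrightarrow>
       (\<exists>T'. submod S T' \<and> (\<forall>j\<in>J. T j \<subseteq> T') \<and> |T'| \<le>o |K| ))"
proof -
  have "small TYPE('u) (Pow (Sigma J \<Lambda> \<times> carrier R))"
    by (intro small_Pow small_Times small_Sigma J \<Lambda> small_R)
  then obtain K :: "'u set" where K: "small TYPE('u) K" "|Pow (Sigma J \<Lambda> \<times> carrier R)| \<le>o |K|"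
    using small_copy by blast
  have "\<exists>T'. submod S T' \<and> (\<forall>j\<in>J. T j \<subseteq> T') \<and> |T'| \<le>o |K|"
    if S: "S \<in> Mods" and T: "\<And>j. j \<in> J \<Longrightarrow> T j \<subseteq> carrier S" "\<And>j. j \<in> J \<Longrightarrow> |T j| \<le>o |\<Lambda> j|" for S T
  proof -
    obtain T' where T': "submod S T'" "(\<Union>j\<in>J. T j) \<subseteq> T'" "|T'| \<le>o |Pow ((\<Union>j\<in>J. T j) \<times> carrier R)|"
      using span_bound[OF S, of "\<Union>j\<in>J. T j"] T(1) by blast
    have "|\<Union>j\<in>J. T j| \<le>o |Sigma J T|" by (rule card_of_UNION_Sigma)
    also have "|Sigma J T| \<le>o |Sigma J \<Lambda>|" using T(2) by (intro card_of_Sigma_mono1) blast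
    finally have "|(\<Union>j\<in>J. T j) \<times> carrier R| \<le>o |Sigma J \<Lambda> \<times> carrier R|"
      by (rule card_of_Times_mono1)
    from ordLeq_transitive[OF ordLeq_transitive[OF T'(3) Pow_mono_ordLeq[OF this]] K(2)]
    have "|T'| \<le>o |K|" .
    then show ?thesis using T' by blast
  qed
  then have "\<forall>S\<in>Mods. \<forall>T. (\<forall>j\<in>J. T j \<subseteq> carrier S \<and> |T j| \<le>o |\<Lambda> j| ) \<longrightarrow>
       (\<exists>T'. submod S T' \<and> (\<forall>j\<in>J. T j \<subseteq> T') \<and> |T'| \<le>o |K| )" by simp
  with K(1) show ?thesis by (intro exI[of _ K] conjI)
qed

lemma small_module_homs:
  assumes "M \<in> Mods" "N \<in> Mods" shows "small TYPE('u) (module_homs R M N)"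
proof (rule small_subset)
  show "small TYPE('u) (carrier M \<rightarrow>\<^sub>E carrier N)"
    using assms by (intro small_PiE) (auto simp: Mods_iff)
  show "module_homs R M N \<subseteq> carrier M \<rightarrow>\<^sub>E carrier N"
  proof
    fix f assume "f \<in> module_homs R M N"
    from module_homsD(1,4)[OF this] show "f \<in> carrier M \<rightarrow>\<^sub>E carrier N" by (simp add: PiE_iff)
  qed
qed

end

section \<open>Abelian groups: factorisations, subgroups and quotients\<close>

lemma group_homsD:
  assumes "f \<in> group_homs G H"
  shows "f \<in> hom G H" "f \<in> extensional (carrier G)" "x \<in> carrier G \<Longrightarrow> f x \<in> carrier H"
    "x \<in> carrier G \<Longrightarrow> y \<in> carrier G \<Longrightarrow> f (x \<otimes>\<^bsub>G\<^esub> y) = f x \<otimes>\<^bsub>H\<^esub> f y"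
  using assms by (auto simp: group_homs_def hom_def)

lemma group_homs_one:
  assumes "f \<in> group_homs G H" "comm_group G" "comm_group H"
  shows "f \<one>\<^bsub>G\<^esub> = \<one>\<^bsub>H\<^esub>"
  using assms by (auto simp: group_homs_def comm_group.axioms(2) intro: hom_one)

lemma group_homs_inv:
  assumes "f \<in> group_homs G H" "comm_group G" "comm_group H" "x \<in> carrier G"
  shows "f (inv\<^bsub>G\<^esub> x) = inv\<^bsub>H\<^esub> f x"
proof -
  interpret group_hom G H f
    using assms by (auto simp: group_homs_def comm_group.axioms(2) group_hom_def group_hom_axioms_def)
  show ?thesis using assms by simp
qed

lemma group_homs_inj:
  assumes "f \<in> group_homs G H" "comm_group G" "comm_group H"
    and "\<And>x. x \<in> carrier G \<Longrightarrow> f x = \<one>\<^bsub>H\<^esub> \<Longrightarrow> x = \<one>\<^bsub>G\<^esub>"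
  shows "inj_on f (carrier G)"
proof -
  interpret group_hom G H f
    using assms by (auto simp: group_homs_def comm_group.axioms(2) group_hom_def group_hom_axioms_def)
  show ?thesis using assms(4) by (auto simp: inj_iff_trivial_ker kernel_def)
qed

lemma restrict_group_homs:
  assumes "comm_group G" "f \<in> hom G H" shows "restrict f (carrier G) \<in> group_homs G H"
proof -
  interpret comm_group G by fact
  show ?thesis using assms(2) by (auto simp: group_homs_def hom_def Pi_iff)
qed

lemma compose_group_homs:
  assumes "comm_group G" "f \<in> group_homs G H" "g \<in> group_homs H K"
  shows "compose (carrier G) g f \<in> group_homs G K"
proof -
  have "g \<circ> f \<in> hom G K" using hom_compose group_homsD(1)[OF assms(2)] group_homsD(1)[OF assms(3)] by blast
  moreover have "compose (carrier G) g f = restrict (g \<circ> f) (carrier G)" by (auto simp: compose_def)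
  ultimately show ?thesis using restrict_group_homs[OF assms(1)] by metis
qed

lemma compose_eq_iff:
  assumes "\<xi> \<in> extensional A"
  shows "compose A g f = \<xi> \<longleftrightarrow> (\<forall>x\<in>A. g (f x) = \<xi> x)"
  using assms by (auto simp: compose_def fun_eq_iff extensional_def)

lemma trivial_group_homs:
  assumes "comm_group G" "comm_group H" shows "(\<lambda>x\<in>carrier G. \<one>\<^bsub>H\<^esub>) \<in> group_homs G H"
proof -
  interpret comm_group H by fact
  show ?thesis by (intro restrict_group_homs assms) (auto simp: hom_def)
qed

lemma id_group_homs: "comm_group G \<Longrightarrow> (\<lambda>x\<in>carrier G. x) \<in> group_homs G G"
  by (intro restrict_group_homs) (auto simp: hom_def)

lemma comm_group_eq_iff:
  assumes "comm_group G" "x \<in> carrier G" "y \<in> carrier G"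
  shows "x = y \<longleftrightarrow> x \<otimes>\<^bsub>G\<^esub> inv\<^bsub>G\<^esub> y = \<one>\<^bsub>G\<^esub>"
proof -
  interpret comm_group G by fact
  show ?thesis using assms by (metis inv_closed inv_inv inv_equality r_inv)
qed

lemma comm_group_subgroup:
  assumes "comm_group G" "subgroup H G" shows "comm_group (G\<lparr>carrier := H\<rparr>)"
proof (rule group.group_comm_groupI)
  interpret comm_group G by fact
  show "group (G\<lparr>carrier := H\<rparr>)" using assms(2) by (rule subgroup_imp_group)
  fix x y assume "x \<in> carrier (G\<lparr>carrier := H\<rparr>)" "y \<in> carrier (G\<lparr>carrier := H\<rparr>)"
  then show "x \<otimes>\<^bsub>G\<lparr>carrier := H\<rparr>\<^esub> y = y \<otimes>\<^bsub>G\<lparr>carrier := H\<rparr>\<^esub> x"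
    using subgroup.subset[OF assms(2)] m_comm by auto
qed

lemma subgroup_where:
  assumes "comm_group G" "\<And>x. P x \<Longrightarrow> x \<in> carrier G" "P \<one>\<^bsub>G\<^esub>" "\<And>x y. P x \<Longrightarrow> P y \<Longrightarrow> P (x \<otimes>\<^bsub>G\<^esub> y)"
    "\<And>x. P x \<Longrightarrow> P (inv\<^bsub>G\<^esub> x)"
  shows "subgroup {x. P x} G"
  using assms by (auto intro: subgroup.intro)

text \<open>The common pattern of kernels and limits: if the family \<open>t\<close> factors uniquely through
  the family \<open>k\<close> at each single element, then uniqueness forces the elementwise factorisations to
  form a homomorphism.\<close>

lemma jointly_mono_factor:
  fixes K :: "('k, 'd) monoid_scheme" and X :: "('x, 'e) monoid_scheme" and Y :: "'j \<Rightarrow> ('y, 'f) monoid_scheme"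
  assumes K: "comm_group K" and X: "comm_group X"
    and k: "\<And>j. j \<in> J \<Longrightarrow> k j \<in> group_homs K (Y j)" and t: "\<And>j. j \<in> J \<Longrightarrow> t j \<in> group_homs X (Y j)"
    and ex: "\<And>x. x \<in> carrier X \<Longrightarrow> \<exists>!g. g \<in> carrier K \<and> (\<forall>j\<in>J. k j g = t j x)"
  shows "\<exists>!v. v \<in> group_homs X K \<and> (\<forall>j\<in>J. \<forall>x\<in>carrier X. k j (v x) = t j x)"
proof -
  interpret K: comm_group K by fact
  interpret X: comm_group X by fact
  define v where "v = (\<lambda>x\<in>carrier X. THE g. g \<in> carrier K \<and> (\<forall>j\<in>J. k j g = t j x))"
  have v: "v x \<in> carrier K" "j \<in> J \<Longrightarrow> k j (v x) = t j x" if "x \<in> carrier X" for x j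
    using theI'[OF ex[OF that]] that unfolding v_def by auto
  have uniq: "g = v x" if "x \<in> carrier X" "g \<in> carrier K" "\<And>j. j \<in> J \<Longrightarrow> k j g = t j x" for g x
    using ex[OF that(1)] v[OF that(1)] that(2,3) by blast
  have "v \<in> hom X K"
  proof (rule homI)
    fix x y assume x: "x \<in> carrier X" and y: "y \<in> carrier X"
    show "v (x \<otimes>\<^bsub>X\<^esub> y) = v x \<otimes>\<^bsub>K\<^esub> v y"
      by (rule uniq[symmetric])
         (use x y v group_homsD(4)[OF k] group_homsD(4)[OF t] in auto)
  qed (use v in auto)
  then have vK: "v \<in> group_homs X K" by (simp add: group_homs_def v_def)
  have vuniq: "w = v" if w: "w \<in> group_homs X K" "\<forall>j\<in>J. \<forall>x\<in>carrier X. k j (w x) = t j x" for w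
  proof (rule extensionalityI[where A = "carrier X"])
    show "w \<in> extensional (carrier X)" using w by (auto dest: group_homsD)
    show "v \<in> extensional (carrier X)" by (simp add: v_def)
    show "w x = v x" if "x \<in> carrier X" for x
      by (rule uniq) (use w that group_homsD(3)[OF w(1)] in auto)
  qed
  show ?thesis
  proof (rule ex1I[of _ v])
    show "v \<in> group_homs X K \<and> (\<forall>j\<in>J. \<forall>x\<in>carrier X. k j (v x) = t j x)"
      using vK v(2) by blast
    show "w = v" if "w \<in> group_homs X K \<and> (\<forall>j\<in>J. \<forall>x\<in>carrier X. k j (w x) = t j x)" for w
      by (rule vuniq[OF conjunct1[OF that] conjunct2[OF that]])
  qed
qed

text \<open>The common pattern of cokernels and colimits.\<close>

lemma epi_factor:
  fixes Q :: "('q, 'd) monoid_scheme" and X :: "('x, 'e) monoid_scheme" and Y :: "('y, 'f) monoid_scheme"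
  assumes Y: "comm_group Y" and Q: "comm_group Q" and X: "comm_group X"
    and q: "q \<in> hom Y Q" "q ` carrier Y = carrier Q" and t: "t \<in> hom Y X"
    and ker: "\<And>y. y \<in> carrier Y \<Longrightarrow> q y = \<one>\<^bsub>Q\<^esub> \<Longrightarrow> t y = \<one>\<^bsub>X\<^esub>"
  shows "\<exists>!v. v \<in> group_homs Q X \<and> (\<forall>y\<in>carrier Y. v (q y) = t y)"
proof -
  interpret Y: comm_group Y by fact
  interpret Q: comm_group Q by fact
  interpret X: comm_group X by fact
  interpret q: group_hom Y Q q using q by unfold_locales
  interpret t: group_hom Y X t using t by unfold_locales
  have eq: "t y = t y'" if "y \<in> carrier Y" "y' \<in> carrier Y" "q y = q y'" for y y'
  proof -
    have "q (y \<otimes>\<^bsub>Y\<^esub> inv\<^bsub>Y\<^esub> y') = \<one>\<^bsub>Q\<^esub>" using that by simp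
    then have "t (y \<otimes>\<^bsub>Y\<^esub> inv\<^bsub>Y\<^esub> y') = \<one>\<^bsub>X\<^esub>" by (intro ker) (use that in auto)
    then have "t y \<otimes>\<^bsub>X\<^esub> inv\<^bsub>X\<^esub> t y' = \<one>\<^bsub>X\<^esub>" using that by simp
    then show ?thesis
      using comm_group_eq_iff[OF X t.hom_closed[OF that(1)] t.hom_closed[OF that(2)]] by blast
  qed
  define v where "v = (\<lambda>z\<in>carrier Q. t (inv_into (carrier Y) q z))"
  have v: "v (q y) = t y" if "y \<in> carrier Y" for y
  proof -
    have "q y \<in> q ` carrier Y" using that by simp
    from eq[OF inv_into_into[OF this] that f_inv_into_f[OF this]]
    show ?thesis using that by (simp add: v_def)
  qed
  have "v \<in> hom Q X"
  proof (rule homI)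
    fix x assume "x \<in> carrier Q"
    then obtain y where "y \<in> carrier Y" "x = q y" using q(2) by blast
    then show "v x \<in> carrier X" using v by simp
  next
    fix x x' assume "x \<in> carrier Q" "x' \<in> carrier Q"
    then obtain y y' where "y \<in> carrier Y" "x = q y" "y' \<in> carrier Y" "x' = q y'" using q(2) by blast
    then show "v (x \<otimes>\<^bsub>Q\<^esub> x') = v x \<otimes>\<^bsub>X\<^esub> v x'"
      using v[of y] v[of y'] v[of "y \<otimes>\<^bsub>Y\<^esub> y'"] by simp
  qed
  then have vQ: "v \<in> group_homs Q X" by (simp add: group_homs_def v_def)
  have vuniq: "w = v" if w: "w \<in> group_homs Q X" "\<forall>y\<in>carrier Y. w (q y) = t y" for w
  proof (rule extensionalityI[where A = "carrier Q"])
    show "w \<in> extensional (carrier Q)" using w by (auto dest: group_homsD)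
    show "v \<in> extensional (carrier Q)" by (simp add: v_def)
    show "w x = v x" if "x \<in> carrier Q" for x
      using that q(2) w(2) v by (metis imageE)
  qed
  show ?thesis
  proof (rule ex1I[of _ v])
    show "v \<in> group_homs Q X \<and> (\<forall>y\<in>carrier Y. v (q y) = t y)" using vQ v by blast
    show "w = v" if "w \<in> group_homs Q X \<and> (\<forall>y\<in>carrier Y. w (q y) = t y)" for w
      by (rule vuniq[OF conjunct1[OF that] conjunct2[OF that]])
  qed
qed

subsection \<open>The category of small abelian groups\<close>

lemma Ab_objs: "G \<in> objs Ab \<longleftrightarrow> comm_group G \<and> small TYPE('u) (carrier (G :: 'u monoid))"
  by (simp add: Ab_def)

lemma Ab_simps: "homs Ab = group_homs" "cmp Ab X Y Z g f = compose (carrier X) g f"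
  "ident Ab X = (\<lambda>x\<in>carrier X. x)"
  by (simp_all add: Ab_def)

text \<open>Products, quotients and direct sums of groups with elements in \<open>'u\<close> have elements of
  other types.  This moves them back to \<open>'u\<close>.\<close>

lemma transport_group:
  fixes G :: "('g, 'd) monoid_scheme"
  assumes G: "comm_group G" and "small TYPE('u) (carrier G)"
  shows "\<exists>H::'u monoid. \<exists>\<alpha> \<beta>. H \<in> objs Ab \<and> \<alpha> \<in> group_homs G H \<and> \<beta> \<in> group_homs H G \<and>
    (\<forall>x\<in>carrier G. \<beta> (\<alpha> x) = x) \<and> (\<forall>y\<in>carrier H. \<alpha> (\<beta> y) = y)"
proof -
  interpret G: comm_group G by fact
  obtain e :: "'g \<Rightarrow> 'u" where e: "inj_on e (carrier G)" using small_embed[OF assms(2)] by blast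
  define d where "d = inv_into (carrier G) e"
  have d: "\<And>x. x \<in> carrier G \<Longrightarrow> d (e x) = x" using e by (simp add: d_def)
  define H where "H = \<lparr>carrier = e ` carrier G, monoid.mult = (\<lambda>x y. e (d x \<otimes>\<^bsub>G\<^esub> d y)), one = e \<one>\<^bsub>G\<^esub>\<rparr>"
  have "comm_group H"
  proof (rule comm_groupI)
    fix x assume "x \<in> carrier H"
    then obtain y where y: "y \<in> carrier G" "x = e y" by (auto simp: H_def)
    then have "e (inv\<^bsub>G\<^esub> y) \<in> carrier H" "e (inv\<^bsub>G\<^esub> y) \<otimes>\<^bsub>H\<^esub> x = \<one>\<^bsub>H\<^esub>"
      by (auto simp: H_def d G.l_inv)
    then show "\<exists>z\<in>carrier H. z \<otimes>\<^bsub>H\<^esub> x = \<one>\<^bsub>H\<^esub>" by blast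
  next
    fix x y z assume "x \<in> carrier H" "y \<in> carrier H" "z \<in> carrier H"
    then show "x \<otimes>\<^bsub>H\<^esub> y \<otimes>\<^bsub>H\<^esub> z = x \<otimes>\<^bsub>H\<^esub> (y \<otimes>\<^bsub>H\<^esub> z)"
      by (auto simp: H_def d G.m_assoc)
  next
    fix x y assume "x \<in> carrier H" "y \<in> carrier H"
    then show "x \<otimes>\<^bsub>H\<^esub> y = y \<otimes>\<^bsub>H\<^esub> x" by (auto simp: H_def d G.m_comm)
  qed (auto simp: H_def d)
  moreover have "small TYPE('u) (carrier H)" using assms(2) by (simp add: H_def small_image)
  moreover have "restrict e (carrier G) \<in> group_homs G H"
    by (rule restrict_group_homs) (use G in \<open>auto simp: hom_def H_def d\<close>)
  moreover have "restrict d (carrier H) \<in> group_homs H G"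
    by (rule restrict_group_homs[OF \<open>comm_group H\<close>]) (auto simp: hom_def H_def d)
  ultimately show ?thesis
    by (intro exI[of _ H] exI[of _ "restrict e (carrier G)"] exI[of _ "restrict d (carrier H)"])
       (auto simp: Ab_objs H_def d)
qed

lemma Ab_subgroup: "G \<in> objs Ab \<Longrightarrow> subgroup H G \<Longrightarrow> G\<lparr>carrier := H\<rparr> \<in> objs Ab"
  using comm_group_subgroup small_subset subgroup.subset by (fastforce simp: Ab_objs)

lemma Ab_quotient:
  fixes G :: "('g, 'd) monoid_scheme"
  assumes G: "comm_group G" "small TYPE('u) (carrier G)" and H: "subgroup H G"
  shows "\<exists>Q::'u monoid. \<exists>q. Q \<in> objs Ab \<and> q \<in> group_homs G Q \<and> q ` carrier G = carrier Q \<and>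
    (\<forall>x\<in>carrier G. q x = \<one>\<^bsub>Q\<^esub> \<longleftrightarrow> x \<in> H)"
proof -
  interpret G: comm_group G by fact
  interpret N: normal H G using H G.normal_iff_subgroup by blast
  have c: "comm_group (G Mod H)" by (rule G.abelian_FactGroup[OF H])
  have "small TYPE('u) (carrier (G Mod H))" using assms(2) by (simp add: carrier_FactGroup small_image)
  from transport_group[OF c this] obtain Q :: "'u monoid" and \<alpha> \<beta> where
    Q: "Q \<in> objs Ab" "\<alpha> \<in> group_homs (G Mod H) Q" "\<beta> \<in> group_homs Q (G Mod H)"
    and inv: "\<forall>x\<in>carrier (G Mod H). \<beta> (\<alpha> x) = x" "\<forall>y\<in>carrier Q. \<alpha> (\<beta> y) = y" by (elim exE conjE)
  have p: "restrict (\<lambda>a. H #>\<^bsub>G\<^esub> a) (carrier G) \<in> group_homs G (G Mod H)"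
    by (rule restrict_group_homs[OF G(1) N.r_coset_hom_Mod])
  let ?q = "compose (carrier G) \<alpha> (restrict (\<lambda>a. H #>\<^bsub>G\<^esub> a) (carrier G))"
  have q: "?q \<in> group_homs G Q" by (rule compose_group_homs[OF G(1) p Q(2)])
  have qx: "?q x = \<alpha> (H #>\<^bsub>G\<^esub> x)" "H #>\<^bsub>G\<^esub> x \<in> carrier (G Mod H)" if "x \<in> carrier G" for x
    using that by (auto simp: compose_def carrier_FactGroup)
  have "carrier Q \<subseteq> ?q ` carrier G"
  proof
    fix y assume y: "y \<in> carrier Q"
    then obtain x where "x \<in> carrier G" "\<beta> y = H #>\<^bsub>G\<^esub> x"
      using group_homsD(3)[OF Q(3)] by (auto simp: carrier_FactGroup)
    then show "y \<in> ?q ` carrier G" using inv(2) y qx by (metis imageI)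
  qed
  then have surj: "?q ` carrier G = carrier Q" using group_homsD(3)[OF q] by blast
  have ker: "?q x = \<one>\<^bsub>Q\<^esub> \<longleftrightarrow> x \<in> H" if x: "x \<in> carrier G" for x
  proof -
    have one: "\<alpha> H = \<one>\<^bsub>Q\<^esub>" using group_homs_one[OF Q(2) c] Q(1) by (simp add: Ab_objs)
    have Hc: "H \<in> carrier (G Mod H)" using c comm_group.axioms(2) group.is_monoid monoid.one_closed by force
    have "?q x = \<one>\<^bsub>Q\<^esub> \<longleftrightarrow> H #>\<^bsub>G\<^esub> x = H" using qx[OF x] one inv(1) Hc by metis
    also have "\<dots> \<longleftrightarrow> x \<in> H" using x H G.coset_join1 G.coset_join2 by blast
    finally show ?thesis .
  qed
  show ?thesis using Q(1) q surj ker by blast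
qed

context universe_type
begin

lemma Ab_trivial: "\<lparr>carrier = {x}, monoid.mult = (\<lambda>_ _. x), one = x\<rparr> \<in> objs (Ab :: ('u monoid, 'u \<Rightarrow> 'u) cat)"
proof -
  have "comm_group \<lparr>carrier = {x}, monoid.mult = (\<lambda>_ _. x), one = x\<rparr>" by (rule comm_groupI) simp_all
  then show ?thesis by (simp add: Ab_objs small_finite)
qed

text \<open>The identity and the trivial endomorphism of a zero object coincide.\<close>

lemma zero_object_Ab:
  assumes "zero_object (Ab :: ('u monoid, 'u \<Rightarrow> 'u) cat) Z" "z \<in> carrier Z" shows "z = \<one>\<^bsub>Z\<^esub>"
proof -
  have Z: "comm_group Z" and "\<exists>!f. f \<in> group_homs Z Z"
    using assms by (auto simp: zero_object_def Ab_simps Ab_objs)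
  then have "(\<lambda>x\<in>carrier Z. x) = (\<lambda>x\<in>carrier Z. \<one>\<^bsub>Z\<^esub>)"
    using id_group_homs[OF Z] trivial_group_homs[OF Z Z] by blast
  then show ?thesis using assms(2) by (metis restrict_apply')
qed

lemma zero_object_Ab_ex: "\<exists>Z. zero_object (Ab :: ('u monoid, 'u \<Rightarrow> 'u) cat) Z"
proof -
  let ?Z = "\<lparr>carrier = {undefined}, monoid.mult = (\<lambda>_ _. undefined), one = undefined\<rparr> :: 'u monoid"
  have Z: "?Z \<in> objs Ab" by (rule Ab_trivial)
  have "\<exists>!f. f \<in> group_homs X ?Z" "\<exists>!f. f \<in> group_homs ?Z X" if X: "comm_group (X :: 'u monoid)" for X
  proof -
    show "\<exists>!f. f \<in> group_homs X ?Z"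
    proof (rule ex1I)
      show "(\<lambda>x\<in>carrier X. \<one>\<^bsub>?Z\<^esub>) \<in> group_homs X ?Z" using Z X by (intro trivial_group_homs) (simp_all add: Ab_objs)
      fix f assume f: "f \<in> group_homs X ?Z"
      show "f = (\<lambda>x\<in>carrier X. \<one>\<^bsub>?Z\<^esub>)"
        by (rule extensionalityI[OF group_homsD(2)[OF f]]) (use group_homsD(3)[OF f] in auto)
    qed
    show "\<exists>!f. f \<in> group_homs ?Z X"
    proof (rule ex1I)
      show "(\<lambda>x\<in>carrier ?Z. \<one>\<^bsub>X\<^esub>) \<in> group_homs ?Z X" using Z X by (intro trivial_group_homs) (simp_all add: Ab_objs)
      fix f assume f: "f \<in> group_homs ?Z X"
      have "f \<one>\<^bsub>?Z\<^esub> = \<one>\<^bsub>X\<^esub>" using group_homs_one[OF f] Z X by (simp add: Ab_objs)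
      then show "f = (\<lambda>x\<in>carrier ?Z. \<one>\<^bsub>X\<^esub>)"
        by (intro extensionalityI[OF group_homsD(2)[OF f]]) auto
    qed
  qed
  then have "zero_object Ab ?Z" using Z unfolding zero_object_def Ab_simps by (simp add: Ab_objs)
  then show ?thesis ..
qed

lemma zero_mor_Ab:
  assumes X: "X \<in> objs (Ab :: ('u monoid, 'u \<Rightarrow> 'u) cat)" and Y: "Y \<in> objs Ab"
  shows "zero_mor Ab X Y f \<longleftrightarrow> f = (\<lambda>x\<in>carrier X. \<one>\<^bsub>Y\<^esub>)"
proof
  assume "zero_mor Ab X Y f"
  then obtain Z g h where Z: "zero_object (Ab :: ('u monoid, 'u \<Rightarrow> 'u) cat) Z"
    and g: "g \<in> group_homs X Z" and h: "h \<in> group_homs Z Y"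
    and f: "f = compose (carrier X) h g" unfolding zero_mor_def Ab_simps by blast
  have "h \<one>\<^bsub>Z\<^esub> = \<one>\<^bsub>Y\<^esub>" using group_homs_one[OF h] Z Y by (auto simp: zero_object_def Ab_objs)
  then have "h (g x) = \<one>\<^bsub>Y\<^esub>" if "x \<in> carrier X" for x
    using zero_object_Ab[OF Z group_homsD(3)[OF g that]] by simp
  then show "f = (\<lambda>x\<in>carrier X. \<one>\<^bsub>Y\<^esub>)" unfolding f by (auto simp: compose_def)
next
  assume f: "f = (\<lambda>x\<in>carrier X. \<one>\<^bsub>Y\<^esub>)"
  obtain Z where Z: "zero_object (Ab :: ('u monoid, 'u \<Rightarrow> 'u) cat) Z" using zero_object_Ab_ex by blast
  then have cZ: "comm_group Z" by (auto simp: zero_object_def Ab_objs)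
  have c: "comm_group X" "comm_group Y" using X Y by (simp_all add: Ab_objs)
  have "f = compose (carrier X) (\<lambda>x\<in>carrier Z. \<one>\<^bsub>Y\<^esub>) (\<lambda>x\<in>carrier X. \<one>\<^bsub>Z\<^esub>)"
    unfolding f using comm_group.axioms(2)[OF cZ] by (auto simp: compose_def group.is_monoid)
  then show "zero_mor Ab X Y f"
    unfolding zero_mor_def Ab_simps using Z trivial_group_homs[OF c(1) cZ] trivial_group_homs[OF cZ c(2)] by blast
qed

end

lemma zero_object_opposite: "zero_object (opposite C) Z = zero_object C Z"
  by (auto simp: zero_object_def opposite_def)

lemma zero_mor_opposite: "zero_mor (opposite C) X Y f = zero_mor C Y X f"
  unfolding zero_mor_def zero_object_opposite by (auto simp: opposite_def)

text \<open>Notions that are defined through the opposite category, in terms of \<open>C\<close> itself.\<close>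

lemma is_cokernel_iff:
  "is_cokernel C X Y f Q q \<longleftrightarrow>
     Q \<in> objs C \<and> q \<in> homs C Y Q \<and> zero_mor C X Q (cmp C X Y Q q f) \<and>
     (\<forall>T\<in>objs C. \<forall>t\<in>homs C Y T. zero_mor C X T (cmp C X Y T t f) \<longrightarrow>
        (\<exists>!u. u \<in> homs C Q T \<and> cmp C Y Q T u q = t))"
  unfolding is_cokernel_def is_kernel_def zero_mor_opposite by (auto simp: opposite_def)

lemma is_epi_iff:
  "is_epi C X Y f \<longleftrightarrow> f \<in> homs C X Y \<and>
     (\<forall>T\<in>objs C. \<forall>g\<in>homs C Y T. \<forall>h\<in>homs C Y T. cmp C X Y T g f = cmp C X Y T h f \<longrightarrow> g = h)"
  by (simp add: is_epi_def is_mono_def opposite_def)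

lemma is_cocone_iff:
  "is_cocone C J D L \<iota> \<longleftrightarrow> L \<in> objs C \<and> (\<forall>j\<in>objs J. \<iota> j \<in> homs C (on_obj D j) L) \<and>
     (\<forall>i\<in>objs J. \<forall>j\<in>objs J. \<forall>f\<in>homs J i j.
        cmp C (on_obj D i) (on_obj D j) L (\<iota> j) (on_mor D i j f) = \<iota> i)"
  by (auto simp: is_cocone_def is_cone_def opposite_def op_ftr_def)

lemma is_colimit_iff:
  "is_colimit C J D L \<iota> \<longleftrightarrow> is_cocone C J D L \<iota> \<and>
     (\<forall>X \<xi>. is_cocone C J D X \<xi> \<longrightarrow>
        (\<exists>!u. u \<in> homs C L X \<and> (\<forall>j\<in>objs J. cmp C (on_obj D j) L X u (\<iota> j) = \<xi> j)))"
  unfolding is_colimit_def is_limit_def is_cocone_def by (simp add: opposite_def op_ftr_def)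

section \<open>Kernels, cokernels, limits and colimits of abelian groups\<close>

context universe_type
begin

lemma is_kernel_Ab_iff:
  fixes X Y K :: "'u monoid"
  assumes "Y \<in> objs Ab"
  shows "is_kernel Ab X Y f K (k :: 'u \<Rightarrow> 'u) \<longleftrightarrow> K \<in> objs Ab \<and> k \<in> group_homs K X \<and>
    compose (carrier K) f k = (\<lambda>x\<in>carrier K. \<one>\<^bsub>Y\<^esub>) \<and>
    (\<forall>T\<in>(objs Ab :: 'u monoid set). \<forall>t\<in>group_homs T X. compose (carrier T) f t = (\<lambda>x\<in>carrier T. \<one>\<^bsub>Y\<^esub>) \<longrightarrow>
      (\<exists>!v. v \<in> group_homs T K \<and> compose (carrier T) k v = t))"
  unfolding is_kernel_def Ab_simps using zero_mor_Ab[OF _ assms] by (simp cong: conj_cong ball_cong)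

lemma is_cokernel_Ab_iff:
  fixes X Y Q :: "'u monoid"
  assumes "X \<in> objs Ab"
  shows "is_cokernel Ab X Y f Q (q :: 'u \<Rightarrow> 'u) \<longleftrightarrow> Q \<in> objs Ab \<and> q \<in> group_homs Y Q \<and>
    compose (carrier X) q f = (\<lambda>x\<in>carrier X. \<one>\<^bsub>Q\<^esub>) \<and>
    (\<forall>T\<in>(objs Ab :: 'u monoid set). \<forall>t\<in>group_homs Y T. compose (carrier X) t f = (\<lambda>x\<in>carrier X. \<one>\<^bsub>T\<^esub>) \<longrightarrow>
      (\<exists>!v. v \<in> group_homs Q T \<and> compose (carrier Y) v q = t))"
  unfolding is_cokernel_iff Ab_simps using zero_mor_Ab[OF assms] by (simp cong: conj_cong ball_cong)

text \<open>The universal property is tested on the kernel of \<open>f\<close>, which has to factor through \<open>k\<close>,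
  and on the kernel of \<open>k\<close>, whose inclusion into \<open>K\<close> has to agree with the trivial map.\<close>

lemma Ab_kernelD:
  fixes X Y K :: "'u monoid"
  assumes X: "X \<in> objs Ab" and Y: "Y \<in> objs Ab" and f: "f \<in> group_homs X Y"
    and ker: "is_kernel Ab X Y f K k"
  shows "inj_on k (carrier K)" "k ` carrier K = kernel X Y f"
proof -
  have K: "K \<in> objs Ab" and k: "k \<in> group_homs K X"
    and kz: "compose (carrier K) f k = (\<lambda>x\<in>carrier K. \<one>\<^bsub>Y\<^esub>)"
    and univ: "\<And>(T :: 'u monoid) t. T \<in> objs Ab \<Longrightarrow> t \<in> group_homs T X \<Longrightarrow> compose (carrier T) f t = (\<lambda>x\<in>carrier T. \<one>\<^bsub>Y\<^esub>) \<Longrightarrow>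
        (\<exists>!v. v \<in> group_homs T K \<and> compose (carrier T) k v = t)"
    using ker unfolding is_kernel_Ab_iff[OF Y] by blast+
  have c: "comm_group X" "comm_group Y" "comm_group K" using X Y K by (auto simp: Ab_objs)
  interpret f: group_hom X Y f
    using f c by (auto simp: group_hom_def group_hom_axioms_def comm_group.axioms(2) group_homs_def)
  interpret k: group_hom K X k
    using k c by (auto simp: group_hom_def group_hom_axioms_def comm_group.axioms(2) group_homs_def)
  have kf: "f (k x) = \<one>\<^bsub>Y\<^esub>" if "x \<in> carrier K" for x
    using fun_cong[OF kz, of x] that by (simp add: compose_def)
  let ?T = "X\<lparr>carrier := kernel X Y f\<rparr>"
  have T: "?T \<in> objs Ab" by (rule Ab_subgroup[OF X f.subgroup_kernel])
  have t: "(\<lambda>x\<in>kernel X Y f. x) \<in> group_homs ?T X"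
    using restrict_group_homs[of ?T "\<lambda>x. x" X] T by (auto simp: Ab_objs kernel_def hom_def)
  have "\<exists>!v. v \<in> group_homs ?T K \<and> compose (carrier ?T) k v = (\<lambda>x\<in>kernel X Y f. x)"
    by (rule univ[OF T t]) (auto simp: compose_def kernel_def)
  then obtain v where v: "v \<in> group_homs ?T K" "compose (carrier ?T) k v = (\<lambda>x\<in>kernel X Y f. x)" by blast
  show "k ` carrier K = kernel X Y f"
  proof
    show "k ` carrier K \<subseteq> kernel X Y f" using kf by (auto simp: kernel_def)
    show "kernel X Y f \<subseteq> k ` carrier K"
    proof
      fix x assume x: "x \<in> kernel X Y f"
      then have "k (v x) = x" using fun_cong[OF v(2), of x] by (simp add: compose_def)
      moreover have "v x \<in> carrier K" using group_homsD(3)[OF v(1)] x by simp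
      ultimately show "x \<in> k ` carrier K" by (metis imageI)
    qed
  qed
  show "inj_on k (carrier K)"
  proof (rule group_homs_inj[OF k c(3,1)])
    fix x assume x: "x \<in> carrier K" "k x = \<one>\<^bsub>X\<^esub>"
    let ?H = "K\<lparr>carrier := kernel K X k\<rparr>"
    have H: "?H \<in> objs Ab" by (rule Ab_subgroup[OF K k.subgroup_kernel])
    then have cH: "comm_group ?H" by (simp add: Ab_objs)
    have u1: "(\<lambda>x\<in>carrier ?H. x) \<in> group_homs ?H K"
      using restrict_group_homs[OF cH, of "\<lambda>x. x" K] by (auto simp: kernel_def hom_def)
    have u2: "(\<lambda>x\<in>carrier ?H. \<one>\<^bsub>K\<^esub>) \<in> group_homs ?H K" by (rule trivial_group_homs[OF cH c(3)])
    have t: "(\<lambda>x\<in>carrier ?H. \<one>\<^bsub>X\<^esub>) \<in> group_homs ?H X" by (rule trivial_group_homs[OF cH c(1)])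
    have "\<exists>!v. v \<in> group_homs ?H K \<and> compose (carrier ?H) k v = (\<lambda>x\<in>carrier ?H. \<one>\<^bsub>X\<^esub>)"
      by (rule univ[OF H t]) (auto simp: compose_def)
    moreover have "compose (carrier ?H) k (\<lambda>x\<in>carrier ?H. x) = (\<lambda>x\<in>carrier ?H. \<one>\<^bsub>X\<^esub>)"
      "compose (carrier ?H) k (\<lambda>x\<in>carrier ?H. \<one>\<^bsub>K\<^esub>) = (\<lambda>x\<in>carrier ?H. \<one>\<^bsub>X\<^esub>)"
      by (auto simp: compose_def kernel_def)
    ultimately have "(\<lambda>x\<in>carrier ?H. x) = (\<lambda>x\<in>carrier ?H. \<one>\<^bsub>K\<^esub>)" using u1 u2 by blast
    from fun_cong[OF this, of x] show "x = \<one>\<^bsub>K\<^esub>" using x by (auto simp: kernel_def)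
  qed
qed

lemma Ab_kernelI:
  fixes X Y K :: "'u monoid"
  assumes X: "X \<in> objs Ab" and Y: "Y \<in> objs Ab" and K: "K \<in> objs Ab"
    and f: "f \<in> group_homs X Y" and k: "k \<in> group_homs K X"
    and inj: "inj_on k (carrier K)" and im: "k ` carrier K = kernel X Y f"
  shows "is_kernel Ab X Y f K k"
proof -
  have c: "comm_group X" "comm_group K" using X K by (auto simp: Ab_objs)
  have h1: "compose (carrier K) f k = (\<lambda>x\<in>carrier K. \<one>\<^bsub>Y\<^esub>)"
    using im by (force simp: compose_def kernel_def intro!: restrict_ext)
  have h2: "\<exists>!v. v \<in> group_homs T K \<and> compose (carrier T) k v = t"
    if T: "T \<in> objs Ab" and t: "t \<in> group_homs T X"
      and z: "compose (carrier T) f t = (\<lambda>x\<in>carrier T. \<one>\<^bsub>Y\<^esub>)" for T :: "'u monoid" and t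
  proof -
    have cT: "comm_group T" using T by (simp add: Ab_objs)
    have "\<exists>!g. g \<in> carrier K \<and> (\<forall>j\<in>{()}. k g = t x)" if x: "x \<in> carrier T" for x
    proof -
      have "t x \<in> kernel X Y f"
        using fun_cong[OF z, of x] x group_homsD(3)[OF t x] by (simp add: kernel_def compose_def)
      then obtain g where "g \<in> carrier K" "k g = t x" using im by (metis imageE)
      then show ?thesis by (intro ex1I[of _ g]) (auto intro: inj_onD[OF inj])
    qed
    from jointly_mono_factor[of K T "{()}" "\<lambda>_. k" "\<lambda>_. X" "\<lambda>_. t", OF c(2) cT k t this]
    show ?thesis by (simp add: compose_eq_iff[OF group_homsD(2)[OF t]])
  qed
  show ?thesis unfolding is_kernel_Ab_iff[OF Y] by (intro conjI ballI impI K k h1 h2)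
qed

text \<open>The universal property is tested on the quotient of \<open>Q\<close> by the image of \<open>q\<close>, which has to
  be trivial, and on the quotient of \<open>Y\<close> by the image of \<open>f\<close>, whose projection has to factor
  through \<open>q\<close>.\<close>

lemma Ab_cokernelD:
  fixes X Y Q :: "'u monoid"
  assumes X: "X \<in> objs Ab" and Y: "Y \<in> objs Ab" and f: "f \<in> group_homs X Y"
    and coker: "is_cokernel Ab X Y f Q q"
  shows "q ` carrier Y = carrier Q" "kernel Y Q q = f ` carrier X"
proof -
  have Q: "Q \<in> objs Ab" and q: "q \<in> group_homs Y Q"
    and qz: "compose (carrier X) q f = (\<lambda>x\<in>carrier X. \<one>\<^bsub>Q\<^esub>)"
    and univ: "\<And>(T :: 'u monoid) t. T \<in> objs Ab \<Longrightarrow> t \<in> group_homs Y T \<Longrightarrow> compose (carrier X) t f = (\<lambda>x\<in>carrier X. \<one>\<^bsub>T\<^esub>) \<Longrightarrow>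
        (\<exists>!v. v \<in> group_homs Q T \<and> compose (carrier Y) v q = t)"
    using coker unfolding is_cokernel_Ab_iff[OF X] by blast+
  have c: "comm_group X" "comm_group Y" "comm_group Q" using X Y Q by (auto simp: Ab_objs)
  interpret f: group_hom X Y f
    using f c by (auto simp: group_hom_def group_hom_axioms_def comm_group.axioms(2) group_homs_def)
  interpret q: group_hom Y Q q
    using q c by (auto simp: group_hom_def group_hom_axioms_def comm_group.axioms(2) group_homs_def)
  have qf: "q (f x) = \<one>\<^bsub>Q\<^esub>" if "x \<in> carrier X" for x
    using fun_cong[OF qz, of x] that by (simp add: compose_def)
  show "q ` carrier Y = carrier Q"
  proof -
    obtain T :: "'u monoid" and t where T: "T \<in> objs Ab" "t \<in> group_homs Q T"
      "\<forall>x\<in>carrier Q. t x = \<one>\<^bsub>T\<^esub> \<longleftrightarrow> x \<in> q ` carrier Y"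
      using Ab_quotient[OF c(3) _ q.img_is_subgroup] Q unfolding Ab_objs by metis
    have cT: "comm_group T" using T by (simp add: Ab_objs)
    have "\<exists>!v. v \<in> group_homs Q T \<and> compose (carrier Y) v q = (\<lambda>x\<in>carrier Y. \<one>\<^bsub>T\<^esub>)"
      by (rule univ[OF T(1) trivial_group_homs[OF c(2) cT]]) (auto simp: compose_def)
    moreover have "compose (carrier Y) t q = (\<lambda>x\<in>carrier Y. \<one>\<^bsub>T\<^esub>)"
      "compose (carrier Y) (\<lambda>x\<in>carrier Q. \<one>\<^bsub>T\<^esub>) q = (\<lambda>x\<in>carrier Y. \<one>\<^bsub>T\<^esub>)"
      using T(3) by (auto simp: compose_def)
    ultimately have "t = (\<lambda>x\<in>carrier Q. \<one>\<^bsub>T\<^esub>)" using T(2) trivial_group_homs[OF c(3) cT] by blast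
    then have "x \<in> q ` carrier Y" if "x \<in> carrier Q" for x using T(3) that by auto
    then show ?thesis by auto
  qed
  show "kernel Y Q q = f ` carrier X"
  proof
    show "f ` carrier X \<subseteq> kernel Y Q q" using qf by (auto simp: kernel_def)
    obtain T :: "'u monoid" and t where T: "T \<in> objs Ab" "t \<in> group_homs Y T"
      "\<forall>x\<in>carrier Y. t x = \<one>\<^bsub>T\<^esub> \<longleftrightarrow> x \<in> f ` carrier X"
      using Ab_quotient[OF c(2) _ f.img_is_subgroup] Y unfolding Ab_objs by metis
    have cT: "comm_group T" using T by (simp add: Ab_objs)
    have "compose (carrier X) t f = (\<lambda>x\<in>carrier X. \<one>\<^bsub>T\<^esub>)" using T(3) by (auto simp: compose_def)
    then obtain v where v: "v \<in> group_homs Q T" "compose (carrier Y) v q = t" using univ[OF T(1,2)] by blast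
    have v1: "v \<one>\<^bsub>Q\<^esub> = \<one>\<^bsub>T\<^esub>" by (rule group_homs_one[OF v(1) c(3) cT])
    show "kernel Y Q q \<subseteq> f ` carrier X"
    proof
      fix y assume y: "y \<in> kernel Y Q q"
      then have "t y = \<one>\<^bsub>T\<^esub>" using fun_cong[OF v(2), of y] v1 by (simp add: compose_def kernel_def)
      then show "y \<in> f ` carrier X" using T(3) y by (simp add: kernel_def)
    qed
  qed
qed

lemma Ab_cokernelI:
  fixes X Y Q :: "'u monoid"
  assumes X: "X \<in> objs Ab" and Y: "Y \<in> objs Ab" and Q: "Q \<in> objs Ab"
    and q: "q \<in> group_homs Y Q"
    and surj: "q ` carrier Y = carrier Q" and ker: "kernel Y Q q = f ` carrier X"
  shows "is_cokernel Ab X Y f Q q"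
proof -
  have c: "comm_group Y" "comm_group Q" using Y Q by (auto simp: Ab_objs)
  have h1: "compose (carrier X) q f = (\<lambda>x\<in>carrier X. \<one>\<^bsub>Q\<^esub>)"
    using ker by (force simp: compose_def kernel_def intro!: restrict_ext)
  have h2: "\<exists>!v. v \<in> group_homs Q T \<and> compose (carrier Y) v q = t"
    if T: "T \<in> objs Ab" and t: "t \<in> group_homs Y T"
      and z: "compose (carrier X) t f = (\<lambda>x\<in>carrier X. \<one>\<^bsub>T\<^esub>)" for T :: "'u monoid" and t
  proof -
    have cT: "comm_group T" using T by (simp add: Ab_objs)
    have kt: "t y = \<one>\<^bsub>T\<^esub>" if "y \<in> carrier Y" "q y = \<one>\<^bsub>Q\<^esub>" for y
    proof -
      have "y \<in> kernel Y Q q" using that by (simp add: kernel_def)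
      then obtain x where x: "x \<in> carrier X" "y = f x" unfolding ker by blast
      then show ?thesis using fun_cong[OF z, of x] by (simp add: compose_def)
    qed
    from epi_factor[OF c cT group_homsD(1)[OF q] surj group_homsD(1)[OF t] kt]
    show ?thesis by (simp add: compose_eq_iff[OF group_homsD(2)[OF t]])
  qed
  show ?thesis unfolding is_cokernel_Ab_iff[OF X] by (intro conjI ballI impI Q q h1 h2)
qed

end

subsection \<open>Limits\<close>

definition compatible :: "('j, 'k) cat \<Rightarrow> ('j, 'k, 'g monoid, 'g \<Rightarrow> 'g) ftr \<Rightarrow> ('j \<Rightarrow> 'g) \<Rightarrow> bool" where
  "compatible J D x \<longleftrightarrow> (\<forall>j\<in>objs J. x j \<in> carrier (on_obj D j)) \<and>
     (\<forall>i\<in>objs J. \<forall>j\<in>objs J. \<forall>f\<in>homs J i j. on_mor D i j f (x i) = x j)"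

text \<open>The elementwise form of a limit: the elements of \<open>L\<close> are the compatible families.  In
  contrast to the universal property this can be transferred between functors and their values.\<close>

definition limit_group ::
    "('j, 'k) cat \<Rightarrow> ('j, 'k, 'g monoid, 'g \<Rightarrow> 'g) ftr \<Rightarrow> ('h, 'd) monoid_scheme \<Rightarrow> ('j \<Rightarrow> 'h \<Rightarrow> 'g) \<Rightarrow> bool" where
  "limit_group J D L \<pi> \<longleftrightarrow> (\<forall>j\<in>objs J. \<pi> j \<in> group_homs L (on_obj D j)) \<and>
     (\<forall>g\<in>carrier L. compatible J D (\<lambda>j. \<pi> j g)) \<and>
     (\<forall>x. compatible J D x \<longrightarrow> (\<exists>!g. g \<in> carrier L \<and> (\<forall>j\<in>objs J. \<pi> j g = x j)))"

text \<open>A diagram of groups on the underlying graph of \<open>J\<close>.\<close>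

definition group_diagram :: "('j, 'k) cat \<Rightarrow> ('j, 'k, 'g monoid, 'g \<Rightarrow> 'g) ftr \<Rightarrow> bool" where
  "group_diagram J D \<longleftrightarrow> (\<forall>j\<in>objs J. comm_group (on_obj D j)) \<and>
     (\<forall>i\<in>objs J. \<forall>j\<in>objs J. \<forall>f\<in>homs J i j. on_mor D i j f \<in> group_homs (on_obj D i) (on_obj D j))"

lemma is_functor_Ab_diagram: "is_functor J Ab D \<Longrightarrow> group_diagram J D"
  unfolding is_functor_def group_diagram_def Ab_simps Ab_objs by blast

lemma limit_group_factor:
  assumes "limit_group J D L \<pi>" "comm_group L" "comm_group X"
    and \<xi>: "\<And>j. j \<in> objs J \<Longrightarrow> \<xi> j \<in> group_homs X (on_obj D j)"
    and "\<And>x. x \<in> carrier X \<Longrightarrow> compatible J D (\<lambda>j. \<xi> j x)"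
  shows "\<exists>!v. v \<in> group_homs X L \<and> (\<forall>j\<in>objs J. \<forall>x\<in>carrier X. \<pi> j (v x) = \<xi> j x)"
  by (rule jointly_mono_factor) (use assms in \<open>auto simp: limit_group_def\<close>)

lemma compatible_subgroup:
  assumes "group_diagram J D"
  shows "subgroup {x \<in> carrier (product_group (objs J) (on_obj D)). compatible J D x}
    (product_group (objs J) (on_obj D))" (is "subgroup _ ?P")
proof (rule subgroup_where)
  have c: "\<And>j. j \<in> objs J \<Longrightarrow> comm_group (on_obj D j)"
    and h: "\<And>i j f. i \<in> objs J \<Longrightarrow> j \<in> objs J \<Longrightarrow> f \<in> homs J i j \<Longrightarrow>
      on_mor D i j f \<in> group_homs (on_obj D i) (on_obj D j)"
    using assms by (auto simp: group_diagram_def)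
  have g: "\<And>j. j \<in> objs J \<Longrightarrow> group (on_obj D j)" "\<And>j. j \<in> objs J \<Longrightarrow> monoid (on_obj D j)"
    using c by (auto simp: comm_group.axioms(2) group.is_monoid)
  show P: "comm_group ?P" using c by blast
  then have gP: "group ?P" "monoid ?P" by (auto simp: comm_group.axioms(2) group.is_monoid)
  show "\<one>\<^bsub>?P\<^esub> \<in> carrier ?P \<and> compatible J D \<one>\<^bsub>?P\<^esub>"
    using monoid.one_closed[OF gP(2)] g
    by (auto simp: compatible_def monoid.one_closed group_homs_one[OF h c c])
  fix x assume x: "x \<in> carrier ?P \<and> compatible J D x"
  then have xc: "\<And>j. j \<in> objs J \<Longrightarrow> x j \<in> carrier (on_obj D j)" by (auto simp: compatible_def)
  show "inv\<^bsub>?P\<^esub> x \<in> carrier ?P \<and> compatible J D (inv\<^bsub>?P\<^esub> x)"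
  proof
    show "inv\<^bsub>?P\<^esub> x \<in> carrier ?P" using x group.inv_closed[OF gP(1)] by blast
    have "inv\<^bsub>?P\<^esub> x = (\<lambda>j\<in>objs J. inv\<^bsub>on_obj D j\<^esub> x j)" using x g by (intro inv_product_group) auto
    then show "compatible J D (inv\<^bsub>?P\<^esub> x)"
      using x g xc by (auto simp: compatible_def group.inv_closed group_homs_inv[OF h c c])
  qed
  fix y assume y: "y \<in> carrier ?P \<and> compatible J D y"
  then have yc: "\<And>j. j \<in> objs J \<Longrightarrow> y j \<in> carrier (on_obj D j)" by (auto simp: compatible_def)
  show "x \<otimes>\<^bsub>?P\<^esub> y \<in> carrier ?P \<and> compatible J D (x \<otimes>\<^bsub>?P\<^esub> y)"
  proof
    show "x \<otimes>\<^bsub>?P\<^esub> y \<in> carrier ?P" using x y monoid.m_closed[OF gP(2)] by blast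
    show "compatible J D (x \<otimes>\<^bsub>?P\<^esub> y)"
      using x y g xc yc by (auto simp: compatible_def monoid.m_closed group_homsD(4)[OF h])
  qed
qed simp

lemma limit_group_inj:
  assumes D: "group_diagram J D" and L: "limit_group J D L \<pi>"
    and "g \<in> carrier L" "g' \<in> carrier L" "\<And>j. j \<in> objs J \<Longrightarrow> \<pi> j g = \<pi> j g'"
  shows "g = g'"
  using L assms(3-5) unfolding limit_group_def by blast

context universe_type
begin

text \<open>The subgroup of compatible families in the product, moved to \<open>'u\<close>.\<close>

lemma limit_group_ex:
  fixes D :: "('j, 'k, 'u monoid, 'u \<Rightarrow> 'u) ftr"
  assumes J: "small TYPE('u) (objs J)" and D: "group_diagram J D"
    and small: "\<And>j. j \<in> objs J \<Longrightarrow> small TYPE('u) (carrier (on_obj D j))"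
  shows "\<exists>L \<pi>. L \<in> objs (Ab :: ('u monoid, 'u \<Rightarrow> 'u) cat) \<and> limit_group J D L \<pi>"
proof -
  let ?P = "product_group (objs J) (on_obj D)"
  let ?H = "{x \<in> carrier ?P. compatible J D x}"
  let ?G = "?P\<lparr>carrier := ?H\<rparr>"
  have c: "\<And>j. j \<in> objs J \<Longrightarrow> comm_group (on_obj D j)" using D by (simp add: group_diagram_def)
  then have P: "comm_group ?P" by blast
  have G: "comm_group ?G" by (rule comm_group_subgroup[OF P compatible_subgroup[OF D]])
  have "small TYPE('u) (carrier ?P)" using J small by (simp add: small_PiE)
  then have "small TYPE('u) (carrier ?G)" by (rule small_subset) auto
  from transport_group[OF G this] obtain L :: "'u monoid" and \<alpha> \<beta> where
    L: "L \<in> objs Ab" "\<alpha> \<in> group_homs ?G L" "\<beta> \<in> group_homs L ?G"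
    and inv: "\<forall>x\<in>carrier ?G. \<beta> (\<alpha> x) = x" "\<forall>y\<in>carrier L. \<alpha> (\<beta> y) = y" by (elim exE conjE)
  have cL: "comm_group L" using L by (simp add: Ab_objs)
  define \<pi> where "\<pi> j = (\<lambda>y\<in>carrier L. \<beta> y j)" for j
  have \<beta>: "\<beta> y \<in> ?H" if "y \<in> carrier L" for y using group_homsD(3)[OF L(3) that] by simp
  have "\<pi> j \<in> group_homs L (on_obj D j)" if "j \<in> objs J" for j
    unfolding \<pi>_def
  proof (rule restrict_group_homs[OF cL], rule homI)
    fix x y assume x: "x \<in> carrier L" and y: "y \<in> carrier L"
    show "\<beta> x j \<in> carrier (on_obj D j)" using \<beta>[OF x] that by (simp add: PiE_iff)
    show "\<beta> (x \<otimes>\<^bsub>L\<^esub> y) j = \<beta> x j \<otimes>\<^bsub>on_obj D j\<^esub> \<beta> y j"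
      using group_homsD(4)[OF L(3) x y] that by simp
  qed
  moreover have "compatible J D (\<lambda>j. \<pi> j g)" if "g \<in> carrier L" for g
    using \<beta>[OF that] that by (simp add: \<pi>_def)
  moreover have "\<exists>!g. g \<in> carrier L \<and> (\<forall>j\<in>objs J. \<pi> j g = x j)" if x: "compatible J D x" for x
  proof -
    let ?x = "restrict x (objs J)"
    have xH: "?x \<in> ?H" using x by (auto simp: compatible_def)
    show ?thesis
    proof (rule ex1I[of _ "\<alpha> ?x"])
      have "\<alpha> ?x \<in> carrier L" using group_homsD(3)[OF L(2)] xH by simp
      moreover have "\<beta> (\<alpha> ?x) = ?x" using inv xH by simp
      ultimately show "\<alpha> ?x \<in> carrier L \<and> (\<forall>j\<in>objs J. \<pi> j (\<alpha> ?x) = x j)" by (simp add: \<pi>_def)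
    next
      fix g assume g: "g \<in> carrier L \<and> (\<forall>j\<in>objs J. \<pi> j g = x j)"
      have "\<beta> g \<in> (\<Pi>\<^sub>E i\<in>objs J. carrier (on_obj D i))" "?x \<in> (\<Pi>\<^sub>E i\<in>objs J. carrier (on_obj D i))"
        using \<beta> g xH by auto
      then have "\<beta> g = ?x" by (rule PiE_ext) (use g in \<open>auto simp: \<pi>_def\<close>)
      then show "g = \<alpha> ?x" using inv(2) g by metis
    qed
  qed
  ultimately have "limit_group J D L \<pi>" by (simp add: limit_group_def)
  with L(1) show ?thesis by blast
qed

text \<open>Elements of a group correspond to homomorphisms from the integers, but these are not an
  object of \<open>Ab\<close> when small means finite.  Therefore existence is tested on the group of all compatible
  families, and uniqueness on the subgroup of \<open>L\<close> that is killed by all \<open>\<pi> j\<close>.\<close>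

lemma Ab_limitD:
  fixes D :: "('u, 'u, 'u monoid, 'u \<Rightarrow> 'u) ftr"
  assumes J: "small_category J" and D: "is_functor J Ab D" and lim: "is_limit Ab J D L \<pi>"
  shows "limit_group J D L \<pi>"
proof -
  note dia = is_functor_Ab_diagram[OF D]
  have Dj: "\<And>j. j \<in> objs J \<Longrightarrow> on_obj D j \<in> objs Ab" using D by (simp add: is_functor_def)
  then have cD: "\<And>j. j \<in> objs J \<Longrightarrow> comm_group (on_obj D j)" by (simp add: Ab_objs)
  have h: "\<And>i j f. i \<in> objs J \<Longrightarrow> j \<in> objs J \<Longrightarrow> f \<in> homs J i j \<Longrightarrow>
      on_mor D i j f \<in> group_homs (on_obj D i) (on_obj D j)"
    using dia by (auto simp: group_diagram_def)
  have L: "L \<in> objs Ab" and \<pi>: "\<And>j. j \<in> objs J \<Longrightarrow> \<pi> j \<in> group_homs L (on_obj D j)"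
    and comm: "\<And>i j f. i \<in> objs J \<Longrightarrow> j \<in> objs J \<Longrightarrow> f \<in> homs J i j \<Longrightarrow>
        compose (carrier L) (on_mor D i j f) (\<pi> i) = \<pi> j"
    using lim unfolding is_limit_def is_cone_def Ab_simps by auto
  have univ: "\<exists>!v. v \<in> group_homs X L \<and> (\<forall>j\<in>objs J. compose (carrier X) (\<pi> j) v = \<xi> j)"
    if "X \<in> objs Ab" "\<And>j. j \<in> objs J \<Longrightarrow> \<xi> j \<in> group_homs X (on_obj D j)"
      "\<And>i j f. i \<in> objs J \<Longrightarrow> j \<in> objs J \<Longrightarrow> f \<in> homs J i j \<Longrightarrow>
        compose (carrier X) (on_mor D i j f) (\<xi> i) = \<xi> j" for X :: "'u monoid" and \<xi>
  proof -
    have "is_cone Ab J D X \<xi>" using that unfolding is_cone_def Ab_simps by simp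
    then show ?thesis using lim unfolding is_limit_def Ab_simps by blast
  qed
  have cL: "comm_group L" using L by (simp add: Ab_objs)
  have 1: "\<exists>g. g \<in> carrier L \<and> (\<forall>j\<in>objs J. \<pi> j g = x j)" if x: "compatible J D x" for x
  proof -
    have "small TYPE('u) (objs J)" using J by (simp add: small_category_def)
    from limit_group_ex[OF this dia] Dj obtain L' :: "'u monoid" and \<pi>' where
      L': "L' \<in> objs Ab" "limit_group J D L' \<pi>'" by (auto simp: Ab_objs)
    have \<pi>': "\<And>j. j \<in> objs J \<Longrightarrow> \<pi>' j \<in> group_homs L' (on_obj D j)"
      and co: "\<And>g. g \<in> carrier L' \<Longrightarrow> compatible J D (\<lambda>j. \<pi>' j g)"
      using L' by (auto simp: limit_group_def)
    have "\<exists>!v. v \<in> group_homs L' L \<and> (\<forall>j\<in>objs J. compose (carrier L') (\<pi> j) v = \<pi>' j)"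
    proof (rule univ[OF L'(1) \<pi>'])
      fix i j f assume ij: "i \<in> objs J" "j \<in> objs J" "f \<in> homs J i j"
      then show "compose (carrier L') (on_mor D i j f) (\<pi>' i) = \<pi>' j"
        using co by (auto simp: compose_eq_iff[OF group_homsD(2)[OF \<pi>'[OF ij(2)]]] compatible_def)
    qed
    then obtain v where v: "v \<in> group_homs L' L" "\<And>j. j \<in> objs J \<Longrightarrow> compose (carrier L') (\<pi> j) v = \<pi>' j"
      by blast
    obtain g where g: "g \<in> carrier L'" "\<forall>j\<in>objs J. \<pi>' j g = x j"
      using L'(2) x unfolding limit_group_def by blast
    have "\<pi> j (v g) = x j" if "j \<in> objs J" for j
      using fun_cong[OF v(2)[OF that], of g] g that by (simp add: compose_def)
    then show ?thesis using group_homsD(3)[OF v(1) g(1)] by blast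
  qed
  have 2: "g = g'" if "g \<in> carrier L" "g' \<in> carrier L" "\<forall>j\<in>objs J. \<pi> j g = \<pi> j g'" for g g'
  proof -
    interpret L: comm_group L by (rule cL)
    let ?N = "{g \<in> carrier L. \<forall>j\<in>objs J. \<pi> j g = \<one>\<^bsub>on_obj D j\<^esub>}"
    have one: "\<one>\<^bsub>on_obj D j\<^esub> \<in> carrier (on_obj D j)" if "j \<in> objs J" for j
      using cD[OF that] by (simp add: comm_group.axioms(2) group.is_monoid)
    have mm: "\<one>\<^bsub>on_obj D j\<^esub> \<otimes>\<^bsub>on_obj D j\<^esub> \<one>\<^bsub>on_obj D j\<^esub> = \<one>\<^bsub>on_obj D j\<^esub>"
      "inv\<^bsub>on_obj D j\<^esub> \<one>\<^bsub>on_obj D j\<^esub> = \<one>\<^bsub>on_obj D j\<^esub>" if "j \<in> objs J" for j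
      using cD[OF that] one[OF that]
      by (simp_all add: comm_group.axioms(2) group.is_monoid monoid.inv_one)
    have N: "subgroup ?N L"
      by (rule subgroup_where[OF cL])
         (auto simp: group_homs_one[OF \<pi> cL cD] group_homs_inv[OF \<pi> cL cD] group_homsD(4)[OF \<pi>] mm)
    let ?N' = "L\<lparr>carrier := ?N\<rparr>"
    have N': "?N' \<in> objs Ab" by (rule Ab_subgroup[OF L N])
    then have cN: "comm_group ?N'" by (simp add: Ab_objs)
    have u1: "(\<lambda>x\<in>?N. x) \<in> group_homs ?N' L"
      using restrict_group_homs[OF cN, of "\<lambda>x. x" L] by (auto simp: hom_def)
    have u2: "(\<lambda>x\<in>?N. \<one>\<^bsub>L\<^esub>) \<in> group_homs ?N' L" using trivial_group_homs[OF cN cL] by simp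
    let ?\<xi> = "\<lambda>j. \<lambda>x\<in>carrier ?N'. \<one>\<^bsub>on_obj D j\<^esub>"
    have "\<exists>!v. v \<in> group_homs ?N' L \<and> (\<forall>j\<in>objs J. compose (carrier ?N') (\<pi> j) v = ?\<xi> j)"
    proof (rule univ[OF N'])
      show "?\<xi> j \<in> group_homs ?N' (on_obj D j)" if "j \<in> objs J" for j
        by (rule trivial_group_homs[OF cN cD[OF that]])
      show "compose (carrier ?N') (on_mor D i j f) (?\<xi> i) = ?\<xi> j"
        if "i \<in> objs J" "j \<in> objs J" "f \<in> homs J i j" for i j f
        using group_homs_one[OF h cD cD] that by (auto simp: compose_def)
    qed
    moreover have "compose (carrier ?N') (\<pi> j) (\<lambda>x\<in>?N. x) = ?\<xi> j"
      "compose (carrier ?N') (\<pi> j) (\<lambda>x\<in>?N. \<one>\<^bsub>L\<^esub>) = ?\<xi> j" if "j \<in> objs J" for j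
      using that by (auto simp: compose_def group_homs_one[OF \<pi> cL cD])
    ultimately have eq: "(\<lambda>x\<in>?N. x) = (\<lambda>x\<in>?N. \<one>\<^bsub>L\<^esub>)" using u1 u2 by blast
    let ?d = "g \<otimes>\<^bsub>L\<^esub> inv\<^bsub>L\<^esub> g'"
    have "\<pi> j ?d = \<one>\<^bsub>on_obj D j\<^esub>" if j: "j \<in> objs J" for j
    proof -
      have "\<pi> j ?d = \<pi> j g' \<otimes>\<^bsub>on_obj D j\<^esub> inv\<^bsub>on_obj D j\<^esub> \<pi> j g'"
        using that \<open>g \<in> carrier L\<close> \<open>g' \<in> carrier L\<close> \<open>\<forall>j\<in>objs J. \<pi> j g = \<pi> j g'\<close>
        by (simp add: group_homsD(4)[OF \<pi>] group_homs_inv[OF \<pi> cL cD])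
      also have "\<dots> = \<one>\<^bsub>on_obj D j\<^esub>"
        using group_homsD(3)[OF \<pi>[OF j] \<open>g' \<in> carrier L\<close>] cD[OF j] by (simp add: comm_group.axioms(2) group.r_inv)
      finally show ?thesis .
    qed
    then have "?d \<in> ?N" using that by simp
    then have "?d = \<one>\<^bsub>L\<^esub>" using fun_cong[OF eq, of ?d] by simp
    then show ?thesis using comm_group_eq_iff[OF cL that(1,2)] by simp
  qed
  have 3: "compatible J D (\<lambda>j. \<pi> j g)" if "g \<in> carrier L" for g
    unfolding compatible_def
  proof (intro conjI ballI)
    fix i j f assume ij: "i \<in> objs J" "j \<in> objs J" "f \<in> homs J i j"
    show "on_mor D i j f (\<pi> i g) = \<pi> j g"
      using fun_cong[OF comm[OF ij], of g] that by (simp add: compose_def)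
  qed (use that group_homsD(3)[OF \<pi>] in blast)
  show ?thesis unfolding limit_group_def
  proof (intro conjI allI impI ballI)
    fix x assume "compatible J D x"
    then obtain g where g: "g \<in> carrier L" "\<forall>j\<in>objs J. \<pi> j g = x j" using 1 by blast
    show "\<exists>!g. g \<in> carrier L \<and> (\<forall>j\<in>objs J. \<pi> j g = x j)"
      by (rule ex1I[of _ g]) (use g in simp, rule 2, use g in auto)
  qed (use \<pi> 3 in auto)
qed

lemma Ab_limitI:
  fixes D :: "('u, 'u, 'u monoid, 'u \<Rightarrow> 'u) ftr"
  assumes L: "L \<in> objs Ab" and lim: "limit_group J D L \<pi>"
  shows "is_limit Ab J D L \<pi>"
proof -
  have \<pi>: "\<And>j. j \<in> objs J \<Longrightarrow> \<pi> j \<in> group_homs L (on_obj D j)"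
    and comp: "\<And>g. g \<in> carrier L \<Longrightarrow> compatible J D (\<lambda>j. \<pi> j g)"
    using lim by (auto simp: limit_group_def)
  have "is_cone Ab J D L \<pi>"
    using L \<pi> comp unfolding is_cone_def Ab_simps
    by (auto simp: compose_eq_iff[OF group_homsD(2)[OF \<pi>]] compatible_def)
  moreover have "\<exists>!v. v \<in> homs Ab X L \<and> (\<forall>j\<in>objs J. cmp Ab X L (on_obj D j) (\<pi> j) v = \<xi> j)"
    if cone: "is_cone Ab J D X \<xi>" for X \<xi>
  proof -
    have X: "X \<in> objs Ab" and \<xi>: "\<And>j. j \<in> objs J \<Longrightarrow> \<xi> j \<in> group_homs X (on_obj D j)"
      and c: "\<And>i j f. i \<in> objs J \<Longrightarrow> j \<in> objs J \<Longrightarrow> f \<in> homs J i j \<Longrightarrow>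
        compose (carrier X) (on_mor D i j f) (\<xi> i) = \<xi> j"
      using cone unfolding is_cone_def Ab_simps by auto
    have "compatible J D (\<lambda>j. \<xi> j x)" if x: "x \<in> carrier X" for x
      unfolding compatible_def
    proof (intro conjI ballI)
      fix i j f assume "i \<in> objs J" "j \<in> objs J" "f \<in> homs J i j"
      from fun_cong[OF c[OF this], of x] show "on_mor D i j f (\<xi> i x) = \<xi> j x"
        using x by (simp add: compose_def)
    qed (use x group_homsD(3)[OF \<xi>] in blast)
    then have "\<exists>!v. v \<in> group_homs X L \<and> (\<forall>j\<in>objs J. \<forall>x\<in>carrier X. \<pi> j (v x) = \<xi> j x)"
      using L X by (intro limit_group_factor[OF lim]) (auto simp: Ab_objs intro: \<xi>)
    then show ?thesis unfolding Ab_simps by (simp add: compose_eq_iff[OF group_homsD(2)[OF \<xi>]])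
  qed
  ultimately show ?thesis by (simp add: is_limit_def)
qed

end

subsection \<open>Colimits\<close>

definition arrows :: "('j, 'k) cat \<Rightarrow> ('j \<times> 'j \<times> 'k) set" where
  "arrows J = (SIGMA i:objs J. SIGMA j:objs J. homs J i j)"

text \<open>The relation that an arrow \<open>f : i \<rightarrow> j\<close> imposes on the direct sum: \<open>y\<close> in the summand \<open>i\<close> is
  identified with its image under \<open>f\<close> in the summand \<open>j\<close>.\<close>

definition rel :: "('j, 'k) cat \<Rightarrow> ('j, 'k, 'g monoid, 'g \<Rightarrow> 'g) ftr \<Rightarrow> 'j \<times> 'j \<times> 'k \<Rightarrow> 'g \<Rightarrow> 'j \<Rightarrow> 'g" where
  "rel J D = (\<lambda>(i, j, f) y. single (objs J) (on_obj D) i y \<otimes>\<^bsub>sum_group (objs J) (on_obj D)\<^esub>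
     inv\<^bsub>sum_group (objs J) (on_obj D)\<^esub> single (objs J) (on_obj D) j (on_mor D i j f y))"

text \<open>The elementwise form of a colimit: the sequence from the direct sum over all arrows to
  the direct sum over all objects to \<open>L\<close> to \<open>0\<close> is exact.\<close>

definition colimit_group ::
    "('j, 'k) cat \<Rightarrow> ('j, 'k, 'g monoid, 'g \<Rightarrow> 'g) ftr \<Rightarrow> ('h, 'd) monoid_scheme \<Rightarrow> ('j \<Rightarrow> 'g \<Rightarrow> 'h) \<Rightarrow> bool" where
  "colimit_group J D L \<iota> \<longleftrightarrow> (\<forall>j\<in>objs J. \<iota> j \<in> group_homs (on_obj D j) L) \<and>
     copair (objs J) L \<iota> ` carrier (sum_group (objs J) (on_obj D)) = carrier L \<and>
     (\<forall>x\<in>carrier (sum_group (objs J) (on_obj D)). copair (objs J) L \<iota> x = \<one>\<^bsub>L\<^esub> \<longleftrightarrow>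
        x \<in> copair (arrows J) (sum_group (objs J) (on_obj D)) (rel J D) `
              carrier (sum_group (arrows J) (\<lambda>a. on_obj D (fst a))))"

context
  fixes J :: "('j, 'k) cat" and D :: "('j, 'k, 'g monoid, 'g \<Rightarrow> 'g) ftr"
  assumes D: "group_diagram J D"
begin

abbreviation "objsum \<equiv> sum_group (objs J) (on_obj D)"
abbreviation "arrsum \<equiv> sum_group (arrows J) (\<lambda>a. on_obj D (fst a))"

lemma diagramD: "j \<in> objs J \<Longrightarrow> comm_group (on_obj D j)"
  "i \<in> objs J \<Longrightarrow> j \<in> objs J \<Longrightarrow> f \<in> homs J i j \<Longrightarrow> on_mor D i j f \<in> group_homs (on_obj D i) (on_obj D j)"
  using D by (auto simp: group_diagram_def)

lemma comm_group_objsum: "comm_group objsum" using diagramD by blast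

lemma arrow_dom: "a \<in> arrows J \<Longrightarrow> comm_group (on_obj D (fst a))"
  using diagramD by (auto simp: arrows_def)

lemma comm_group_arrsum: "comm_group arrsum" using arrow_dom by blast

lemma rel_hom:
  assumes "a \<in> arrows J" shows "rel J D a \<in> hom (on_obj D (fst a)) objsum"
proof -
  obtain i j f where a: "a = (i, j, f)" "i \<in> objs J" "j \<in> objs J" "f \<in> homs J i j"
    using assms by (auto simp: arrows_def)
  interpret S: comm_group objsum by (rule comm_group_objsum)
  have s: "single (objs J) (on_obj D) i \<in> hom (on_obj D i) objsum"
    "single (objs J) (on_obj D) j \<in> hom (on_obj D j) objsum"
    using a by (auto intro!: single_hom diagramD)
  have f: "on_mor D i j f \<in> group_homs (on_obj D i) (on_obj D j)" using a diagramD by blast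
  let ?s = "single (objs J) (on_obj D)"
  have sc: "?s i y \<in> carrier objsum" "?s j (on_mor D i j f y) \<in> carrier objsum"
    if "y \<in> carrier (on_obj D i)" for y
    using hom_in_carrier[OF s(1) that] hom_in_carrier[OF s(2) group_homsD(3)[OF f that]] .
  show ?thesis unfolding a rel_def split_conv fst_conv
  proof (rule homI)
    fix y z assume yz: "y \<in> carrier (on_obj D i)" "z \<in> carrier (on_obj D i)"
    have "?s i (y \<otimes>\<^bsub>on_obj D i\<^esub> z) = ?s i y \<otimes>\<^bsub>objsum\<^esub> ?s i z" by (rule hom_mult[OF s(1) yz])
    moreover have "?s j (on_mor D i j f (y \<otimes>\<^bsub>on_obj D i\<^esub> z))
        = ?s j (on_mor D i j f y) \<otimes>\<^bsub>objsum\<^esub> ?s j (on_mor D i j f z)"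
      unfolding group_homsD(4)[OF f yz]
      by (rule hom_mult[OF s(2)]) (rule group_homsD(3)[OF f yz(1)], rule group_homsD(3)[OF f yz(2)])
    ultimately show "?s i (y \<otimes>\<^bsub>on_obj D i\<^esub> z) \<otimes>\<^bsub>objsum\<^esub> inv\<^bsub>objsum\<^esub> ?s j (on_mor D i j f (y \<otimes>\<^bsub>on_obj D i\<^esub> z))
      = (?s i y \<otimes>\<^bsub>objsum\<^esub> inv\<^bsub>objsum\<^esub> ?s j (on_mor D i j f y)) \<otimes>\<^bsub>objsum\<^esub>
        (?s i z \<otimes>\<^bsub>objsum\<^esub> inv\<^bsub>objsum\<^esub> ?s j (on_mor D i j f z))"
      using sc[OF yz(1)] sc[OF yz(2)]
      by (simp only: S.inv_mult S.m_ac S.inv_closed S.m_closed)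
  qed (use sc in \<open>simp del: mult_sum_group inv_sum_group\<close>)
qed

lemma rels_hom: "copair (arrows J) objsum (rel J D) \<in> hom arrsum objsum"
  by (rule copair_hom[where G = "\<lambda>a. on_obj D (fst a)", OF arrow_dom comm_group_objsum rel_hom])

text \<open>The map induced by a cocone kills the relations.  This is checked on the summands.\<close>

lemma copair_rel:
  assumes X: "comm_group X" and \<xi>: "\<And>j. j \<in> objs J \<Longrightarrow> \<xi> j \<in> group_homs (on_obj D j) X"
    and c: "\<And>i j f y. i \<in> objs J \<Longrightarrow> j \<in> objs J \<Longrightarrow> f \<in> homs J i j \<Longrightarrow> y \<in> carrier (on_obj D i) \<Longrightarrow>
      \<xi> j (on_mor D i j f y) = \<xi> i y"
    and z: "z \<in> carrier arrsum"
  shows "copair (objs J) X \<xi> (copair (arrows J) objsum (rel J D) z) = \<one>\<^bsub>X\<^esub>"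
proof -
  interpret X: comm_group X by (rule X)
  interpret S: comm_group objsum by (rule comm_group_objsum)
  let ?q = "copair (objs J) X \<xi>" and ?r = "copair (arrows J) objsum (rel J D)"
  have \<xi>': "\<And>j. j \<in> objs J \<Longrightarrow> \<xi> j \<in> hom (on_obj D j) X" using \<xi> by (rule group_homsD(1))
  have q: "?q \<in> hom objsum X" by (rule copair_hom[where G = "on_obj D", OF diagramD(1) X \<xi>'])
  interpret q: group_hom objsum X ?q using q by unfold_locales
  have "?q (?r z) = (\<lambda>_. \<one>\<^bsub>X\<^esub>) z"
  proof (rule sum_group_hom_eq[where G = "\<lambda>a. on_obj D (fst a)" and I = "arrows J" and H = X, OF arrow_dom X])
    show "(\<lambda>z. ?q (?r z)) \<in> hom arrsum X" using hom_compose[OF rels_hom q] by (simp add: comp_def)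
    show "(\<lambda>_. \<one>\<^bsub>X\<^esub>) \<in> hom arrsum X" by (simp add: hom_def)
    fix a y assume a: "a \<in> arrows J" and y: "y \<in> carrier (on_obj D (fst a))"
    obtain i j f where ijf: "a = (i, j, f)" "i \<in> objs J" "j \<in> objs J" "f \<in> homs J i j"
      using a by (auto simp: arrows_def)
    have fy: "on_mor D i j f y \<in> carrier (on_obj D j)"
      using group_homsD(3)[OF diagramD(2)[OF ijf(2,3,4)]] y ijf(1) by simp
    have "?r (single (arrows J) (\<lambda>a. on_obj D (fst a)) a y) = rel J D a y"
      by (rule copair_single[where G = "\<lambda>a. on_obj D (fst a)", OF arrow_dom comm_group_objsum rel_hom a y])
    moreover have "?q (rel J D a y) = \<xi> i y \<otimes>\<^bsub>X\<^esub> inv\<^bsub>X\<^esub> \<xi> j (on_mor D i j f y)"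
      using single_closed[where G = "on_obj D", OF diagramD(1) ijf(2), of y] single_closed[where G = "on_obj D", OF diagramD(1) ijf(3) fy] y ijf fy
      by (simp add: rel_def copair_single[where G = "on_obj D", OF diagramD(1) X \<xi>'] del: mult_sum_group inv_sum_group)
    moreover have "\<dots> = \<one>\<^bsub>X\<^esub>"
      using c[OF ijf(2,3,4)] y ijf group_homsD(3)[OF \<xi>[OF ijf(2)]] by simp
    ultimately show "?q (?r (single (arrows J) (\<lambda>a. on_obj D (fst a)) a y)) = \<one>\<^bsub>X\<^esub>" by simp
  qed (assumption, rule z)
  then show ?thesis by simp
qed

lemma colimit_group_compat:
  assumes L: "comm_group L" and colim: "colimit_group J D L \<iota>"
    and ij: "i \<in> objs J" "j \<in> objs J" "f \<in> homs J i j" and y: "y \<in> carrier (on_obj D i)"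
  shows "\<iota> j (on_mor D i j f y) = \<iota> i y"
proof -
  interpret L: comm_group L by (rule L)
  interpret S: comm_group objsum by (rule comm_group_objsum)
  have \<iota>: "\<And>j. j \<in> objs J \<Longrightarrow> \<iota> j \<in> group_homs (on_obj D j) L"
    and ker: "\<And>x. x \<in> carrier objsum \<Longrightarrow> copair (objs J) L \<iota> x = \<one>\<^bsub>L\<^esub> \<longleftrightarrow>
       x \<in> copair (arrows J) objsum (rel J D) ` carrier arrsum"
    using colim by (auto simp: colimit_group_def)
  note \<iota>' = group_homsD(1)[OF \<iota>]
  interpret q: group_hom objsum L "copair (objs J) L \<iota>"
    using copair_hom[where G = "on_obj D", OF diagramD(1) L \<iota>'] by unfold_locales
  let ?a = "(i, j, f)"
  have a: "?a \<in> arrows J" using ij by (auto simp: arrows_def)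
  have y': "y \<in> carrier (on_obj D (fst ?a))" using y by simp
  have fy: "on_mor D i j f y \<in> carrier (on_obj D j)" using group_homsD(3)[OF diagramD(2)[OF ij] y] .
  have "rel J D ?a y = copair (arrows J) objsum (rel J D) (single (arrows J) (\<lambda>a. on_obj D (fst a)) ?a y)"
    by (rule copair_single[where G = "\<lambda>a. on_obj D (fst a)", OF arrow_dom comm_group_objsum rel_hom a y', symmetric])
  then have "rel J D ?a y \<in> copair (arrows J) objsum (rel J D) ` carrier arrsum"
    using single_closed[where G = "\<lambda>a. on_obj D (fst a)", OF arrow_dom a y'] by blast
  then have "copair (objs J) L \<iota> (rel J D ?a y) = \<one>\<^bsub>L\<^esub>"
    using ker hom_in_carrier[OF rel_hom[OF a] y'] by blast
  moreover have "copair (objs J) L \<iota> (rel J D ?a y) = \<iota> i y \<otimes>\<^bsub>L\<^esub> inv\<^bsub>L\<^esub> \<iota> j (on_mor D i j f y)"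
    using single_closed[where G = "on_obj D", OF diagramD(1) ij(1) y] single_closed[where G = "on_obj D", OF diagramD(1) ij(2) fy] y ij fy
    by (simp add: rel_def copair_single[where G = "on_obj D", OF diagramD(1) L \<iota>'] del: mult_sum_group inv_sum_group)
  ultimately show ?thesis
    using comm_group_eq_iff[OF L group_homsD(3)[OF \<iota>[OF ij(1)] y] group_homsD(3)[OF \<iota>[OF ij(2)] fy]] by simp
qed

text \<open>By exactness a map out of \<open>L\<close> is a map out of the direct sum that kills the
  relations, that is, a cocone.\<close>

lemma colimit_group_factor:
  assumes L: "comm_group L" and colim: "colimit_group J D L \<iota>"
    and X: "comm_group X" and \<xi>: "\<And>j. j \<in> objs J \<Longrightarrow> \<xi> j \<in> group_homs (on_obj D j) X"
    and c: "\<And>i j f y. i \<in> objs J \<Longrightarrow> j \<in> objs J \<Longrightarrow> f \<in> homs J i j \<Longrightarrow> y \<in> carrier (on_obj D i) \<Longrightarrow>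
      \<xi> j (on_mor D i j f y) = \<xi> i y"
  shows "\<exists>!v. v \<in> group_homs L X \<and> (\<forall>j\<in>objs J. \<forall>y\<in>carrier (on_obj D j). v (\<iota> j y) = \<xi> j y)"
proof -
  let ?q = "copair (objs J) L \<iota>" and ?t = "copair (objs J) X \<xi>"
  have \<iota>: "\<And>j. j \<in> objs J \<Longrightarrow> \<iota> j \<in> group_homs (on_obj D j) L"
    and surj: "?q ` carrier objsum = carrier L"
    and ker: "\<And>x. x \<in> carrier objsum \<Longrightarrow> ?q x = \<one>\<^bsub>L\<^esub> \<longleftrightarrow>
       x \<in> copair (arrows J) objsum (rel J D) ` carrier arrsum"
    using colim by (auto simp: colimit_group_def)
  note \<iota>' = group_homsD(1)[OF \<iota>]
  note \<xi>' = group_homsD(1)[OF \<xi>]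
  have q: "?q \<in> hom objsum L" by (rule copair_hom[where G = "on_obj D", OF diagramD(1) L \<iota>'])
  have t: "?t \<in> hom objsum X" by (rule copair_hom[where G = "on_obj D", OF diagramD(1) X \<xi>'])
  have kt: "?t x = \<one>\<^bsub>X\<^esub>" if "x \<in> carrier objsum" "?q x = \<one>\<^bsub>L\<^esub>" for x
    using ker[OF that(1)] that(2) copair_rel[OF X \<xi> c] by auto
  from epi_factor[OF comm_group_objsum L X q surj t kt]
  have ex: "\<exists>!v. v \<in> group_homs L X \<and> (\<forall>y\<in>carrier objsum. v (?q y) = ?t y)" .
  have "(\<forall>x\<in>carrier objsum. v (?q x) = ?t x) \<longleftrightarrow> (\<forall>j\<in>objs J. \<forall>y\<in>carrier (on_obj D j). v (\<iota> j y) = \<xi> j y)"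
    if v: "v \<in> group_homs L X" for v
  proof
    assume a: "\<forall>x\<in>carrier objsum. v (?q x) = ?t x"
    show "\<forall>j\<in>objs J. \<forall>y\<in>carrier (on_obj D j). v (\<iota> j y) = \<xi> j y"
    proof (intro ballI)
      fix j y assume j: "j \<in> objs J" and y: "y \<in> carrier (on_obj D j)"
      from a have "v (?q (single (objs J) (on_obj D) j y)) = ?t (single (objs J) (on_obj D) j y)"
        using single_closed[where G = "on_obj D", OF diagramD(1) j y] by blast
      then show "v (\<iota> j y) = \<xi> j y"
        using copair_single[where G = "on_obj D", OF diagramD(1) L \<iota>' j y] copair_single[where G = "on_obj D", OF diagramD(1) X \<xi>' j y] by simp
    qed
  next
    assume a: "\<forall>j\<in>objs J. \<forall>y\<in>carrier (on_obj D j). v (\<iota> j y) = \<xi> j y"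
    have vq: "(\<lambda>x. v (?q x)) \<in> hom objsum X"
      using hom_compose[OF q group_homsD(1)[OF v]] by (simp add: comp_def)
    show "\<forall>x\<in>carrier objsum. v (?q x) = ?t x"
    proof
      fix x assume x: "x \<in> carrier objsum"
      show "v (?q x) = ?t x"
      proof (rule sum_group_hom_eq[where G = "on_obj D", OF diagramD(1) X vq t _ x])
        fix j y assume j: "j \<in> objs J" and y: "y \<in> carrier (on_obj D j)"
        show "v (?q (single (objs J) (on_obj D) j y)) = ?t (single (objs J) (on_obj D) j y)"
          using copair_single[where G = "on_obj D", OF diagramD(1) L \<iota>' j y] copair_single[where G = "on_obj D", OF diagramD(1) X \<xi>' j y] a j y by simp
      qed
    qed
  qed
  then have "(v \<in> group_homs L X \<and> (\<forall>y\<in>carrier objsum. v (?q y) = ?t y)) \<longleftrightarrow>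
    (v \<in> group_homs L X \<and> (\<forall>j\<in>objs J. \<forall>y\<in>carrier (on_obj D j). v (\<iota> j y) = \<xi> j y))" for v
    by blast
  with ex show ?thesis by simp
qed

end

context universe_type
begin

text \<open>Surjectivity is tested on the quotient of \<open>L\<close> by the image of the direct sum.  The kernel
  is found from the quotient of the direct sum by all relations, which is the target of a cocone and
  to which \<open>L\<close> therefore maps.\<close>

lemma Ab_colimitD:
  fixes D :: "('u, 'u, 'u monoid, 'u \<Rightarrow> 'u) ftr"
  assumes J: "small_category J" and D: "is_functor J Ab D" and colim: "is_colimit Ab J D L \<iota>"
  shows "colimit_group J D L \<iota>"
proof -
  note dia = is_functor_Ab_diagram[OF D]
  note dD = diagramD[OF dia]
  let ?S = "sum_group (objs J) (on_obj D)" and ?A = "sum_group (arrows J) (\<lambda>a. on_obj D (fst a))"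
  let ?s = "single (objs J) (on_obj D)" and ?r = "copair (arrows J) (sum_group (objs J) (on_obj D)) (rel J D)"
  note S = comm_group_objsum[OF dia]
  interpret S: comm_group ?S by (rule S)
  have L: "L \<in> objs Ab" and \<iota>: "\<And>j. j \<in> objs J \<Longrightarrow> \<iota> j \<in> group_homs (on_obj D j) L"
    and comm: "\<And>i j f. i \<in> objs J \<Longrightarrow> j \<in> objs J \<Longrightarrow> f \<in> homs J i j \<Longrightarrow>
        compose (carrier (on_obj D i)) (\<iota> j) (on_mor D i j f) = \<iota> i"
    using colim unfolding is_colimit_iff is_cocone_iff Ab_simps by auto
  have univ: "\<exists>!v. v \<in> group_homs L X \<and> (\<forall>j\<in>objs J. compose (carrier (on_obj D j)) v (\<iota> j) = \<xi> j)"
    if "X \<in> objs Ab" "\<And>j. j \<in> objs J \<Longrightarrow> \<xi> j \<in> group_homs (on_obj D j) X"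
      "\<And>i j f. i \<in> objs J \<Longrightarrow> j \<in> objs J \<Longrightarrow> f \<in> homs J i j \<Longrightarrow>
        compose (carrier (on_obj D i)) (\<xi> j) (on_mor D i j f) = \<xi> i" for X :: "'u monoid" and \<xi>
  proof -
    have "is_cocone Ab J D X \<xi>" using that unfolding is_cocone_iff Ab_simps by simp
    then show ?thesis using colim unfolding is_colimit_iff Ab_simps by blast
  qed
  have cL: "comm_group L" using L by (simp add: Ab_objs)
  note \<iota>' = group_homsD(1)[OF \<iota>]
  let ?q = "copair (objs J) L \<iota>"
  have q: "?q \<in> hom ?S L" by (rule copair_hom[where G = "on_obj D", OF dD(1) cL \<iota>'])
  interpret q: group_hom ?S L ?q
    using q cL by (auto simp: group_hom_def group_hom_axioms_def comm_group.axioms(2) S.is_group)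
  have \<iota>f: "\<iota> j (on_mor D i j f y) = \<iota> i y"
    if "i \<in> objs J" "j \<in> objs J" "f \<in> homs J i j" "y \<in> carrier (on_obj D i)" for i j f y
    using fun_cong[OF comm[OF that(1-3)], of y] that(4) by (simp add: compose_def)
  have surj: "?q ` carrier ?S = carrier L"
  proof -
    obtain T :: "'u monoid" and t where T: "T \<in> objs Ab" "t \<in> group_homs L T"
      "\<forall>x\<in>carrier L. t x = \<one>\<^bsub>T\<^esub> \<longleftrightarrow> x \<in> ?q ` carrier ?S"
      using Ab_quotient[OF cL _ q.img_is_subgroup] L unfolding Ab_objs by metis
    have cT: "comm_group T" using T by (simp add: Ab_objs)
    let ?\<xi> = "\<lambda>j. \<lambda>x\<in>carrier (on_obj D j). \<one>\<^bsub>T\<^esub>"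
    have "\<exists>!v. v \<in> group_homs L T \<and> (\<forall>j\<in>objs J. compose (carrier (on_obj D j)) v (\<iota> j) = ?\<xi> j)"
    proof (rule univ[OF T(1)])
      show "?\<xi> j \<in> group_homs (on_obj D j) T" if "j \<in> objs J" for j
        by (rule trivial_group_homs[OF dD(1)[OF that] cT])
      show "compose (carrier (on_obj D i)) (?\<xi> j) (on_mor D i j f) = ?\<xi> i"
        if "i \<in> objs J" "j \<in> objs J" "f \<in> homs J i j" for i j f
        using group_homsD(3)[OF dD(2)[OF that]] by (auto simp: compose_def)
    qed
    moreover have "compose (carrier (on_obj D j)) t (\<iota> j) = ?\<xi> j" if j: "j \<in> objs J" for j
    proof -
      have "t (\<iota> j y) = \<one>\<^bsub>T\<^esub>" if y: "y \<in> carrier (on_obj D j)" for y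
      proof -
        have "\<iota> j y = ?q (?s j y)" by (rule copair_single[where G = "on_obj D", OF dD(1) cL \<iota>' j y, symmetric])
        then have "\<iota> j y \<in> ?q ` carrier ?S" using single_closed[where G = "on_obj D", OF dD(1) j y] by blast
        then show ?thesis using T(3) group_homsD(3)[OF \<iota>[OF j] y] by blast
      qed
      then show ?thesis by (auto simp: compose_def)
    qed
    moreover have "compose (carrier (on_obj D j)) (\<lambda>x\<in>carrier L. \<one>\<^bsub>T\<^esub>) (\<iota> j) = ?\<xi> j" if "j \<in> objs J" for j
      using group_homsD(3)[OF \<iota>[OF that]] by (auto simp: compose_def)
    ultimately have "t = (\<lambda>x\<in>carrier L. \<one>\<^bsub>T\<^esub>)" using T(2) trivial_group_homs[OF cL cT] by blast
    then have "x \<in> ?q ` carrier ?S" if "x \<in> carrier L" for x using T(3) that by auto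
    then show ?thesis by auto
  qed
  have ker1: "?q (?r z) = \<one>\<^bsub>L\<^esub>" if "z \<in> carrier ?A" for z
    by (rule copair_rel[OF dia cL \<iota> \<iota>f that])
  have ker2: "x \<in> ?r ` carrier ?A" if x: "x \<in> carrier ?S" "?q x = \<one>\<^bsub>L\<^esub>" for x
  proof -
    interpret r: group_hom ?A ?S ?r
      using rels_hom[OF dia] comm_group_arrsum[OF dia] S
      by (auto simp: group_hom_def group_hom_axioms_def comm_group.axioms(2))
    have "small TYPE('u) (\<Pi>\<^sub>E j\<in>objs J. carrier (on_obj D j))"
      using J D by (intro small_PiE) (auto simp: small_category_def is_functor_def Ab_objs)
    then have "small TYPE('u) (carrier ?S)"
      by (rule small_subset) (use dD(1) in \<open>auto simp: carrier_sum_group comm_group.axioms(2)\<close>)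
    then obtain T :: "'u monoid" and t where T: "T \<in> objs Ab" "t \<in> group_homs ?S T"
      "\<forall>x\<in>carrier ?S. t x = \<one>\<^bsub>T\<^esub> \<longleftrightarrow> x \<in> ?r ` carrier ?A"
      using Ab_quotient[OF S _ r.img_is_subgroup] by metis
    have cT: "comm_group T" using T by (simp add: Ab_objs)
    define \<xi> where "\<xi> j = (\<lambda>y\<in>carrier (on_obj D j). t (?s j y))" for j
    have \<xi>: "\<xi> j \<in> group_homs (on_obj D j) T" if "j \<in> objs J" for j
      using restrict_group_homs[OF dD(1)[OF that] hom_compose[OF single_hom[where G = "on_obj D", OF dD(1) that] group_homsD(1)[OF T(2)]]]
      by (simp add: \<xi>_def comp_def)
    have comp: "\<xi> j (on_mor D i j f y) = \<xi> i y"
      if ij: "i \<in> objs J" "j \<in> objs J" "f \<in> homs J i j" and y: "y \<in> carrier (on_obj D i)" for i j f y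
    proof -
      have a: "(i, j, f) \<in> arrows J" using ij by (auto simp: arrows_def)
      have y': "y \<in> carrier (on_obj D (fst (i, j, f)))" using y by simp
      have fy: "on_mor D i j f y \<in> carrier (on_obj D j)" using group_homsD(3)[OF dD(2)[OF ij] y] .
      note sc = single_closed[where G = "on_obj D", OF dD(1) ij(1) y]
        single_closed[where G = "on_obj D", OF dD(1) ij(2) fy]
      have "rel J D (i, j, f) y = ?r (single (arrows J) (\<lambda>a. on_obj D (fst a)) (i, j, f) y)"
        by (rule copair_single[where G = "\<lambda>a. on_obj D (fst a)", OF arrow_dom[OF dia] S rel_hom[OF dia] a y', symmetric])
      then have "rel J D (i, j, f) y \<in> ?r ` carrier ?A"
        using single_closed[where G = "\<lambda>a. on_obj D (fst a)", OF arrow_dom[OF dia] a y'] by blast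
      then have "t (?s i y \<otimes>\<^bsub>?S\<^esub> inv\<^bsub>?S\<^esub> ?s j (on_mor D i j f y)) = \<one>\<^bsub>T\<^esub>"
        using T(3) sc unfolding rel_def split_conv by blast
      then have "t (?s i y) \<otimes>\<^bsub>T\<^esub> inv\<^bsub>T\<^esub> t (?s j (on_mor D i j f y)) = \<one>\<^bsub>T\<^esub>"
        using group_homsD(4)[OF T(2) sc(1) S.inv_closed[OF sc(2)]] group_homs_inv[OF T(2) S cT sc(2)] by simp
      then have "t (?s i y) = t (?s j (on_mor D i j f y))"
        using comm_group_eq_iff[OF cT group_homsD(3)[OF T(2) sc(1)] group_homsD(3)[OF T(2) sc(2)]] by simp
      then show ?thesis using y fy by (simp add: \<xi>_def)
    qed
    have "\<exists>!v. v \<in> group_homs L T \<and> (\<forall>j\<in>objs J. compose (carrier (on_obj D j)) v (\<iota> j) = \<xi> j)"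
      by (rule univ[OF T(1) \<xi>]) (use comp in \<open>auto simp: compose_eq_iff[OF group_homsD(2)[OF \<xi>]]\<close>)
    then obtain v where v: "v \<in> group_homs L T" "\<And>j. j \<in> objs J \<Longrightarrow> compose (carrier (on_obj D j)) v (\<iota> j) = \<xi> j"
      by blast
    have "t x = copair (objs J) T (\<lambda>j y. t (?s j y)) x"
      by (rule copair_expand[where G = "on_obj D", OF dD(1) cT group_homsD(1)[OF T(2)] x(1)])
    also have "\<dots> = copair (objs J) T (\<lambda>j y. v (\<iota> j y)) x"
    proof (rule copair_cong[where G = "on_obj D", OF dD(1) cT])
      fix j assume j: "j \<in> objs J"
      have xj: "x j \<in> carrier (on_obj D j)"
        using x(1) j dD(1) by (auto simp: carrier_sum_group comm_group.axioms(2) PiE_iff)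
      show "v (\<iota> j (x j)) \<in> carrier T" using group_homsD(3)[OF v(1) group_homsD(3)[OF \<iota>[OF j] xj]] .
      show "t (?s j (x j)) = v (\<iota> j (x j))"
        using fun_cong[OF v(2)[OF j], of "x j"] xj by (simp add: compose_def \<xi>_def)
    qed
    also have "\<dots> = v (?q x)"
      by (rule hom_copair[where G = "on_obj D", OF dD(1) cL \<iota>' cT group_homsD(1)[OF v(1)] x(1), symmetric])
    also have "\<dots> = \<one>\<^bsub>T\<^esub>" using group_homs_one[OF v(1) cL cT] x(2) by simp
    finally show ?thesis using T(3) x(1) by blast
  qed
  show ?thesis unfolding colimit_group_def using \<iota> surj ker1 ker2 by blast
qed

lemma Ab_colimitI:
  fixes D :: "('u, 'u, 'u monoid, 'u \<Rightarrow> 'u) ftr"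
  assumes dia: "group_diagram J D" and L: "L \<in> objs Ab" and colim: "colimit_group J D L \<iota>"
  shows "is_colimit Ab J D L \<iota>"
proof -
  have cL: "comm_group L" using L by (simp add: Ab_objs)
  have \<iota>: "\<And>j. j \<in> objs J \<Longrightarrow> \<iota> j \<in> group_homs (on_obj D j) L"
    using colim by (auto simp: colimit_group_def)
  have "is_cocone Ab J D L \<iota>"
    using L \<iota> colimit_group_compat[OF dia cL colim] unfolding is_cocone_iff Ab_simps
    by (auto simp: compose_eq_iff[OF group_homsD(2)[OF \<iota>]])
  moreover have "\<exists>!v. v \<in> homs Ab L X \<and> (\<forall>j\<in>objs J. cmp Ab (on_obj D j) L X v (\<iota> j) = \<xi> j)"
    if cone: "is_cocone Ab J D X \<xi>" for X \<xi>
  proof -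
    have X: "X \<in> objs Ab" and \<xi>: "\<And>j. j \<in> objs J \<Longrightarrow> \<xi> j \<in> group_homs (on_obj D j) X"
      and c: "\<And>i j f. i \<in> objs J \<Longrightarrow> j \<in> objs J \<Longrightarrow> f \<in> homs J i j \<Longrightarrow>
        compose (carrier (on_obj D i)) (\<xi> j) (on_mor D i j f) = \<xi> i"
      using cone unfolding is_cocone_iff Ab_simps by auto
    have cX: "comm_group X" using X by (simp add: Ab_objs)
    have "\<exists>!v. v \<in> group_homs L X \<and> (\<forall>j\<in>objs J. \<forall>y\<in>carrier (on_obj D j). v (\<iota> j y) = \<xi> j y)"
    proof (rule colimit_group_factor[OF dia cL colim cX \<xi>])
      fix i j f y assume "i \<in> objs J" "j \<in> objs J" "f \<in> homs J i j" "y \<in> carrier (on_obj D i)"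
      then show "\<xi> j (on_mor D i j f y) = \<xi> i y"
        using fun_cong[OF c, of i j f y] by (simp add: compose_def)
    qed
    then show ?thesis unfolding Ab_simps by (simp add: compose_eq_iff[OF group_homsD(2)[OF \<xi>]])
  qed
  ultimately show ?thesis by (simp add: is_colimit_iff)
qed

end

section \<open>Additive functors with values in abelian groups\<close>

abbreviation el :: "('r, 'u, 'g) group_ftr \<Rightarrow> ('r, 'u) module \<Rightarrow> 'g set" where
  "el F S \<equiv> carrier (on_obj F S)"

context small_ring
begin

text \<open>Additive functors to abelian groups of arbitrary type and size.  The objects of \<open>RR_Mod\<close> are
  those with small values in \<open>'u\<close>; module schemes and direct sums are functors of this more general
  kind.\<close>

definition grp_ftr :: "('r, 'u, 'g) group_ftr \<Rightarrow> bool" where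
  "grp_ftr F \<longleftrightarrow> (\<forall>S\<in>Mods. comm_group (on_obj F S)) \<and>
     (\<forall>S\<in>Mods. \<forall>T\<in>Mods. \<forall>f\<in>module_homs R S T. on_mor F S T f \<in> group_homs (on_obj F S) (on_obj F T)) \<and>
     (\<forall>S\<in>Mods. \<forall>x\<in>el F S. on_mor F S S (\<lambda>x\<in>carrier S. x) x = x) \<and>
     (\<forall>S\<in>Mods. \<forall>T\<in>Mods. \<forall>U\<in>Mods. \<forall>f\<in>module_homs R S T. \<forall>g\<in>module_homs R T U. \<forall>x\<in>el F S.
        on_mor F S U (compose (carrier S) g f) x = on_mor F T U g (on_mor F S T f x)) \<and>
     (\<forall>S\<in>Mods. \<forall>T\<in>Mods. \<forall>f\<in>module_homs R S T. \<forall>g\<in>module_homs R S T. \<forall>x\<in>el F S.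
        on_mor F S T (\<lambda>s\<in>carrier S. f s \<oplus>\<^bsub>T\<^esub> g s) x = on_mor F S T f x \<otimes>\<^bsub>on_obj F T\<^esub> on_mor F S T g x)"

definition small_valued :: "('r, 'u, 'g) group_ftr \<Rightarrow> bool" where
  "small_valued F \<longleftrightarrow> (\<forall>S\<in>Mods. small TYPE('u) (el F S))"

lemma grp_ftrD:
  assumes "grp_ftr F"
  shows "S \<in> Mods \<Longrightarrow> comm_group (on_obj F S)"
    "S \<in> Mods \<Longrightarrow> T \<in> Mods \<Longrightarrow> f \<in> module_homs R S T \<Longrightarrow> on_mor F S T f \<in> group_homs (on_obj F S) (on_obj F T)"
    "S \<in> Mods \<Longrightarrow> x \<in> el F S \<Longrightarrow> on_mor F S S (\<lambda>x\<in>carrier S. x) x = x"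
    "S \<in> Mods \<Longrightarrow> T \<in> Mods \<Longrightarrow> U \<in> Mods \<Longrightarrow> f \<in> module_homs R S T \<Longrightarrow> g \<in> module_homs R T U \<Longrightarrow> x \<in> el F S \<Longrightarrow>
      on_mor F S U (compose (carrier S) g f) x = on_mor F T U g (on_mor F S T f x)"
    "S \<in> Mods \<Longrightarrow> T \<in> Mods \<Longrightarrow> f \<in> module_homs R S T \<Longrightarrow> g \<in> module_homs R S T \<Longrightarrow> x \<in> el F S \<Longrightarrow>
      on_mor F S T (\<lambda>s\<in>carrier S. f s \<oplus>\<^bsub>T\<^esub> g s) x = on_mor F S T f x \<otimes>\<^bsub>on_obj F T\<^esub> on_mor F S T g x"
proof -
  note a = assms[unfolded grp_ftr_def]
  note a2 = conjunct2[OF a] note a3 = conjunct2[OF a2] note a4 = conjunct2[OF a3] note a5 = conjunct2[OF a4]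
  show "S \<in> Mods \<Longrightarrow> comm_group (on_obj F S)" using conjunct1[OF a] by blast
  show "S \<in> Mods \<Longrightarrow> T \<in> Mods \<Longrightarrow> f \<in> module_homs R S T \<Longrightarrow> on_mor F S T f \<in> group_homs (on_obj F S) (on_obj F T)"
    using conjunct1[OF a2] by blast
  show "S \<in> Mods \<Longrightarrow> x \<in> el F S \<Longrightarrow> on_mor F S S (\<lambda>x\<in>carrier S. x) x = x" using conjunct1[OF a3] by blast
  show "S \<in> Mods \<Longrightarrow> T \<in> Mods \<Longrightarrow> U \<in> Mods \<Longrightarrow> f \<in> module_homs R S T \<Longrightarrow> g \<in> module_homs R T U \<Longrightarrow> x \<in> el F S \<Longrightarrow>
      on_mor F S U (compose (carrier S) g f) x = on_mor F T U g (on_mor F S T f x)" using conjunct1[OF a4, THEN bspec, THEN bspec, THEN bspec, THEN bspec, THEN bspec, THEN bspec, of S T U f g x] by simp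
  show "S \<in> Mods \<Longrightarrow> T \<in> Mods \<Longrightarrow> f \<in> module_homs R S T \<Longrightarrow> g \<in> module_homs R S T \<Longrightarrow> x \<in> el F S \<Longrightarrow>
      on_mor F S T (\<lambda>s\<in>carrier S. f s \<oplus>\<^bsub>T\<^esub> g s) x = on_mor F S T f x \<otimes>\<^bsub>on_obj F T\<^esub> on_mor F S T g x"
    using a5[THEN bspec, THEN bspec, THEN bspec, THEN bspec, THEN bspec, of S T f g x] by simp
qed

lemma grp_ftr_closed:
  "grp_ftr F \<Longrightarrow> S \<in> Mods \<Longrightarrow> T \<in> Mods \<Longrightarrow> f \<in> module_homs R S T \<Longrightarrow> x \<in> el F S \<Longrightarrow> on_mor F S T f x \<in> el F T"
  by (rule group_homsD(3)[OF grp_ftrD(2)])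

lemma RR_Mod_simps:
  "homs (RR_Mod R) = nat_trans R"
  "ident (RR_Mod R) F = (\<lambda>S\<in>Mods. \<lambda>x\<in>el F S. x)"
  "cmp (RR_Mod R) F G H \<beta> \<alpha> = (\<lambda>S\<in>Mods. compose (el F S) (\<beta> S) (\<alpha> S))"
  by (simp_all add: RR_Mod_def)

lemma RR_Mod_iff:
  "F \<in> objs (RR_Mod R) \<longleftrightarrow> grp_ftr F \<and> small_valued F"
proof
  assume "F \<in> objs (RR_Mod R)"
  then have func: "is_functor (RMod R) Ab F" and add: "additive_ftr R F" by (auto simp: RR_Mod_def)
  have "on_obj F S \<in> objs Ab" if "S \<in> Mods" for S using func that by (simp add: is_functor_def)
  moreover have "on_mor F S T f \<in> group_homs (on_obj F S) (on_obj F T)"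
    if "S \<in> Mods" "T \<in> Mods" "f \<in> module_homs R S T" for S T f
    using func that by (simp add: is_functor_def Ab_simps homs_RMod)
  moreover have "on_mor F S S (\<lambda>x\<in>carrier S. x) x = x" if "S \<in> Mods" "x \<in> el F S" for S x
  proof -
    have "on_mor F S S (\<lambda>x\<in>carrier S. x) = (\<lambda>x\<in>el F S. x)"
      using func that by (simp add: is_functor_def Ab_simps RMod_def)
    then show ?thesis using that by simp
  qed
  moreover have "on_mor F S U (compose (carrier S) g f) x = on_mor F T U g (on_mor F S T f x)"
    if "S \<in> Mods" "T \<in> Mods" "U \<in> Mods" "f \<in> module_homs R S T" "g \<in> module_homs R T U" "x \<in> el F S"
    for S T U f g x
  proof -
    have "on_mor F S U (compose (carrier S) g f) = compose (el F S) (on_mor F T U g) (on_mor F S T f)"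
      using func that by (simp add: is_functor_def Ab_simps RMod_def)
    then show ?thesis using that by (simp add: compose_def)
  qed
  moreover have "on_mor F S T (\<lambda>s\<in>carrier S. f s \<oplus>\<^bsub>T\<^esub> g s) x = on_mor F S T f x \<otimes>\<^bsub>on_obj F T\<^esub> on_mor F S T g x"
    if "S \<in> Mods" "T \<in> Mods" "f \<in> module_homs R S T" "g \<in> module_homs R S T" "x \<in> el F S" for S T f g x
    using add that by (simp add: additive_ftr_def homs_RMod)
  ultimately show "grp_ftr F \<and> small_valued F"
    by (simp add: grp_ftr_def small_valued_def Ab_objs)
next
  assume F: "grp_ftr F \<and> small_valued F"
  note D = grp_ftrD[OF conjunct1[OF F]]
  have ob: "on_obj F S \<in> objs Ab" if "S \<in> Mods" for S
    using F D(1)[OF that] that by (simp add: Ab_objs small_valued_def)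
  have id: "on_mor F S S (ident (RMod R) S) = ident Ab (on_obj F S)" if "S \<in> Mods" for S
  proof (rule extensionalityI[where A = "el F S"])
    show "on_mor F S S (ident (RMod R) S) \<in> extensional (el F S)"
      using group_homsD(2)[OF D(2)[OF that that id_hom[OF that]]] by (simp add: RMod_def)
  qed (use D(3)[OF that] in \<open>auto simp: RMod_def Ab_simps\<close>)
  have comp: "on_mor F S U (cmp (RMod R) S T U g f) =
      cmp Ab (on_obj F S) (on_obj F T) (on_obj F U) (on_mor F T U g) (on_mor F S T f)"
    if S: "S \<in> Mods" "T \<in> Mods" "U \<in> Mods" "f \<in> homs (RMod R) S T" "g \<in> homs (RMod R) T U" for S T U f g
  proof (rule extensionalityI[where A = "el F S"])
    have f: "f \<in> module_homs R S T" "g \<in> module_homs R T U" using S by (auto simp: homs_RMod)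
    show "on_mor F S U (cmp (RMod R) S T U g f) \<in> extensional (el F S)"
      using group_homsD(2)[OF D(2)[OF S(1,3) compose_hom[OF f S(1)]]] by (simp add: RMod_def)
    fix x assume x: "x \<in> el F S"
    show "on_mor F S U (cmp (RMod R) S T U g f) x = cmp Ab (on_obj F S) (on_obj F T) (on_obj F U) (on_mor F T U g) (on_mor F S T f) x"
      using D(4)[OF S(1,2,3) f x] x by (simp add: RMod_def Ab_simps compose_def)
  qed (simp add: Ab_simps compose_def)
  have "is_functor (RMod R) Ab F"
    using ob id comp D(2) unfolding is_functor_def by (simp add: homs_RMod Ab_simps)
  moreover have "additive_ftr R F" using D(5) by (simp add: additive_ftr_def homs_RMod)
  ultimately show "F \<in> objs (RR_Mod R)" by (simp add: RR_Mod_def)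
qed

subsection \<open>Natural transformations\<close>

lemma nat_transD:
  assumes "\<alpha> \<in> nat_trans R F G"
  shows "S \<in> Mods \<Longrightarrow> \<alpha> S \<in> group_homs (on_obj F S) (on_obj G S)"
    "S \<in> Mods \<Longrightarrow> T \<in> Mods \<Longrightarrow> f \<in> module_homs R S T \<Longrightarrow> x \<in> el F S \<Longrightarrow>
      \<alpha> T (on_mor F S T f x) = on_mor G S T f (\<alpha> S x)"
    "\<alpha> \<in> extensional Mods"
    "S \<in> Mods \<Longrightarrow> x \<in> el F S \<Longrightarrow> \<alpha> S x \<in> el G S"
    "S \<in> Mods \<Longrightarrow> x \<in> el F S \<Longrightarrow> y \<in> el F S \<Longrightarrow> \<alpha> S (x \<otimes>\<^bsub>on_obj F S\<^esub> y) = \<alpha> S x \<otimes>\<^bsub>on_obj G S\<^esub> \<alpha> S y"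
  using assms unfolding nat_trans_def homs_RMod group_homs_def hom_def by auto

lemma nat_trans_one:
  "\<alpha> \<in> nat_trans R F G \<Longrightarrow> grp_ftr F \<Longrightarrow> grp_ftr G \<Longrightarrow> S \<in> Mods \<Longrightarrow> \<alpha> S \<one>\<^bsub>on_obj F S\<^esub> = \<one>\<^bsub>on_obj G S\<^esub>"
  by (rule group_homs_one[OF nat_transD(1) grp_ftrD(1) grp_ftrD(1)])

text \<open>Natural transformations are extensional both in the module and in the element.\<close>

definition mk_nt :: "('r, 'u, 'g) group_ftr \<Rightarrow> (('r, 'u) module \<Rightarrow> 'g \<Rightarrow> 'h) \<Rightarrow> ('r, 'u) module \<Rightarrow> 'g \<Rightarrow> 'h" where
  "mk_nt F \<alpha> = (\<lambda>S\<in>Mods. \<lambda>x\<in>el F S. \<alpha> S x)"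

lemma mk_nt_apply [simp]: "S \<in> Mods \<Longrightarrow> x \<in> el F S \<Longrightarrow> mk_nt F \<alpha> S x = \<alpha> S x"
  by (simp add: mk_nt_def)

lemma mk_nt_nat_trans:
  assumes F: "grp_ftr F" and h: "\<And>S. S \<in> Mods \<Longrightarrow> \<alpha> S \<in> hom (on_obj F S) (on_obj G S)"
    and n: "\<And>S T f x. S \<in> Mods \<Longrightarrow> T \<in> Mods \<Longrightarrow> f \<in> module_homs R S T \<Longrightarrow> x \<in> el F S \<Longrightarrow>
      \<alpha> T (on_mor F S T f x) = on_mor G S T f (\<alpha> S x)"
  shows "mk_nt F \<alpha> \<in> nat_trans R F G"
  unfolding nat_trans_def homs_RMod
proof (intro CollectI conjI ballI)
  show "mk_nt F \<alpha> \<in> extensional Mods" by (simp add: mk_nt_def)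
  show "mk_nt F \<alpha> S \<in> group_homs (on_obj F S) (on_obj G S)" if "S \<in> Mods" for S
    using restrict_group_homs[OF grp_ftrD(1)[OF F that] h[OF that]] that by (simp add: mk_nt_def)
  show "mk_nt F \<alpha> T (on_mor F S T f x) = on_mor G S T f (mk_nt F \<alpha> S x)"
    if "S \<in> Mods" "T \<in> Mods" "f \<in> module_homs R S T" "x \<in> el F S" for S T f x
    using that n grp_ftr_closed[OF F that] by simp
qed

lemma nt_eqI:
  assumes "\<alpha> \<in> nat_trans R F G" "\<beta> \<in> nat_trans R F G"
    "\<And>S x. S \<in> Mods \<Longrightarrow> x \<in> el F S \<Longrightarrow> \<alpha> S x = \<beta> S x"
  shows "\<alpha> = \<beta>"
proof (rule extensionalityI[where A = Mods])
  fix S assume S: "S \<in> Mods"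
  show "\<alpha> S = \<beta> S"
    by (rule extensionalityI[where A = "el F S"])
       (use assms(3)[OF S] group_homsD(2)[OF nat_transD(1)[OF assms(1) S]]
          group_homsD(2)[OF nat_transD(1)[OF assms(2) S]] in auto)
qed (use nat_transD(3) assms in auto)

lemma cmp_RR_Mod: "cmp (RR_Mod R) F G H \<beta> \<alpha> = mk_nt F (\<lambda>S x. \<beta> S (\<alpha> S x))"
  by (simp add: RR_Mod_simps mk_nt_def compose_def)

lemma ident_RR_Mod: "ident (RR_Mod R) F = mk_nt F (\<lambda>S x. x)"
  by (simp add: RR_Mod_simps mk_nt_def)

lemma nt_compose:
  assumes F: "grp_ftr F" and \<alpha>: "\<alpha> \<in> nat_trans R F G" and \<beta>: "\<beta> \<in> nat_trans R G H"
  shows "mk_nt F (\<lambda>S x. \<beta> S (\<alpha> S x)) \<in> nat_trans R F H"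
proof (rule mk_nt_nat_trans[OF F])
  fix S assume S: "S \<in> Mods"
  show "(\<lambda>x. \<beta> S (\<alpha> S x)) \<in> hom (on_obj F S) (on_obj H S)"
    using nat_transD(4,5)[OF \<alpha> S] nat_transD(4,5)[OF \<beta> S] by (auto simp: hom_def)
qed (use nat_transD(2)[OF \<alpha>] nat_transD(2)[OF \<beta>] nat_transD(4)[OF \<alpha>] in simp)

lemma nt_id: "grp_ftr F \<Longrightarrow> mk_nt F (\<lambda>S x. x) \<in> nat_trans R F F"
  by (rule mk_nt_nat_trans) (auto simp: hom_def)

lemma nt_trivial:
  assumes F: "grp_ftr F" and G: "grp_ftr G"
  shows "mk_nt F (\<lambda>S x. \<one>\<^bsub>on_obj G S\<^esub>) \<in> nat_trans R F G"
proof (rule mk_nt_nat_trans[OF F])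
  fix S assume S: "S \<in> Mods"
  interpret comm_group "on_obj G S" by (rule grp_ftrD(1)[OF G S])
  show "(\<lambda>x. \<one>\<^bsub>on_obj G S\<^esub>) \<in> hom (on_obj F S) (on_obj G S)" by (simp add: hom_def)
qed (simp add: group_homs_one[OF grp_ftrD(2)[OF G] grp_ftrD(1)[OF G] grp_ftrD(1)[OF G]])

lemma compose_nt_eq_iff:
  assumes "\<xi> \<in> nat_trans R F H"
  shows "mk_nt F \<alpha> = \<xi> \<longleftrightarrow> (\<forall>S\<in>Mods. \<forall>x\<in>el F S. \<alpha> S x = \<xi> S x)"
proof
  assume "\<forall>S\<in>Mods. \<forall>x\<in>el F S. \<alpha> S x = \<xi> S x"
  show "mk_nt F \<alpha> = \<xi>"
  proof (rule extensionalityI[where A = Mods])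
    fix S assume S: "S \<in> Mods"
    show "mk_nt F \<alpha> S = \<xi> S"
      by (rule extensionalityI[where A = "el F S"])
         (use S \<open>\<forall>S\<in>Mods. _\<close> group_homsD(2)[OF nat_transD(1)[OF assms S]] in \<open>auto simp: mk_nt_def\<close>)
  qed (use nat_transD(3)[OF assms] in \<open>auto simp: mk_nt_def\<close>)
qed auto

text \<open>Naturality of a componentwise factorisation follows from its uniqueness.\<close>

lemma nt_jointly_mono_factor:
  assumes K: "grp_ftr K" and X: "grp_ftr X"
    and k: "\<And>j. j \<in> J \<Longrightarrow> k j \<in> nat_trans R K (Y j)" and t: "\<And>j. j \<in> J \<Longrightarrow> t j \<in> nat_trans R X (Y j)"
    and ex: "\<And>S x. S \<in> Mods \<Longrightarrow> x \<in> el X S \<Longrightarrow> \<exists>!g. g \<in> el K S \<and> (\<forall>j\<in>J. k j S g = t j S x)"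
  shows "\<exists>!v. v \<in> nat_trans R X K \<and> (\<forall>j\<in>J. \<forall>S\<in>Mods. \<forall>x\<in>el X S. k j S (v S x) = t j S x)"
proof -
  have "\<exists>!v. v \<in> group_homs (on_obj X S) (on_obj K S) \<and> (\<forall>j\<in>J. \<forall>x\<in>el X S. k j S (v x) = t j S x)"
    if S: "S \<in> Mods" for S
    by (rule jointly_mono_factor[where Y = "\<lambda>j. on_obj (Y j) S", OF grp_ftrD(1)[OF K S] grp_ftrD(1)[OF X S]
          nat_transD(1)[OF k S] nat_transD(1)[OF t S] ex[OF S]])
  then have "\<forall>S\<in>Mods. \<exists>v. v \<in> group_homs (on_obj X S) (on_obj K S) \<and> (\<forall>j\<in>J. \<forall>x\<in>el X S. k j S (v x) = t j S x)"
    by blast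
  then obtain v where v: "\<And>S. S \<in> Mods \<Longrightarrow> v S \<in> group_homs (on_obj X S) (on_obj K S)"
    and kv: "\<And>S j x. S \<in> Mods \<Longrightarrow> j \<in> J \<Longrightarrow> x \<in> el X S \<Longrightarrow> k j S (v S x) = t j S x"
    by metis
  have uniq: "g = v S x" if "S \<in> Mods" "x \<in> el X S" "g \<in> el K S" "\<And>j. j \<in> J \<Longrightarrow> k j S g = t j S x" for g S x
    using ex[OF that(1,2)] that(3,4) kv[OF that(1) _ that(2)] group_homsD(3)[OF v[OF that(1)] that(2)] by blast
  have "mk_nt X v \<in> nat_trans R X K"
  proof (rule mk_nt_nat_trans[OF X group_homsD(1)[OF v]])
    fix S T f x assume S: "S \<in> Mods" and T: "T \<in> Mods" and f: "f \<in> module_homs R S T" and x: "x \<in> el X S"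
    have vx: "v S x \<in> el K S" by (rule group_homsD(3)[OF v[OF S] x])
    show "v T (on_mor X S T f x) = on_mor K S T f (v S x)"
    proof (rule uniq[OF T grp_ftr_closed[OF X S T f x] grp_ftr_closed[OF K S T f vx], symmetric])
      fix j assume j: "j \<in> J"
      show "k j T (on_mor K S T f (v S x)) = t j T (on_mor X S T f x)"
        using nat_transD(2)[OF k[OF j] S T f vx] nat_transD(2)[OF t[OF j] S T f x] kv[OF S j x] by simp
    qed
  qed
  moreover have "w = mk_nt X v"
    if w: "w \<in> nat_trans R X K" "\<forall>j\<in>J. \<forall>S\<in>Mods. \<forall>x\<in>el X S. k j S (w S x) = t j S x" for w
  proof (rule nt_eqI[OF w(1) \<open>mk_nt X v \<in> _\<close>])
    fix S x assume S: "S \<in> Mods" "x \<in> el X S"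
    have "w S x = v S x" by (rule uniq[OF S nat_transD(4)[OF w(1) S]]) (use w(2) S in blast)
    then show "w S x = mk_nt X v S x" using S by simp
  qed
  moreover have "\<forall>j\<in>J. \<forall>S\<in>Mods. \<forall>x\<in>el X S. k j S (mk_nt X v S x) = t j S x" using kv by simp
  ultimately show ?thesis by (intro ex1I[of _ "mk_nt X v"] conjI; (elim conjE)?)
qed

text \<open>Naturality only has to be checked on the elements \<open>q S y\<close>.\<close>

lemma nt_epi_factor:
  assumes Y: "grp_ftr Y" and Q: "grp_ftr Q" and X: "grp_ftr X"
    and q: "q \<in> nat_trans R Y Q" "\<And>S. S \<in> Mods \<Longrightarrow> q S ` el Y S = el Q S" and t: "t \<in> nat_trans R Y X"
    and ker: "\<And>S y. S \<in> Mods \<Longrightarrow> y \<in> el Y S \<Longrightarrow> q S y = \<one>\<^bsub>on_obj Q S\<^esub> \<Longrightarrow> t S y = \<one>\<^bsub>on_obj X S\<^esub>"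
  shows "\<exists>!v. v \<in> nat_trans R Q X \<and> (\<forall>S\<in>Mods. \<forall>y\<in>el Y S. v S (q S y) = t S y)"
proof -
  have "\<exists>!v. v \<in> group_homs (on_obj Q S) (on_obj X S) \<and> (\<forall>y\<in>el Y S. v (q S y) = t S y)"
    if S: "S \<in> Mods" for S
    by (rule epi_factor[OF grp_ftrD(1)[OF Y S] grp_ftrD(1)[OF Q S] grp_ftrD(1)[OF X S]
          group_homsD(1)[OF nat_transD(1)[OF q(1) S]] q(2)[OF S] group_homsD(1)[OF nat_transD(1)[OF t S]] ker[OF S]])
  then have "\<forall>S\<in>Mods. \<exists>v. v \<in> group_homs (on_obj Q S) (on_obj X S) \<and> (\<forall>y\<in>el Y S. v (q S y) = t S y)"
    by blast
  then obtain v where v: "\<And>S. S \<in> Mods \<Longrightarrow> v S \<in> group_homs (on_obj Q S) (on_obj X S)"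
    and vq: "\<And>S y. S \<in> Mods \<Longrightarrow> y \<in> el Y S \<Longrightarrow> v S (q S y) = t S y"
    by metis
  have "mk_nt Q v \<in> nat_trans R Q X"
  proof (rule mk_nt_nat_trans[OF Q group_homsD(1)[OF v]])
    fix S T f x assume S: "S \<in> Mods" and T: "T \<in> Mods" and f: "f \<in> module_homs R S T" and x: "x \<in> el Q S"
    obtain y where y: "y \<in> el Y S" "x = q S y" using x q(2)[OF S] by blast
    have "v T (on_mor Q S T f x) = t T (on_mor Y S T f y)"
      using vq[OF T grp_ftr_closed[OF Y S T f y(1)]] nat_transD(2)[OF q(1) S T f y(1)] y(2) by simp
    also have "\<dots> = on_mor X S T f (v S x)" using nat_transD(2)[OF t S T f y(1)] vq[OF S y(1)] y(2) by simp
    finally show "v T (on_mor Q S T f x) = on_mor X S T f (v S x)" .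
  qed
  moreover have "w = mk_nt Q v"
    if w: "w \<in> nat_trans R Q X" "\<forall>S\<in>Mods. \<forall>y\<in>el Y S. w S (q S y) = t S y" for w
  proof (rule nt_eqI[OF w(1) \<open>mk_nt Q v \<in> _\<close>])
    fix S x assume S: "S \<in> Mods" "x \<in> el Q S"
    obtain y where y: "y \<in> el Y S" "x = q S y" using S q(2)[OF S(1)] by blast
    then show "w S x = mk_nt Q v S x" using S w(2) vq by simp
  qed
  moreover have "\<forall>S\<in>Mods. \<forall>y\<in>el Y S. mk_nt Q v S (q S y) = t S y"
    using vq nat_transD(4)[OF q(1)] by simp
  ultimately show ?thesis by (intro ex1I[of _ "mk_nt Q v"] conjI; (elim conjE)?)
qed

subsection \<open>Constructions of functors\<close>

text \<open>The functor laws may be tested after a jointly injective family of maps into functors.\<close>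

lemma grp_ftr_jointly_mono:
  assumes F: "\<And>j. j \<in> J \<Longrightarrow> grp_ftr (F j)" and L: "\<And>S. S \<in> Mods \<Longrightarrow> comm_group (on_obj L S)"
    and closed: "\<And>S T f x. S \<in> Mods \<Longrightarrow> T \<in> Mods \<Longrightarrow> f \<in> module_homs R S T \<Longrightarrow> x \<in> el L S \<Longrightarrow> on_mor L S T f x \<in> el L T"
    and ext: "\<And>S T f. S \<in> Mods \<Longrightarrow> T \<in> Mods \<Longrightarrow> f \<in> module_homs R S T \<Longrightarrow> on_mor L S T f \<in> extensional (el L S)"
    and \<pi>: "\<And>j S. j \<in> J \<Longrightarrow> S \<in> Mods \<Longrightarrow> \<pi> j S \<in> hom (on_obj L S) (on_obj (F j) S)"
    and inj: "\<And>S x y. S \<in> Mods \<Longrightarrow> x \<in> el L S \<Longrightarrow> y \<in> el L S \<Longrightarrow> (\<And>j. j \<in> J \<Longrightarrow> \<pi> j S x = \<pi> j S y) \<Longrightarrow> x = y"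
    and nat: "\<And>j S T f x. j \<in> J \<Longrightarrow> S \<in> Mods \<Longrightarrow> T \<in> Mods \<Longrightarrow> f \<in> module_homs R S T \<Longrightarrow> x \<in> el L S \<Longrightarrow>
      \<pi> j T (on_mor L S T f x) = on_mor (F j) S T f (\<pi> j S x)"
  shows "grp_ftr L"
  unfolding grp_ftr_def
proof (intro conjI ballI)
  have m: "\<pi> j S (x \<otimes>\<^bsub>on_obj L S\<^esub> y) = \<pi> j S x \<otimes>\<^bsub>on_obj (F j) S\<^esub> \<pi> j S y" "\<pi> j S x \<in> el (F j) S"
    if "j \<in> J" "S \<in> Mods" "x \<in> el L S" "y \<in> el L S" for j S x y
    using \<pi>[OF that(1,2)] that(3,4) by (auto simp: hom_def)
  have mc: "x \<otimes>\<^bsub>on_obj L S\<^esub> y \<in> el L S" if "S \<in> Mods" "x \<in> el L S" "y \<in> el L S" for S x y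
    using L[OF that(1)] that(2,3) by (simp add: comm_groupE(1))
  fix S assume S: "S \<in> Mods"
  show "comm_group (on_obj L S)" by (rule L[OF S])
  show "on_mor L S S (\<lambda>x\<in>carrier S. x) x = x" if x: "x \<in> el L S" for x
    by (rule inj[OF S closed[OF S S id_hom[OF S] x] x])
       (use nat[OF _ S S id_hom[OF S] x] grp_ftrD(3)[OF F S m(2)[OF _ S x x]] in simp)
  fix T assume T: "T \<in> Mods"
  show "on_mor L S T f \<in> group_homs (on_obj L S) (on_obj L T)" if f: "f \<in> module_homs R S T" for f
    unfolding group_homs_def
  proof (intro IntI homI)
    fix x y assume x: "x \<in> el L S" and y: "y \<in> el L S"
    show "on_mor L S T f (x \<otimes>\<^bsub>on_obj L S\<^esub> y) = on_mor L S T f x \<otimes>\<^bsub>on_obj L T\<^esub> on_mor L S T f y"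
    proof (rule inj[OF T closed[OF S T f mc[OF S x y]] mc[OF T closed[OF S T f x] closed[OF S T f y]]])
      fix j assume j: "j \<in> J"
      show "\<pi> j T (on_mor L S T f (x \<otimes>\<^bsub>on_obj L S\<^esub> y)) = \<pi> j T (on_mor L S T f x \<otimes>\<^bsub>on_obj L T\<^esub> on_mor L S T f y)"
        using m(1)[OF j S x y] m(2)[OF j S x x] m(2)[OF j S y y] m(1)[OF j T closed[OF S T f x] closed[OF S T f y]]
          nat[OF j S T f] x y mc[OF S x y] group_homsD(4)[OF grp_ftrD(2)[OF F[OF j] S T f]] by simp
    qed
  qed (use ext closed S T f in auto)
  show "on_mor L S T (\<lambda>s\<in>carrier S. f s \<oplus>\<^bsub>T\<^esub> g s) x = on_mor L S T f x \<otimes>\<^bsub>on_obj L T\<^esub> on_mor L S T g x"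
    if f: "f \<in> module_homs R S T" and g: "g \<in> module_homs R S T" and x: "x \<in> el L S" for f g x
  proof -
    let ?fg = "\<lambda>s\<in>carrier S. f s \<oplus>\<^bsub>T\<^esub> g s"
    have fg: "?fg \<in> module_homs R S T"
    proof -
      interpret S: left_module R S using S by (simp add: Mods_iff)
      interpret T: left_module R T using T by (simp add: Mods_iff)
      show ?thesis
        by (rule module_homsI)
           (use module_homsD[OF f] module_homsD[OF g] in
             \<open>auto simp: T.M.a_ac T.smult_r_distr S.smult_closed\<close>)
    qed
    show ?thesis
    proof (rule inj[OF T closed[OF S T fg x] mc[OF T closed[OF S T f x] closed[OF S T g x]]])
      fix j assume j: "j \<in> J"
      show "\<pi> j T (on_mor L S T ?fg x) = \<pi> j T (on_mor L S T f x \<otimes>\<^bsub>on_obj L T\<^esub> on_mor L S T g x)"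
        using nat[OF j S T fg x] nat[OF j S T f x] nat[OF j S T g x] grp_ftrD(5)[OF F[OF j] S T f g m(2)[OF j S x x]]
          m(1)[OF j T closed[OF S T f x] closed[OF S T g x]] by simp
    qed
  qed
  fix U assume U: "U \<in> Mods"
  show "on_mor L S U (compose (carrier S) g f) x = on_mor L T U g (on_mor L S T f x)"
    if f: "f \<in> module_homs R S T" and g: "g \<in> module_homs R T U" and x: "x \<in> el L S" for f g x
    by (rule inj[OF U closed[OF S U compose_hom[OF f g S] x] closed[OF T U g closed[OF S T f x]]])
       (use nat[OF _ S U compose_hom[OF f g S] x] nat[OF _ S T f x] nat[OF _ T U g closed[OF S T f x]]
          grp_ftrD(4)[OF F S T U f g m(2)[OF _ S x x]] in simp)
qed

text \<open>Dually, the functor laws may be tested after a surjection from a functor.\<close>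

lemma grp_ftr_epi:
  assumes G: "grp_ftr G" and Q: "\<And>S. S \<in> Mods \<Longrightarrow> comm_group (on_obj Q S)"
    and hom: "\<And>S T f. S \<in> Mods \<Longrightarrow> T \<in> Mods \<Longrightarrow> f \<in> module_homs R S T \<Longrightarrow>
      on_mor Q S T f \<in> group_homs (on_obj Q S) (on_obj Q T)"
    and q: "\<And>S. S \<in> Mods \<Longrightarrow> q S \<in> group_homs (on_obj G S) (on_obj Q S)"
    and surj: "\<And>S. S \<in> Mods \<Longrightarrow> q S ` el G S = el Q S"
    and nat: "\<And>S T f x. S \<in> Mods \<Longrightarrow> T \<in> Mods \<Longrightarrow> f \<in> module_homs R S T \<Longrightarrow> x \<in> el G S \<Longrightarrow>
      on_mor Q S T f (q S x) = q T (on_mor G S T f x)"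
  shows "grp_ftr Q"
  unfolding grp_ftr_def
proof (intro conjI ballI)
  fix S assume S: "S \<in> Mods"
  show "comm_group (on_obj Q S)" by (rule Q[OF S])
  show "on_mor Q S S (\<lambda>x\<in>carrier S. x) x = x" if x: "x \<in> el Q S" for x
  proof -
    obtain y where y: "y \<in> el G S" "x = q S y" using x[folded surj[OF S]] by blast
    show ?thesis unfolding y(2) nat[OF S S id_hom[OF S] y(1)] grp_ftrD(3)[OF G S y(1)] ..
  qed
  fix T assume T: "T \<in> Mods"
  show "on_mor Q S T f \<in> group_homs (on_obj Q S) (on_obj Q T)" if "f \<in> module_homs R S T" for f
    by (rule hom[OF S T that])
  show "on_mor Q S T (\<lambda>s\<in>carrier S. f s \<oplus>\<^bsub>T\<^esub> g s) x = on_mor Q S T f x \<otimes>\<^bsub>on_obj Q T\<^esub> on_mor Q S T g x"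
    if f: "f \<in> module_homs R S T" and g: "g \<in> module_homs R S T" and x: "x \<in> el Q S" for f g x
  proof -
    obtain y where y: "y \<in> el G S" "x = q S y" using x[folded surj[OF S]] by blast
    have fg: "(\<lambda>s\<in>carrier S. f s \<oplus>\<^bsub>T\<^esub> g s) \<in> module_homs R S T"
    proof -
      interpret S: left_module R S using S by (simp add: Mods_iff)
      interpret T: left_module R T using T by (simp add: Mods_iff)
      show ?thesis
        by (rule module_homsI)
           (use module_homsD[OF f] module_homsD[OF g] in
             \<open>auto simp: T.M.a_ac T.smult_r_distr S.smult_closed\<close>)
    qed
    show ?thesis unfolding y(2) nat[OF S T fg y(1)] nat[OF S T f y(1)] nat[OF S T g y(1)] grp_ftrD(5)[OF G S T f g y(1)]
      by (rule group_homsD(4)[OF q[OF T] grp_ftr_closed[OF G S T f y(1)] grp_ftr_closed[OF G S T g y(1)]])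
  qed
  fix U assume U: "U \<in> Mods"
  show "on_mor Q S U (compose (carrier S) g f) x = on_mor Q T U g (on_mor Q S T f x)"
    if f: "f \<in> module_homs R S T" and g: "g \<in> module_homs R T U" and x: "x \<in> el Q S" for f g x
  proof -
    obtain y where y: "y \<in> el G S" "x = q S y" using x[folded surj[OF S]] by blast
    show ?thesis unfolding y(2) nat[OF S U compose_hom[OF f g S] y(1)] nat[OF S T f y(1)]
        nat[OF T U g grp_ftr_closed[OF G S T f y(1)]] grp_ftrD(4)[OF G S T U f g y(1)] ..
  qed
qed

lemma RR_simps [simp]:
  "carrier (on_obj RR S) = carrier S" "monoid.mult (on_obj RR S) = add S" "one (on_obj RR S) = \<zero>\<^bsub>S\<^esub>"
  "on_mor RR S T f = f"
  by (simp_all add: RR_def monoid.truncate_def)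

lemma comm_group_RR: "S \<in> Mods \<Longrightarrow> comm_group (on_obj RR S)"
proof -
  assume "S \<in> Mods"
  then interpret left_module R S by (simp add: Mods_iff)
  show ?thesis
  proof (rule comm_groupI)
    show "\<exists>y\<in>carrier (on_obj RR S). y \<otimes>\<^bsub>on_obj RR S\<^esub> x = \<one>\<^bsub>on_obj RR S\<^esub>"
      if "x \<in> carrier (on_obj RR S)" for x
      using that M.l_neg[of x] M.a_inv_closed[of x] by auto
  qed (auto simp: M.a_assoc intro: M.a_comm)
qed

lemma grp_ftr_RR: "grp_ftr RR"
  unfolding grp_ftr_def
proof (intro conjI ballI)
  fix S T f assume "S \<in> Mods" "T \<in> Mods" "f \<in> module_homs R S T"
  then show "on_mor RR S T f \<in> group_homs (on_obj RR S) (on_obj RR T)"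
    by (simp add: module_homs_def group_homs_def hom_def)
qed (auto simp: comm_group_RR compose_def)

lemma RR_objs: "(RR :: ('r, 'u, 'u) group_ftr) \<in> objs (RR_Mod R)"
  using grp_ftr_RR by (simp add: RR_Mod_iff small_valued_def Mods_iff)

lemma mod_scheme_simps:
  "carrier (on_obj (mod_scheme R N) S) = module_homs R N S"
  "monoid.mult (on_obj (mod_scheme R N) S) = (\<lambda>f g. \<lambda>x\<in>carrier N. f x \<oplus>\<^bsub>S\<^esub> g x)"
  "one (on_obj (mod_scheme R N) S) = (\<lambda>x\<in>carrier N. \<zero>\<^bsub>S\<^esub>)"
  "on_mor (mod_scheme R N) S T f = (\<lambda>h\<in>module_homs R N S. compose (carrier N) f h)"
  by (simp_all add: mod_scheme_def homs_RMod) (simp_all add: RMod_def)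

lemma comm_group_mod_scheme:
  assumes N: "N \<in> Mods" and S: "S \<in> Mods"
  shows "comm_group (on_obj (mod_scheme R N) S)"
proof (rule comm_groupI; unfold mod_scheme_simps)
  interpret N: left_module R N using N by (simp add: Mods_iff)
  interpret S: left_module R S using S by (simp add: Mods_iff)
  note sc = N.smult_closed S.smult_closed
  fix f assume f: "f \<in> module_homs R N S"
  note fD = module_homsD[OF f]
  show "(\<lambda>x\<in>carrier N. (\<lambda>x\<in>carrier N. \<zero>\<^bsub>S\<^esub>) x \<oplus>\<^bsub>S\<^esub> f x) = f"
    using fD by (intro extensionalityI[where A = "carrier N"]) auto
  have s0: "a \<odot>\<^bsub>S\<^esub> \<zero>\<^bsub>S\<^esub> = \<zero>\<^bsub>S\<^esub>" if "a \<in> carrier R" for a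
    using S.smult_r_distr[OF that, of "\<zero>\<^bsub>S\<^esub>" "\<zero>\<^bsub>S\<^esub>"] sc(2)[OF that, of "\<zero>\<^bsub>S\<^esub>"] by (simp add: S.M.add.l_cancel_one')
  have sn: "a \<odot>\<^bsub>S\<^esub> (\<ominus>\<^bsub>S\<^esub> x) = \<ominus>\<^bsub>S\<^esub> (a \<odot>\<^bsub>S\<^esub> x)" if "a \<in> carrier R" "x \<in> carrier S" for a x
  proof -
    have "a \<odot>\<^bsub>S\<^esub> (\<ominus>\<^bsub>S\<^esub> x) \<oplus>\<^bsub>S\<^esub> a \<odot>\<^bsub>S\<^esub> x = \<zero>\<^bsub>S\<^esub>"
      using that s0[OF that(1)] S.smult_r_distr[OF that(1), of "\<ominus>\<^bsub>S\<^esub> x" x] by (simp add: S.M.l_neg)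
    then show ?thesis using S.M.minus_equality sc that by (metis S.M.a_inv_closed)
  qed
  have "(\<lambda>x\<in>carrier N. \<ominus>\<^bsub>S\<^esub> f x) \<in> module_homs R N S"
    by (rule module_homsI) (use fD sc sn in \<open>auto simp: S.M.minus_add\<close>)
  moreover have "(\<lambda>x\<in>carrier N. (\<lambda>x\<in>carrier N. \<ominus>\<^bsub>S\<^esub> f x) x \<oplus>\<^bsub>S\<^esub> f x) = (\<lambda>x\<in>carrier N. \<zero>\<^bsub>S\<^esub>)"
    using fD by (auto simp: S.M.l_neg)
  ultimately show "\<exists>y\<in>module_homs R N S. (\<lambda>x\<in>carrier N. y x \<oplus>\<^bsub>S\<^esub> f x) = (\<lambda>x\<in>carrier N. \<zero>\<^bsub>S\<^esub>)" by blast
  fix g assume g: "g \<in> module_homs R N S"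
  note gD = module_homsD[OF g]
  show "(\<lambda>x\<in>carrier N. f x \<oplus>\<^bsub>S\<^esub> g x) \<in> module_homs R N S"
    by (rule module_homsI) (use fD gD sc in \<open>auto simp: S.M.a_ac S.smult_r_distr\<close>)
  show "(\<lambda>x\<in>carrier N. f x \<oplus>\<^bsub>S\<^esub> g x) = (\<lambda>x\<in>carrier N. g x \<oplus>\<^bsub>S\<^esub> f x)"
    using fD gD by (auto simp: S.M.a_comm)
  fix h assume h: "h \<in> module_homs R N S"
  note hD = module_homsD[OF h]
  show "(\<lambda>x\<in>carrier N. (\<lambda>x\<in>carrier N. f x \<oplus>\<^bsub>S\<^esub> g x) x \<oplus>\<^bsub>S\<^esub> h x) =
      (\<lambda>x\<in>carrier N. f x \<oplus>\<^bsub>S\<^esub> (\<lambda>x\<in>carrier N. g x \<oplus>\<^bsub>S\<^esub> h x) x)"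
    using fD gD hD by (auto simp: S.M.a_assoc)
next
  interpret N: left_module R N using N by (simp add: Mods_iff)
  interpret S: left_module R S using S by (simp add: Mods_iff)
  have s0: "a \<odot>\<^bsub>S\<^esub> \<zero>\<^bsub>S\<^esub> = \<zero>\<^bsub>S\<^esub>" if "a \<in> carrier R" for a
    using S.smult_r_distr[OF that, of "\<zero>\<^bsub>S\<^esub>" "\<zero>\<^bsub>S\<^esub>"] S.smult_closed[OF that, of "\<zero>\<^bsub>S\<^esub>"] by (simp add: S.M.add.l_cancel_one')
  show "(\<lambda>x\<in>carrier N. \<zero>\<^bsub>S\<^esub>) \<in> module_homs R N S"
    by (rule module_homsI) (auto simp: N.smult_closed s0)
qed

lemma grp_ftr_mod_scheme:
  assumes N: "N \<in> Mods" shows "grp_ftr (mod_scheme R N)"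
proof (rule grp_ftr_jointly_mono[where J = "carrier N" and F = "\<lambda>_. RR" and \<pi> = "\<lambda>x S h. h x"])
  show "grp_ftr RR" by (rule grp_ftr_RR)
  show "comm_group (on_obj (mod_scheme R N) S)" if "S \<in> Mods" for S
    by (rule comm_group_mod_scheme[OF N that])
  show "on_mor (mod_scheme R N) S T f h \<in> el (mod_scheme R N) T"
    if "f \<in> module_homs R S T" "h \<in> el (mod_scheme R N) S" for S T f h
    using that compose_hom[OF _ that(1) N] by (simp add: mod_scheme_simps)
  show "h = h'" if "h \<in> el (mod_scheme R N) S" "h' \<in> el (mod_scheme R N) S" "\<And>x. x \<in> carrier N \<Longrightarrow> h x = h' x"
    for S h h'
    using that module_homsD(4) unfolding mod_scheme_simps by (metis extensionalityI)
qed (use module_homsD(1) in \<open>auto simp: mod_scheme_simps hom_def compose_def\<close>)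

lemma small_valued_mod_scheme: "N \<in> Mods \<Longrightarrow> small_valued (mod_scheme R N)"
  by (simp add: small_valued_def mod_scheme_simps small_module_homs)

lemma direct_sum_simps:
  "on_obj (direct_sum I F) S = sum_group I (\<lambda>i. on_obj (F i) S)"
  "on_mor (direct_sum I F) S T f = (\<lambda>x\<in>carrier (sum_group I (\<lambda>i. on_obj (F i) S)). \<lambda>i\<in>I. on_mor (F i) S T f (x i))"
  by (simp_all add: direct_sum_def)

lemma el_direct_sum:
  assumes "\<And>i. i \<in> I \<Longrightarrow> grp_ftr (F i)" "S \<in> Mods"
  shows "el (direct_sum I F) S = {x \<in> \<Pi>\<^sub>E i\<in>I. el (F i) S. finite {i \<in> I. x i \<noteq> \<one>\<^bsub>on_obj (F i) S\<^esub>}}"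
  unfolding direct_sum_simps
  by (subst carrier_sum_group) (use assms in \<open>auto intro!: comm_group.axioms(2) grp_ftrD(1)\<close>)

lemma grp_ftr_direct_sum:
  assumes F: "\<And>i. i \<in> I \<Longrightarrow> grp_ftr (F i)" shows "grp_ftr (direct_sum I F)"
proof (rule grp_ftr_jointly_mono[where J = I and F = F and \<pi> = "\<lambda>i S x. x i"])
  have el: "el (direct_sum I F) S = {x \<in> \<Pi>\<^sub>E i\<in>I. el (F i) S. finite {i \<in> I. x i \<noteq> \<one>\<^bsub>on_obj (F i) S\<^esub>}}"
    if "S \<in> Mods" for S by (rule el_direct_sum[OF F that])
  show "comm_group (on_obj (direct_sum I F) S)" if "S \<in> Mods" for S
    unfolding direct_sum_simps using grp_ftrD(1)[OF F that] by blast
  show "on_mor (direct_sum I F) S T f x \<in> el (direct_sum I F) T"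
    if S: "S \<in> Mods" and T: "T \<in> Mods" and f: "f \<in> module_homs R S T" and x: "x \<in> el (direct_sum I F) S" for S T f x
  proof -
    have fin: "finite {i \<in> I. x i \<noteq> \<one>\<^bsub>on_obj (F i) S\<^esub>}" and xi: "\<And>i. i \<in> I \<Longrightarrow> x i \<in> el (F i) S"
      using x el[OF S] by auto
    have "finite {i \<in> I. on_mor (F i) S T f (x i) \<noteq> \<one>\<^bsub>on_obj (F i) T\<^esub>}"
      by (rule finite_subset[OF _ fin])
         (auto simp: group_homs_one[OF grp_ftrD(2)[OF F S T f] grp_ftrD(1)[OF F S] grp_ftrD(1)[OF F T]])
    moreover have "on_mor (F i) S T f (x i) \<in> el (F i) T" if "i \<in> I" for i
      using grp_ftr_closed[OF F[OF that] S T f xi[OF that]] .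
    ultimately show ?thesis unfolding el[OF T]
      using x by (simp add: direct_sum_simps cong: conj_cong)
  qed
  show "x = y" if "S \<in> Mods" "x \<in> el (direct_sum I F) S" "y \<in> el (direct_sum I F) S" "\<And>i. i \<in> I \<Longrightarrow> x i = y i" for S x y
  proof -
    have "x \<in> (\<Pi>\<^sub>E i\<in>I. el (F i) S)" "y \<in> (\<Pi>\<^sub>E i\<in>I. el (F i) S)" using that(2,3) el[OF that(1)] by auto
    then show ?thesis by (rule PiE_ext) (use that(4) in blast)
  qed
  show "(\<lambda>x. x i) \<in> hom (on_obj (direct_sum I F) S) (on_obj (F i) S)" if "i \<in> I" "S \<in> Mods" for i S
    using that el[OF that(2)] by (auto simp: hom_def direct_sum_simps)
qed (use F in \<open>auto simp: direct_sum_simps\<close>)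

lemma small_valued_direct_sum:
  assumes I: "small TYPE('u) I" and F: "\<And>i. i \<in> I \<Longrightarrow> grp_ftr (F i)" "\<And>i. i \<in> I \<Longrightarrow> small_valued (F i)"
  shows "small_valued (direct_sum I F)"
  unfolding small_valued_def
proof
  fix S assume S: "S \<in> Mods"
  have "small TYPE('u) (\<Pi>\<^sub>E i\<in>I. el (F i) S)" using I F(2) S by (intro small_PiE) (auto simp: small_valued_def)
  then show "small TYPE('u) (el (direct_sum I F) S)"
    by (rule small_subset) (auto simp: el_direct_sum[of I F, OF F(1) S])
qed

definition nt_copair :: "'i set \<Rightarrow> ('i \<Rightarrow> ('r, 'u, 'g) group_ftr) \<Rightarrow> ('r, 'u, 'h) group_ftr \<Rightarrow>
    ('i \<Rightarrow> ('r, 'u) module \<Rightarrow> 'g \<Rightarrow> 'h) \<Rightarrow> ('r, 'u) module \<Rightarrow> ('i \<Rightarrow> 'g) \<Rightarrow> 'h" where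
  "nt_copair I F H \<phi> = mk_nt (direct_sum I F) (\<lambda>S. copair I (on_obj H S) (\<lambda>i. \<phi> i S))"

lemma nt_copair_nat_trans:
  assumes F: "\<And>i. i \<in> I \<Longrightarrow> grp_ftr (F i)" and H: "grp_ftr H"
    and \<phi>: "\<And>i. i \<in> I \<Longrightarrow> \<phi> i \<in> nat_trans R (F i) H"
  shows "nt_copair I F H \<phi> \<in> nat_trans R (direct_sum I F) H"
  unfolding nt_copair_def
proof (rule mk_nt_nat_trans[OF grp_ftr_direct_sum[OF F]])
  have \<phi>S: "\<phi> i S \<in> hom (on_obj (F i) S) (on_obj H S)" if "S \<in> Mods" "i \<in> I" for i S
    by (rule group_homsD(1)[OF nat_transD(1)[OF \<phi>[OF that(2)] that(1)]])
  show "copair I (on_obj H S) (\<lambda>i. \<phi> i S) \<in> hom (on_obj (direct_sum I F) S) (on_obj H S)" if S: "S \<in> Mods" for S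
    unfolding direct_sum_simps
    by (rule copair_hom[where G = "\<lambda>i. on_obj (F i) S", OF grp_ftrD(1)[OF F S] grp_ftrD(1)[OF H S] \<phi>S[OF S]])
  fix S T f x assume S: "S \<in> Mods" and T: "T \<in> Mods" and f: "f \<in> module_homs R S T" and x: "x \<in> el (direct_sum I F) S"
  have xi: "x i \<in> el (F i) S" if "i \<in> I" for i using x that el_direct_sum[of I F, OF F S] by auto
  have "on_mor H S T f (copair I (on_obj H S) (\<lambda>i. \<phi> i S) x) = copair I (on_obj H T) (\<lambda>i y. on_mor H S T f (\<phi> i S y)) x"
    by (rule hom_copair[where G = "\<lambda>i. on_obj (F i) S", OF grp_ftrD(1)[OF F S] grp_ftrD(1)[OF H S] \<phi>S[OF S]
          grp_ftrD(1)[OF H T] group_homsD(1)[OF grp_ftrD(2)[OF H S T f]] x[unfolded direct_sum_simps]])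
  also have "\<dots> = copair I (on_obj H T) (\<lambda>i. \<phi> i T) (on_mor (direct_sum I F) S T f x)"
  proof (rule copair_cong[where G = "\<lambda>i. on_obj (F i) S", OF grp_ftrD(1)[OF F S] grp_ftrD(1)[OF H T]])
    fix i assume i: "i \<in> I"
    have e: "on_mor (direct_sum I F) S T f x i = on_mor (F i) S T f (x i)"
      using x i by (simp add: direct_sum_simps)
    show "\<phi> i T (on_mor (direct_sum I F) S T f x i) \<in> el H T"
      unfolding e by (rule nat_transD(4)[OF \<phi>[OF i] T grp_ftr_closed[OF F[OF i] S T f xi[OF i]]])
    show "on_mor H S T f (\<phi> i S (x i)) = \<phi> i T (on_mor (direct_sum I F) S T f x i)"
      unfolding e by (rule nat_transD(2)[OF \<phi>[OF i] S T f xi[OF i], symmetric])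
  qed
  finally show "copair I (on_obj H T) (\<lambda>i. \<phi> i T) (on_mor (direct_sum I F) S T f x) =
      on_mor H S T f (copair I (on_obj H S) (\<lambda>i. \<phi> i S) x)" ..
qed

lemma nt_copair_apply:
  "S \<in> Mods \<Longrightarrow> x \<in> el (direct_sum I F) S \<Longrightarrow> nt_copair I F H \<phi> S x = copair I (on_obj H S) (\<lambda>i. \<phi> i S) x"
  by (simp add: nt_copair_def)

definition nt_single :: "'i set \<Rightarrow> ('i \<Rightarrow> ('r, 'u, 'g) group_ftr) \<Rightarrow> 'i \<Rightarrow> ('r, 'u) module \<Rightarrow> 'g \<Rightarrow> 'i \<Rightarrow> 'g" where
  "nt_single I F i = mk_nt (F i) (\<lambda>S. single I (\<lambda>i. on_obj (F i) S) i)"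

lemma nt_single_nat_trans:
  assumes F: "\<And>i. i \<in> I \<Longrightarrow> grp_ftr (F i)" and i: "i \<in> I"
  shows "nt_single I F i \<in> nat_trans R (F i) (direct_sum I F)"
  unfolding nt_single_def
proof (rule mk_nt_nat_trans[OF F[OF i]])
  show "single I (\<lambda>i. on_obj (F i) S) i \<in> hom (on_obj (F i) S) (on_obj (direct_sum I F) S)" if S: "S \<in> Mods" for S
    unfolding direct_sum_simps by (rule single_hom[where G = "\<lambda>i. on_obj (F i) S", OF grp_ftrD(1)[OF F S] i])
  fix S T f x assume S: "S \<in> Mods" and T: "T \<in> Mods" and f: "f \<in> module_homs R S T" and x: "x \<in> el (F i) S"
  have "single I (\<lambda>i. on_obj (F i) S) i x \<in> carrier (sum_group I (\<lambda>i. on_obj (F i) S))"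
    by (rule single_closed[where G = "\<lambda>i. on_obj (F i) S", OF grp_ftrD(1)[OF F S] i x])
  then show "single I (\<lambda>i. on_obj (F i) T) i (on_mor (F i) S T f x) =
      on_mor (direct_sum I F) S T f (single I (\<lambda>i. on_obj (F i) S) i x)"
    using group_homs_one[OF grp_ftrD(2)[OF F S T f] grp_ftrD(1)[OF F S] grp_ftrD(1)[OF F T]]
    by (auto simp: direct_sum_simps single_def intro!: restrict_ext)
qed

lemma nt_single_apply:
  "S \<in> Mods \<Longrightarrow> x \<in> el (F i) S \<Longrightarrow> nt_single I F i S x = single I (\<lambda>i. on_obj (F i) S) i x"
  by (simp add: nt_single_def)

definition ker_ftr :: "('r, 'u, 'g) group_ftr \<Rightarrow> ('r, 'u, 'h) group_ftr \<Rightarrow> (('r, 'u) module \<Rightarrow> 'g \<Rightarrow> 'h) \<Rightarrow> ('r, 'u, 'g) group_ftr" where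
  "ker_ftr F G \<alpha> = \<lparr>on_obj = (\<lambda>S. (on_obj F S)\<lparr>carrier := kernel (on_obj F S) (on_obj G S) (\<alpha> S)\<rparr>),
     on_mor = (\<lambda>S T f. restrict (on_mor F S T f) (kernel (on_obj F S) (on_obj G S) (\<alpha> S)))\<rparr>"

lemma nat_trans_group_hom:
  assumes F: "grp_ftr F" and G: "grp_ftr G" and \<alpha>: "\<alpha> \<in> nat_trans R F G" and S: "S \<in> Mods"
  shows "group_hom (on_obj F S) (on_obj G S) (\<alpha> S)"
  using group_homsD(1)[OF nat_transD(1)[OF \<alpha> S]] grp_ftrD(1)[OF F S] grp_ftrD(1)[OF G S]
  by (simp add: group_hom_def group_hom_axioms_def comm_group.axioms(2))

lemma el_ker_ftr: "el (ker_ftr F G \<alpha>) S = {x \<in> el F S. \<alpha> S x = \<one>\<^bsub>on_obj G S\<^esub>}"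
  by (simp add: ker_ftr_def kernel_def)

lemma
  assumes F: "grp_ftr F" and G: "grp_ftr G" and \<alpha>: "\<alpha> \<in> nat_trans R F G"
  shows grp_ftr_ker_ftr: "grp_ftr (ker_ftr F G \<alpha>)"
    and ker_ftr_incl: "mk_nt (ker_ftr F G \<alpha>) (\<lambda>S x. x) \<in> nat_trans R (ker_ftr F G \<alpha>) F"
proof -
  show K: "grp_ftr (ker_ftr F G \<alpha>)"
  proof (rule grp_ftr_jointly_mono[where J = "{()}" and F = "\<lambda>_. F" and \<pi> = "\<lambda>_ S x. x"])
    show "comm_group (on_obj (ker_ftr F G \<alpha>) S)" if S: "S \<in> Mods" for S
      using comm_group_subgroup[OF grp_ftrD(1)[OF F S] group_hom.subgroup_kernel[OF nat_trans_group_hom[OF F G \<alpha> S]]]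
      by (simp add: ker_ftr_def)
    show "on_mor (ker_ftr F G \<alpha>) S T f x \<in> el (ker_ftr F G \<alpha>) T"
      if S: "S \<in> Mods" and T: "T \<in> Mods" and f: "f \<in> module_homs R S T" and x: "x \<in> el (ker_ftr F G \<alpha>) S" for S T f x
    proof -
      have x': "x \<in> el F S" "\<alpha> S x = \<one>\<^bsub>on_obj G S\<^esub>" using x by (auto simp: el_ker_ftr)
      have "\<alpha> T (on_mor F S T f x) = \<one>\<^bsub>on_obj G T\<^esub>"
        using nat_transD(2)[OF \<alpha> S T f x'(1)] x'(2)
          group_homs_one[OF grp_ftrD(2)[OF G S T f] grp_ftrD(1)[OF G S] grp_ftrD(1)[OF G T]] by simp
      then show ?thesis using x' grp_ftr_closed[OF F S T f x'(1)]
        by (simp add: ker_ftr_def kernel_def)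
    qed
  qed (use F in \<open>auto simp: ker_ftr_def hom_def kernel_def\<close>)
  show "mk_nt (ker_ftr F G \<alpha>) (\<lambda>S x. x) \<in> nat_trans R (ker_ftr F G \<alpha>) F"
    by (rule mk_nt_nat_trans[OF K]) (auto simp: ker_ftr_def hom_def kernel_def)
qed

text \<open>For each module separately the group \<open>F S\<close> is replaced by a copy with elements in \<open>'u\<close>, and
  morphisms act through the chosen bijections.\<close>

lemma transport_ftr:
  fixes F :: "('r, 'u, 'g) group_ftr"
  assumes F: "grp_ftr F" and sm: "small_valued F"
  shows "\<exists>F' \<alpha> \<beta>. F' \<in> objs (RR_Mod R :: ('r, 'u) ftr_cat) \<and> \<alpha> \<in> nat_trans R F F' \<and> \<beta> \<in> nat_trans R F' F \<and>
    (\<forall>S\<in>Mods. (\<forall>x\<in>el F S. \<beta> S (\<alpha> S x) = x) \<and> (\<forall>y\<in>el F' S. \<alpha> S (\<beta> S y) = y))"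
proof -
  have "\<forall>S\<in>Mods. \<exists>H::'u monoid. \<exists>\<alpha> \<beta>. H \<in> objs Ab \<and> \<alpha> \<in> group_homs (on_obj F S) H \<and> \<beta> \<in> group_homs H (on_obj F S) \<and>
    (\<forall>x\<in>el F S. \<beta> (\<alpha> x) = x) \<and> (\<forall>y\<in>carrier H. \<alpha> (\<beta> y) = y)"
  proof
    fix S assume S: "S \<in> Mods"
    have "small TYPE('u) (el F S)" using sm S by (simp add: small_valued_def)
    from transport_group[OF grp_ftrD(1)[OF F S] this]
    show "\<exists>H::'u monoid. \<exists>\<alpha> \<beta>. H \<in> objs Ab \<and> \<alpha> \<in> group_homs (on_obj F S) H \<and> \<beta> \<in> group_homs H (on_obj F S) \<and>
      (\<forall>x\<in>el F S. \<beta> (\<alpha> x) = x) \<and> (\<forall>y\<in>carrier H. \<alpha> (\<beta> y) = y)" .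
  qed
  from bchoice[OF this] obtain H :: "('r, 'u) module \<Rightarrow> 'u monoid" where
    "\<forall>S\<in>Mods. \<exists>\<alpha> \<beta>. H S \<in> objs Ab \<and> \<alpha> \<in> group_homs (on_obj F S) (H S) \<and> \<beta> \<in> group_homs (H S) (on_obj F S) \<and>
      (\<forall>x\<in>el F S. \<beta> (\<alpha> x) = x) \<and> (\<forall>y\<in>carrier (H S). \<alpha> (\<beta> y) = y)" by (elim exE)
  from bchoice[OF this] obtain a where
    "\<forall>S\<in>Mods. \<exists>\<beta>. H S \<in> objs Ab \<and> a S \<in> group_homs (on_obj F S) (H S) \<and> \<beta> \<in> group_homs (H S) (on_obj F S) \<and>
      (\<forall>x\<in>el F S. \<beta> (a S x) = x) \<and> (\<forall>y\<in>carrier (H S). a S (\<beta> y) = y)" by (elim exE)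
  from bchoice[OF this] obtain b where
    Hab: "\<forall>S\<in>Mods. H S \<in> objs Ab \<and> a S \<in> group_homs (on_obj F S) (H S) \<and> b S \<in> group_homs (H S) (on_obj F S) \<and>
      (\<forall>x\<in>el F S. b S (a S x) = x) \<and> (\<forall>y\<in>carrier (H S). a S (b S y) = y)" by (elim exE)
  have H: "\<And>S. S \<in> Mods \<Longrightarrow> H S \<in> objs Ab" and a: "\<And>S. S \<in> Mods \<Longrightarrow> a S \<in> group_homs (on_obj F S) (H S)"
    and b: "\<And>S. S \<in> Mods \<Longrightarrow> b S \<in> group_homs (H S) (on_obj F S)"
    and ba: "\<And>S x. S \<in> Mods \<Longrightarrow> x \<in> el F S \<Longrightarrow> b S (a S x) = x"
    and ab: "\<And>S y. S \<in> Mods \<Longrightarrow> y \<in> carrier (H S) \<Longrightarrow> a S (b S y) = y"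
    using Hab by simp_all
  define F' :: "('r, 'u, 'u) group_ftr" where
    "F' = \<lparr>on_obj = H, on_mor = (\<lambda>S T f. \<lambda>y\<in>carrier (H S). a T (on_mor F S T f (b S y)))\<rparr>"
  have bc: "b S y \<in> el F S" if "S \<in> Mods" "y \<in> carrier (H S)" for S y by (rule group_homsD(3)[OF b[OF that(1)] that(2)])
  have nb: "b T (on_mor F' S T f y) = on_mor F S T f (b S y)"
    if "S \<in> Mods" "T \<in> Mods" "f \<in> module_homs R S T" "y \<in> el F' S" for S T f y
    using that ba[OF that(2) grp_ftr_closed[OF F that(1-3) bc]] by (simp add: F'_def)
  have F': "grp_ftr F'"
  proof (rule grp_ftr_jointly_mono[where J = "{()}" and F = "\<lambda>_. F" and \<pi> = "\<lambda>_. b"])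
    show "comm_group (on_obj F' S)" if "S \<in> Mods" for S using H[OF that] by (simp add: F'_def Ab_objs)
    show "on_mor F' S T f x \<in> el F' T"
      if S: "S \<in> Mods" and T: "T \<in> Mods" and f: "f \<in> module_homs R S T" and x: "x \<in> el F' S" for S T f x
      using x group_homsD(3)[OF a[OF T] grp_ftr_closed[OF F S T f bc[OF S]]] by (simp add: F'_def)
    show "x = y" if "S \<in> Mods" "x \<in> el F' S" "y \<in> el F' S" "\<And>j. j \<in> {()} \<Longrightarrow> b S x = b S y" for S x y
      using that ab[OF that(1)] by (simp add: F'_def) metis
  qed (use F nb group_homsD(1)[OF b] in \<open>auto simp: F'_def\<close>)
  have "F' \<in> objs (RR_Mod R)" using F' H by (simp add: RR_Mod_iff small_valued_def F'_def Ab_objs)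
  moreover have "mk_nt F a \<in> nat_trans R F F'"
    by (rule mk_nt_nat_trans[OF F])
       (use group_homsD(1)[OF a] group_homsD(3)[OF a] ba in \<open>auto simp: F'_def\<close>)
  moreover have "mk_nt F' b \<in> nat_trans R F' F"
    by (rule mk_nt_nat_trans[OF F']) (use group_homsD(1)[OF b] nb in \<open>auto simp: F'_def\<close>)
  moreover have "mk_nt F' b S (mk_nt F a S x) = x" if "S \<in> Mods" "x \<in> el F S" for S x
    using that ba group_homsD(3)[OF a[OF that(1)] that(2)] by (simp add: F'_def)
  moreover have "mk_nt F a S (mk_nt F' b S y) = y" if "S \<in> Mods" "y \<in> el F' S" for S y
    using that ab bc by (simp add: F'_def)
  ultimately show ?thesis by blast
qed

text \<open>The quotients are chosen for each module separately, and morphisms between modules act by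
  factorisation through the projections.\<close>

lemma cokernel_ftr_ex:
  fixes G :: "('r, 'u, 'g) group_ftr" and F :: "('r, 'u, 'f) group_ftr"
  assumes F: "grp_ftr F" and G: "grp_ftr G" and sm: "small_valued G" and \<alpha>: "\<alpha> \<in> nat_trans R F G"
  shows "\<exists>Q q. Q \<in> objs (RR_Mod R :: ('r, 'u) ftr_cat) \<and> q \<in> nat_trans R G Q \<and>
    (\<forall>S\<in>Mods. q S ` el G S = el Q S \<and> kernel (on_obj G S) (on_obj Q S) (q S) = \<alpha> S ` el F S)"
proof -
  have "\<exists>H::'u monoid. \<exists>q. H \<in> objs Ab \<and> q \<in> group_homs (on_obj G S) H \<and> q ` el G S = carrier H \<and>
    (\<forall>x\<in>el G S. q x = \<one>\<^bsub>H\<^esub> \<longleftrightarrow> x \<in> \<alpha> S ` el F S)" if S: "S \<in> Mods" for S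
    using Ab_quotient[OF grp_ftrD(1)[OF G S] _ group_hom.img_is_subgroup[OF nat_trans_group_hom[OF F G \<alpha> S]]]
      sm S by (auto simp: small_valued_def)
  then obtain H :: "('r, 'u) module \<Rightarrow> 'u monoid" and q where
    H: "\<And>S. S \<in> Mods \<Longrightarrow> H S \<in> objs Ab" and q: "\<And>S. S \<in> Mods \<Longrightarrow> q S \<in> group_homs (on_obj G S) (H S)"
    and surj: "\<And>S. S \<in> Mods \<Longrightarrow> q S ` el G S = carrier (H S)"
    and ker: "\<And>S x. S \<in> Mods \<Longrightarrow> x \<in> el G S \<Longrightarrow> q S x = \<one>\<^bsub>H S\<^esub> \<longleftrightarrow> x \<in> \<alpha> S ` el F S" by metis
  have cH: "\<And>S. S \<in> Mods \<Longrightarrow> comm_group (H S)" using H by (simp add: Ab_objs)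
  define P where "P S T f v \<longleftrightarrow> v \<in> group_homs (H S) (H T) \<and> (\<forall>y\<in>el G S. v (q S y) = q T (on_mor G S T f y))" for S T f v
  have "\<exists>v. P S T f v" if S: "S \<in> Mods" and T: "T \<in> Mods" and f: "f \<in> module_homs R S T" for S T f
  proof -
    have h: "(\<lambda>y. q T (on_mor G S T f y)) \<in> hom (on_obj G S) (H T)"
      using hom_compose[OF group_homsD(1)[OF grp_ftrD(2)[OF G S T f]] group_homsD(1)[OF q[OF T]]] by (simp add: comp_def)
    have k: "q T (on_mor G S T f y) = \<one>\<^bsub>H T\<^esub>" if y: "y \<in> el G S" "q S y = \<one>\<^bsub>H S\<^esub>" for y
    proof -
      obtain x where x: "x \<in> el F S" "y = \<alpha> S x" using ker[OF S y(1)] y(2) by blast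
      have "on_mor G S T f y = \<alpha> T (on_mor F S T f x)" using nat_transD(2)[OF \<alpha> S T f x(1)] x(2) by simp
      then have "on_mor G S T f y \<in> \<alpha> T ` el F T" using grp_ftr_closed[OF F S T f x(1)] by blast
      then show ?thesis using ker[OF T grp_ftr_closed[OF G S T f y(1)]] by simp
    qed
    from epi_factor[OF grp_ftrD(1)[OF G S] cH[OF S] cH[OF T] group_homsD(1)[OF q[OF S]] surj[OF S] h k]
    show ?thesis unfolding P_def by blast
  qed
  then obtain v where v: "\<And>S T f. S \<in> Mods \<Longrightarrow> T \<in> Mods \<Longrightarrow> f \<in> module_homs R S T \<Longrightarrow> P S T f (v S T f)" by metis
  define Q :: "('r, 'u, 'u) group_ftr" where "Q = \<lparr>on_obj = H, on_mor = v\<rparr>"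
  have "grp_ftr Q"
    by (rule grp_ftr_epi[OF G, of Q q]) (use cH v q surj in \<open>auto simp: Q_def P_def\<close>)
  then have "Q \<in> objs (RR_Mod R)" using H by (simp add: RR_Mod_iff small_valued_def Q_def Ab_objs)
  moreover have "mk_nt G q \<in> nat_trans R G Q"
    by (rule mk_nt_nat_trans[OF G]) (use group_homsD(1)[OF q] v in \<open>auto simp: Q_def P_def\<close>)
  moreover have "mk_nt G q S ` el G S = el Q S" if "S \<in> Mods" for S
    using surj[OF that] that by (auto simp: Q_def mk_nt_def)
  moreover have "kernel (on_obj G S) (on_obj Q S) (mk_nt G q S) = \<alpha> S ` el F S" if "S \<in> Mods" for S
    using ker[OF that] nat_transD(4)[OF \<alpha> that] that by (auto simp: Q_def kernel_def)
  ultimately show ?thesis by blast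
qed

subsection \<open>Objectwise limits and colimits\<close>

definition ftr_diagram ::
    "('j, 'k) cat \<Rightarrow> ('j, 'k, ('r, 'u, 'u) group_ftr, ('r, 'u) module \<Rightarrow> 'u \<Rightarrow> 'u) ftr \<Rightarrow> bool" where
  "ftr_diagram J D \<longleftrightarrow> (\<forall>j\<in>objs J. on_obj D j \<in> objs (RR_Mod R)) \<and>
     (\<forall>i\<in>objs J. \<forall>j\<in>objs J. \<forall>f\<in>homs J i j. on_mor D i j f \<in> nat_trans R (on_obj D i) (on_obj D j))"

lemma ftr_diagramD:
  assumes "ftr_diagram J D"
  shows "j \<in> objs J \<Longrightarrow> grp_ftr (on_obj D j)" "j \<in> objs J \<Longrightarrow> small_valued (on_obj D j)"
    "i \<in> objs J \<Longrightarrow> j \<in> objs J \<Longrightarrow> f \<in> homs J i j \<Longrightarrow> on_mor D i j f \<in> nat_trans R (on_obj D i) (on_obj D j)"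
  using assms by (simp_all add: ftr_diagram_def RR_Mod_iff)

lemma eval_at_simps [simp]:
  "on_obj (eval_at S D) j = on_obj (on_obj D j) S" "on_mor (eval_at S D) i j f = on_mor D i j f S"
  by (simp_all add: eval_at_def)

lemma eval_diagram:
  assumes D: "ftr_diagram J D" and S: "S \<in> Mods" shows "group_diagram J (eval_at S D)"
  unfolding group_diagram_def eval_at_simps
  using grp_ftrD(1)[OF ftr_diagramD(1)[OF D] S] nat_transD(1)[OF ftr_diagramD(3)[OF D] S] by blast

definition limit_ftr where
  "limit_ftr J D L \<pi> \<longleftrightarrow> (\<forall>j\<in>objs J. \<pi> j \<in> nat_trans R L (on_obj D j)) \<and>
     (\<forall>S\<in>Mods. limit_group J (eval_at S D) (on_obj L S) (\<lambda>j. \<pi> j S))"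

definition colimit_ftr where
  "colimit_ftr J D L \<iota> \<longleftrightarrow> (\<forall>j\<in>objs J. \<iota> j \<in> nat_trans R (on_obj D j) L) \<and>
     (\<forall>S\<in>Mods. colimit_group J (eval_at S D) (on_obj L S) (\<lambda>j. \<iota> j S))"

text \<open>The limits are chosen for each module separately, and morphisms between modules act by
  factorisation through the projections to the diagram.\<close>

lemma limit_ftr_ex:
  assumes J: "small TYPE('u) (objs J)" and D: "ftr_diagram J D"
  shows "\<exists>L \<pi>. L \<in> objs (RR_Mod R :: ('r, 'u) ftr_cat) \<and> limit_ftr J D L \<pi>"
proof -
  note DD = ftr_diagramD[OF D]
  have "\<forall>S\<in>Mods. \<exists>H \<pi>. H \<in> objs (Ab :: ('u monoid, 'u \<Rightarrow> 'u) cat) \<and> limit_group J (eval_at S D) H \<pi>"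
  proof
    fix S assume S: "S \<in> Mods"
    show "\<exists>H \<pi>. H \<in> objs (Ab :: ('u monoid, 'u \<Rightarrow> 'u) cat) \<and> limit_group J (eval_at S D) H \<pi>"
      by (rule limit_group_ex[OF J eval_diagram[OF D S]]) (use DD(2) S in \<open>simp add: small_valued_def\<close>)
  qed
  from bchoice[OF this] obtain H where
    "\<forall>S\<in>Mods. \<exists>\<pi>. H S \<in> objs (Ab :: ('u monoid, 'u \<Rightarrow> 'u) cat) \<and> limit_group J (eval_at S D) (H S) \<pi>" by (elim exE)
  from bchoice[OF this] obtain \<pi> where
    H\<pi>: "\<forall>S\<in>Mods. H S \<in> objs (Ab :: ('u monoid, 'u \<Rightarrow> 'u) cat) \<and> limit_group J (eval_at S D) (H S) (\<pi> S)" by (elim exE)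
  then have H: "\<And>S. S \<in> Mods \<Longrightarrow> H S \<in> objs (Ab :: ('u monoid, 'u \<Rightarrow> 'u) cat)"
    and lim: "\<And>S. S \<in> Mods \<Longrightarrow> limit_group J (eval_at S D) (H S) (\<pi> S)" by simp_all
  have cH: "\<And>S. S \<in> Mods \<Longrightarrow> comm_group (H S)" using H by (simp add: Ab_objs)
  have \<pi>: "\<pi> S j \<in> group_homs (H S) (on_obj (on_obj D j) S)" if "S \<in> Mods" "j \<in> objs J" for S j
    using lim[OF that(1)] that(2) by (simp add: limit_group_def)
  have comp: "compatible J (eval_at S D) (\<lambda>j. \<pi> S j g)" if "S \<in> Mods" "g \<in> carrier (H S)" for S g
    using lim[OF that(1)] that(2) by (simp add: limit_group_def)
  define P where "P S T f v \<longleftrightarrow> v \<in> group_homs (H S) (H T) \<and>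
    (\<forall>j\<in>objs J. \<forall>x\<in>carrier (H S). \<pi> T j (v x) = on_mor (on_obj D j) S T f (\<pi> S j x))" for S T f v
  have "\<exists>v. P S T f v" if S: "S \<in> Mods" and T: "T \<in> Mods" and f: "f \<in> module_homs R S T" for S T f
  proof -
    let ?\<xi> = "\<lambda>j. compose (carrier (H S)) (on_mor (on_obj D j) S T f) (\<pi> S j)"
    have 1: "?\<xi> j \<in> group_homs (H S) (on_obj (eval_at T D) j)" if j: "j \<in> objs J" for j
      using compose_group_homs[OF cH[OF S] \<pi>[OF S j] grp_ftrD(2)[OF DD(1)[OF j] S T f]] by simp
    have 2: "compatible J (eval_at T D) (\<lambda>j. ?\<xi> j x)" if x: "x \<in> carrier (H S)" for x
      unfolding compatible_def
    proof (intro conjI ballI)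
      fix j assume j: "j \<in> objs J"
      show "?\<xi> j x \<in> carrier (on_obj (eval_at T D) j)" by (rule group_homsD(3)[OF 1[OF j] x])
      fix i g assume i: "i \<in> objs J" and g: "g \<in> homs J i j"
      have "on_mor D i j g T (on_mor (on_obj D i) S T f (\<pi> S i x)) = on_mor (on_obj D j) S T f (on_mor D i j g S (\<pi> S i x))"
        by (rule nat_transD(2)[OF DD(3)[OF i j g] S T f group_homsD(3)[OF \<pi>[OF S i] x]])
      also have "on_mor D i j g S (\<pi> S i x) = \<pi> S j x"
        using comp[OF S x] i j g by (simp add: compatible_def)
      finally show "on_mor (eval_at T D) i j g (?\<xi> i x) = ?\<xi> j x" using x by (simp add: compose_def)
    qed
    from limit_group_factor[OF lim[OF T] cH[OF T] cH[OF S], of ?\<xi>, OF 1 2]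
    obtain v where "v \<in> group_homs (H S) (H T)" "\<forall>j\<in>objs J. \<forall>x\<in>carrier (H S). \<pi> T j (v x) = ?\<xi> j x" by blast
    then show ?thesis by (intro exI[of _ v]) (simp add: P_def compose_def)
  qed
  then obtain v where v: "\<And>S T f. S \<in> Mods \<Longrightarrow> T \<in> Mods \<Longrightarrow> f \<in> module_homs R S T \<Longrightarrow> P S T f (v S T f)" by metis
  have vh: "v S T f \<in> group_homs (H S) (H T)"
    and v\<pi>: "\<And>j x. j \<in> objs J \<Longrightarrow> x \<in> carrier (H S) \<Longrightarrow> \<pi> T j (v S T f x) = on_mor (on_obj D j) S T f (\<pi> S j x)"
    if "S \<in> Mods" "T \<in> Mods" "f \<in> module_homs R S T" for S T f
    using v[OF that] by (simp_all add: P_def)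
  define L :: "('r, 'u, 'u) group_ftr" where "L = \<lparr>on_obj = H, on_mor = v\<rparr>"
  have L: "grp_ftr L"
  proof (rule grp_ftr_jointly_mono[where J = "objs J" and F = "on_obj D" and \<pi> = "\<lambda>j S. \<pi> S j"])
    show "grp_ftr (on_obj D j)" if "j \<in> objs J" for j by (rule DD(1)[OF that])
    show "comm_group (on_obj L S)" if "S \<in> Mods" for S using cH[OF that] by (simp add: L_def)
    show "x = y" if "S \<in> Mods" "x \<in> el L S" "y \<in> el L S" "\<And>j. j \<in> objs J \<Longrightarrow> \<pi> S j x = \<pi> S j y" for S x y
      by (rule limit_group_inj[OF eval_diagram[OF D that(1)] lim[OF that(1)] _ _ that(4)])
         (use that in \<open>simp_all add: L_def\<close>)
    show "on_mor L S T f x \<in> el L T" if "S \<in> Mods" "T \<in> Mods" "f \<in> module_homs R S T" "x \<in> el L S" for S T f x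
      using group_homsD(3)[OF vh[OF that(1-3)]] that(4) by (simp add: L_def)
    show "on_mor L S T f \<in> extensional (el L S)" if "S \<in> Mods" "T \<in> Mods" "f \<in> module_homs R S T" for S T f
      using group_homsD(2)[OF vh[OF that]] by (simp add: L_def)
    show "\<pi> S j \<in> hom (on_obj L S) (on_obj (on_obj D j) S)" if "j \<in> objs J" "S \<in> Mods" for S j
      using group_homsD(1)[OF \<pi>[OF that(2,1)]] by (simp add: L_def)
    show "\<pi> T j (on_mor L S T f x) = on_mor (on_obj D j) S T f (\<pi> S j x)"
      if "j \<in> objs J" "S \<in> Mods" "T \<in> Mods" "f \<in> module_homs R S T" "x \<in> el L S" for j S T f x
      using v\<pi>[OF that(2-4,1)] that(5) by (simp add: L_def)
  qed
  have "L \<in> objs (RR_Mod R)" using L H by (simp add: RR_Mod_iff small_valued_def L_def Ab_objs)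
  moreover have "limit_ftr J D L (\<lambda>j. mk_nt L (\<lambda>S. \<pi> S j))"
    unfolding limit_ftr_def
  proof (intro conjI ballI)
    show "mk_nt L (\<lambda>S. \<pi> S j) \<in> nat_trans R L (on_obj D j)" if j: "j \<in> objs J" for j
    proof (rule mk_nt_nat_trans[OF L])
      show "\<pi> S j \<in> hom (on_obj L S) (on_obj (on_obj D j) S)" if "S \<in> Mods" for S
        using group_homsD(1)[OF \<pi>[OF that j]] by (simp add: L_def)
      show "\<pi> T j (on_mor L S T f x) = on_mor (on_obj D j) S T f (\<pi> S j x)"
        if "S \<in> Mods" "T \<in> Mods" "f \<in> module_homs R S T" "x \<in> el L S" for S T f x
        using v\<pi>[OF that(1-3) j] that(4) by (simp add: L_def)
    qed
    fix S assume S: "S \<in> Mods"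
    have eq: "mk_nt L (\<lambda>S. \<pi> S j) S = \<pi> S j" if "j \<in> objs J" for j
      using S group_homsD(2)[OF \<pi>[OF S that]] by (simp add: mk_nt_def L_def extensional_restrict)
    have oL: "on_obj L S = H S" by (simp add: L_def)
    show "limit_group J (eval_at S D) (on_obj L S) (\<lambda>j. mk_nt L (\<lambda>S. \<pi> S j) S)"
      using lim[OF S] by (simp add: limit_group_def compatible_def eq oL cong: ball_cong conj_cong)
  qed
  ultimately show ?thesis by blast
qed

text \<open>The natural map of direct sums whose cokernel is the colimit of \<open>D\<close>.\<close>

definition nt_rels where
  "nt_rels J D = nt_copair (arrows J) (\<lambda>a. on_obj D (fst a)) (direct_sum (objs J) (on_obj D))
     (\<lambda>a. mk_nt (on_obj D (fst a)) (\<lambda>S. rel J (eval_at S D) a))"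

lemma rel_natural:
  assumes D: "ftr_diagram J D" and a: "a \<in> arrows J"
  shows "mk_nt (on_obj D (fst a)) (\<lambda>S. rel J (eval_at S D) a)
    \<in> nat_trans R (on_obj D (fst a)) (direct_sum (objs J) (on_obj D))"
proof -
  note DD = ftr_diagramD[OF D]
  obtain i j g where ijg: "a = (i, j, g)" "i \<in> objs J" "j \<in> objs J" "g \<in> homs J i j"
    using a by (auto simp: arrows_def)
  let ?A = "direct_sum (objs J) (on_obj D)"
  have A: "grp_ftr ?A" by (rule grp_ftr_direct_sum[OF DD(1)])
  have s: "nt_single (objs J) (on_obj D) k \<in> nat_trans R (on_obj D k) ?A" if "k \<in> objs J" for k
    by (rule nt_single_nat_trans[OF DD(1) that])
  have Di: "grp_ftr (on_obj D (fst a))" using DD(1) ijg by simp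
  have gy: "on_mor D i j g S y \<in> el (on_obj D j) S" if "S \<in> Mods" "y \<in> el (on_obj D i) S" for S y
    by (rule nat_transD(4)[OF DD(3)[OF ijg(2-4)] that])
  have r: "rel J (eval_at S D) a y = nt_single (objs J) (on_obj D) i S y \<otimes>\<^bsub>on_obj ?A S\<^esub>
      inv\<^bsub>on_obj ?A S\<^esub> nt_single (objs J) (on_obj D) j S (on_mor D i j g S y)"
    if "S \<in> Mods" "y \<in> el (on_obj D i) S" for S y
    using that gy[OF that] unfolding rel_def ijg split_conv
    by (simp add: nt_single_apply direct_sum_simps eval_at_def)
  show ?thesis
  proof (rule mk_nt_nat_trans[OF Di])
    fix S assume S: "S \<in> Mods"
    show "rel J (eval_at S D) a \<in> hom (on_obj (on_obj D (fst a)) S) (on_obj ?A S)"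
      using rel_hom[OF eval_diagram[OF D S] a] by (simp add: direct_sum_simps eval_at_def)
    fix T f y assume T: "T \<in> Mods" and f: "f \<in> module_homs R S T" and "y \<in> el (on_obj D (fst a)) S"
    then have y: "y \<in> el (on_obj D i) S" by (simp add: ijg)
    let ?s = "nt_single (objs J) (on_obj D)" and ?f = "on_mor ?A S T f"
    have si: "?s i S y \<in> el ?A S" by (rule nat_transD(4)[OF s[OF ijg(2)] S y])
    have sj: "?s j S (on_mor D i j g S y) \<in> el ?A S" by (rule nat_transD(4)[OF s[OF ijg(3)] S gy[OF S y]])
    interpret AS: comm_group "on_obj ?A S" by (rule grp_ftrD(1)[OF A S])
    have fh: "?f \<in> group_homs (on_obj ?A S) (on_obj ?A T)" by (rule grp_ftrD(2)[OF A S T f])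
    have "?f (rel J (eval_at S D) a y) = ?f (?s i S y) \<otimes>\<^bsub>on_obj ?A T\<^esub>
        inv\<^bsub>on_obj ?A T\<^esub> ?f (?s j S (on_mor D i j g S y))"
      unfolding r[OF S y] group_homsD(4)[OF fh si AS.inv_closed[OF sj]]
        group_homs_inv[OF fh grp_ftrD(1)[OF A S] grp_ftrD(1)[OF A T] sj] ..
    also have "\<dots> = rel J (eval_at T D) a (on_mor (on_obj D i) S T f y)"
      unfolding r[OF T grp_ftr_closed[OF DD(1)[OF ijg(2)] S T f y]] nat_transD(2)[OF s[OF ijg(2)] S T f y]
        nat_transD(2)[OF DD(3)[OF ijg(2-4)] S T f y] nat_transD(2)[OF s[OF ijg(3)] S T f gy[OF S y]] ..
    finally show "rel J (eval_at T D) a (on_mor (on_obj D (fst a)) S T f y) = ?f (rel J (eval_at S D) a y)"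
      by (simp add: ijg)
  qed
qed

lemma arrow_dom_ftr: "ftr_diagram J D \<Longrightarrow> a \<in> arrows J \<Longrightarrow> grp_ftr (on_obj D (fst a))"
  by (auto simp: arrows_def dest: ftr_diagramD(1))

lemma nt_rels_nat_trans:
  assumes D: "ftr_diagram J D"
  shows "nt_rels J D \<in> nat_trans R (direct_sum (arrows J) (\<lambda>a. on_obj D (fst a))) (direct_sum (objs J) (on_obj D))"
  unfolding nt_rels_def
  by (rule nt_copair_nat_trans[OF arrow_dom_ftr[OF D] grp_ftr_direct_sum[OF ftr_diagramD(1)[OF D]] rel_natural[OF D]])

lemma nt_rels_apply:
  assumes D: "ftr_diagram J D" and S: "S \<in> Mods"
    and x: "x \<in> el (direct_sum (arrows J) (\<lambda>a. on_obj D (fst a))) S"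
  shows "nt_rels J D S x = copair (arrows J) (sum_group (objs J) (on_obj (eval_at S D))) (rel J (eval_at S D)) x"
proof -
  note dia = eval_diagram[OF D S]
  have xa: "x a \<in> el (on_obj D (fst a)) S" if "a \<in> arrows J" for a
    using x that el_direct_sum[of "arrows J" "\<lambda>a. on_obj D (fst a)", OF arrow_dom_ftr[OF D] S] by auto
  have "nt_rels J D S x = copair (arrows J) (sum_group (objs J) (on_obj (eval_at S D)))
      (\<lambda>a. mk_nt (on_obj D (fst a)) (\<lambda>S. rel J (eval_at S D) a) S) x"
    using x S unfolding nt_rels_def by (simp add: nt_copair_apply direct_sum_simps eval_at_def)
  also have "\<dots> = copair (arrows J) (sum_group (objs J) (on_obj (eval_at S D))) (rel J (eval_at S D)) x"
  proof (rule copair_cong[where G = "\<lambda>a. on_obj (eval_at S D) (fst a)", OF arrow_dom[OF dia] comm_group_objsum[OF dia]])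
    fix a assume a: "a \<in> arrows J"
    show "rel J (eval_at S D) a (x a) \<in> carrier (sum_group (objs J) (on_obj (eval_at S D)))"
      by (rule hom_in_carrier[OF rel_hom[OF dia a]]) (use xa[OF a] in simp)
    show "mk_nt (on_obj D (fst a)) (\<lambda>S. rel J (eval_at S D) a) S (x a) = rel J (eval_at S D) a (x a)"
      using xa[OF a] S by simp
  qed
  finally show ?thesis .
qed

lemma el_objsum: "el (direct_sum (objs J) (on_obj D)) S = carrier (sum_group (objs J) (on_obj (eval_at S D)))"
  "on_obj (direct_sum (objs J) (on_obj D)) S = sum_group (objs J) (on_obj (eval_at S D))"
  "el (direct_sum (arrows J) (\<lambda>a. on_obj D (fst a))) S = carrier (sum_group (arrows J) (\<lambda>a. on_obj (eval_at S D) (fst a)))"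
  by (simp_all add: direct_sum_simps eval_at_def)

lemma colimit_ftr_exact:
  assumes D: "ftr_diagram J D" and L: "grp_ftr L" and colim: "colimit_ftr J D L \<iota>"
  defines "q \<equiv> nt_copair (objs J) (on_obj D) L \<iota>"
  shows "q \<in> nat_trans R (direct_sum (objs J) (on_obj D)) L"
    and "\<And>S. S \<in> Mods \<Longrightarrow> q S ` el (direct_sum (objs J) (on_obj D)) S = el L S"
    and "\<And>S. S \<in> Mods \<Longrightarrow> kernel (on_obj (direct_sum (objs J) (on_obj D)) S) (on_obj L S) (q S) =
      nt_rels J D S ` el (direct_sum (arrows J) (\<lambda>a. on_obj D (fst a))) S"
proof -
  have \<iota>: "\<And>j. j \<in> objs J \<Longrightarrow> \<iota> j \<in> nat_trans R (on_obj D j) L"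
    and cg: "\<And>S. S \<in> Mods \<Longrightarrow> colimit_group J (eval_at S D) (on_obj L S) (\<lambda>j. \<iota> j S)"
    using colim by (auto simp: colimit_ftr_def)
  show "q \<in> nat_trans R (direct_sum (objs J) (on_obj D)) L"
    unfolding q_def by (rule nt_copair_nat_trans[OF ftr_diagramD(1)[OF D] L \<iota>])
  fix S assume S: "S \<in> Mods"
  have qS: "q S x = copair (objs J) (on_obj L S) (\<lambda>j. \<iota> j S) x" if "x \<in> el (direct_sum (objs J) (on_obj D)) S" for x
    unfolding q_def by (rule nt_copair_apply[OF S that])
  show "q S ` el (direct_sum (objs J) (on_obj D)) S = el L S"
    using cg[OF S] qS by (simp add: colimit_group_def el_objsum)
  show "kernel (on_obj (direct_sum (objs J) (on_obj D)) S) (on_obj L S) (q S) =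
      nt_rels J D S ` el (direct_sum (arrows J) (\<lambda>a. on_obj D (fst a))) S"
  proof -
    have im: "nt_rels J D S ` el (direct_sum (arrows J) (\<lambda>a. on_obj D (fst a))) S =
      copair (arrows J) (sum_group (objs J) (on_obj (eval_at S D))) (rel J (eval_at S D)) `
        carrier (sum_group (arrows J) (\<lambda>a. on_obj (eval_at S D) (fst a)))"
      using nt_rels_apply[OF D S] by (simp add: el_objsum)
    have sub: "nt_rels J D S ` el (direct_sum (arrows J) (\<lambda>a. on_obj D (fst a))) S \<subseteq> el (direct_sum (objs J) (on_obj D)) S"
      using nat_transD(4)[OF nt_rels_nat_trans[OF D] S] by blast
    have "x \<in> kernel (on_obj (direct_sum (objs J) (on_obj D)) S) (on_obj L S) (q S) \<longleftrightarrow>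
      x \<in> nt_rels J D S ` el (direct_sum (arrows J) (\<lambda>a. on_obj D (fst a))) S"
      if "x \<in> el (direct_sum (objs J) (on_obj D)) S" for x
      using cg[OF S] qS[OF that] that unfolding im by (simp add: kernel_def colimit_group_def el_objsum)
    then show ?thesis using sub by (auto simp: kernel_def)
  qed
qed

lemma colimit_ftr_ex:
  assumes J: "small_category (J :: ('u, 'u) cat)" and D: "ftr_diagram J D"
  shows "\<exists>L \<iota>. L \<in> objs (RR_Mod R :: ('r, 'u) ftr_cat) \<and> colimit_ftr J D L \<iota>"
proof -
  note DD = ftr_diagramD[OF D]
  let ?A = "direct_sum (objs J) (on_obj D)" and ?B = "direct_sum (arrows J) (\<lambda>a. on_obj D (fst a))"
  have A: "grp_ftr ?A" by (rule grp_ftr_direct_sum[OF DD(1)])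
  have B: "grp_ftr ?B" by (rule grp_ftr_direct_sum[OF arrow_dom_ftr[OF D]])
  have "small_valued ?A" using J by (intro small_valued_direct_sum DD) (simp_all add: small_category_def)
  from cokernel_ftr_ex[OF B A this nt_rels_nat_trans[OF D]] obtain L q where
    Lq: "L \<in> objs (RR_Mod R :: ('r, 'u) ftr_cat) \<and> q \<in> nat_trans R ?A L \<and>
      (\<forall>S\<in>Mods. q S ` el ?A S = el L S \<and> kernel (on_obj ?A S) (on_obj L S) (q S) = nt_rels J D S ` el ?B S)"
    by (elim exE)
  then have L: "L \<in> objs (RR_Mod R :: ('r, 'u) ftr_cat)" and q: "q \<in> nat_trans R ?A L"
    and ex: "\<And>S. S \<in> Mods \<Longrightarrow> q S ` el ?A S = el L S"
      "\<And>S. S \<in> Mods \<Longrightarrow> kernel (on_obj ?A S) (on_obj L S) (q S) = nt_rels J D S ` el ?B S" by simp_all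
  have gL: "grp_ftr L" using L by (simp add: RR_Mod_iff)
  define \<iota> where "\<iota> j = mk_nt (on_obj D j) (\<lambda>S x. q S (nt_single (objs J) (on_obj D) j S x))" for j
  have \<iota>: "\<iota> j \<in> nat_trans R (on_obj D j) L" if "j \<in> objs J" for j
    unfolding \<iota>_def by (rule nt_compose[OF DD(1)[OF that] nt_single_nat_trans[OF DD(1) that] q])
  have "colimit_group J (eval_at S D) (on_obj L S) (\<lambda>j. \<iota> j S)" if S: "S \<in> Mods" for S
  proof -
    note dia = eval_diagram[OF D S]
    have qS: "copair (objs J) (on_obj L S) (\<lambda>j. \<iota> j S) x = q S x" if x: "x \<in> el ?A S" for x
    proof -
      have "q S x = copair (objs J) (on_obj L S) (\<lambda>j y. q S (single (objs J) (on_obj (eval_at S D)) j y)) x"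
        by (rule copair_expand[where G = "on_obj (eval_at S D)", OF diagramD(1)[OF dia] grp_ftrD(1)[OF gL S]])
           (use x group_homsD(1)[OF nat_transD(1)[OF q S]] in \<open>simp_all add: el_objsum\<close>)
      also have "\<dots> = copair (objs J) (on_obj L S) (\<lambda>j. \<iota> j S) x"
      proof (rule copair_cong[where G = "on_obj (eval_at S D)", OF diagramD(1)[OF dia] grp_ftrD(1)[OF gL S]])
        fix j assume j: "j \<in> objs J"
        have xj: "x j \<in> el (on_obj D j) S" using x j el_direct_sum[of "objs J" "on_obj D", OF DD(1) S] by auto
        show "\<iota> j S (x j) \<in> el L S" by (rule nat_transD(4)[OF \<iota>[OF j] S xj])
        show "q S (single (objs J) (on_obj (eval_at S D)) j (x j)) = \<iota> j S (x j)"
          using S xj by (simp add: \<iota>_def nt_single_apply eval_at_def)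
      qed
      finally show ?thesis ..
    qed
    have "x \<in> kernel (on_obj ?A S) (on_obj L S) (q S) \<longleftrightarrow> q S x = \<one>\<^bsub>on_obj L S\<^esub>" if "x \<in> el ?A S" for x
      using that by (simp add: kernel_def)
    moreover have "nt_rels J D S ` el ?B S =
      copair (arrows J) (sum_group (objs J) (on_obj (eval_at S D))) (rel J (eval_at S D)) `
        carrier (sum_group (arrows J) (\<lambda>a. on_obj (eval_at S D) (fst a)))"
      using nt_rels_apply[OF D S] by (simp add: el_objsum)
    moreover have "copair (objs J) (on_obj L S) (\<lambda>j. \<iota> j S) ` el ?A S = el L S"
      using qS ex(1)[OF S] by simp
    ultimately show ?thesis
      using nat_transD(1)[OF \<iota> S] qS ex(2)[OF S] by (simp add: colimit_group_def el_objsum)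
  qed
  then have "colimit_ftr J D L \<iota>" using \<iota> by (simp add: colimit_ftr_def)
  with L show ?thesis by blast
qed

end

section \<open>Accessible functors\<close>

context small_ring
begin

text \<open>The map from \<open>F T\<close> to \<open>F T'\<close> for submodules \<open>T \<subseteq> T'\<close> of \<open>S\<close>.  For \<open>T' = carrier S\<close> its target
  is \<open>F S\<close> itself, because replacing the carrier of \<open>S\<close> by itself does not change \<open>S\<close>.\<close>

definition res :: "('r, 'u, 'g) group_ftr \<Rightarrow> ('r, 'u) module \<Rightarrow> 'u set \<Rightarrow> 'u set \<Rightarrow> 'g \<Rightarrow> 'g" where
  "res F S T T' = on_mor F (S\<lparr>carrier := T\<rparr>) (S\<lparr>carrier := T'\<rparr>) (incl T)"

text \<open>Bounds on sizes are given by small sets \<open>\<Lambda>\<close>, which are chosen before \<open>S\<close>.\<close>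

definition generated :: "('r, 'u, 'g) group_ftr \<Rightarrow> bool" where
  "generated F \<longleftrightarrow> (\<exists>\<Lambda> :: 'u set. small TYPE('u) \<Lambda> \<and> (\<forall>S\<in>Mods. \<forall>x\<in>el F S.
     \<exists>T. submod S T \<and> |T| \<le>o |\<Lambda>| \<and> (\<exists>y\<in>el F (S\<lparr>carrier := T\<rparr>). res F S T (carrier S) y = x)))"

text \<open>For elements over submodules of size at most \<open>M\<close> the bound \<open>\<Lambda>\<close> on the size of the larger
  submodule may depend on \<open>M\<close>.\<close>

definition related :: "('r, 'u, 'g) group_ftr \<Rightarrow> bool" where
  "related F \<longleftrightarrow> (\<forall>M :: 'u set. small TYPE('u) M \<longrightarrow> (\<exists>\<Lambda> :: 'u set. small TYPE('u) \<Lambda> \<and>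
     (\<forall>S\<in>Mods. \<forall>T. submod S T \<and> |T| \<le>o |M| \<longrightarrow>
        (\<forall>y\<in>el F (S\<lparr>carrier := T\<rparr>). res F S T (carrier S) y = \<one>\<^bsub>on_obj F S\<^esub> \<longrightarrow>
           (\<exists>T'. submod S T' \<and> T \<subseteq> T' \<and> |T'| \<le>o |\<Lambda>| \<and> res F S T T' y = \<one>\<^bsub>on_obj F (S\<lparr>carrier := T'\<rparr>)\<^esub>)))))"

text \<open>Roughly, \<open>F S\<close> is the directed colimit of the groups \<open>F T\<close> over the submodules \<open>T\<close> of \<open>S\<close> of
  bounded size, with bounds that are uniform in \<open>S\<close>.\<close>

definition accessible :: "('r, 'u, 'g) group_ftr \<Rightarrow> bool" where
  "accessible F \<longleftrightarrow> generated F \<and> related F"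

lemma generated_ex:
  assumes "generated F"
  shows "\<exists>\<Lambda> :: 'u set. small TYPE('u) \<Lambda> \<and> (\<forall>S x. S \<in> Mods \<longrightarrow> x \<in> el F S \<longrightarrow>
     (\<exists>T y. submod S T \<and> |T| \<le>o |\<Lambda>| \<and> y \<in> el F (S\<lparr>carrier := T\<rparr>) \<and> res F S T (carrier S) y = x))"
  using assms unfolding generated_def Bex_def Ball_def by simp

lemma related_ex:
  fixes M :: "'u set"
  assumes "related F" "small TYPE('u) M"
  shows "\<exists>\<Lambda> :: 'u set. small TYPE('u) \<Lambda> \<and> (\<forall>S T y. S \<in> Mods \<longrightarrow> submod S T \<longrightarrow> |T| \<le>o |M| \<longrightarrow>
     y \<in> el F (S\<lparr>carrier := T\<rparr>) \<longrightarrow> res F S T (carrier S) y = \<one>\<^bsub>on_obj F S\<^esub> \<longrightarrow>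
     (\<exists>T'. submod S T' \<and> T \<subseteq> T' \<and> |T'| \<le>o |\<Lambda>| \<and> res F S T T' y = \<one>\<^bsub>on_obj F (S\<lparr>carrier := T'\<rparr>)\<^esub>))"
  using assms unfolding related_def Ball_def by (simp add: imp_conjL)

lemma join_ex:
  fixes J :: "'j set" and \<Lambda> :: "'j \<Rightarrow> 'u set"
  assumes "small TYPE('u) J" "\<forall>j\<in>J. small TYPE('u) (\<Lambda> j)"
  shows "\<exists>K :: 'u set. small TYPE('u) K \<and> (\<forall>S T. S \<in> Mods \<longrightarrow> (\<forall>j. j \<in> J \<longrightarrow> submod S (T j)) \<longrightarrow>
    (\<forall>j. j \<in> J \<longrightarrow> |T j| \<le>o |\<Lambda> j| ) \<longrightarrow> (\<exists>T'. submod S T' \<and> (\<forall>j\<in>J. T j \<subseteq> T') \<and> |T'| \<le>o |K| ))"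
proof -
  have "\<exists>K :: 'u set. small TYPE('u) K \<and> (\<forall>S\<in>Mods. \<forall>T. (\<forall>j\<in>J. T j \<subseteq> carrier S \<and> |T j| \<le>o |\<Lambda> j| ) \<longrightarrow>
       (\<exists>T'. submod S T' \<and> (\<forall>j\<in>J. T j \<subseteq> T') \<and> |T'| \<le>o |K| ))"
    by (rule join_bound) (use assms in auto)
  then obtain K :: "'u set" where
    K: "small TYPE('u) K" and a: "\<forall>S\<in>Mods. \<forall>T. (\<forall>j\<in>J. T j \<subseteq> carrier S \<and> |T j| \<le>o |\<Lambda> j| ) \<longrightarrow>
       (\<exists>T'. submod S T' \<and> (\<forall>j\<in>J. T j \<subseteq> T') \<and> |T'| \<le>o |K| )" by (elim exE conjE)
  have claim: "\<exists>T'. submod S T' \<and> (\<forall>j\<in>J. T j \<subseteq> T') \<and> |T'| \<le>o |K|"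
    if S: "S \<in> Mods" and T: "\<forall>j. j \<in> J \<longrightarrow> submod S (T j)" "\<forall>j. j \<in> J \<longrightarrow> |T j| \<le>o |\<Lambda> j|" for S T
  proof -
    have "\<forall>j\<in>J. T j \<subseteq> carrier S \<and> |T j| \<le>o |\<Lambda> j|" using T by (auto simp: submod_def)
    from mp[OF spec[OF bspec[OF a S], of T] this] show ?thesis .
  qed
  show ?thesis by (rule exI[of _ K], intro conjI allI impI, rule K, rule claim, assumption+)
qed

lemma join2:
  fixes A B :: "'u set"
  assumes "small TYPE('u) A" "small TYPE('u) B"
  shows "\<exists>K :: 'u set. small TYPE('u) K \<and> (\<forall>S T1 T2. S \<in> Mods \<longrightarrow> submod S T1 \<longrightarrow> |T1| \<le>o |A| \<longrightarrow>
    submod S T2 \<longrightarrow> |T2| \<le>o |B| \<longrightarrow> (\<exists>T'. submod S T' \<and> T1 \<subseteq> T' \<and> T2 \<subseteq> T' \<and> |T'| \<le>o |K| ))"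
proof -
  have "\<exists>K :: 'u set. small TYPE('u) K \<and> (\<forall>S T. S \<in> Mods \<longrightarrow> (\<forall>j :: bool. j \<in> UNIV \<longrightarrow> submod S (T j)) \<longrightarrow>
    (\<forall>j. j \<in> UNIV \<longrightarrow> |T j| \<le>o |if j then A else B| ) \<longrightarrow> (\<exists>T'. submod S T' \<and> (\<forall>j\<in>UNIV. T j \<subseteq> T') \<and> |T'| \<le>o |K| ))"
    by (rule join_ex) (use assms in \<open>auto simp: small_finite\<close>)
  then obtain K :: "'u set" where K: "small TYPE('u) K"
    and a: "\<forall>S T. S \<in> Mods \<longrightarrow> (\<forall>j :: bool. j \<in> UNIV \<longrightarrow> submod S (T j)) \<longrightarrow>
    (\<forall>j. j \<in> UNIV \<longrightarrow> |T j| \<le>o |if j then A else B| ) \<longrightarrow> (\<exists>T'. submod S T' \<and> (\<forall>j\<in>UNIV. T j \<subseteq> T') \<and> |T'| \<le>o |K| )"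
    by (elim exE conjE)
  have claim: "\<exists>T'. submod S T' \<and> T1 \<subseteq> T' \<and> T2 \<subseteq> T' \<and> |T'| \<le>o |K|"
    if S: "S \<in> Mods" and T: "submod S T1" "|T1| \<le>o |A|" "submod S T2" "|T2| \<le>o |B|" for S T1 T2
  proof -
    let ?T = "\<lambda>j. if j then T1 else T2"
    have 1: "\<forall>j. j \<in> UNIV \<longrightarrow> submod S (?T j)" "\<forall>j. j \<in> UNIV \<longrightarrow> |?T j| \<le>o |if j then A else B|"
      using T by auto
    from a[THEN spec, THEN spec, of S ?T, THEN mp, OF S, THEN mp, OF 1(1), THEN mp, OF 1(2)] obtain T' where
      T': "submod S T'" "\<forall>j\<in>UNIV. ?T j \<subseteq> T'" "|T'| \<le>o |K|" by (elim exE conjE)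
    have "T1 \<subseteq> T'" "T2 \<subseteq> T'" using bspec[OF T'(2), of True] bspec[OF T'(2), of False] by simp_all
    with T' show ?thesis by (intro exI[of _ T'] conjI)
  qed
  show ?thesis by (rule exI[of _ K], intro conjI allI impI, rule K, rule claim, assumption+)
qed

context
  fixes S :: "('r, 'u) module"
  assumes S: "S \<in> Mods"
begin

lemma sub_Mods: "submod S T \<Longrightarrow> S\<lparr>carrier := T\<rparr> \<in> Mods" by (rule submod_Mods[OF S])

lemma sub_le: "submod S T \<Longrightarrow> T \<subseteq> carrier S" by (simp add: submod_def)

lemma res_group_homs:
  "grp_ftr F \<Longrightarrow> submod S T \<Longrightarrow> submod S T' \<Longrightarrow> T \<subseteq> T' \<Longrightarrow>
    res F S T T' \<in> group_homs (on_obj F (S\<lparr>carrier := T\<rparr>)) (on_obj F (S\<lparr>carrier := T'\<rparr>))"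
  unfolding res_def by (rule grp_ftrD(2)) (auto intro: sub_Mods incl_hom[OF S])

lemma res_closed:
  "grp_ftr F \<Longrightarrow> submod S T \<Longrightarrow> submod S T' \<Longrightarrow> T \<subseteq> T' \<Longrightarrow> x \<in> el F (S\<lparr>carrier := T\<rparr>) \<Longrightarrow>
    res F S T T' x \<in> el F (S\<lparr>carrier := T'\<rparr>)"
  by (rule group_homsD(3)[OF res_group_homs])

lemma res_group_homs_top:
  "grp_ftr F \<Longrightarrow> submod S T \<Longrightarrow> res F S T (carrier S) \<in> group_homs (on_obj F (S\<lparr>carrier := T\<rparr>)) (on_obj F S)"
  using res_group_homs[OF _ _ submod_self[OF S] sub_le] by simp

lemma res_trans:
  assumes F: "grp_ftr F" and T: "submod S T" "submod S T'" "submod S T''" "T \<subseteq> T'" "T' \<subseteq> T''"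
    and x: "x \<in> el F (S\<lparr>carrier := T\<rparr>)"
  shows "res F S T' T'' (res F S T T' x) = res F S T T'' x"
proof -
  have "compose (carrier (S\<lparr>carrier := T\<rparr>)) (incl T') (incl T) = incl T"
    using T(4) by (auto simp: fun_eq_iff compose_def incl_def)
  then show ?thesis unfolding res_def
    using grp_ftrD(4)[OF F sub_Mods[OF T(1)] sub_Mods[OF T(2)] sub_Mods[OF T(3)]
        incl_hom[OF S T(1,4)] incl_hom[OF S T(2,5)] x] by simp
qed

lemma res_trans_top:
  assumes F: "grp_ftr F" and T: "submod S T" "submod S T'" "T \<subseteq> T'" and x: "x \<in> el F (S\<lparr>carrier := T\<rparr>)"
  shows "res F S T' (carrier S) (res F S T T' x) = res F S T (carrier S) x"
  by (rule res_trans[OF F T(1,2) submod_self[OF S] T(3) sub_le[OF T(2)] x])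

lemma res_natural:
  assumes \<alpha>: "\<alpha> \<in> nat_trans R F G" and T: "submod S T" "submod S T'" "T \<subseteq> T'" and x: "x \<in> el F (S\<lparr>carrier := T\<rparr>)"
  shows "\<alpha> (S\<lparr>carrier := T'\<rparr>) (res F S T T' x) = res G S T T' (\<alpha> (S\<lparr>carrier := T\<rparr>) x)"
  unfolding res_def by (rule nat_transD(2)[OF \<alpha> sub_Mods[OF T(1)] sub_Mods[OF T(2)] incl_hom[OF S T(1,3)] x])

lemma res_natural_top:
  assumes \<alpha>: "\<alpha> \<in> nat_trans R F G" and T: "submod S T" and x: "x \<in> el F (S\<lparr>carrier := T\<rparr>)"
  shows "\<alpha> S (res F S T (carrier S) x) = res G S T (carrier S) (\<alpha> (S\<lparr>carrier := T\<rparr>) x)"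
  using res_natural[OF \<alpha> T submod_self[OF S] sub_le[OF T] x] by simp

lemma res_one:
  assumes F: "grp_ftr F" and T: "submod S T" "submod S T'" "T \<subseteq> T'"
  shows "res F S T T' \<one>\<^bsub>on_obj F (S\<lparr>carrier := T\<rparr>)\<^esub> = \<one>\<^bsub>on_obj F (S\<lparr>carrier := T'\<rparr>)\<^esub>"
  by (rule group_homs_one[OF res_group_homs[OF F T] grp_ftrD(1)[OF F sub_Mods] grp_ftrD(1)[OF F sub_Mods]]) (rule T)+

end

text \<open>The condition is applied to the difference of the two elements.\<close>

lemma related_eq:
  fixes M :: "'u set"
  assumes F: "grp_ftr F" and rel: "related F" and M: "small TYPE('u) M"
  shows "\<exists>\<Lambda> :: 'u set. small TYPE('u) \<Lambda> \<and> (\<forall>S T y z. S \<in> Mods \<longrightarrow> submod S T \<longrightarrow> |T| \<le>o |M| \<longrightarrow>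
     y \<in> el F (S\<lparr>carrier := T\<rparr>) \<longrightarrow> z \<in> el F (S\<lparr>carrier := T\<rparr>) \<longrightarrow> res F S T (carrier S) y = res F S T (carrier S) z \<longrightarrow>
     (\<exists>T'. submod S T' \<and> T \<subseteq> T' \<and> |T'| \<le>o |\<Lambda>| \<and> res F S T T' y = res F S T T' z))"
proof -
  obtain \<Lambda> :: "'u set" where s: "small TYPE('u) \<Lambda>" and a: "\<forall>S T y. S \<in> Mods \<longrightarrow> submod S T \<longrightarrow> |T| \<le>o |M| \<longrightarrow>
     y \<in> el F (S\<lparr>carrier := T\<rparr>) \<longrightarrow> res F S T (carrier S) y = \<one>\<^bsub>on_obj F S\<^esub> \<longrightarrow>
     (\<exists>T'. submod S T' \<and> T \<subseteq> T' \<and> |T'| \<le>o |\<Lambda>| \<and> res F S T T' y = \<one>\<^bsub>on_obj F (S\<lparr>carrier := T'\<rparr>)\<^esub>)"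
    using related_ex[OF rel M] by (elim exE conjE)
  show ?thesis
  proof (rule exI[of _ \<Lambda>], intro conjI s allI impI)
    fix S T y z assume S: "S \<in> Mods" and T: "submod S T" "|T| \<le>o |M|"
      and y: "y \<in> el F (S\<lparr>carrier := T\<rparr>)" and z: "z \<in> el F (S\<lparr>carrier := T\<rparr>)"
      and e: "res F S T (carrier S) y = res F S T (carrier S) z"
    let ?G = "on_obj F (S\<lparr>carrier := T\<rparr>)"
    interpret G: comm_group ?G by (rule grp_ftrD(1)[OF F sub_Mods[OF S T(1)]])
    note c = grp_ftrD(1)[OF F sub_Mods[OF S T(1)]] grp_ftrD(1)[OF F S]
    have d: "y \<otimes>\<^bsub>?G\<^esub> inv\<^bsub>?G\<^esub> z \<in> carrier ?G" using y z by simp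
    have mi: "\<phi> (y \<otimes>\<^bsub>?G\<^esub> inv\<^bsub>?G\<^esub> z) = \<one>\<^bsub>H\<^esub> \<longleftrightarrow> \<phi> y = \<phi> z" if \<phi>: "\<phi> \<in> group_homs ?G H" and H: "comm_group H" for \<phi> H
      using comm_group_eq_iff[OF H group_homsD(3)[OF \<phi> y] group_homsD(3)[OF \<phi> z]]
      by (simp add: group_homsD(4)[OF \<phi> y G.inv_closed[OF z]] group_homs_inv[OF \<phi> c(1) H z])
    have "res F S T (carrier S) (y \<otimes>\<^bsub>?G\<^esub> inv\<^bsub>?G\<^esub> z) = \<one>\<^bsub>on_obj F S\<^esub>"
      using mi[OF res_group_homs_top[OF S F T(1)] c(2)] e by simp
    from a[rule_format, OF S T d this] obtain T' where
      T': "submod S T'" "T \<subseteq> T'" "|T'| \<le>o |\<Lambda>|" "res F S T T' (y \<otimes>\<^bsub>?G\<^esub> inv\<^bsub>?G\<^esub> z) = \<one>\<^bsub>on_obj F (S\<lparr>carrier := T'\<rparr>)\<^esub>"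
      by (elim exE conjE)
    have "res F S T T' y = res F S T T' z"
      using mi[OF res_group_homs[OF S F T(1) T'(1,2)] grp_ftrD(1)[OF F sub_Mods[OF S T'(1)]]] T'(4) by simp
    with T' show "\<exists>T'. submod S T' \<and> T \<subseteq> T' \<and> |T'| \<le>o |\<Lambda>| \<and> res F S T T' y = res F S T T' z"
      by (intro exI[of _ T'] conjI)
  qed
qed

subsection \<open>Closure properties\<close>

text \<open>The images \<open>k j y\<close> vanish over submodules of bounded sizes, hence all of them over one
  submodule \<open>V\<close> of bounded size, and over \<open>V\<close> the element \<open>y\<close> itself vanishes by joint injectivity.\<close>

lemma related_jointly_mono:
  assumes K: "grp_ftr K" and F: "\<And>j. j \<in> J \<Longrightarrow> grp_ftr (F j)" and J: "small TYPE('u) J"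
    and k: "\<And>j. j \<in> J \<Longrightarrow> k j \<in> nat_trans R K (F j)"
    and inj: "\<And>S x. S \<in> Mods \<Longrightarrow> x \<in> el K S \<Longrightarrow> (\<And>j. j \<in> J \<Longrightarrow> k j S x = \<one>\<^bsub>on_obj (F j) S\<^esub>) \<Longrightarrow> x = \<one>\<^bsub>on_obj K S\<^esub>"
    and rel: "\<And>j. j \<in> J \<Longrightarrow> related (F j)"
  shows "related K"
  unfolding related_def
proof (intro allI impI)
  fix M :: "'u set" assume M: "small TYPE('u) M"
  define P where "P j \<Lambda> \<longleftrightarrow> small TYPE('u) \<Lambda> \<and> (\<forall>S T y. S \<in> Mods \<longrightarrow> submod S T \<longrightarrow> |T| \<le>o |M| \<longrightarrow>
     y \<in> el (F j) (S\<lparr>carrier := T\<rparr>) \<longrightarrow> res (F j) S T (carrier S) y = \<one>\<^bsub>on_obj (F j) S\<^esub> \<longrightarrow>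
     (\<exists>T'. submod S T' \<and> T \<subseteq> T' \<and> |T'| \<le>o |\<Lambda>| \<and> res (F j) S T T' y = \<one>\<^bsub>on_obj (F j) (S\<lparr>carrier := T'\<rparr>)\<^esub>))"
    for j and \<Lambda> :: "'u set"
  have "\<exists>\<Lambda>. P j \<Lambda>" if "j \<in> J" for j
    using related_ex[OF rel[OF that] M] unfolding P_def .
  then obtain \<Lambda> where \<Lambda>: "\<And>j. j \<in> J \<Longrightarrow> P j (\<Lambda> j)" by metis
  then have s\<Lambda>: "\<forall>j\<in>J. small TYPE('u) (\<Lambda> j)" by (simp add: P_def)
  obtain N :: "'u set" where N: "small TYPE('u) N" "\<forall>S T. S \<in> Mods \<longrightarrow> (\<forall>j. j \<in> J \<longrightarrow> submod S (T j)) \<longrightarrow>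
    (\<forall>j. j \<in> J \<longrightarrow> |T j| \<le>o |\<Lambda> j| ) \<longrightarrow> (\<exists>T'. submod S T' \<and> (\<forall>j\<in>J. T j \<subseteq> T') \<and> |T'| \<le>o |N| )"
      using join_ex[OF J s\<Lambda>] by (elim exE conjE)
  obtain N' :: "'u set" where N': "small TYPE('u) N'" "\<forall>S T1 T2. S \<in> Mods \<longrightarrow> submod S T1 \<longrightarrow> |T1| \<le>o |M| \<longrightarrow>
    submod S T2 \<longrightarrow> |T2| \<le>o |N| \<longrightarrow> (\<exists>T'. submod S T' \<and> T1 \<subseteq> T' \<and> T2 \<subseteq> T' \<and> |T'| \<le>o |N'| )"
      using join2[OF M N(1)] by (elim exE conjE)
  have "\<exists>T'. submod S T' \<and> T \<subseteq> T' \<and> |T'| \<le>o |N'| \<and> res K S T T' y = \<one>\<^bsub>on_obj K (S\<lparr>carrier := T'\<rparr>)\<^esub>"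
    if S: "S \<in> Mods" and T: "submod S T" "|T| \<le>o |M|" and y: "y \<in> el K (S\<lparr>carrier := T\<rparr>)"
      and z: "res K S T (carrier S) y = \<one>\<^bsub>on_obj K S\<^esub>" for S T y
  proof -
    have ky: "k j (S\<lparr>carrier := T\<rparr>) y \<in> el (F j) (S\<lparr>carrier := T\<rparr>)" if "j \<in> J" for j
      by (rule nat_transD(4)[OF k[OF that] sub_Mods[OF S T(1)] y])
    have "\<exists>T'. submod S T' \<and> T \<subseteq> T' \<and> |T'| \<le>o |\<Lambda> j| \<and>
        res (F j) S T T' (k j (S\<lparr>carrier := T\<rparr>) y) = \<one>\<^bsub>on_obj (F j) (S\<lparr>carrier := T'\<rparr>)\<^esub>" if j: "j \<in> J" for j
    proof -
      have "res (F j) S T (carrier S) (k j (S\<lparr>carrier := T\<rparr>) y) = \<one>\<^bsub>on_obj (F j) S\<^esub>"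
        using res_natural_top[OF S k[OF j] T(1) y] z nat_trans_one[OF k[OF j] K F[OF j] S] by simp
      then show ?thesis using \<Lambda>[OF j] S T ky[OF j] unfolding P_def by simp
    qed
    then obtain T' where T': "\<And>j. j \<in> J \<Longrightarrow> submod S (T' j)" "\<And>j. j \<in> J \<Longrightarrow> T \<subseteq> T' j" "\<And>j. j \<in> J \<Longrightarrow> |T' j| \<le>o |\<Lambda> j|"
      "\<And>j. j \<in> J \<Longrightarrow> res (F j) S T (T' j) (k j (S\<lparr>carrier := T\<rparr>) y) = \<one>\<^bsub>on_obj (F j) (S\<lparr>carrier := T' j\<rparr>)\<^esub>"
      by metis
    have "\<exists>U. submod S U \<and> (\<forall>j\<in>J. T' j \<subseteq> U) \<and> |U| \<le>o |N|"
      by (rule N(2)[rule_format, OF S T'(1,3)])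
    then obtain U where U: "submod S U" "\<forall>j\<in>J. T' j \<subseteq> U" "|U| \<le>o |N|" by (elim exE conjE)
    obtain V where V: "submod S V" "T \<subseteq> V" "U \<subseteq> V" "|V| \<le>o |N'|" using N'(2)[rule_format, OF S T U(1,3)] by (elim exE conjE)
    have "res K S T V y = \<one>\<^bsub>on_obj K (S\<lparr>carrier := V\<rparr>)\<^esub>"
    proof (rule inj[OF sub_Mods[OF S V(1)] res_closed[OF S K T(1) V(1,2) y]])
      fix j assume j: "j \<in> J"
      have TV: "T' j \<subseteq> V" using U(2) j V(3) by blast
      have "k j (S\<lparr>carrier := V\<rparr>) (res K S T V y) = res (F j) S T V (k j (S\<lparr>carrier := T\<rparr>) y)"
        by (rule res_natural[OF S k[OF j] T(1) V(1,2) y])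
      also have "\<dots> = res (F j) S (T' j) V (res (F j) S T (T' j) (k j (S\<lparr>carrier := T\<rparr>) y))"
        by (rule res_trans[OF S F[OF j] T(1) T'(1)[OF j] V(1) T'(2)[OF j] TV ky[OF j], symmetric])
      also have "\<dots> = \<one>\<^bsub>on_obj (F j) (S\<lparr>carrier := V\<rparr>)\<^esub>"
        unfolding T'(4)[OF j] by (rule res_one[OF S F[OF j] T'(1)[OF j] V(1) TV])
      finally show "k j (S\<lparr>carrier := V\<rparr>) (res K S T V y) = \<one>\<^bsub>on_obj (F j) (S\<lparr>carrier := V\<rparr>)\<^esub>" .
    qed
    with V show ?thesis by (intro exI[of _ V] conjI)
  qed
  then show "\<exists>\<Lambda> :: 'u set. small TYPE('u) \<Lambda> \<and> (\<forall>S\<in>Mods. \<forall>T. submod S T \<and> |T| \<le>o |M| \<longrightarrow>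
        (\<forall>y\<in>el K (S\<lparr>carrier := T\<rparr>). res K S T (carrier S) y = \<one>\<^bsub>on_obj K S\<^esub> \<longrightarrow>
           (\<exists>T'. submod S T' \<and> T \<subseteq> T' \<and> |T'| \<le>o |\<Lambda>| \<and> res K S T T' y = \<one>\<^bsub>on_obj K (S\<lparr>carrier := T'\<rparr>)\<^esub>)))"
    by (rule_tac x = N' in exI) (simp add: N'(1))
qed

text \<open>An element \<open>x\<close> of the kernel comes from some \<open>y\<close> in \<open>F T\<close> with \<open>T\<close> of bounded size.  As
  \<open>f y\<close> vanishes over \<open>S\<close>, it vanishes over a larger \<open>T'\<close> of bounded size, and over \<open>T'\<close> the element
  \<open>y\<close> lies in the kernel.\<close>

lemma accessible_kernel:
  assumes K: "grp_ftr K" and F: "grp_ftr F" and G: "grp_ftr G"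
    and f: "f \<in> nat_trans R F G" and k: "k \<in> nat_trans R K F"
    and inj: "\<And>S. S \<in> Mods \<Longrightarrow> inj_on (k S) (el K S)"
    and im: "\<And>S. S \<in> Mods \<Longrightarrow> k S ` el K S = kernel (on_obj F S) (on_obj G S) (f S)"
    and accF: "accessible F" and accG: "related G"
  shows "accessible K"
proof -
  have k1: "x = \<one>\<^bsub>on_obj K S\<^esub>" if "S \<in> Mods" "x \<in> el K S" "k S x = \<one>\<^bsub>on_obj F S\<^esub>" for S x
  proof (rule inj_onD[OF inj[OF that(1)]])
    show "k S x = k S \<one>\<^bsub>on_obj K S\<^esub>" using that nat_trans_one[OF k K F that(1)] by simp
    show "\<one>\<^bsub>on_obj K S\<^esub> \<in> el K S"
      using grp_ftrD(1)[OF K that(1)] by (simp add: comm_group.axioms(2) group.is_monoid)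
  qed (rule that)
  have "related K"
    by (rule related_jointly_mono[of K "{()}" "\<lambda>_. F" "\<lambda>_. k"])
       (use K F k k1 accF in \<open>auto simp: accessible_def small_finite\<close>)
  moreover have "generated K"
  proof -
    obtain \<Lambda>F :: "'u set" where \<Lambda>F: "small TYPE('u) \<Lambda>F" "\<forall>S x. S \<in> Mods \<longrightarrow> x \<in> el F S \<longrightarrow> (\<exists>T y. submod S T \<and> |T| \<le>o |\<Lambda>F| \<and> y \<in> el F (S\<lparr>carrier := T\<rparr>) \<and> res F S T (carrier S) y = x)"
      using generated_ex[OF conjunct1[OF accF[unfolded accessible_def]]] by (elim exE conjE)
    obtain \<Lambda> :: "'u set" where \<Lambda>: "small TYPE('u) \<Lambda>" "\<forall>S T y. S \<in> Mods \<longrightarrow> submod S T \<longrightarrow> |T| \<le>o |\<Lambda>F| \<longrightarrow>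
      y \<in> el G (S\<lparr>carrier := T\<rparr>) \<longrightarrow> res G S T (carrier S) y = \<one>\<^bsub>on_obj G S\<^esub> \<longrightarrow> (\<exists>T'. submod S T' \<and> T \<subseteq> T' \<and> |T'| \<le>o |\<Lambda>| \<and> res G S T T' y = \<one>\<^bsub>on_obj G (S\<lparr>carrier := T'\<rparr>)\<^esub>)"
      using related_ex[OF accG \<Lambda>F(1)] by (elim exE conjE)
    have "\<exists>T. submod S T \<and> |T| \<le>o |\<Lambda>| \<and> (\<exists>y\<in>el K (S\<lparr>carrier := T\<rparr>). res K S T (carrier S) y = x)"
      if S: "S \<in> Mods" and x: "x \<in> el K S" for S x
    proof -
      have kx: "k S x \<in> el F S" "f S (k S x) = \<one>\<^bsub>on_obj G S\<^esub>"
        using im[OF S] x by (auto simp: kernel_def)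
      obtain T y where T: "submod S T" "|T| \<le>o |\<Lambda>F|" and y: "y \<in> el F (S\<lparr>carrier := T\<rparr>)"
        and yx: "res F S T (carrier S) y = k S x" using \<Lambda>F(2)[rule_format, OF S kx(1)] by (elim exE conjE)
      have fy: "f (S\<lparr>carrier := T\<rparr>) y \<in> el G (S\<lparr>carrier := T\<rparr>)" by (rule nat_transD(4)[OF f sub_Mods[OF S T(1)] y])
      have "res G S T (carrier S) (f (S\<lparr>carrier := T\<rparr>) y) = \<one>\<^bsub>on_obj G S\<^esub>"
        using res_natural_top[OF S f T(1) y] yx kx(2) by simp
      from \<Lambda>(2)[rule_format, OF S T fy this] obtain T' where T': "submod S T'" "T \<subseteq> T'" "|T'| \<le>o |\<Lambda>|"
        and z: "res G S T T' (f (S\<lparr>carrier := T\<rparr>) y) = \<one>\<^bsub>on_obj G (S\<lparr>carrier := T'\<rparr>)\<^esub>" by (elim exE conjE)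
      have "res F S T T' y \<in> kernel (on_obj F (S\<lparr>carrier := T'\<rparr>)) (on_obj G (S\<lparr>carrier := T'\<rparr>)) (f (S\<lparr>carrier := T'\<rparr>))"
        using res_natural[OF S f T(1) T'(1,2) y] z res_closed[OF S F T(1) T'(1,2) y] by (simp add: kernel_def)
      from this[folded im[OF sub_Mods[OF S T'(1)]]]
      obtain w where w: "w \<in> el K (S\<lparr>carrier := T'\<rparr>)" "k (S\<lparr>carrier := T'\<rparr>) w = res F S T T' y" by auto
      have "k S (res K S T' (carrier S) w) = res F S T' (carrier S) (res F S T T' y)"
        using res_natural_top[OF S k T'(1) w(1)] w(2) by simp
      also have "\<dots> = k S x" using res_trans_top[OF S F T(1) T'(1,2) y] yx by simp
      finally have "res K S T' (carrier S) w = x"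
        by (rule inj_onD[OF inj[OF S]]) (use x group_homsD(3)[OF res_group_homs_top[OF S K T'(1)] w(1)] in auto)
      with w T' show ?thesis by (intro exI[of _ T'] conjI bexI[of _ w])
    qed
    then show ?thesis unfolding generated_def by (rule_tac x = \<Lambda> in exI) (simp add: \<Lambda>(1))
  qed
  ultimately show ?thesis by (simp add: accessible_def)
qed

text \<open>If the class of \<open>w \<in> G T\<close> vanishes over \<open>S\<close>, then \<open>w = \<alpha> z\<close> over \<open>S\<close> for some \<open>z\<close>, which
  comes from a submodule of bounded size.  The equation \<open>w = \<alpha> z\<close> then holds already over some
  submodule of bounded size.\<close>

lemma accessible_cokernel:
  assumes F: "grp_ftr F" and G: "grp_ftr G" and Q: "grp_ftr Q"
    and \<alpha>: "\<alpha> \<in> nat_trans R F G" and q: "q \<in> nat_trans R G Q"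
    and surj: "\<And>S. S \<in> Mods \<Longrightarrow> q S ` el G S = el Q S"
    and ker: "\<And>S. S \<in> Mods \<Longrightarrow> kernel (on_obj G S) (on_obj Q S) (q S) = \<alpha> S ` el F S"
    and accF: "generated F" and accG: "accessible G"
  shows "accessible Q"
proof -
  obtain \<Lambda>G :: "'u set" where \<Lambda>G: "small TYPE('u) \<Lambda>G" "\<forall>S x. S \<in> Mods \<longrightarrow> x \<in> el G S \<longrightarrow> (\<exists>T y. submod S T \<and> |T| \<le>o |\<Lambda>G| \<and> y \<in> el G (S\<lparr>carrier := T\<rparr>) \<and> res G S T (carrier S) y = x)"
      using generated_ex[OF conjunct1[OF accG[unfolded accessible_def]]] by (elim exE conjE)
  have "\<exists>T. submod S T \<and> |T| \<le>o |\<Lambda>G| \<and> (\<exists>y\<in>el Q (S\<lparr>carrier := T\<rparr>). res Q S T (carrier S) y = x)"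
    if S: "S \<in> Mods" and x: "x \<in> el Q S" for S x
  proof -
    obtain w where w: "w \<in> el G S" "q S w = x" using x[folded surj[OF S]] by auto
    obtain T y where T: "submod S T" "|T| \<le>o |\<Lambda>G|" and y: "y \<in> el G (S\<lparr>carrier := T\<rparr>)"
      "res G S T (carrier S) y = w" using \<Lambda>G(2)[rule_format, OF S w(1)] by (elim exE conjE)
    have "res Q S T (carrier S) (q (S\<lparr>carrier := T\<rparr>) y) = x"
      using res_natural_top[OF S q T(1) y(1)] y(2) w(2) by simp
    with T nat_transD(4)[OF q sub_Mods[OF S T(1)] y(1)] show ?thesis
      by (intro exI[of _ T] conjI bexI[of _ "q (S\<lparr>carrier := T\<rparr>) y"])
  qed
  then have "generated Q" unfolding generated_def by (rule_tac x = \<Lambda>G in exI) (simp add: \<Lambda>G(1))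
  moreover have "related Q"
    unfolding related_def
  proof (intro allI impI)
    fix M :: "'u set" assume M: "small TYPE('u) M"
    obtain \<Lambda>F :: "'u set" where \<Lambda>F: "small TYPE('u) \<Lambda>F" "\<forall>S x. S \<in> Mods \<longrightarrow> x \<in> el F S \<longrightarrow> (\<exists>T y. submod S T \<and> |T| \<le>o |\<Lambda>F| \<and> y \<in> el F (S\<lparr>carrier := T\<rparr>) \<and> res F S T (carrier S) y = x)"
      using generated_ex[OF accF] by (elim exE conjE)
    obtain N :: "'u set" where N: "small TYPE('u) N" "\<forall>S T1 T2. S \<in> Mods \<longrightarrow> submod S T1 \<longrightarrow> |T1| \<le>o |M| \<longrightarrow>
      submod S T2 \<longrightarrow> |T2| \<le>o |\<Lambda>F| \<longrightarrow> (\<exists>T'. submod S T' \<and> T1 \<subseteq> T' \<and> T2 \<subseteq> T' \<and> |T'| \<le>o |N| )"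
      using join2[OF M \<Lambda>F(1)] by (elim exE conjE)
    have rG: "related G" using accG by (simp add: accessible_def)
    obtain \<Lambda> :: "'u set" where \<Lambda>: "small TYPE('u) \<Lambda>" "\<forall>S T y z. S \<in> Mods \<longrightarrow> submod S T \<longrightarrow> |T| \<le>o |N| \<longrightarrow>
       y \<in> el G (S\<lparr>carrier := T\<rparr>) \<longrightarrow> z \<in> el G (S\<lparr>carrier := T\<rparr>) \<longrightarrow> res G S T (carrier S) y = res G S T (carrier S) z \<longrightarrow> (\<exists>T'. submod S T' \<and> T \<subseteq> T' \<and> |T'| \<le>o |\<Lambda>| \<and> res G S T T' y = res G S T T' z)"
      using related_eq[OF G rG N(1)] by (elim exE conjE)
    have "\<exists>T'. submod S T' \<and> T \<subseteq> T' \<and> |T'| \<le>o |\<Lambda>| \<and> res Q S T T' y = \<one>\<^bsub>on_obj Q (S\<lparr>carrier := T'\<rparr>)\<^esub>"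
      if S: "S \<in> Mods" and T: "submod S T" "|T| \<le>o |M|" and y: "y \<in> el Q (S\<lparr>carrier := T\<rparr>)"
        and y1: "res Q S T (carrier S) y = \<one>\<^bsub>on_obj Q S\<^esub>" for S T y
    proof -
      note ST = sub_Mods[OF S T(1)]
      obtain w where w: "w \<in> el G (S\<lparr>carrier := T\<rparr>)" "q (S\<lparr>carrier := T\<rparr>) w = y"
        using y[folded surj[OF ST]] by auto
      have "q S (res G S T (carrier S) w) = \<one>\<^bsub>on_obj Q S\<^esub>"
        using res_natural_top[OF S q T(1) w(1)] w(2) y1 by simp
      then have "res G S T (carrier S) w \<in> kernel (on_obj G S) (on_obj Q S) (q S)"
        using group_homsD(3)[OF res_group_homs_top[OF S G T(1)] w(1)] by (simp add: kernel_def)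
      then have "res G S T (carrier S) w \<in> \<alpha> S ` el F S" unfolding ker[OF S] .
      then obtain z where z: "z \<in> el F S" "\<alpha> S z = res G S T (carrier S) w" by auto
      obtain T1 z1 where T1: "submod S T1" "|T1| \<le>o |\<Lambda>F|" and z1: "z1 \<in> el F (S\<lparr>carrier := T1\<rparr>)"
        "res F S T1 (carrier S) z1 = z" using \<Lambda>F(2)[rule_format, OF S z(1)] by (elim exE conjE)
      obtain T2 where T2: "submod S T2" "T \<subseteq> T2" "T1 \<subseteq> T2" "|T2| \<le>o |N|" using N(2)[rule_format, OF S T T1] by (elim exE conjE)
      let ?w = "res G S T T2 w" and ?z = "\<alpha> (S\<lparr>carrier := T2\<rparr>) (res F S T1 T2 z1)"
      have wz: "?w \<in> el G (S\<lparr>carrier := T2\<rparr>)" "?z \<in> el G (S\<lparr>carrier := T2\<rparr>)"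
        by (rule res_closed[OF S G T(1) T2(1,2) w(1)])
           (rule nat_transD(4)[OF \<alpha> sub_Mods[OF S T2(1)] res_closed[OF S F T1(1) T2(1,3) z1(1)]])
      have "res G S T2 (carrier S) ?z = \<alpha> S (res F S T2 (carrier S) (res F S T1 T2 z1))"
        by (rule res_natural_top[OF S \<alpha> T2(1) res_closed[OF S F T1(1) T2(1,3) z1(1)], symmetric])
      also have "\<dots> = res G S T2 (carrier S) ?w"
        using res_trans_top[OF S F T1(1) T2(1,3) z1(1)] res_trans_top[OF S G T(1) T2(1,2) w(1)] z1(2) z(2) by simp
      finally have "res G S T2 (carrier S) ?w = res G S T2 (carrier S) ?z" ..
      from \<Lambda>(2)[rule_format, OF S T2(1,4) wz this] obtain T3 where
        T3: "submod S T3" "T2 \<subseteq> T3" "|T3| \<le>o |\<Lambda>|" and e: "res G S T2 T3 ?w = res G S T2 T3 ?z" by (elim exE conjE)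
      note S2 = sub_Mods[OF S T2(1)] and S3 = sub_Mods[OF S T3(1)]
      have TT3: "T \<subseteq> T3" using T2 T3 by blast
      have "?z \<in> \<alpha> (S\<lparr>carrier := T2\<rparr>) ` el F (S\<lparr>carrier := T2\<rparr>)"
        using res_closed[OF S F T1(1) T2(1,3) z1(1)] by blast
      then have qz: "q (S\<lparr>carrier := T2\<rparr>) ?z = \<one>\<^bsub>on_obj Q (S\<lparr>carrier := T2\<rparr>)\<^esub>"
        using ker[OF S2] by (auto simp: kernel_def)
      have "res Q S T T3 y = q (S\<lparr>carrier := T3\<rparr>) (res G S T2 T3 ?w)"
        unfolding res_trans[OF S G T(1) T2(1) T3(1) T2(2) T3(2) w(1)] res_natural[OF S q T(1) T3(1) TT3 w(1)] w(2) ..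
      also have "\<dots> = res Q S T2 T3 (q (S\<lparr>carrier := T2\<rparr>) ?z)"
        unfolding e by (rule res_natural[OF S q T2(1) T3(1,2) wz(2)])
      also have "\<dots> = \<one>\<^bsub>on_obj Q (S\<lparr>carrier := T3\<rparr>)\<^esub>" unfolding qz by (rule res_one[OF S Q T2(1) T3(1,2)])
      finally show ?thesis using T3 TT3 by (intro exI[of _ T3] conjI)
    qed
    then show "\<exists>\<Lambda> :: 'u set. small TYPE('u) \<Lambda> \<and> (\<forall>S\<in>Mods. \<forall>T. submod S T \<and> |T| \<le>o |M| \<longrightarrow>
        (\<forall>y\<in>el Q (S\<lparr>carrier := T\<rparr>). res Q S T (carrier S) y = \<one>\<^bsub>on_obj Q S\<^esub> \<longrightarrow>
           (\<exists>T'. submod S T' \<and> T \<subseteq> T' \<and> |T'| \<le>o |\<Lambda>| \<and> res Q S T T' y = \<one>\<^bsub>on_obj Q (S\<lparr>carrier := T'\<rparr>)\<^esub>)))"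
      by (rule_tac x = \<Lambda> in exI) (simp add: \<Lambda>(1))
  qed
  ultimately show ?thesis by (simp add: accessible_def)
qed

text \<open>An isomorphism is a cokernel of the zero map.\<close>

lemma accessible_iso:
  assumes F: "grp_ftr F" and G: "grp_ftr G" and q: "q \<in> nat_trans R F G"
    and bij: "\<And>S. S \<in> Mods \<Longrightarrow> bij_betw (q S) (el F S) (el G S)" and acc: "accessible F"
  shows "accessible G"
proof (rule accessible_cokernel[OF F F G nt_trivial[OF F F] q])
  fix S assume S: "S \<in> Mods"
  show "q S ` el F S = el G S" using bij[OF S] by (simp add: bij_betw_def)
  have one: "\<one>\<^bsub>on_obj F S\<^esub> \<in> el F S"
    using grp_ftrD(1)[OF F S] by (simp add: comm_group.axioms(2) group.is_monoid)
  have "kernel (on_obj F S) (on_obj G S) (q S) = {\<one>\<^bsub>on_obj F S\<^esub>}"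
  proof -
    have "x = \<one>\<^bsub>on_obj F S\<^esub>" if "x \<in> el F S" "q S x = \<one>\<^bsub>on_obj G S\<^esub>" for x
      by (rule inj_onD[OF bij_betw_imp_inj_on[OF bij[OF S]]])
         (use that one nat_trans_one[OF q F G S] in auto)
    then have "kernel (on_obj F S) (on_obj G S) (q S) \<subseteq> {\<one>\<^bsub>on_obj F S\<^esub>}" unfolding kernel_def by blast
    moreover have "\<one>\<^bsub>on_obj F S\<^esub> \<in> kernel (on_obj F S) (on_obj G S) (q S)"
      using one nat_trans_one[OF q F G S] by (simp add: kernel_def)
    ultimately show ?thesis by blast
  qed
  also have "\<dots> = mk_nt F (\<lambda>S x. \<one>\<^bsub>on_obj F S\<^esub>) S ` el F S" using one S by auto
  finally show "kernel (on_obj F S) (on_obj G S) (q S) = mk_nt F (\<lambda>S x. \<one>\<^bsub>on_obj F S\<^esub>) S ` el F S" .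
qed (use acc in \<open>auto simp: accessible_def\<close>)

lemma nt_proj_nat_trans:
  assumes F: "\<And>i. i \<in> I \<Longrightarrow> grp_ftr (F i)" and i: "i \<in> I"
  shows "mk_nt (direct_sum I F) (\<lambda>S x. x i) \<in> nat_trans R (direct_sum I F) (F i)"
proof (rule mk_nt_nat_trans[OF grp_ftr_direct_sum[OF F]])
  show "(\<lambda>x. x i) \<in> hom (on_obj (direct_sum I F) S) (on_obj (F i) S)" if S: "S \<in> Mods" for S
    using i el_direct_sum[of I F, OF F S] by (auto simp: hom_def direct_sum_simps PiE_iff)
qed (use i in \<open>auto simp: direct_sum_simps\<close>)

text \<open>The projections to the summands are jointly injective, which settles the relations;
  an element is lifted componentwise.\<close>

lemma accessible_direct_sum:
  assumes I: "small TYPE('u) I" and F: "\<And>i. i \<in> I \<Longrightarrow> grp_ftr (F i)" and acc: "\<And>i. i \<in> I \<Longrightarrow> accessible (F i)"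
  shows "accessible (direct_sum I F)"
proof -
  let ?D = "direct_sum I F"
  note D = grp_ftr_direct_sum[OF F]
  have el: "el ?D S = {x \<in> \<Pi>\<^sub>E i\<in>I. el (F i) S. finite {i \<in> I. x i \<noteq> \<one>\<^bsub>on_obj (F i) S\<^esub>}}" if "S \<in> Mods" for S
    by (rule el_direct_sum[OF F that])
  have "related ?D"
  proof (rule related_jointly_mono[where J = I and F = F and k = "\<lambda>i. mk_nt ?D (\<lambda>S x. x i)", OF D F I nt_proj_nat_trans[OF F]])
    fix S x assume S: "S \<in> Mods" and x: "x \<in> el ?D S"
      and 1: "\<And>i. i \<in> I \<Longrightarrow> mk_nt ?D (\<lambda>S x. x i) S x = \<one>\<^bsub>on_obj (F i) S\<^esub>"
    have "x \<in> extensional I" using x el[OF S] by (auto simp: PiE_iff)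
    then show "x = \<one>\<^bsub>on_obj ?D S\<^esub>"
      using 1 S x by (intro extensionalityI[where A = I]) (auto simp: direct_sum_simps)
  qed (use acc in \<open>auto simp: accessible_def\<close>)
  moreover have "generated ?D"
  proof -
    define P where "P i \<Lambda> \<longleftrightarrow> small TYPE('u) \<Lambda> \<and> (\<forall>S x. S \<in> Mods \<longrightarrow> x \<in> el (F i) S \<longrightarrow>
     (\<exists>T y. submod S T \<and> |T| \<le>o |\<Lambda>| \<and> y \<in> el (F i) (S\<lparr>carrier := T\<rparr>) \<and> res (F i) S T (carrier S) y = x))"
      for i and \<Lambda> :: "'u set"
    have "\<exists>\<Lambda>. P i \<Lambda>" if "i \<in> I" for i
      unfolding P_def by (rule generated_ex) (use acc that in \<open>simp add: accessible_def\<close>)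
    then obtain \<Lambda> where \<Lambda>: "\<And>i. i \<in> I \<Longrightarrow> P i (\<Lambda> i)" by metis
    then have s\<Lambda>: "\<forall>i\<in>I. small TYPE('u) (\<Lambda> i)" by (simp add: P_def)
    obtain N :: "'u set" where N: "small TYPE('u) N" "\<forall>S T. S \<in> Mods \<longrightarrow> (\<forall>i. i \<in> I \<longrightarrow> submod S (T i)) \<longrightarrow>
      (\<forall>i. i \<in> I \<longrightarrow> |T i| \<le>o |\<Lambda> i| ) \<longrightarrow> (\<exists>T'. submod S T' \<and> (\<forall>i\<in>I. T i \<subseteq> T') \<and> |T'| \<le>o |N| )"
      using join_ex[OF I s\<Lambda>] by (elim exE conjE)
    have "\<exists>T. submod S T \<and> |T| \<le>o |N| \<and> (\<exists>y\<in>el ?D (S\<lparr>carrier := T\<rparr>). res ?D S T (carrier S) y = x)"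
      if S: "S \<in> Mods" and x: "x \<in> el ?D S" for S x
    proof -
      have xi: "x i \<in> el (F i) S" if "i \<in> I" for i using x that el[OF S] by auto
      have fin: "finite {i \<in> I. x i \<noteq> \<one>\<^bsub>on_obj (F i) S\<^esub>}" using x el[OF S] by auto
      have "\<exists>T y. submod S T \<and> |T| \<le>o |\<Lambda> i| \<and> y \<in> el (F i) (S\<lparr>carrier := T\<rparr>) \<and> res (F i) S T (carrier S) y = x i"
        if "i \<in> I" for i using \<Lambda>[OF that] S xi[OF that] unfolding P_def by simp
      then obtain T y where T: "\<And>i. i \<in> I \<Longrightarrow> submod S (T i)" "\<And>i. i \<in> I \<Longrightarrow> |T i| \<le>o |\<Lambda> i|"
        and y: "\<And>i. i \<in> I \<Longrightarrow> y i \<in> el (F i) (S\<lparr>carrier := T i\<rparr>)"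
        "\<And>i. i \<in> I \<Longrightarrow> res (F i) S (T i) (carrier S) (y i) = x i" by metis
      have "\<exists>T'. submod S T' \<and> (\<forall>i\<in>I. T i \<subseteq> T') \<and> |T'| \<le>o |N|"
        by (rule N(2)[rule_format, OF S T])
      then obtain T' where T': "submod S T'" "\<forall>i\<in>I. T i \<subseteq> T'" "|T'| \<le>o |N|" by (elim exE conjE)
      note ST = sub_Mods[OF S T'(1)]
      \<comment> \<open>Zero components are lifted to zero, so that the lift has finite support.\<close>
      define z where "z = (\<lambda>i\<in>I. if x i = \<one>\<^bsub>on_obj (F i) S\<^esub> then \<one>\<^bsub>on_obj (F i) (S\<lparr>carrier := T'\<rparr>)\<^esub>
        else res (F i) S (T i) T' (y i))"
      have zi: "z i \<in> el (F i) (S\<lparr>carrier := T'\<rparr>)" if i: "i \<in> I" for i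
        using i res_closed[OF S F[OF i] T(1)[OF i] T'(1) bspec[OF T'(2) i] y(1)[OF i]] grp_ftrD(1)[OF F[OF i] ST]
        by (simp add: z_def comm_group.axioms(2) group.is_monoid)
      have "finite {i \<in> I. z i \<noteq> \<one>\<^bsub>on_obj (F i) (S\<lparr>carrier := T'\<rparr>)\<^esub>}"
        by (rule finite_subset[OF _ fin]) (auto simp: z_def)
      then have z: "z \<in> el ?D (S\<lparr>carrier := T'\<rparr>)"
        unfolding el[OF ST] using zi by (simp add: PiE_iff z_def)
      have "res (F i) S T' (carrier S) (z i) = x i" if i: "i \<in> I" for i
      proof (cases "x i = \<one>\<^bsub>on_obj (F i) S\<^esub>")
        case True
        then show ?thesis
          using i group_homs_one[OF res_group_homs_top[OF S F[OF i] T'(1)] grp_ftrD(1)[OF F[OF i] ST] grp_ftrD(1)[OF F[OF i] S]]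
          by (simp add: z_def)
      next
        case False
        then show ?thesis using i y(2)[OF i] res_trans_top[OF S F[OF i] T(1)[OF i] T'(1) bspec[OF T'(2) i] y(1)[OF i]]
          by (simp add: z_def)
      qed
      moreover have "res ?D S T' (carrier S) z = (\<lambda>i\<in>I. res (F i) S T' (carrier S) (z i))"
        using z unfolding res_def by (simp add: direct_sum_simps)
      moreover have "x \<in> extensional I" using x el[OF S] by (auto simp: PiE_iff)
      ultimately have "res ?D S T' (carrier S) z = x"
        by (intro extensionalityI[where A = I]) auto
      with z T' show ?thesis by (intro exI[of _ T'] conjI bexI[of _ z])
    qed
    then show ?thesis unfolding generated_def by (rule_tac x = N in exI) (simp add: N(1))
  qed
  ultimately show ?thesis by (simp add: accessible_def)
qed

lemma small_arrows: "small_category (J :: ('u, 'u) cat) \<Longrightarrow> small TYPE('u) (arrows J)"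
  unfolding arrows_def small_category_def locally_small_def by (intro small_Sigma) auto

text \<open>The components \<open>\<pi> j x\<close> of an element \<open>x\<close> come from one submodule \<open>U\<close> of bounded size.  The
  lifts need not be compatible over \<open>U\<close>, but each arrow gives one equation that holds over \<open>S\<close> and
  hence over a larger submodule of bounded size.  As the arrows form a small set, all of them hold
  over one submodule \<open>W\<close> of bounded size, where the lifts define an element of the limit.\<close>

lemma accessible_limit:
  assumes J: "small_category (J :: ('u, 'u) cat)" and D: "ftr_diagram J D" and L: "grp_ftr L"
    and lim: "limit_ftr J D L \<pi>" and acc: "\<And>j. j \<in> objs J \<Longrightarrow> accessible (on_obj D j)"
  shows "accessible L"
proof -
  note DD = ftr_diagramD[OF D]
  have \<pi>: "\<And>j. j \<in> objs J \<Longrightarrow> \<pi> j \<in> nat_trans R L (on_obj D j)"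
    and lg: "\<And>S. S \<in> Mods \<Longrightarrow> limit_group J (eval_at S D) (on_obj L S) (\<lambda>j. \<pi> j S)"
    using lim by (auto simp: limit_ftr_def)
  have sJ: "small TYPE('u) (objs J)" using J by (simp add: small_category_def)
  have inj: "x = y" if "S \<in> Mods" "x \<in> el L S" "y \<in> el L S" "\<And>j. j \<in> objs J \<Longrightarrow> \<pi> j S x = \<pi> j S y" for S x y
    by (rule limit_group_inj[OF eval_diagram[OF D that(1)] lg[OF that(1)] that(2-4)])
  have "related L"
  proof (rule related_jointly_mono[where J = "objs J" and F = "on_obj D" and k = \<pi>, OF L DD(1) sJ \<pi>])
    fix S x assume S: "S \<in> Mods" and x: "x \<in> el L S" and 1: "\<And>j. j \<in> objs J \<Longrightarrow> \<pi> j S x = \<one>\<^bsub>on_obj (on_obj D j) S\<^esub>"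
    show "x = \<one>\<^bsub>on_obj L S\<^esub>"
    proof (rule inj[OF S x])
      show "\<one>\<^bsub>on_obj L S\<^esub> \<in> el L S" using grp_ftrD(1)[OF L S] by (simp add: comm_group.axioms(2) group.is_monoid)
      show "\<pi> j S x = \<pi> j S \<one>\<^bsub>on_obj L S\<^esub>" if "j \<in> objs J" for j
        using 1[OF that] nat_trans_one[OF \<pi>[OF that] L DD(1)[OF that] S] by simp
    qed
  qed (use acc in \<open>auto simp: accessible_def\<close>)
  moreover have "generated L"
  proof -
    define P where "P j \<Lambda> \<longleftrightarrow> small TYPE('u) \<Lambda> \<and> (\<forall>S x. S \<in> Mods \<longrightarrow> x \<in> el (on_obj D j) S \<longrightarrow>
     (\<exists>T y. submod S T \<and> |T| \<le>o |\<Lambda>| \<and> y \<in> el (on_obj D j) (S\<lparr>carrier := T\<rparr>) \<and> res (on_obj D j) S T (carrier S) y = x))"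
      for j and \<Lambda> :: "'u set"
    have "\<exists>\<Lambda>. P j \<Lambda>" if "j \<in> objs J" for j
      unfolding P_def by (rule generated_ex) (use acc that in \<open>simp add: accessible_def\<close>)
    then obtain \<Lambda> where \<Lambda>: "\<And>j. j \<in> objs J \<Longrightarrow> P j (\<Lambda> j)" by metis
    then have s\<Lambda>: "\<forall>j\<in>objs J. small TYPE('u) (\<Lambda> j)" by (simp add: P_def)
    obtain N :: "'u set" where N: "small TYPE('u) N" "\<forall>S T. S \<in> Mods \<longrightarrow> (\<forall>i. i \<in> objs J \<longrightarrow> submod S (T i)) \<longrightarrow>
      (\<forall>i. i \<in> objs J \<longrightarrow> |T i| \<le>o |\<Lambda> i| ) \<longrightarrow> (\<exists>T'. submod S T' \<and> (\<forall>i\<in>objs J. T i \<subseteq> T') \<and> |T'| \<le>o |N| )"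
      using join_ex[OF sJ s\<Lambda>] by (elim exE conjE)
    \<comment> \<open>The size of \<open>U\<close> below is at most \<open>N\<close>, and \<open>\<Gamma> j\<close> bounds where elements over \<open>U\<close> that agree over \<open>S\<close> become equal.\<close>
    define Q where "Q j \<Gamma> \<longleftrightarrow> small TYPE('u) \<Gamma> \<and> (\<forall>S T y z. S \<in> Mods \<longrightarrow> submod S T \<longrightarrow> |T| \<le>o |N| \<longrightarrow>
      y \<in> el (on_obj D j) (S\<lparr>carrier := T\<rparr>) \<longrightarrow> z \<in> el (on_obj D j) (S\<lparr>carrier := T\<rparr>) \<longrightarrow>
      res (on_obj D j) S T (carrier S) y = res (on_obj D j) S T (carrier S) z \<longrightarrow>
      (\<exists>T'. submod S T' \<and> T \<subseteq> T' \<and> |T'| \<le>o |\<Gamma>| \<and> res (on_obj D j) S T T' y = res (on_obj D j) S T T' z))"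
      for j and \<Gamma> :: "'u set"
    have "\<exists>\<Gamma>. Q j \<Gamma>" if "j \<in> objs J" for j
      unfolding Q_def by (rule related_eq[OF DD(1)[OF that] _ N(1)]) (use acc that in \<open>simp add: accessible_def\<close>)
    then obtain \<Gamma> where \<Gamma>: "\<And>j. j \<in> objs J \<Longrightarrow> Q j (\<Gamma> j)" by metis
    have s\<Gamma>: "\<forall>a\<in>arrows J. small TYPE('u) (\<Gamma> (fst (snd a)))" using \<Gamma> by (auto simp: arrows_def Q_def)
    obtain N' :: "'u set" where N': "small TYPE('u) N'" "\<forall>S T. S \<in> Mods \<longrightarrow> (\<forall>a. a \<in> arrows J \<longrightarrow> submod S (T a)) \<longrightarrow>
      (\<forall>a. a \<in> arrows J \<longrightarrow> |T a| \<le>o |\<Gamma> (fst (snd a))| ) \<longrightarrow> (\<exists>T'. submod S T' \<and> (\<forall>a\<in>arrows J. T a \<subseteq> T') \<and> |T'| \<le>o |N'| )"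
      using join_ex[OF small_arrows[OF J] s\<Gamma>] by (elim exE conjE)
    obtain K :: "'u set" where K: "small TYPE('u) K" "\<forall>S T1 T2. S \<in> Mods \<longrightarrow> submod S T1 \<longrightarrow> |T1| \<le>o |N| \<longrightarrow>
      submod S T2 \<longrightarrow> |T2| \<le>o |N'| \<longrightarrow> (\<exists>T'. submod S T' \<and> T1 \<subseteq> T' \<and> T2 \<subseteq> T' \<and> |T'| \<le>o |K| )"
      using join2[OF N(1) N'(1)] by (elim exE conjE)
    have "\<exists>T. submod S T \<and> |T| \<le>o |K| \<and> (\<exists>y\<in>el L (S\<lparr>carrier := T\<rparr>). res L S T (carrier S) y = x)"
      if S: "S \<in> Mods" and x: "x \<in> el L S" for S x
    proof -
      have xc: "compatible J (eval_at S D) (\<lambda>j. \<pi> j S x)" using lg[OF S] x by (simp add: limit_group_def)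
      have "\<exists>T y. submod S T \<and> |T| \<le>o |\<Lambda> j| \<and> y \<in> el (on_obj D j) (S\<lparr>carrier := T\<rparr>) \<and> res (on_obj D j) S T (carrier S) y = \<pi> j S x"
        if "j \<in> objs J" for j using \<Lambda>[OF that] S nat_transD(4)[OF \<pi>[OF that] S x] unfolding P_def by simp
      then obtain T y where T: "\<And>j. j \<in> objs J \<Longrightarrow> submod S (T j)" "\<And>j. j \<in> objs J \<Longrightarrow> |T j| \<le>o |\<Lambda> j|"
        and y: "\<And>j. j \<in> objs J \<Longrightarrow> y j \<in> el (on_obj D j) (S\<lparr>carrier := T j\<rparr>)"
        "\<And>j. j \<in> objs J \<Longrightarrow> res (on_obj D j) S (T j) (carrier S) (y j) = \<pi> j S x" by metis
      have "\<exists>T'. submod S T' \<and> (\<forall>j\<in>objs J. T j \<subseteq> T') \<and> |T'| \<le>o |N|"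
        by (rule N(2)[rule_format, OF S T])
      then obtain U where U: "submod S U" "\<forall>j\<in>objs J. T j \<subseteq> U" "|U| \<le>o |N|" by (elim exE conjE)
      note SU = sub_Mods[OF S U(1)]
      \<comment> \<open>The lifts of the components to \<open>U\<close>, and below their images \<open>v\<close> over \<open>W\<close>.\<close>
      define w where "w j = res (on_obj D j) S (T j) U (y j)" for j
      have w: "w j \<in> el (on_obj D j) (S\<lparr>carrier := U\<rparr>)" if j: "j \<in> objs J" for j
        unfolding w_def by (rule res_closed[OF S DD(1)[OF j] T(1)[OF j] U(1) bspec[OF U(2) j] y(1)[OF j]])
      have wx: "res (on_obj D j) S U (carrier S) (w j) = \<pi> j S x" if j: "j \<in> objs J" for j
        unfolding w_def res_trans_top[OF S DD(1)[OF j] T(1)[OF j] U(1) bspec[OF U(2) j] y(1)[OF j]] by (rule y(2)[OF j])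
      have "\<exists>V. submod S V \<and> U \<subseteq> V \<and> |V| \<le>o |\<Gamma> j| \<and>
          res (on_obj D j) S U V (on_mor D i j f (S\<lparr>carrier := U\<rparr>) (w i)) = res (on_obj D j) S U V (w j)"
        if i: "i \<in> objs J" and j: "j \<in> objs J" and f: "f \<in> homs J i j" for i j f
      proof -
        note Df = DD(3)[OF i j f]
        have "res (on_obj D j) S U (carrier S) (on_mor D i j f (S\<lparr>carrier := U\<rparr>) (w i)) = on_mor D i j f S (\<pi> i S x)"
          using res_natural_top[OF S Df U(1) w[OF i]] wx[OF i] by simp
        also have "\<dots> = res (on_obj D j) S U (carrier S) (w j)"
          unfolding wx[OF j] using xc i j f by (simp add: compatible_def)
        finally show ?thesis
          using \<Gamma>[OF j] S U(1,3) nat_transD(4)[OF Df SU w[OF i]] w[OF j] unfolding Q_def by simp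
      qed
      then have "\<forall>a\<in>arrows J. \<exists>V. submod S V \<and> U \<subseteq> V \<and> |V| \<le>o |\<Gamma> (fst (snd a))| \<and>
          res (on_obj D (fst (snd a))) S U V (on_mor D (fst a) (fst (snd a)) (snd (snd a)) (S\<lparr>carrier := U\<rparr>) (w (fst a)))
            = res (on_obj D (fst (snd a))) S U V (w (fst (snd a)))"
        by (simp add: arrows_def)
      from bchoice[OF this] obtain V where V: "\<forall>a\<in>arrows J. submod S (V a) \<and> U \<subseteq> V a \<and> |V a| \<le>o |\<Gamma> (fst (snd a))| \<and>
          res (on_obj D (fst (snd a))) S U (V a) (on_mor D (fst a) (fst (snd a)) (snd (snd a)) (S\<lparr>carrier := U\<rparr>) (w (fst a)))
            = res (on_obj D (fst (snd a))) S U (V a) (w (fst (snd a)))" by (elim exE)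
      have "\<exists>T'. submod S T' \<and> (\<forall>a\<in>arrows J. V a \<subseteq> T') \<and> |T'| \<le>o |N'|"
        by (rule N'(2)[rule_format, OF S]) (use V in auto)
      then obtain W' where W': "submod S W'" "\<forall>a\<in>arrows J. V a \<subseteq> W'" "|W'| \<le>o |N'|" by (elim exE conjE)
      obtain W where W: "submod S W" "U \<subseteq> W" "W' \<subseteq> W" "|W| \<le>o |K|"
        using K(2)[rule_format, OF S U(1,3) W'(1,3)] by (elim exE conjE)
      note SW = sub_Mods[OF S W(1)]
      define v where "v j = res (on_obj D j) S U W (w j)" for j
      have v: "v j \<in> el (on_obj D j) (S\<lparr>carrier := W\<rparr>)" if j: "j \<in> objs J" for j
        unfolding v_def by (rule res_closed[OF S DD(1)[OF j] U(1) W(1,2) w[OF j]])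
      have "compatible J (eval_at (S\<lparr>carrier := W\<rparr>) D) v"
        unfolding compatible_def eval_at_simps
      proof (intro conjI ballI v)
        fix i j f assume i: "i \<in> objs J" and j: "j \<in> objs J" and f: "f \<in> homs J i j"
        note Df = DD(3)[OF i j f]
        have a: "(i, j, f) \<in> arrows J" using i j f by (simp add: arrows_def)
        have Va: "submod S (V (i, j, f))" "U \<subseteq> V (i, j, f)" "V (i, j, f) \<subseteq> W"
          "res (on_obj D j) S U (V (i, j, f)) (on_mor D i j f (S\<lparr>carrier := U\<rparr>) (w i))
            = res (on_obj D j) S U (V (i, j, f)) (w j)"
          using bspec[OF V a] W'(2) W(3) a by auto
        have fw: "on_mor D i j f (S\<lparr>carrier := U\<rparr>) (w i) \<in> el (on_obj D j) (S\<lparr>carrier := U\<rparr>)"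
          by (rule nat_transD(4)[OF Df SU w[OF i]])
        have "on_mor D i j f (S\<lparr>carrier := W\<rparr>) (v i) = res (on_obj D j) S U W (on_mor D i j f (S\<lparr>carrier := U\<rparr>) (w i))"
          unfolding v_def by (rule res_natural[OF S Df U(1) W(1,2) w[OF i]])
        also have "\<dots> = v j"
          unfolding v_def using res_trans[OF S DD(1)[OF j] U(1) Va(1) W(1) Va(2,3) fw]
            res_trans[OF S DD(1)[OF j] U(1) Va(1) W(1) Va(2,3) w[OF j]] Va(4) by simp
        finally show "on_mor D i j f (S\<lparr>carrier := W\<rparr>) (v i) = v j" .
      qed
      then have "\<exists>!g. g \<in> el L (S\<lparr>carrier := W\<rparr>) \<and> (\<forall>j\<in>objs J. \<pi> j (S\<lparr>carrier := W\<rparr>) g = v j)"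
        using lg[OF SW] unfolding limit_group_def by blast
      then obtain g where g: "g \<in> el L (S\<lparr>carrier := W\<rparr>)" "\<forall>j\<in>objs J. \<pi> j (S\<lparr>carrier := W\<rparr>) g = v j" by blast
      have "res L S W (carrier S) g = x"
      proof (rule inj[OF S group_homsD(3)[OF res_group_homs_top[OF S L W(1)] g(1)] x])
        fix j assume j: "j \<in> objs J"
        show "\<pi> j S (res L S W (carrier S) g) = \<pi> j S x"
          using res_natural_top[OF S \<pi>[OF j] W(1) g(1)] g(2) j wx[OF j]
            res_trans_top[OF S DD(1)[OF j] U(1) W(1,2) w[OF j]] by (simp add: v_def)
      qed
      with g W show ?thesis by (intro exI[of _ W] conjI bexI[of _ g])
    qed
    then show ?thesis unfolding generated_def by (rule_tac x = K in exI) (simp add: K(1))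
  qed
  ultimately show ?thesis by (simp add: accessible_def)
qed

text \<open>The element \<open>x\<close> lies in its span, and inclusions of submodules are injective.\<close>

lemma accessible_RR: "accessible RR"
proof -
  have "related RR"
    unfolding related_def
  proof (intro allI impI)
    fix M :: "'u set" assume M: "small TYPE('u) M"
    have "\<exists>T'. submod S T' \<and> T \<subseteq> T' \<and> |T'| \<le>o |M| \<and> res RR S T T' y = \<one>\<^bsub>on_obj RR (S\<lparr>carrier := T'\<rparr>)\<^esub>"
      if "submod S T" "|T| \<le>o |M|" "y \<in> el RR (S\<lparr>carrier := T\<rparr>)" "res RR S T (carrier S) y = \<one>\<^bsub>on_obj RR S\<^esub>" for S T y
      using that by (intro exI[of _ T]) (auto simp: res_def incl_def)
    then show "\<exists>\<Lambda> :: 'u set. small TYPE('u) \<Lambda> \<and> (\<forall>S\<in>Mods. \<forall>T. submod S T \<and> |T| \<le>o |M| \<longrightarrow>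
        (\<forall>y\<in>el RR (S\<lparr>carrier := T\<rparr>). res RR S T (carrier S) y = \<one>\<^bsub>on_obj RR S\<^esub> \<longrightarrow>
           (\<exists>T'. submod S T' \<and> T \<subseteq> T' \<and> |T'| \<le>o |\<Lambda>| \<and> res RR S T T' y = \<one>\<^bsub>on_obj RR (S\<lparr>carrier := T'\<rparr>)\<^esub>)))"
      by (rule_tac x = M in exI) (simp add: M)
  qed
  moreover have "generated RR"
  proof -
    have "\<exists>K :: 'u set. small TYPE('u) K \<and> (\<forall>S\<in>Mods. \<forall>T. (\<forall>j\<in>{()}. T j \<subseteq> carrier S \<and> |T j| \<le>o |{()}| ) \<longrightarrow>
       (\<exists>T'. submod S T' \<and> (\<forall>j\<in>{()}. T j \<subseteq> T') \<and> |T'| \<le>o |K| ))"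
      by (rule join_bound) (simp_all add: small_finite)
    then obtain K :: "'u set" where K: "small TYPE('u) K" "\<forall>S\<in>Mods. \<forall>T. (\<forall>j\<in>{()}. T j \<subseteq> carrier S \<and> |T j| \<le>o |{()}| ) \<longrightarrow>
       (\<exists>T'. submod S T' \<and> (\<forall>j\<in>{()}. T j \<subseteq> T') \<and> |T'| \<le>o |K| )" by (elim exE conjE)
    have "\<exists>T. submod S T \<and> |T| \<le>o |K| \<and> (\<exists>y\<in>el RR (S\<lparr>carrier := T\<rparr>). res RR S T (carrier S) y = x)"
      if S: "S \<in> Mods" and x: "x \<in> el RR S" for S x
    proof -
      have "|{x}| \<le>o |{()}|" by (rule card_of_ordLeqI[of "\<lambda>_. ()"]) auto
      then have "\<forall>j\<in>{()}. {x} \<subseteq> carrier S \<and> |{x}| \<le>o |{()}|" using x by simp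
      from mp[OF spec[OF bspec[OF K(2) S], of "\<lambda>_. {x}"] this]
      obtain T where T: "submod S T" "{x} \<subseteq> T" "|T| \<le>o |K|" by auto
      show ?thesis
        by (intro exI[of _ T] conjI T(1,3) bexI[of _ x]) (use T(2) in \<open>auto simp: res_def incl_def\<close>)
    qed
    then show ?thesis unfolding generated_def by (rule_tac x = K in exI) (simp add: K(1))
  qed
  ultimately show ?thesis by (simp add: accessible_def)
qed

text \<open>A homomorphism takes its values in the span of its image, and composition with the
  inclusion of a submodule does not change its values.\<close>

lemma accessible_mod_scheme:
  assumes N: "N \<in> Mods" shows "accessible (mod_scheme R N)"
proof -
  let ?F = "mod_scheme R N"
  have res_id: "res ?F S T T' h = h" if "h \<in> module_homs R N (S\<lparr>carrier := T\<rparr>)" for S T T' h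
  proof -
    have "compose (carrier N) (incl T) h = h"
      using module_homsD(1,4)[OF that]
      by (intro extensionalityI[where A = "carrier N"]) (auto simp: compose_def incl_def)
    then show ?thesis using that by (simp add: res_def mod_scheme_simps)
  qed
  have "related ?F"
    unfolding related_def
  proof (intro allI impI)
    fix M :: "'u set" assume M: "small TYPE('u) M"
    have "\<exists>T'. submod S T' \<and> T \<subseteq> T' \<and> |T'| \<le>o |M| \<and> res ?F S T T' y = \<one>\<^bsub>on_obj ?F (S\<lparr>carrier := T'\<rparr>)\<^esub>"
      if "submod S T" "|T| \<le>o |M|" "y \<in> el ?F (S\<lparr>carrier := T\<rparr>)" "res ?F S T (carrier S) y = \<one>\<^bsub>on_obj ?F S\<^esub>" for S T y
      using that by (intro exI[of _ T]) (simp add: mod_scheme_simps res_id)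
    then show "\<exists>\<Lambda> :: 'u set. small TYPE('u) \<Lambda> \<and> (\<forall>S\<in>Mods. \<forall>T. submod S T \<and> |T| \<le>o |M| \<longrightarrow>
        (\<forall>y\<in>el ?F (S\<lparr>carrier := T\<rparr>). res ?F S T (carrier S) y = \<one>\<^bsub>on_obj ?F S\<^esub> \<longrightarrow>
           (\<exists>T'. submod S T' \<and> T \<subseteq> T' \<and> |T'| \<le>o |\<Lambda>| \<and> res ?F S T T' y = \<one>\<^bsub>on_obj ?F (S\<lparr>carrier := T'\<rparr>)\<^esub>)))"
      by (rule_tac x = M in exI) (simp add: M)
  qed
  moreover have "generated ?F"
  proof -
    have "\<exists>K :: 'u set. small TYPE('u) K \<and> (\<forall>S\<in>Mods. \<forall>T. (\<forall>j\<in>{()}. T j \<subseteq> carrier S \<and> |T j| \<le>o |carrier N| ) \<longrightarrow>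
       (\<exists>T'. submod S T' \<and> (\<forall>j\<in>{()}. T j \<subseteq> T') \<and> |T'| \<le>o |K| ))"
      by (rule join_bound) (use N in \<open>simp_all add: small_finite Mods_iff\<close>)
    then obtain K :: "'u set" where K: "small TYPE('u) K" "\<forall>S\<in>Mods. \<forall>T. (\<forall>j\<in>{()}. T j \<subseteq> carrier S \<and> |T j| \<le>o |carrier N| ) \<longrightarrow>
       (\<exists>T'. submod S T' \<and> (\<forall>j\<in>{()}. T j \<subseteq> T') \<and> |T'| \<le>o |K| )" by (elim exE conjE)
    have "\<exists>T. submod S T \<and> |T| \<le>o |K| \<and> (\<exists>y\<in>el ?F (S\<lparr>carrier := T\<rparr>). res ?F S T (carrier S) y = h)"
      if S: "S \<in> Mods" and "h \<in> el ?F S" for S h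
    proof -
      have h: "h \<in> module_homs R N S" using that by (simp add: mod_scheme_simps)
      have "\<forall>j\<in>{()}. h ` carrier N \<subseteq> carrier S \<and> |h ` carrier N| \<le>o |carrier N|"
        using module_homsD(1)[OF h] card_of_image by blast
      from mp[OF spec[OF bspec[OF K(2) S], of "\<lambda>_. h ` carrier N"] this]
      obtain T where T: "submod S T" "h ` carrier N \<subseteq> T" "|T| \<le>o |K|" by auto
      have "h \<in> module_homs R N (S\<lparr>carrier := T\<rparr>)"
        by (rule module_homsI) (use T(2) module_homsD[OF h] in auto)
      then show ?thesis
        by (intro exI[of _ T] conjI T(1,3) bexI[of _ h] res_id) (simp_all add: mod_scheme_simps)
    qed
    then show ?thesis unfolding generated_def by (rule_tac x = K in exI) (simp add: K(1))
  qed
  ultimately show ?thesis by (simp add: accessible_def)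
qed

end

section \<open>Accessible functors are the presentable ones\<close>

context small_ring
begin

text \<open>The structure of \<open>M\<close> transported along an injection \<open>e\<close> and recorded as sets of tuples.  The
  records in \<open>Mods\<close> have arbitrary values off the carrier and in unrelated fields, so even those with
  a fixed carrier do not form a small set; the codes with values in a small set do.\<close>

definition code :: "('r, 'u) module \<Rightarrow> ('u \<Rightarrow> 'u) \<Rightarrow> 'u set \<times> ('u \<times> 'u \<times> 'u) set \<times> ('r \<times> 'u \<times> 'u) set" where
  "code M e = (e ` carrier M, (\<lambda>(x, y). (e x, e y, e (x \<oplus>\<^bsub>M\<^esub> y))) ` (carrier M \<times> carrier M),
     (\<lambda>(a, x). (a, e x, e (a \<odot>\<^bsub>M\<^esub> x))) ` (carrier R \<times> carrier M))"

text \<open>The isomorphism between two modules with the same code.\<close>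

definition decode :: "('r, 'u) module \<Rightarrow> ('u \<Rightarrow> 'u) \<Rightarrow> ('r, 'u) module \<Rightarrow> ('u \<Rightarrow> 'u) \<Rightarrow> 'u \<Rightarrow> 'u" where
  "decode M e M' e' = (\<lambda>x\<in>carrier M. inv_into (carrier M') e' (e x))"

lemma decode:
  assumes M: "M \<in> Mods" and M': "M' \<in> Mods" and e: "inj_on e (carrier M)" and e': "inj_on e' (carrier M')"
    and eq: "code M e = code M' e'"
  shows decode_hom: "decode M e M' e' \<in> module_homs R M M'"
    and decode_eq: "x \<in> carrier M \<Longrightarrow> e' (decode M e M' e' x) = e x"
proof -
  interpret M: left_module R M using M by (simp add: Mods_iff)
  interpret M': left_module R M' using M' by (simp add: Mods_iff)
  have im: "e ` carrier M = e' ` carrier M'"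
    and ad: "(\<lambda>(x, y). (e x, e y, e (x \<oplus>\<^bsub>M\<^esub> y))) ` (carrier M \<times> carrier M) =
       (\<lambda>(x, y). (e' x, e' y, e' (x \<oplus>\<^bsub>M'\<^esub> y))) ` (carrier M' \<times> carrier M')"
    and sm: "(\<lambda>(a, x). (a, e x, e (a \<odot>\<^bsub>M\<^esub> x))) ` (carrier R \<times> carrier M) =
       (\<lambda>(a, x). (a, e' x, e' (a \<odot>\<^bsub>M'\<^esub> x))) ` (carrier R \<times> carrier M')"
    using eq by (simp_all add: code_def)
  have d: "decode M e M' e' x \<in> carrier M'" "e' (decode M e M' e' x) = e x" if "x \<in> carrier M" for x
  proof -
    have "e x \<in> e' ` carrier M'" using that im by blast
    then show "decode M e M' e' x \<in> carrier M'" "e' (decode M e M' e' x) = e x"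
      using that by (auto simp: decode_def inv_into_into f_inv_into_f)
  qed
  have uniq: "decode M e M' e' x = y" if "x \<in> carrier M" "y \<in> carrier M'" "e' y = e x" for x y
    by (rule inj_onD[OF e']) (use that d in auto)
  show "e' (decode M e M' e' x) = e x" if "x \<in> carrier M" by (rule d(2)[OF that])
  show "decode M e M' e' \<in> module_homs R M M'"
  proof (rule module_homsI)
    fix x y assume x: "x \<in> carrier M" and y: "y \<in> carrier M"
    have "(e x, e y, e (x \<oplus>\<^bsub>M\<^esub> y)) \<in> (\<lambda>(x, y). (e' x, e' y, e' (x \<oplus>\<^bsub>M'\<^esub> y))) ` (carrier M' \<times> carrier M')"
      unfolding ad[symmetric] using x y by force
    then obtain x' y' where "x' \<in> carrier M'" "y' \<in> carrier M'" "e' x' = e x" "e' y' = e y"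
      "e' (x' \<oplus>\<^bsub>M'\<^esub> y') = e (x \<oplus>\<^bsub>M\<^esub> y)" by auto
    then show "decode M e M' e' (x \<oplus>\<^bsub>M\<^esub> y) = decode M e M' e' x \<oplus>\<^bsub>M'\<^esub> decode M e M' e' y"
      using x y uniq[of x x'] uniq[of y y'] uniq[of "x \<oplus>\<^bsub>M\<^esub> y" "x' \<oplus>\<^bsub>M'\<^esub> y'"] by simp
  next
    fix a x assume a: "a \<in> carrier R" and x: "x \<in> carrier M"
    have "(a, e x, e (a \<odot>\<^bsub>M\<^esub> x)) \<in> (\<lambda>(a, x). (a, e' x, e' (a \<odot>\<^bsub>M'\<^esub> x))) ` (carrier R \<times> carrier M')"
      unfolding sm[symmetric] using a x by force
    then obtain x' where "x' \<in> carrier M'" "e' x' = e x" "e' (a \<odot>\<^bsub>M'\<^esub> x') = e (a \<odot>\<^bsub>M\<^esub> x)" by auto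
    then show "decode M e M' e' (a \<odot>\<^bsub>M\<^esub> x) = a \<odot>\<^bsub>M'\<^esub> decode M e M' e' x"
      using a x uniq[of x x'] uniq[of "a \<odot>\<^bsub>M\<^esub> x" "a \<odot>\<^bsub>M'\<^esub> x'"] M.smult_closed M'.smult_closed by simp
  qed (use d in \<open>auto simp: decode_def\<close>)
qed

lemma small_codes:
  fixes \<Lambda> :: "'u set"
  assumes "small TYPE('u) \<Lambda>"
  shows "small TYPE('u) {code M e |M e. M \<in> Mods \<and> inj_on e (carrier M) \<and> e ` carrier M \<subseteq> \<Lambda>}"
proof (rule small_subset)
  show "small TYPE('u) (Pow \<Lambda> \<times> Pow (\<Lambda> \<times> \<Lambda> \<times> \<Lambda>) \<times> Pow (carrier R \<times> \<Lambda> \<times> \<Lambda>))"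
    by (intro small_Times small_Pow assms small_R)
  show "{code M e |M e. M \<in> Mods \<and> inj_on e (carrier M) \<and> e ` carrier M \<subseteq> \<Lambda>} \<subseteq>
    Pow \<Lambda> \<times> Pow (\<Lambda> \<times> \<Lambda> \<times> \<Lambda>) \<times> Pow (carrier R \<times> \<Lambda> \<times> \<Lambda>)"
  proof
    fix c assume "c \<in> {code M e |M e. M \<in> Mods \<and> inj_on e (carrier M) \<and> e ` carrier M \<subseteq> \<Lambda>}"
    then obtain M e where c: "c = code M e" and M: "M \<in> Mods" and e: "e ` carrier M \<subseteq> \<Lambda>" by blast
    interpret M: left_module R M using M by (simp add: Mods_iff)
    have "e x \<in> \<Lambda>" if "x \<in> carrier M" for x using e that by blast
    then show "c \<in> Pow \<Lambda> \<times> Pow (\<Lambda> \<times> \<Lambda> \<times> \<Lambda>) \<times> Pow (carrier R \<times> \<Lambda> \<times> \<Lambda>)"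
      by (auto simp: c code_def M.smult_closed)
  qed
qed

text \<open>For each code \<open>c\<close> of a module that embeds into \<open>\<Lambda>\<close> choose a module \<open>r c\<close> with this code.  Each
  submodule of size at most \<open>\<Lambda>\<close> is isomorphic to some \<open>r c\<close>, so every element of \<open>F S\<close> is the image
  of an element of some \<open>F (r c)\<close>.  The index set \<open>I\<close> is a copy in \<open>'u\<close> of the set \<open>P\<close> of all these
  elements.\<close>

lemma cover_ex:
  fixes F :: "('r, 'u, 'g) group_ftr"
  assumes F: "grp_ftr F" and sm: "small_valued F" and gen: "generated F"
  shows "\<exists>(I :: 'u set) N m. small TYPE('u) I \<and> (\<forall>i\<in>I. N i \<in> Mods \<and> m i \<in> el F (N i)) \<and>
    (\<forall>S\<in>Mods. \<forall>x\<in>el F S. \<exists>i\<in>I. \<exists>h\<in>module_homs R (N i) S. on_mor F (N i) S h (m i) = x)"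
proof -
  obtain \<Lambda> :: "'u set" where \<Lambda>: "small TYPE('u) \<Lambda>" "\<forall>S x. S \<in> Mods \<longrightarrow> x \<in> el F S \<longrightarrow>
     (\<exists>T y. submod S T \<and> |T| \<le>o |\<Lambda>| \<and> y \<in> el F (S\<lparr>carrier := T\<rparr>) \<and> res F S T (carrier S) y = x)"
    using generated_ex[OF gen] by (elim exE conjE)
  define C where "C = {code M e |M e. M \<in> Mods \<and> inj_on e (carrier M) \<and> e ` carrier M \<subseteq> \<Lambda>}"
  have "\<forall>c\<in>C. \<exists>Me. fst Me \<in> Mods \<and> inj_on (snd Me) (carrier (fst Me)) \<and> code (fst Me) (snd Me) = c"
    unfolding C_def by force
  from bchoice[OF this] obtain r where
    r: "\<forall>c\<in>C. fst (r c) \<in> Mods \<and> inj_on (snd (r c)) (carrier (fst (r c))) \<and> code (fst (r c)) (snd (r c)) = c" by (elim exE)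
  define P where "P = (SIGMA c:C. el F (fst (r c)))"
  have "small TYPE('u) P" unfolding P_def
  proof (rule small_Sigma)
    show "small TYPE('u) C" unfolding C_def by (rule small_codes[OF \<Lambda>(1)])
    show "small TYPE('u) (el F (fst (r c)))" if "c \<in> C" for c
      using r that sm by (simp add: small_valued_def)
  qed
  then obtain I :: "'u set" and f where I: "small TYPE('u) I" "bij_betw f P I" using small_copy by blast
  define N where "N i = fst (r (fst (inv_into P f i)))" for i
  define m where "m i = snd (inv_into P f i)" for i
  have inv: "inv_into P f i \<in> P" if "i \<in> I" for i
    using that I(2) by (metis bij_betw_imp_surj_on inv_into_into)
  have Nm: "N i \<in> Mods \<and> m i \<in> el F (N i)" if "i \<in> I" for i
    using inv[OF that] r unfolding P_def N_def m_def by auto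
  have "\<exists>i\<in>I. \<exists>h\<in>module_homs R (N i) S. on_mor F (N i) S h (m i) = x" if S: "S \<in> Mods" and x: "x \<in> el F S" for S x
  proof -
    obtain T y where T: "submod S T" "|T| \<le>o |\<Lambda>|" and y: "y \<in> el F (S\<lparr>carrier := T\<rparr>)" "res F S T (carrier S) y = x"
      using \<Lambda>(2)[rule_format, OF S x] by (elim exE conjE)
    let ?T = "S\<lparr>carrier := T\<rparr>"
    have ST: "?T \<in> Mods" by (rule sub_Mods[OF S T(1)])
    obtain e where e: "inj_on e T" "e ` T \<subseteq> \<Lambda>" using T(2) unfolding card_of_ordLeq[symmetric] by blast
    define c where "c = code ?T e"
    have c: "c \<in> C" unfolding C_def c_def using ST e by force
    define M where "M = fst (r c)"
    define e' where "e' = snd (r c)"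
    have M: "M \<in> Mods" "inj_on e' (carrier M)" "code M e' = code ?T e" using r c by (auto simp: M_def e'_def c_def)
    have e1: "inj_on e (carrier ?T)" using e by simp
    note a = decode_hom[OF ST M(1) e1 M(2) M(3)[symmetric]] and b = decode_hom[OF M(1) ST M(2) e1 M(3)]
    let ?a = "decode ?T e M e'" and ?b = "decode M e' ?T e"
    have ba: "compose (carrier ?T) ?b ?a = (\<lambda>x\<in>carrier ?T. x)"
    proof (rule restrict_ext[of "carrier ?T" "\<lambda>x. ?b (?a x)" "\<lambda>x. x", folded compose_def])
      fix t assume t: "t \<in> carrier ?T"
      have at: "?a t \<in> carrier M" by (rule module_homsD(1)[OF a t])
      have "e (?b (?a t)) = e t"
        using decode_eq[OF M(1) ST M(2) e1 M(3) at] decode_eq[OF ST M(1) e1 M(2) M(3)[symmetric] t] by simp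
      then show "?b (?a t) = t" by (rule inj_onD[OF e1]) (use t module_homsD(1)[OF b at] in auto)
    qed
    define w where "w = on_mor F ?T M ?a y"
    have w: "w \<in> el F M" unfolding w_def by (rule grp_ftr_closed[OF F ST M(1) a y(1)])
    have bw: "on_mor F M ?T ?b w = y"
      unfolding w_def grp_ftrD(4)[OF F ST M(1) ST a b y(1), symmetric] ba by (rule grp_ftrD(3)[OF F ST y(1)])
    have inc: "incl T \<in> module_homs R ?T S" using incl_hom[OF S T(1) sub_le[OF S T(1)]] by simp
    let ?h = "compose (carrier M) (incl T) ?b"
    have h: "?h \<in> module_homs R M S" by (rule compose_hom[OF b inc M(1)])
    have "on_mor F M S ?h w = on_mor F ?T S (incl T) y"
      unfolding grp_ftrD(4)[OF F M(1) ST S b inc w] bw ..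
    also have "\<dots> = x" using y(2) by (simp add: res_def)
    finally have hw: "on_mor F M S ?h w = x" .
    have cw: "(c, w) \<in> P" using c w by (simp add: P_def M_def)
    then have fI: "f (c, w) \<in> I" using I(2) by (auto simp: bij_betw_def)
    have "inv_into P f (f (c, w)) = (c, w)" using cw I(2) by (simp add: bij_betw_def)
    then have "N (f (c, w)) = M" "m (f (c, w)) = w" by (simp_all add: N_def m_def M_def)
    with h hw fI show ?thesis by (intro bexI[of _ "f (c, w)"] bexI[of _ ?h]) simp_all
  qed
  with I(1) Nm show ?thesis by (intro exI[of _ I] exI[of _ N] exI[of _ m]) simp
qed

text \<open>The transformation that corresponds to \<open>m\<close> under the Yoneda lemma.\<close>

lemma yoneda_nat_trans:
  assumes F: "grp_ftr F" and N: "N \<in> Mods" and m: "m \<in> el F N"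
  shows "mk_nt (mod_scheme R N) (\<lambda>S h. on_mor F N S h m) \<in> nat_trans R (mod_scheme R N) F"
proof (rule mk_nt_nat_trans[OF grp_ftr_mod_scheme[OF N]])
  fix S assume S: "S \<in> Mods"
  show "(\<lambda>h. on_mor F N S h m) \<in> hom (on_obj (mod_scheme R N) S) (on_obj F S)"
    by (rule homI) (use grp_ftr_closed[OF F N S _ m] grp_ftrD(5)[OF F N S _ _ m] in \<open>simp_all add: mod_scheme_simps\<close>)
  fix T f h assume "T \<in> Mods" "f \<in> module_homs R S T" "h \<in> el (mod_scheme R N) S"
  then show "on_mor F N T (on_mor (mod_scheme R N) S T f h) m = on_mor F S T f (on_mor F N S h m)"
    using grp_ftrD(4)[OF F N S _ _ _ m] by (simp add: mod_scheme_simps)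
qed

lemma cover_surj_ex:
  fixes F :: "('r, 'u, 'g) group_ftr"
  assumes F: "grp_ftr F" and sm: "small_valued F" and gen: "generated F"
  shows "\<exists>(I :: 'u set) N \<beta>. small TYPE('u) I \<and> (\<forall>i\<in>I. N i \<in> Mods) \<and>
    \<beta> \<in> nat_trans R (direct_sum I (\<lambda>i. mod_scheme R (N i))) F \<and>
    (\<forall>S\<in>Mods. \<beta> S ` el (direct_sum I (\<lambda>i. mod_scheme R (N i))) S = el F S)"
proof -
  obtain I :: "'u set" and N m where I: "small TYPE('u) I" and Nm: "\<forall>i\<in>I. N i \<in> Mods \<and> m i \<in> el F (N i)"
    and cov: "\<forall>S\<in>Mods. \<forall>x\<in>el F S. \<exists>i\<in>I. \<exists>h\<in>module_homs R (N i) S. on_mor F (N i) S h (m i) = x"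
    using cover_ex[OF F sm gen] by (elim exE conjE)
  let ?G = "\<lambda>i. mod_scheme R (N i)"
  define \<phi> where "\<phi> i = mk_nt (?G i) (\<lambda>S h. on_mor F (N i) S h (m i))" for i
  have G: "grp_ftr (?G i)" if "i \<in> I" for i using Nm that by (simp add: grp_ftr_mod_scheme)
  have \<phi>: "\<phi> i \<in> nat_trans R (?G i) F" if "i \<in> I" for i
    unfolding \<phi>_def using yoneda_nat_trans[OF F] Nm that by blast
  let ?\<beta> = "nt_copair I ?G F \<phi>"
  have \<beta>: "?\<beta> \<in> nat_trans R (direct_sum I ?G) F" by (rule nt_copair_nat_trans[OF G F \<phi>])
  have "?\<beta> S ` el (direct_sum I ?G) S = el F S" if S: "S \<in> Mods" for S
  proof
    show "?\<beta> S ` el (direct_sum I ?G) S \<subseteq> el F S" using nat_transD(4)[OF \<beta> S] by blast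
    show "el F S \<subseteq> ?\<beta> S ` el (direct_sum I ?G) S"
    proof
      fix x assume "x \<in> el F S"
      then obtain i h where i: "i \<in> I" and h: "h \<in> module_homs R (N i) S" "on_mor F (N i) S h (m i) = x"
        using cov S by blast
      have hG: "h \<in> el (?G i) S" using h by (simp add: mod_scheme_simps)
      let ?s = "single I (\<lambda>i. on_obj (?G i) S) i h"
      have s: "?s \<in> el (direct_sum I ?G) S"
        unfolding direct_sum_simps by (rule single_closed[where G = "\<lambda>i. on_obj (?G i) S", OF grp_ftrD(1)[OF G S] i hG])
      have "?\<beta> S ?s = copair I (on_obj F S) (\<lambda>i. \<phi> i S) ?s" by (rule nt_copair_apply[OF S s])
      also have "\<dots> = \<phi> i S h"
        by (rule copair_single[where G = "\<lambda>i. on_obj (?G i) S", OF grp_ftrD(1)[OF G S] grp_ftrD(1)[OF F S]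
              group_homsD(1)[OF nat_transD(1)[OF \<phi> S]] i hG])
      also have "\<dots> = x" using S hG h(2) by (simp add: \<phi>_def)
      finally show "x \<in> ?\<beta> S ` el (direct_sum I ?G) S" using s by blast
    qed
  qed
  with I Nm \<beta> show ?thesis by (intro exI[of _ I] exI[of _ N] exI[of _ ?\<beta>]) simp
qed

text \<open>Cover \<open>F\<close> by a direct sum of module schemes, and then cover the kernel, which is
  accessible again.\<close>

lemma accessible_imp_presentable:
  assumes F: "F \<in> objs (RR_Mod R :: ('r, 'u) ftr_cat)" and acc: "accessible F"
  shows "presentable R F"
proof -
  have gF: "grp_ftr F" and sF: "small_valued F" using F by (simp_all add: RR_Mod_iff)
  have gen: "generated F" using acc by (simp add: accessible_def)
  obtain J :: "'u set" and N' \<beta> where J: "small TYPE('u) J" and N': "\<forall>j\<in>J. N' j \<in> Mods"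
    and \<beta>: "\<beta> \<in> nat_trans R (direct_sum J (\<lambda>j. mod_scheme R (N' j))) F"
    and \<beta>s: "\<forall>S\<in>Mods. \<beta> S ` el (direct_sum J (\<lambda>j. mod_scheme R (N' j))) S = el F S"
    using cover_surj_ex[OF gF sF gen] by (elim exE conjE)
  let ?B = "direct_sum J (\<lambda>j. mod_scheme R (N' j))"
  have gG: "grp_ftr (mod_scheme R (N' j))" "small_valued (mod_scheme R (N' j))" "accessible (mod_scheme R (N' j))"
    if "j \<in> J" for j using N' that by (simp_all add: grp_ftr_mod_scheme small_valued_mod_scheme accessible_mod_scheme)
  have gB: "grp_ftr ?B" by (rule grp_ftr_direct_sum[OF gG(1)])
  have sB: "small_valued ?B" by (rule small_valued_direct_sum[OF J gG(1,2)])
  have aB: "accessible ?B" by (rule accessible_direct_sum[OF J gG(1,3)])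
  let ?K = "ker_ftr ?B F \<beta>"
  have gK: "grp_ftr ?K" and k: "mk_nt ?K (\<lambda>S x. x) \<in> nat_trans R ?K ?B"
    by (rule grp_ftr_ker_ftr[OF gB gF \<beta>], rule ker_ftr_incl[OF gB gF \<beta>])
  have sK: "small_valued ?K"
    unfolding small_valued_def
  proof
    fix S assume "S \<in> Mods"
    then have "small TYPE('u) (el ?B S)" using sB by (simp add: small_valued_def)
    then show "small TYPE('u) (el ?K S)" by (rule small_subset) (auto simp: el_ker_ftr)
  qed
  have aK: "accessible ?K"
  proof (rule accessible_kernel[OF gK gB gF \<beta> k _ _ aB])
    fix S assume S: "S \<in> Mods"
    show "inj_on (mk_nt ?K (\<lambda>S x. x) S) (el ?K S)" using S by (auto simp: inj_on_def)
    have "mk_nt ?K (\<lambda>S x. x) S ` el ?K S = el ?K S" using S by (auto simp: image_iff)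
    then show "mk_nt ?K (\<lambda>S x. x) S ` el ?K S = kernel (on_obj ?B S) (on_obj F S) (\<beta> S)"
      by (simp add: el_ker_ftr kernel_def)
  qed (use acc in \<open>simp add: accessible_def\<close>)
  obtain I :: "'u set" and N \<gamma> where I: "small TYPE('u) I" and N: "\<forall>i\<in>I. N i \<in> Mods"
    and \<gamma>: "\<gamma> \<in> nat_trans R (direct_sum I (\<lambda>i. mod_scheme R (N i))) ?K"
    and \<gamma>s: "\<forall>S\<in>Mods. \<gamma> S ` el (direct_sum I (\<lambda>i. mod_scheme R (N i))) S = el ?K S"
    using cover_surj_ex[OF gK sK conjunct1[OF aK[unfolded accessible_def]]] by (elim exE conjE)
  let ?A = "direct_sum I (\<lambda>i. mod_scheme R (N i))"
  have gA: "grp_ftr ?A" using N by (intro grp_ftr_direct_sum grp_ftr_mod_scheme) simp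
  let ?\<alpha> = "mk_nt ?A (\<lambda>S x. mk_nt ?K (\<lambda>S x. x) S (\<gamma> S x))"
  have \<alpha>: "?\<alpha> \<in> nat_trans R ?A ?B" by (rule nt_compose[OF gA \<gamma> k])
  have "?\<alpha> S ` el ?A S = kernel (on_obj ?B S) (on_obj F S) (\<beta> S)" if S: "S \<in> Mods" for S
  proof -
    have "?\<alpha> S x = \<gamma> S x" if "x \<in> el ?A S" for x using that S nat_transD(4)[OF \<gamma> S that] by simp
    then have "?\<alpha> S ` el ?A S = \<gamma> S ` el ?A S" by (rule image_cong[OF refl])
    also have "\<dots> = el ?K S" using \<gamma>s S by blast
    finally show ?thesis by (simp add: el_ker_ftr kernel_def)
  qed
  then have "right_exact_seq R ?A ?B F ?\<alpha> \<beta>" using \<alpha> \<beta> \<beta>s by (simp add: right_exact_seq_def)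
  with I J N N' show ?thesis unfolding presentable_def by blast
qed

text \<open>A cokernel of a map between direct sums of module schemes.\<close>

lemma presentable_imp_accessible:
  assumes F: "grp_ftr F" and "presentable R F"
  shows "accessible F"
proof -
  obtain I J :: "'u set" and N N' \<alpha> \<beta> where I: "small TYPE('u) I" and J: "small TYPE('u) J"
    and N: "\<forall>i\<in>I. N i \<in> Mods" and N': "\<forall>j\<in>J. N' j \<in> Mods"
    and ex: "right_exact_seq R (direct_sum I (\<lambda>i. mod_scheme R (N i))) (direct_sum J (\<lambda>j. mod_scheme R (N' j))) F \<alpha> \<beta>"
    using assms(2) unfolding presentable_def by (elim exE conjE)
  let ?A = "direct_sum I (\<lambda>i. mod_scheme R (N i))" and ?B = "direct_sum J (\<lambda>j. mod_scheme R (N' j))"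
  have "accessible ?A" by (rule accessible_direct_sum[OF I]) (use N in \<open>simp_all add: grp_ftr_mod_scheme accessible_mod_scheme\<close>)
  moreover have "accessible ?B" by (rule accessible_direct_sum[OF J]) (use N' in \<open>simp_all add: grp_ftr_mod_scheme accessible_mod_scheme\<close>)
  moreover have "grp_ftr ?A" "grp_ftr ?B" using N N' by (auto intro!: grp_ftr_direct_sum grp_ftr_mod_scheme)
  ultimately show ?thesis
    using ex F by (intro accessible_cokernel[of ?A ?B F \<alpha> \<beta>]) (auto simp: right_exact_seq_def accessible_def)
qed

lemma ModSch_objs_iff:
  "F \<in> objs (ModSch R :: ('r, 'u) ftr_cat) \<longleftrightarrow> F \<in> objs (RR_Mod R) \<and> accessible F"
  using accessible_imp_presentable[of F] presentable_imp_accessible[of F]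
  by (auto simp: ModSch_def full_subcat_def RR_Mod_iff)

text \<open>A natural transformation is determined by its values at the generating elements \<open>m i\<close>.\<close>

lemma small_nat_trans:
  assumes F: "grp_ftr F" "small_valued F" "generated F" and G: "small_valued G"
  shows "small TYPE('u) (nat_trans R F G)"
proof -
  obtain I :: "'u set" and N m where I: "small TYPE('u) I" and Nm: "\<forall>i\<in>I. N i \<in> Mods \<and> m i \<in> el F (N i)"
    and cov: "\<forall>S\<in>Mods. \<forall>x\<in>el F S. \<exists>i\<in>I. \<exists>h\<in>module_homs R (N i) S. on_mor F (N i) S h (m i) = x"
    using cover_ex[OF F] by (elim exE conjE)
  let ?f = "\<lambda>\<alpha>. \<lambda>i\<in>I. \<alpha> (N i) (m i)"
  have "inj_on ?f (nat_trans R F G)"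
  proof (rule inj_onI)
    fix \<alpha> \<beta> assume \<alpha>: "\<alpha> \<in> nat_trans R F G" and \<beta>: "\<beta> \<in> nat_trans R F G" and e: "?f \<alpha> = ?f \<beta>"
    show "\<alpha> = \<beta>"
    proof (rule nt_eqI[OF \<alpha> \<beta>])
      fix S x assume S: "S \<in> Mods" and "x \<in> el F S"
      then obtain i h where i: "i \<in> I" and h: "h \<in> module_homs R (N i) S" "on_mor F (N i) S h (m i) = x"
        using cov by blast
      have Ni: "N i \<in> Mods" "m i \<in> el F (N i)" using Nm i by auto
      have "\<alpha> (N i) (m i) = \<beta> (N i) (m i)" using fun_cong[OF e, of i] i by simp
      then show "\<alpha> S x = \<beta> S x"
        using nat_transD(2)[OF \<alpha> Ni(1) S h(1) Ni(2)] nat_transD(2)[OF \<beta> Ni(1) S h(1) Ni(2)] h(2) by simp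
    qed
  qed
  moreover have "?f ` nat_trans R F G \<subseteq> (\<Pi>\<^sub>E i\<in>I. el G (N i))"
    using nat_transD(4) Nm by fastforce
  moreover have "small TYPE('u) (\<Pi>\<^sub>E i\<in>I. el G (N i))"
    using I G Nm by (intro small_PiE) (auto simp: small_valued_def)
  ultimately show ?thesis by (rule small_inj)
qed

end

section \<open>Stability of the accessible functors\<close>

context small_ring
begin

abbreviation MS :: "('r, 'u) ftr_cat" where "MS \<equiv> ModSch R"

lemma ModSch_simps:
  "homs MS = nat_trans R" "cmp MS F G H \<beta> \<alpha> = mk_nt F (\<lambda>S x. \<beta> S (\<alpha> S x))" "ident MS F = mk_nt F (\<lambda>S x. x)"
  using cmp_RR_Mod ident_RR_Mod by (simp_all add: ModSch_def full_subcat_def RR_Mod_simps(1))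

lemma ModSchD:
  assumes "F \<in> objs MS"
  shows "grp_ftr F" "small_valued F" "accessible F" "F \<in> objs (RR_Mod R)" "S \<in> Mods \<Longrightarrow> on_obj F S \<in> objs Ab"
  using assms grp_ftrD(1)[of F S] by (auto simp: ModSch_objs_iff RR_Mod_iff Ab_objs small_valued_def)

lemma RR_Mod_Ab: "F \<in> objs (RR_Mod R :: ('r, 'u) ftr_cat) \<Longrightarrow> S \<in> Mods \<Longrightarrow> on_obj F S \<in> objs Ab"
  using grp_ftrD(1)[of F S] by (auto simp: RR_Mod_iff Ab_objs small_valued_def)

lemma stable_kernels_ModSch: "stable_kernels R (objs MS)"
  unfolding stable_kernels_def RR_Mod_simps(1)
proof (intro ballI impI)
  fix F G f K k assume F: "F \<in> objs MS" and G: "G \<in> objs MS" and f: "f \<in> nat_trans R F G"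
    and K: "K \<in> objs (RR_Mod R)" and k: "k \<in> nat_trans R K F"
    and ker: "\<forall>S\<in>Mods. is_kernel Ab (on_obj F S) (on_obj G S) (f S) (on_obj K S) (k S)"
  note D = Ab_kernelD[OF ModSchD(5)[OF F] ModSchD(5)[OF G] nat_transD(1)[OF f] bspec[OF ker]]
  have "accessible K"
    by (rule accessible_kernel[OF _ ModSchD(1)[OF F] ModSchD(1)[OF G] f k D ModSchD(3)[OF F]])
       (use K ModSchD(3)[OF G] in \<open>auto simp: RR_Mod_iff accessible_def\<close>)
  with K show "K \<in> objs MS" by (simp add: ModSch_objs_iff)
qed

lemma stable_cokernels_ModSch: "stable_cokernels R (objs MS)"
  unfolding stable_cokernels_def RR_Mod_simps(1)
proof (intro ballI impI)
  fix F G f Q q assume F: "F \<in> objs MS" and G: "G \<in> objs MS" and f: "f \<in> nat_trans R F G"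
    and Q: "Q \<in> objs (RR_Mod R)" and q: "q \<in> nat_trans R G Q"
    and coker: "\<forall>S\<in>Mods. is_cokernel Ab (on_obj F S) (on_obj G S) (f S) (on_obj Q S) (q S)"
  note D = Ab_cokernelD[OF ModSchD(5)[OF F] ModSchD(5)[OF G] nat_transD(1)[OF f] bspec[OF coker]]
  have "accessible Q"
    by (rule accessible_cokernel[OF ModSchD(1)[OF F] ModSchD(1)[OF G] _ f q D _ ModSchD(3)[OF G]])
       (use Q ModSchD(3)[OF F] in \<open>auto simp: RR_Mod_iff accessible_def\<close>)
  with Q show "Q \<in> objs MS" by (simp add: ModSch_objs_iff)
qed

lemma functor_diagram:
  assumes P: "P \<subseteq> objs (RR_Mod R)" and D: "is_functor J (full_subcat (RR_Mod R) P) D"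
  shows "ftr_diagram J D" "j \<in> objs J \<Longrightarrow> on_obj D j \<in> P"
  using assms by (auto simp: is_functor_def full_subcat_def ftr_diagram_def RR_Mod_simps(1))

lemma functor_eval:
  assumes P: "P \<subseteq> objs (RR_Mod R)" and J: "category J" and D: "is_functor J (full_subcat (RR_Mod R) P) D" and S: "S \<in> Mods"
  shows "is_functor J Ab (eval_at S D)"
  unfolding is_functor_def eval_at_simps
proof (intro conjI ballI)
  note dia = functor_diagram[OF P D]
  fix i assume i: "i \<in> objs J"
  show Di: "on_obj (on_obj D i) S \<in> objs Ab" using RR_Mod_Ab[OF _ S] dia(2)[OF i] P by blast
  have "on_mor D i i (ident J i) = ident (RR_Mod R) (on_obj D i)"
    using D i by (simp add: is_functor_def full_subcat_def)
  then show "on_mor D i i (ident J i) S = ident Ab (on_obj (on_obj D i) S)"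
    using S by (simp add: RR_Mod_simps Ab_simps)
  fix j assume j: "j \<in> objs J"
  show "on_mor D i j f S \<in> homs Ab (on_obj (on_obj D i) S) (on_obj (on_obj D j) S)" if "f \<in> homs J i j" for f
    using nat_transD(1)[OF ftr_diagramD(3)[OF dia(1) i j that] S] by (simp add: Ab_simps)
  fix k f g assume k: "k \<in> objs J" and f: "f \<in> homs J i j" and g: "g \<in> homs J j k"
  have "on_mor D i k (cmp J i j k g f) =
      cmp (RR_Mod R) (on_obj D i) (on_obj D j) (on_obj D k) (on_mor D j k g) (on_mor D i j f)"
    using D i j k f g by (simp add: is_functor_def full_subcat_def)
  then show "on_mor D i k (cmp J i j k g f) S = cmp Ab (on_obj (on_obj D i) S) (on_obj (on_obj D j) S)
      (on_obj (on_obj D k) S) (on_mor D j k g S) (on_mor D i j f S)"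
    using S by (simp add: RR_Mod_simps Ab_simps)
qed

lemma MS_sub: "objs MS \<subseteq> objs (RR_Mod R)" by (auto simp: ModSch_objs_iff)

text \<open>A colimit is the cokernel of \<open>nt_rels\<close>, a map between direct sums.\<close>

lemma accessible_colimit:
  assumes J: "small_category (J :: ('u, 'u) cat)" and D: "ftr_diagram J D" and L: "grp_ftr L"
    and colim: "colimit_ftr J D L \<iota>" and acc: "\<And>j. j \<in> objs J \<Longrightarrow> accessible (on_obj D j)"
  shows "accessible L"
proof (rule accessible_cokernel[OF _ _ L nt_rels_nat_trans[OF D] colimit_ftr_exact[OF D L colim]])
  note DD = ftr_diagramD[OF D]
  show "grp_ftr (direct_sum (arrows J) (\<lambda>a. on_obj D (fst a)))" by (rule grp_ftr_direct_sum[OF arrow_dom_ftr[OF D]])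
  show "grp_ftr (direct_sum (objs J) (on_obj D))" by (rule grp_ftr_direct_sum[OF DD(1)])
  have "accessible (direct_sum (arrows J) (\<lambda>a. on_obj D (fst a)))"
    by (rule accessible_direct_sum[OF small_arrows[OF J] arrow_dom_ftr[OF D]]) (use acc in \<open>auto simp: arrows_def\<close>)
  then show "generated (direct_sum (arrows J) (\<lambda>a. on_obj D (fst a)))" by (simp add: accessible_def)
  show "accessible (direct_sum (objs J) (on_obj D))"
    by (rule accessible_direct_sum[OF _ DD(1) acc]) (use J in \<open>simp_all add: small_category_def\<close>)
qed

lemma stable_limits_ModSch: "stable_limits R (objs MS)"
  unfolding stable_limits_def
proof (intro allI impI, elim conjE)
  fix J :: "('u, 'u) cat" and D L \<pi>
  assume J: "small_category J" and D: "is_functor J (full_subcat (RR_Mod R) (objs MS)) D"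
    and cone: "is_cone (RR_Mod R) J D L \<pi>"
    and lim: "\<forall>S\<in>Mods. is_limit Ab J (eval_at S D) (on_obj L S) (\<lambda>j. \<pi> j S)"
  note dia = functor_diagram[OF MS_sub D]
  have cJ: "category J" using J by (simp add: small_category_def)
  have L: "L \<in> objs (RR_Mod R)" and \<pi>: "\<And>j. j \<in> objs J \<Longrightarrow> \<pi> j \<in> nat_trans R L (on_obj D j)"
    using cone by (auto simp: is_cone_def RR_Mod_simps(1))
  have lf: "limit_ftr J D L \<pi>"
    using \<pi> Ab_limitD[OF J functor_eval[OF MS_sub cJ D] bspec[OF lim]] by (simp add: limit_ftr_def)
  have gL: "grp_ftr L" using L by (simp add: RR_Mod_iff)
  have aD: "accessible (on_obj D j)" if "j \<in> objs J" for j using dia(2)[OF that] by (simp add: ModSch_objs_iff)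
  have "accessible L" by (rule accessible_limit[OF J dia(1) gL lf aD])
  with L show "L \<in> objs MS" by (simp add: ModSch_objs_iff)
qed

lemma stable_colimits_ModSch: "stable_colimits R (objs MS)"
  unfolding stable_colimits_def
proof (intro allI impI, elim conjE)
  fix J :: "('u, 'u) cat" and D L \<iota>
  assume J: "small_category J" and D: "is_functor J (full_subcat (RR_Mod R) (objs MS)) D"
    and cocone: "is_cocone (RR_Mod R) J D L \<iota>"
    and colim: "\<forall>S\<in>Mods. is_colimit Ab J (eval_at S D) (on_obj L S) (\<lambda>j. \<iota> j S)"
  note dia = functor_diagram[OF MS_sub D]
  have cJ: "category J" using J by (simp add: small_category_def)
  have L: "L \<in> objs (RR_Mod R)" and \<iota>: "\<And>j. j \<in> objs J \<Longrightarrow> \<iota> j \<in> nat_trans R (on_obj D j) L"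
    using cocone by (auto simp: is_cocone_iff RR_Mod_simps(1))
  have lf: "colimit_ftr J D L \<iota>"
    using \<iota> Ab_colimitD[OF J functor_eval[OF MS_sub cJ D] bspec[OF colim]] by (simp add: colimit_ftr_def)
  have gL: "grp_ftr L" using L by (simp add: RR_Mod_iff)
  have aD: "accessible (on_obj D j)" if "j \<in> objs J" for j using dia(2)[OF that] by (simp add: ModSch_objs_iff)
  have "accessible L" by (rule accessible_colimit[OF J dia(1) gL lf aD])
  with L show "L \<in> objs MS" by (simp add: ModSch_objs_iff)
qed

lemma stable_isos_ModSch: "stable_isos R (objs MS)"
  unfolding stable_isos_def isomorphic_def RR_Mod_simps(1) cmp_RR_Mod ident_RR_Mod
proof (intro ballI impI, elim bexE conjE)
  fix F G f g assume F: "F \<in> objs MS" and G: "G \<in> objs (RR_Mod R)" and f: "f \<in> nat_trans R F G" and g: "g \<in> nat_trans R G F"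
    and gf: "mk_nt F (\<lambda>S x. g S (f S x)) = mk_nt F (\<lambda>S x. x)" and fg: "mk_nt G (\<lambda>S x. f S (g S x)) = mk_nt G (\<lambda>S x. x)"
  have gG: "grp_ftr G" using G by (simp add: RR_Mod_iff)
  have 1: "g S (f S x) = x" if "S \<in> Mods" "x \<in> el F S" for S x using fun_cong[OF fun_cong[OF gf, of S], of x] that by simp
  have 2: "f S (g S x) = x" if "S \<in> Mods" "x \<in> el G S" for S x using fun_cong[OF fun_cong[OF fg, of S], of x] that by simp
  have "accessible G"
  proof (rule accessible_iso[OF ModSchD(1)[OF F] gG f _ ModSchD(3)[OF F]])
    fix S assume S: "S \<in> Mods"
    show "bij_betw (f S) (el F S) (el G S)"
      by (rule bij_betw_byWitness[where f' = "g S"])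
         (use 1[OF S] 2[OF S] nat_transD(4)[OF f S] nat_transD(4)[OF g S] in auto)
  qed
  with G show "G \<in> objs MS" by (simp add: ModSch_objs_iff)
qed

lemma stable_containing_RR_ModSch: "stable_containing_RR R (objs MS)"
  unfolding stable_containing_RR_def
  using MS_sub RR_objs accessible_RR stable_kernels_ModSch stable_cokernels_ModSch stable_colimits_ModSch
    stable_limits_ModSch stable_isos_ModSch by (simp add: ModSch_objs_iff)

section \<open>The category of presentable functors\<close>

lemma category_ModSch: "category MS"
  unfolding category_def ModSch_simps
proof (intro conjI ballI)
  fix X assume X: "X \<in> objs MS"
  note gX = ModSchD(1)[OF X]
  show "mk_nt X (\<lambda>S x. x) \<in> nat_trans R X X" by (rule nt_id[OF gX])
  fix Y assume Y: "Y \<in> objs MS"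
  show "mk_nt X (\<lambda>S x. f S (mk_nt X (\<lambda>S x. x) S x)) = f" if f: "f \<in> nat_trans R X Y" for f
    unfolding compose_nt_eq_iff[OF f] by simp
  show "mk_nt X (\<lambda>S x. mk_nt Y (\<lambda>S x. x) S (f S x)) = f" if f: "f \<in> nat_trans R X Y" for f
    unfolding compose_nt_eq_iff[OF f] using nat_transD(4)[OF f] by simp
  fix Z assume Z: "Z \<in> objs MS"
  show "mk_nt X (\<lambda>S x. g S (f S x)) \<in> nat_trans R X Z" if "f \<in> nat_trans R X Y" "g \<in> nat_trans R Y Z" for f g
    by (rule nt_compose[OF gX that])
  fix W f g h assume W: "W \<in> objs MS" and f: "f \<in> nat_trans R X Y" and g: "g \<in> nat_trans R Y Z" and h: "h \<in> nat_trans R Z W"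
  show "mk_nt X (\<lambda>S x. mk_nt Y (\<lambda>S x. h S (g S x)) S (f S x)) = mk_nt X (\<lambda>S x. h S (mk_nt X (\<lambda>S x. g S (f S x)) S x))"
    using nat_transD(4)[OF f] by (auto simp: mk_nt_def fun_eq_iff)
qed

lemma locally_small_ModSch: "locally_small TYPE('u) MS"
  unfolding locally_small_def ModSch_simps
proof (intro ballI)
  fix X Y assume X: "X \<in> objs MS" and Y: "Y \<in> objs MS"
  show "small TYPE('u) (nat_trans R X Y)"
    by (rule small_nat_trans[OF ModSchD(1,2)[OF X] conjunct1[OF ModSchD(3)[OF X, unfolded accessible_def]] ModSchD(2)[OF Y]])
qed

lemma transport_ModSch:
  fixes F :: "('r, 'u, 'g) group_ftr"
  assumes F: "grp_ftr F" "small_valued F" "accessible F"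
  shows "\<exists>F' \<alpha> \<beta>. F' \<in> objs MS \<and> \<alpha> \<in> nat_trans R F F' \<and> \<beta> \<in> nat_trans R F' F \<and>
    (\<forall>S\<in>Mods. (\<forall>x\<in>el F S. \<beta> S (\<alpha> S x) = x) \<and> (\<forall>y\<in>el F' S. \<alpha> S (\<beta> S y) = y))"
proof -
  obtain F' :: "('r, 'u, 'u) group_ftr" and \<alpha> \<beta> where F': "F' \<in> objs (RR_Mod R)" and \<alpha>: "\<alpha> \<in> nat_trans R F F'"
    and \<beta>: "\<beta> \<in> nat_trans R F' F"
    and inv: "\<forall>S\<in>Mods. (\<forall>x\<in>el F S. \<beta> S (\<alpha> S x) = x) \<and> (\<forall>y\<in>el F' S. \<alpha> S (\<beta> S y) = y)"
    using transport_ftr[OF F(1,2)] by (elim exE conjE)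
  have gF': "grp_ftr F'" using F' by (simp add: RR_Mod_iff)
  have "accessible F'"
  proof (rule accessible_iso[OF F(1) gF' \<alpha> _ F(3)])
    fix S assume S: "S \<in> Mods"
    show "bij_betw (\<alpha> S) (el F S) (el F' S)"
      by (rule bij_betw_byWitness[where f' = "\<beta> S"])
         (use inv S nat_transD(4)[OF \<alpha> S] nat_transD(4)[OF \<beta> S] in auto)
  qed
  with F' \<alpha> \<beta> inv show ?thesis by (intro exI[of _ F'] exI[of _ \<alpha>] exI[of _ \<beta>]) (simp add: ModSch_objs_iff)
qed

lemma grp_ftr_one: "grp_ftr F \<Longrightarrow> S \<in> Mods \<Longrightarrow> \<one>\<^bsub>on_obj F S\<^esub> \<in> el F S"
  using grp_ftrD(1)[of F S] by (simp add: comm_group.axioms(2) group.is_monoid)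

text \<open>The empty direct sum.  The summand \<open>RR\<close> only determines its type.\<close>

lemma zero_ftr_ex: "\<exists>Z. Z \<in> objs MS \<and> (\<forall>S\<in>Mods. el Z S = {\<one>\<^bsub>on_obj Z S\<^esub>})"
proof -
  let ?F = "direct_sum ({} :: 'u set) (\<lambda>_. RR :: ('r, 'u, 'u) group_ftr)"
  have F: "grp_ftr ?F" "small_valued ?F" "accessible ?F"
    by (auto intro!: grp_ftr_direct_sum small_valued_direct_sum accessible_direct_sum small_finite)
  obtain Z \<alpha> \<beta> where Z: "Z \<in> objs MS" and \<alpha>: "\<alpha> \<in> nat_trans R ?F Z" and \<beta>: "\<beta> \<in> nat_trans R Z ?F"
    and inv: "\<forall>S\<in>Mods. (\<forall>x\<in>el ?F S. \<beta> S (\<alpha> S x) = x) \<and> (\<forall>y\<in>el Z S. \<alpha> S (\<beta> S y) = y)"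
    using transport_ModSch[OF F] by (elim exE conjE)
  have "el Z S = {\<one>\<^bsub>on_obj Z S\<^esub>}" if S: "S \<in> Mods" for S
  proof -
    have elF: "el ?F S = {\<lambda>_. undefined}" by (subst el_direct_sum) (use S in auto)
    have eq: "y = \<alpha> S (\<lambda>_. undefined)" if y: "y \<in> el Z S" for y
    proof -
      have "\<beta> S y = (\<lambda>_. undefined)" using nat_transD(4)[OF \<beta> S y] unfolding elF by simp
      then show ?thesis using bspec[OF conjunct2[OF bspec[OF inv S]] y] by simp
    qed
    have one: "\<one>\<^bsub>on_obj Z S\<^esub> \<in> el Z S" by (rule grp_ftr_one[OF ModSchD(1)[OF Z] S])
    show ?thesis
    proof (intro equalityI subsetI)
      show "y \<in> {\<one>\<^bsub>on_obj Z S\<^esub>}" if "y \<in> el Z S" for y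
        unfolding singleton_iff eq[OF that] eq[OF one] ..
      show "y \<in> el Z S" if "y \<in> {\<one>\<^bsub>on_obj Z S\<^esub>}" for y using that one by simp
    qed
  qed
  with Z show ?thesis by blast
qed

lemma zero_objectI:
  assumes Z: "Z \<in> objs MS" and triv: "\<And>S. S \<in> Mods \<Longrightarrow> el Z S = {\<one>\<^bsub>on_obj Z S\<^esub>}"
  shows "zero_object MS Z"
  unfolding zero_object_def ModSch_simps
proof (intro conjI Z ballI)
  note gZ = ModSchD(1)[OF Z]
  fix X assume X: "X \<in> objs MS"
  note gX = ModSchD(1)[OF X]
  show "\<exists>!f. f \<in> nat_trans R X Z"
  proof (rule ex1I[of _ "mk_nt X (\<lambda>S x. \<one>\<^bsub>on_obj Z S\<^esub>)"], rule nt_trivial[OF gX gZ])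
    fix f assume f: "f \<in> nat_trans R X Z"
    show "f = mk_nt X (\<lambda>S x. \<one>\<^bsub>on_obj Z S\<^esub>)"
      by (rule nt_eqI[OF f nt_trivial[OF gX gZ]]) (use nat_transD(4)[OF f] triv in force)
  qed
  show "\<exists>!f. f \<in> nat_trans R Z X"
  proof (rule ex1I[of _ "mk_nt Z (\<lambda>S x. \<one>\<^bsub>on_obj X S\<^esub>)"], rule nt_trivial[OF gZ gX])
    fix f assume f: "f \<in> nat_trans R Z X"
    show "f = mk_nt Z (\<lambda>S x. \<one>\<^bsub>on_obj X S\<^esub>)"
    proof (rule nt_eqI[OF f nt_trivial[OF gZ gX]])
      fix S x assume S: "S \<in> Mods" and x: "x \<in> el Z S"
      then have "x = \<one>\<^bsub>on_obj Z S\<^esub>" using triv by blast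
      then show "f S x = mk_nt Z (\<lambda>S x. \<one>\<^bsub>on_obj X S\<^esub>) S x" using nat_trans_one[OF f gZ gX S] S x by simp
    qed
  qed
qed

lemma zero_mor_ModSch:
  assumes X: "X \<in> objs MS" and Y: "Y \<in> objs MS"
  shows "zero_mor MS X Y f \<longleftrightarrow> f = mk_nt X (\<lambda>S x. \<one>\<^bsub>on_obj Y S\<^esub>)"
proof
  note gX = ModSchD(1)[OF X] and gY = ModSchD(1)[OF Y]
  assume "zero_mor MS X Y f"
  then obtain Z g h where Z: "zero_object MS Z" and g: "g \<in> nat_trans R X Z" and h: "h \<in> nat_trans R Z Y"
    and f: "f = mk_nt X (\<lambda>S x. h S (g S x))" unfolding zero_mor_def ModSch_simps by blast
  have ZM: "Z \<in> objs MS" and ex: "\<exists>!f. f \<in> nat_trans R Z Z" using Z by (auto simp: zero_object_def ModSch_simps)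
  note gZ = ModSchD(1)[OF ZM]
  have e: "mk_nt Z (\<lambda>S x. x) = mk_nt Z (\<lambda>S x. \<one>\<^bsub>on_obj Z S\<^esub>)" using ex nt_id[OF gZ] nt_trivial[OF gZ gZ] by blast
  have "z = \<one>\<^bsub>on_obj Z S\<^esub>" if "S \<in> Mods" "z \<in> el Z S" for S z
    using fun_cong[OF fun_cong[OF e, of S], of z] that by simp
  then have "h S (g S x) = \<one>\<^bsub>on_obj Y S\<^esub>" if "S \<in> Mods" "x \<in> el X S" for S x
    using nat_transD(4)[OF g that] nat_trans_one[OF h gZ gY that(1)] that(1) by metis
  then show "f = mk_nt X (\<lambda>S x. \<one>\<^bsub>on_obj Y S\<^esub>)" unfolding f by (auto simp: mk_nt_def fun_eq_iff)
next
  note gX = ModSchD(1)[OF X] and gY = ModSchD(1)[OF Y]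
  assume f: "f = mk_nt X (\<lambda>S x. \<one>\<^bsub>on_obj Y S\<^esub>)"
  obtain Z where Z: "Z \<in> objs MS" and triv: "\<forall>S\<in>Mods. el Z S = {\<one>\<^bsub>on_obj Z S\<^esub>}" using zero_ftr_ex by blast
  note gZ = ModSchD(1)[OF Z]
  have "zero_object MS Z" using zero_objectI[OF Z] triv by blast
  moreover have "f = mk_nt X (\<lambda>S x. mk_nt Z (\<lambda>S x. \<one>\<^bsub>on_obj Y S\<^esub>) S (mk_nt X (\<lambda>S x. \<one>\<^bsub>on_obj Z S\<^esub>) S x))"
    unfolding f using grp_ftr_one[OF gZ] by (auto simp: mk_nt_def fun_eq_iff)
  ultimately show "zero_mor MS X Y f"
    unfolding zero_mor_def ModSch_simps using nt_trivial[OF gX gZ] nt_trivial[OF gZ gY] by blast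
qed

lemma is_kernel_ModSch_iff:
  assumes Y: "Y \<in> objs MS"
  shows "is_kernel MS X Y f K k \<longleftrightarrow> K \<in> objs MS \<and> k \<in> nat_trans R K X \<and>
    mk_nt K (\<lambda>S x. f S (k S x)) = mk_nt K (\<lambda>S x. \<one>\<^bsub>on_obj Y S\<^esub>) \<and>
    (\<forall>T\<in>objs MS. \<forall>t\<in>nat_trans R T X. mk_nt T (\<lambda>S x. f S (t S x)) = mk_nt T (\<lambda>S x. \<one>\<^bsub>on_obj Y S\<^esub>) \<longrightarrow>
      (\<exists>!v. v \<in> nat_trans R T K \<and> mk_nt T (\<lambda>S x. k S (v S x)) = t))"
  unfolding is_kernel_def ModSch_simps using zero_mor_ModSch[OF _ Y] by (simp cong: conj_cong ball_cong)

lemma is_cokernel_ModSch_iff: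
  assumes X: "X \<in> objs MS"
  shows "is_cokernel MS X Y f Q q \<longleftrightarrow> Q \<in> objs MS \<and> q \<in> nat_trans R Y Q \<and>
    mk_nt X (\<lambda>S x. q S (f S x)) = mk_nt X (\<lambda>S x. \<one>\<^bsub>on_obj Q S\<^esub>) \<and>
    (\<forall>T\<in>objs MS. \<forall>t\<in>nat_trans R Y T. mk_nt X (\<lambda>S x. t S (f S x)) = mk_nt X (\<lambda>S x. \<one>\<^bsub>on_obj T S\<^esub>) \<longrightarrow>
      (\<exists>!v. v \<in> nat_trans R Q T \<and> mk_nt Y (\<lambda>S x. v S (q S x)) = t))"
  unfolding is_cokernel_iff ModSch_simps using zero_mor_ModSch[OF X] by (simp cong: conj_cong ball_cong)

lemma mk_nt_eqD: "mk_nt F \<alpha> = mk_nt F \<beta> \<Longrightarrow> S \<in> Mods \<Longrightarrow> x \<in> el F S \<Longrightarrow> \<alpha> S x = \<beta> S x"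
  by (metis mk_nt_apply)

lemma mk_nt_cong: "(\<And>S x. S \<in> Mods \<Longrightarrow> x \<in> el F S \<Longrightarrow> \<alpha> S x = \<beta> S x) \<Longrightarrow> mk_nt F \<alpha> = mk_nt F \<beta>"
  by (auto simp: mk_nt_def fun_eq_iff)

lemma ModSch_kernelI:
  assumes X: "X \<in> objs MS" and Y: "Y \<in> objs MS" and K: "K \<in> objs MS"
    and k: "k \<in> nat_trans R K X" and inj: "\<And>S. S \<in> Mods \<Longrightarrow> inj_on (k S) (el K S)"
    and im: "\<And>S. S \<in> Mods \<Longrightarrow> k S ` el K S = kernel (on_obj X S) (on_obj Y S) (f S)"
  shows "is_kernel MS X Y f K k"
  unfolding is_kernel_ModSch_iff[OF Y]
proof (intro conjI ballI impI K k)
  show "mk_nt K (\<lambda>S x. f S (k S x)) = mk_nt K (\<lambda>S x. \<one>\<^bsub>on_obj Y S\<^esub>)"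
  proof (rule mk_nt_cong)
    fix S x assume S: "S \<in> Mods" and x: "x \<in> el K S"
    then have "k S x \<in> kernel (on_obj X S) (on_obj Y S) (f S)" unfolding im[OF S, symmetric] by blast
    then show "f S (k S x) = \<one>\<^bsub>on_obj Y S\<^esub>" by (simp add: kernel_def)
  qed
  fix T t assume T: "T \<in> objs MS" and t: "t \<in> nat_trans R T X"
    and z: "mk_nt T (\<lambda>S x. f S (t S x)) = mk_nt T (\<lambda>S x. \<one>\<^bsub>on_obj Y S\<^esub>)"
  have "\<exists>!v. v \<in> nat_trans R T K \<and> (\<forall>j\<in>{()}. \<forall>S\<in>Mods. \<forall>x\<in>el T S. k S (v S x) = t S x)"
  proof (rule nt_jointly_mono_factor[OF ModSchD(1)[OF K] ModSchD(1)[OF T] k t])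
    fix S x assume S: "S \<in> Mods" and x: "x \<in> el T S"
    have "t S x \<in> kernel (on_obj X S) (on_obj Y S) (f S)"
      using mk_nt_eqD[OF z S x] nat_transD(4)[OF t S x] by (simp add: kernel_def)
    from this[folded im[OF S]] obtain g where g: "g \<in> el K S" "t S x = k S g" by blast
    show "\<exists>!g. g \<in> el K S \<and> (\<forall>j\<in>{()}. k S g = t S x)"
      by (rule ex1I[of _ g]) (use g inj_onD[OF inj[OF S]] in auto)
  qed
  then show "\<exists>!v. v \<in> nat_trans R T K \<and> mk_nt T (\<lambda>S x. k S (v S x)) = t"
    unfolding compose_nt_eq_iff[OF t] by simp
qed

lemma ModSch_cokernelI:
  assumes X: "X \<in> objs MS" and Y: "Y \<in> objs MS" and Q: "Q \<in> objs MS"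
    and f: "f \<in> nat_trans R X Y" and q: "q \<in> nat_trans R Y Q" and surj: "\<And>S. S \<in> Mods \<Longrightarrow> q S ` el Y S = el Q S"
    and ker: "\<And>S. S \<in> Mods \<Longrightarrow> kernel (on_obj Y S) (on_obj Q S) (q S) = f S ` el X S"
  shows "is_cokernel MS X Y f Q q"
  unfolding is_cokernel_ModSch_iff[OF X]
proof (intro conjI ballI impI Q q)
  show "mk_nt X (\<lambda>S x. q S (f S x)) = mk_nt X (\<lambda>S x. \<one>\<^bsub>on_obj Q S\<^esub>)"
  proof (rule mk_nt_cong)
    fix S x assume S: "S \<in> Mods" and x: "x \<in> el X S"
    then have "f S x \<in> kernel (on_obj Y S) (on_obj Q S) (q S)" unfolding ker[OF S] by blast
    then show "q S (f S x) = \<one>\<^bsub>on_obj Q S\<^esub>" by (simp add: kernel_def)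
  qed
  fix T t assume T: "T \<in> objs MS" and t: "t \<in> nat_trans R Y T"
    and z: "mk_nt X (\<lambda>S x. t S (f S x)) = mk_nt X (\<lambda>S x. \<one>\<^bsub>on_obj T S\<^esub>)"
  have "\<exists>!v. v \<in> nat_trans R Q T \<and> (\<forall>S\<in>Mods. \<forall>y\<in>el Y S. v S (q S y) = t S y)"
  proof (rule nt_epi_factor[OF ModSchD(1)[OF Y] ModSchD(1)[OF Q] ModSchD(1)[OF T] q surj t])
    fix S y assume S: "S \<in> Mods" and y: "y \<in> el Y S" "q S y = \<one>\<^bsub>on_obj Q S\<^esub>"
    then have "y \<in> kernel (on_obj Y S) (on_obj Q S) (q S)" by (simp add: kernel_def)
    then obtain x where "x \<in> el X S" "y = f S x" unfolding ker[OF S] by blast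
    then show "t S y = \<one>\<^bsub>on_obj T S\<^esub>" using mk_nt_eqD[OF z S] by simp
  qed
  then show "\<exists>!v. v \<in> nat_trans R Q T \<and> mk_nt Y (\<lambda>S x. v S (q S x)) = t"
    unfolding compose_nt_eq_iff[OF t] .
qed

lemma ModSch_kernel_ex:
  assumes X: "X \<in> objs MS" and Y: "Y \<in> objs MS" and f: "f \<in> nat_trans R X Y"
  shows "\<exists>K k. K \<in> objs MS \<and> k \<in> nat_trans R K X \<and> (\<forall>S\<in>Mods. inj_on (k S) (el K S) \<and>
    k S ` el K S = kernel (on_obj X S) (on_obj Y S) (f S))"
proof -
  note gX = ModSchD(1)[OF X] and gY = ModSchD(1)[OF Y]
  let ?K = "ker_ftr X Y f" and ?k = "mk_nt (ker_ftr X Y f) (\<lambda>S x. x)"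
  have gK: "grp_ftr ?K" by (rule grp_ftr_ker_ftr[OF gX gY f])
  have k: "?k \<in> nat_trans R ?K X" by (rule ker_ftr_incl[OF gX gY f])
  have sK: "small_valued ?K"
    unfolding small_valued_def
  proof
    fix S assume "S \<in> Mods"
    then have "small TYPE('u) (el X S)" using ModSchD(2)[OF X] by (simp add: small_valued_def)
    then show "small TYPE('u) (el ?K S)" by (rule small_subset) (auto simp: el_ker_ftr)
  qed
  have inj: "inj_on (?k S) (el ?K S)" and im: "?k S ` el ?K S = kernel (on_obj X S) (on_obj Y S) (f S)" if S: "S \<in> Mods" for S
  proof -
    show "inj_on (?k S) (el ?K S)" using S by (auto simp: inj_on_def)
    have "?k S ` el ?K S = el ?K S" using S by (auto simp: image_iff)
    then show "?k S ` el ?K S = kernel (on_obj X S) (on_obj Y S) (f S)" by (simp add: el_ker_ftr kernel_def)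
  qed
  have "accessible ?K"
    by (rule accessible_kernel[OF gK gX gY f k inj im ModSchD(3)[OF X]]) (use ModSchD(3)[OF Y] in \<open>simp_all add: accessible_def\<close>)
  then have "?K \<in> objs MS" using gK sK by (simp add: ModSch_objs_iff RR_Mod_iff)
  with k inj im show ?thesis by (intro exI[of _ ?K] exI[of _ ?k]) simp
qed

lemma ModSch_cokernel_ex:
  assumes X: "X \<in> objs MS" and Y: "Y \<in> objs MS" and f: "f \<in> nat_trans R X Y"
  shows "\<exists>Q q. Q \<in> objs MS \<and> q \<in> nat_trans R Y Q \<and> (\<forall>S\<in>Mods. q S ` el Y S = el Q S \<and>
    kernel (on_obj Y S) (on_obj Q S) (q S) = f S ` el X S)"
proof -
  obtain Q q where Q: "Q \<in> objs (RR_Mod R :: ('r, 'u) ftr_cat)" and q: "q \<in> nat_trans R Y Q"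
    and ex: "\<forall>S\<in>Mods. q S ` el Y S = el Q S \<and> kernel (on_obj Y S) (on_obj Q S) (q S) = f S ` el X S"
    using cokernel_ftr_ex[OF ModSchD(1)[OF X] ModSchD(1)[OF Y] ModSchD(2)[OF Y] f] by (elim exE conjE)
  have "accessible Q"
    by (rule accessible_cokernel[OF ModSchD(1)[OF X] ModSchD(1)[OF Y] _ f q _ _ _ ModSchD(3)[OF Y]])
       (use Q ex ModSchD(3)[OF X] in \<open>simp_all add: RR_Mod_iff accessible_def\<close>)
  with Q q ex show ?thesis by (intro exI[of _ Q] exI[of _ q]) (simp add: ModSch_objs_iff)
qed

text \<open>The composites of \<open>f\<close> with its kernel and with the zero map agree, so the kernel is
  zero.\<close>

lemma mono_objectwise_inj:
  assumes X: "X \<in> objs MS" and Y: "Y \<in> objs MS" and mono: "is_mono MS X Y f" and S: "S \<in> Mods"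
  shows "inj_on (f S) (el X S)"
proof -
  have f: "f \<in> nat_trans R X Y" using mono by (simp add: is_mono_def ModSch_simps)
  note gX = ModSchD(1)[OF X] and gY = ModSchD(1)[OF Y]
  obtain K k where K: "K \<in> objs MS" and k: "k \<in> nat_trans R K X"
    and ex: "\<forall>S\<in>Mods. inj_on (k S) (el K S) \<and> k S ` el K S = kernel (on_obj X S) (on_obj Y S) (f S)"
    using ModSch_kernel_ex[OF X Y f] by (elim exE conjE)
  note gK = ModSchD(1)[OF K]
  let ?z = "mk_nt K (\<lambda>S x. \<one>\<^bsub>on_obj X S\<^esub>)"
  have "mk_nt K (\<lambda>S x. f S (k S x)) = mk_nt K (\<lambda>S x. f S (?z S x))"
  proof (rule mk_nt_cong)
    fix S x assume S: "S \<in> Mods" and x: "x \<in> el K S"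
    then have "k S x \<in> kernel (on_obj X S) (on_obj Y S) (f S)" using ex by blast
    then show "f S (k S x) = f S (?z S x)" using nat_trans_one[OF f gX gY S] S x by (simp add: kernel_def)
  qed
  then have kz: "k = ?z" using mono K k nt_trivial[OF gK gX] unfolding is_mono_def ModSch_simps by blast
  show ?thesis
  proof (rule group_homs_inj[OF nat_transD(1)[OF f S] grp_ftrD(1)[OF gX S] grp_ftrD(1)[OF gY S]])
    fix x assume "x \<in> el X S" "f S x = \<one>\<^bsub>on_obj Y S\<^esub>"
    then have "x \<in> kernel (on_obj X S) (on_obj Y S) (f S)" by (simp add: kernel_def)
    then obtain y where "y \<in> el K S" "x = k S y" using ex S by blast
    then show "x = \<one>\<^bsub>on_obj X S\<^esub>" using kz S by simp
  qed
qed

text \<open>Dually, the cokernel of an epimorphism is zero.\<close>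

lemma epi_objectwise_surj:
  assumes X: "X \<in> objs MS" and Y: "Y \<in> objs MS" and epi: "is_epi MS X Y f" and S: "S \<in> Mods"
  shows "f S ` el X S = el Y S"
proof -
  have f: "f \<in> nat_trans R X Y" using epi by (simp add: is_epi_iff ModSch_simps)
  note gY = ModSchD(1)[OF Y]
  obtain Q q where Q: "Q \<in> objs MS" and q: "q \<in> nat_trans R Y Q"
    and ex: "\<forall>S\<in>Mods. q S ` el Y S = el Q S \<and> kernel (on_obj Y S) (on_obj Q S) (q S) = f S ` el X S"
    using ModSch_cokernel_ex[OF X Y f] by (elim exE conjE)
  note gQ = ModSchD(1)[OF Q]
  let ?z = "mk_nt Y (\<lambda>S x. \<one>\<^bsub>on_obj Q S\<^esub>)"
  have "mk_nt X (\<lambda>S x. q S (f S x)) = mk_nt X (\<lambda>S x. ?z S (f S x))"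
  proof (rule mk_nt_cong)
    fix S x assume S: "S \<in> Mods" and x: "x \<in> el X S"
    then have "f S x \<in> kernel (on_obj Y S) (on_obj Q S) (q S)" using ex by blast
    then show "q S (f S x) = ?z S (f S x)" using S x nat_transD(4)[OF f S x] by (simp add: kernel_def)
  qed
  then have qz: "q = ?z" using epi Q q nt_trivial[OF gY gQ] unfolding is_epi_iff ModSch_simps by blast
  have "kernel (on_obj Y S) (on_obj Q S) (q S) = el Y S" unfolding qz using S by (auto simp: kernel_def)
  then show ?thesis using ex S by blast
qed

definition nt_group :: "('r, 'u, 'u) group_ftr \<Rightarrow> ('r, 'u, 'u) group_ftr \<Rightarrow> (('r, 'u) module \<Rightarrow> 'u \<Rightarrow> 'u) monoid" where
  "nt_group X Y = \<lparr>carrier = nat_trans R X Y,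
     monoid.mult = (\<lambda>\<alpha> \<beta>. mk_nt X (\<lambda>S x. \<alpha> S x \<otimes>\<^bsub>on_obj Y S\<^esub> \<beta> S x)),
     one = mk_nt X (\<lambda>S x. \<one>\<^bsub>on_obj Y S\<^esub>)\<rparr>"

lemma nt_mult:
  assumes X: "grp_ftr X" and Y: "grp_ftr Y" and \<alpha>: "\<alpha> \<in> nat_trans R X Y" and \<beta>: "\<beta> \<in> nat_trans R X Y"
  shows "mk_nt X (\<lambda>S x. \<alpha> S x \<otimes>\<^bsub>on_obj Y S\<^esub> \<beta> S x) \<in> nat_trans R X Y"
proof (rule mk_nt_nat_trans[OF X])
  fix S assume S: "S \<in> Mods"
  interpret Y: comm_group "on_obj Y S" by (rule grp_ftrD(1)[OF Y S])
  show "(\<lambda>x. \<alpha> S x \<otimes>\<^bsub>on_obj Y S\<^esub> \<beta> S x) \<in> hom (on_obj X S) (on_obj Y S)"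
  proof (rule homI)
    fix x y assume x: "x \<in> el X S" and y: "y \<in> el X S"
    show "\<alpha> S (x \<otimes>\<^bsub>on_obj X S\<^esub> y) \<otimes>\<^bsub>on_obj Y S\<^esub> \<beta> S (x \<otimes>\<^bsub>on_obj X S\<^esub> y) =
      (\<alpha> S x \<otimes>\<^bsub>on_obj Y S\<^esub> \<beta> S x) \<otimes>\<^bsub>on_obj Y S\<^esub> (\<alpha> S y \<otimes>\<^bsub>on_obj Y S\<^esub> \<beta> S y)"
      unfolding nat_transD(5)[OF \<alpha> S x y] nat_transD(5)[OF \<beta> S x y]
      using nat_transD(4)[OF \<alpha> S x] nat_transD(4)[OF \<beta> S x] nat_transD(4)[OF \<alpha> S y] nat_transD(4)[OF \<beta> S y]
      by (simp add: Y.m_ac)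
  qed (use nat_transD(4)[OF \<alpha> S] nat_transD(4)[OF \<beta> S] in simp)
  fix T f x assume T: "T \<in> Mods" and f: "f \<in> module_homs R S T" and x: "x \<in> el X S"
  show "\<alpha> T (on_mor X S T f x) \<otimes>\<^bsub>on_obj Y T\<^esub> \<beta> T (on_mor X S T f x) = on_mor Y S T f (\<alpha> S x \<otimes>\<^bsub>on_obj Y S\<^esub> \<beta> S x)"
    unfolding nat_transD(2)[OF \<alpha> S T f x] nat_transD(2)[OF \<beta> S T f x]
    by (rule group_homsD(4)[OF grp_ftrD(2)[OF Y S T f] nat_transD(4)[OF \<alpha> S x] nat_transD(4)[OF \<beta> S x], symmetric])
qed

lemma nt_inverse:
  assumes X: "grp_ftr X" and Y: "grp_ftr Y" and \<alpha>: "\<alpha> \<in> nat_trans R X Y"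
  shows "mk_nt X (\<lambda>S x. inv\<^bsub>on_obj Y S\<^esub> \<alpha> S x) \<in> nat_trans R X Y"
proof (rule mk_nt_nat_trans[OF X])
  fix S assume S: "S \<in> Mods"
  interpret Y: comm_group "on_obj Y S" by (rule grp_ftrD(1)[OF Y S])
  show "(\<lambda>x. inv\<^bsub>on_obj Y S\<^esub> \<alpha> S x) \<in> hom (on_obj X S) (on_obj Y S)"
  proof (rule homI)
    fix x y assume x: "x \<in> el X S" and y: "y \<in> el X S"
    show "inv\<^bsub>on_obj Y S\<^esub> \<alpha> S (x \<otimes>\<^bsub>on_obj X S\<^esub> y) = inv\<^bsub>on_obj Y S\<^esub> \<alpha> S x \<otimes>\<^bsub>on_obj Y S\<^esub> inv\<^bsub>on_obj Y S\<^esub> \<alpha> S y"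
      unfolding nat_transD(5)[OF \<alpha> S x y] by (rule Y.inv_mult[OF nat_transD(4)[OF \<alpha> S x] nat_transD(4)[OF \<alpha> S y]])
  qed (use nat_transD(4)[OF \<alpha> S] in simp)
  fix T f x assume T: "T \<in> Mods" and f: "f \<in> module_homs R S T" and x: "x \<in> el X S"
  show "inv\<^bsub>on_obj Y T\<^esub> \<alpha> T (on_mor X S T f x) = on_mor Y S T f (inv\<^bsub>on_obj Y S\<^esub> \<alpha> S x)"
    unfolding nat_transD(2)[OF \<alpha> S T f x]
    by (rule group_homs_inv[OF grp_ftrD(2)[OF Y S T f] grp_ftrD(1)[OF Y S] grp_ftrD(1)[OF Y T] nat_transD(4)[OF \<alpha> S x], symmetric])
qed

lemma comm_group_nt_group:
  assumes X: "grp_ftr X" and Y: "grp_ftr Y" shows "comm_group (nt_group X Y)"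
proof (rule comm_groupI)
  show "\<one>\<^bsub>nt_group X Y\<^esub> \<in> carrier (nt_group X Y)" using nt_trivial[OF X Y] by (simp add: nt_group_def)
  fix \<alpha> assume "\<alpha> \<in> carrier (nt_group X Y)"
  then have \<alpha>: "\<alpha> \<in> nat_trans R X Y" by (simp add: nt_group_def)
  have "\<one>\<^bsub>on_obj Y S\<^esub> \<otimes>\<^bsub>on_obj Y S\<^esub> \<alpha> S x = \<alpha> S x" if "S \<in> Mods" "x \<in> el X S" for S x
    using grp_ftrD(1)[OF Y that(1)] nat_transD(4)[OF \<alpha> that] by (simp add: comm_groupE(5))
  then show "\<one>\<^bsub>nt_group X Y\<^esub> \<otimes>\<^bsub>nt_group X Y\<^esub> \<alpha> = \<alpha>"
    by (simp add: nt_group_def compose_nt_eq_iff[OF \<alpha>])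
  let ?\<gamma> = "mk_nt X (\<lambda>S x. inv\<^bsub>on_obj Y S\<^esub> \<alpha> S x)"
  have "?\<gamma> \<in> carrier (nt_group X Y)" using nt_inverse[OF X Y \<alpha>] by (simp add: nt_group_def)
  moreover have "?\<gamma> \<otimes>\<^bsub>nt_group X Y\<^esub> \<alpha> = \<one>\<^bsub>nt_group X Y\<^esub>"
    unfolding nt_group_def monoid.simps
  proof (rule mk_nt_cong)
    fix S x assume S: "S \<in> Mods" and x: "x \<in> el X S"
    interpret Y: comm_group "on_obj Y S" by (rule grp_ftrD(1)[OF Y S])
    show "?\<gamma> S x \<otimes>\<^bsub>on_obj Y S\<^esub> \<alpha> S x = \<one>\<^bsub>on_obj Y S\<^esub>" using S x nat_transD(4)[OF \<alpha> S x] by simp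
  qed
  ultimately show "\<exists>\<gamma>\<in>carrier (nt_group X Y). \<gamma> \<otimes>\<^bsub>nt_group X Y\<^esub> \<alpha> = \<one>\<^bsub>nt_group X Y\<^esub>" by blast
  fix \<beta> assume "\<beta> \<in> carrier (nt_group X Y)"
  then have \<beta>: "\<beta> \<in> nat_trans R X Y" by (simp add: nt_group_def)
  show "\<alpha> \<otimes>\<^bsub>nt_group X Y\<^esub> \<beta> \<in> carrier (nt_group X Y)" using nt_mult[OF X Y \<alpha> \<beta>] by (simp add: nt_group_def)
  show "\<alpha> \<otimes>\<^bsub>nt_group X Y\<^esub> \<beta> = \<beta> \<otimes>\<^bsub>nt_group X Y\<^esub> \<alpha>"
    unfolding nt_group_def monoid.simps
  proof (rule mk_nt_cong)
    fix S x assume S: "S \<in> Mods" and x: "x \<in> el X S"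
    interpret Y: comm_group "on_obj Y S" by (rule grp_ftrD(1)[OF Y S])
    show "\<alpha> S x \<otimes>\<^bsub>on_obj Y S\<^esub> \<beta> S x = \<beta> S x \<otimes>\<^bsub>on_obj Y S\<^esub> \<alpha> S x"
      by (rule Y.m_comm[OF nat_transD(4)[OF \<alpha> S x] nat_transD(4)[OF \<beta> S x]])
  qed
  fix \<gamma> assume "\<gamma> \<in> carrier (nt_group X Y)"
  then have \<gamma>: "\<gamma> \<in> nat_trans R X Y" by (simp add: nt_group_def)
  show "\<alpha> \<otimes>\<^bsub>nt_group X Y\<^esub> \<beta> \<otimes>\<^bsub>nt_group X Y\<^esub> \<gamma> = \<alpha> \<otimes>\<^bsub>nt_group X Y\<^esub> (\<beta> \<otimes>\<^bsub>nt_group X Y\<^esub> \<gamma>)"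
    unfolding nt_group_def monoid.simps
  proof (rule mk_nt_cong)
    fix S x assume S: "S \<in> Mods" and x: "x \<in> el X S"
    interpret Y: comm_group "on_obj Y S" by (rule grp_ftrD(1)[OF Y S])
    show "mk_nt X (\<lambda>S x. \<alpha> S x \<otimes>\<^bsub>on_obj Y S\<^esub> \<beta> S x) S x \<otimes>\<^bsub>on_obj Y S\<^esub> \<gamma> S x =
      \<alpha> S x \<otimes>\<^bsub>on_obj Y S\<^esub> mk_nt X (\<lambda>S x. \<beta> S x \<otimes>\<^bsub>on_obj Y S\<^esub> \<gamma> S x) S x"
      using S x Y.m_assoc[OF nat_transD(4)[OF \<alpha> S x] nat_transD(4)[OF \<beta> S x] nat_transD(4)[OF \<gamma> S x]] by simp
  qed
qed

lemma preadditive_ModSch: "preadditive MS nt_group"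
  unfolding preadditive_def ModSch_simps
proof (intro conjI ballI)
  fix X Y assume X: "X \<in> objs MS" and Y: "Y \<in> objs MS"
  show "comm_group (nt_group X Y)" by (rule comm_group_nt_group[OF ModSchD(1)[OF X] ModSchD(1)[OF Y]])
  show "carrier (nt_group X Y) = nat_trans R X Y" by (simp add: nt_group_def)
  fix Z f f' g g' assume Z: "Z \<in> objs MS" and f: "f \<in> nat_trans R X Y" and f': "f' \<in> nat_trans R X Y"
    and g: "g \<in> nat_trans R Y Z" and g': "g' \<in> nat_trans R Y Z"
  show "mk_nt X (\<lambda>S x. g S ((f \<otimes>\<^bsub>nt_group X Y\<^esub> f') S x)) =
      mk_nt X (\<lambda>S x. g S (f S x)) \<otimes>\<^bsub>nt_group X Z\<^esub> mk_nt X (\<lambda>S x. g S (f' S x))"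
    unfolding nt_group_def monoid.simps
    by (rule mk_nt_cong) (simp add: nat_transD(5)[OF g _ nat_transD(4)[OF f] nat_transD(4)[OF f']])
  show "mk_nt X (\<lambda>S x. (g \<otimes>\<^bsub>nt_group Y Z\<^esub> g') S (f S x)) =
      mk_nt X (\<lambda>S x. g S (f S x)) \<otimes>\<^bsub>nt_group X Z\<^esub> mk_nt X (\<lambda>S x. g' S (f S x))"
    unfolding nt_group_def monoid.simps
    by (rule mk_nt_cong) (simp add: nat_transD(4)[OF f])
qed

text \<open>The direct sum indexed by the two booleans, moved to \<open>'u\<close>.\<close>

lemma biproduct_ModSch:
  assumes X: "X \<in> objs MS" and Y: "Y \<in> objs MS"
  shows "has_biproduct MS nt_group X Y"
proof -
  let ?G = "\<lambda>b :: bool. if b then X else Y"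
  let ?F = "direct_sum UNIV ?G"
  note gX = ModSchD(1)[OF X] and gY = ModSchD(1)[OF Y]
  have G: "grp_ftr (?G b)" "small_valued (?G b)" "accessible (?G b)" for b
    using ModSchD(1,2,3)[OF X] ModSchD(1,2,3)[OF Y] by auto
  have sB: "small TYPE('u) (UNIV :: bool set)" by (simp add: small_finite)
  have F: "grp_ftr ?F" "small_valued ?F" "accessible ?F"
    by (rule grp_ftr_direct_sum[OF G(1)], rule small_valued_direct_sum[OF sB G(1,2)], rule accessible_direct_sum[OF sB G(1,3)])
  obtain B \<alpha> \<beta> where B: "B \<in> objs MS" and \<alpha>: "\<alpha> \<in> nat_trans R ?F B" and \<beta>: "\<beta> \<in> nat_trans R B ?F"
    and inv: "\<forall>S\<in>Mods. (\<forall>x\<in>el ?F S. \<beta> S (\<alpha> S x) = x) \<and> (\<forall>y\<in>el B S. \<alpha> S (\<beta> S y) = y)"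
    using transport_ModSch[OF F] by (elim exE conjE)
  note gB = ModSchD(1)[OF B]
  have sX: "nt_single UNIV ?G True \<in> nat_trans R X ?F" and sY: "nt_single UNIV ?G False \<in> nat_trans R Y ?F"
    using nt_single_nat_trans[of UNIV ?G True, OF G(1)] nt_single_nat_trans[of UNIV ?G False, OF G(1)] by simp_all
  have pX: "mk_nt ?F (\<lambda>S x. x True) \<in> nat_trans R ?F X" and pY: "mk_nt ?F (\<lambda>S x. x False) \<in> nat_trans R ?F Y"
    using nt_proj_nat_trans[of UNIV ?G True, OF G(1)] nt_proj_nat_trans[of UNIV ?G False, OF G(1)] by simp_all
  define i where "i = mk_nt X (\<lambda>S x. \<alpha> S (nt_single UNIV ?G True S x))"
  define j where "j = mk_nt Y (\<lambda>S x. \<alpha> S (nt_single UNIV ?G False S x))"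
  define p where "p = mk_nt B (\<lambda>S x. mk_nt ?F (\<lambda>S x. x True) S (\<beta> S x))"
  define q where "q = mk_nt B (\<lambda>S x. mk_nt ?F (\<lambda>S x. x False) S (\<beta> S x))"
  have i: "i \<in> nat_trans R X B" unfolding i_def by (rule nt_compose[OF gX sX \<alpha>])
  have j: "j \<in> nat_trans R Y B" unfolding j_def by (rule nt_compose[OF gY sY \<alpha>])
  have p: "p \<in> nat_trans R B X" unfolding p_def by (rule nt_compose[OF gB \<beta> pX])
  have q: "q \<in> nat_trans R B Y" unfolding q_def by (rule nt_compose[OF gB \<beta> pY])
  have ix: "\<beta> S (i S x) = (\<lambda>b. if b then x else \<one>\<^bsub>on_obj Y S\<^esub>)" if S: "S \<in> Mods" and x: "x \<in> el X S" for S x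
  proof -
    have "\<beta> S (i S x) = nt_single UNIV ?G True S x"
      unfolding i_def using S x bspec[OF conjunct1[OF bspec[OF inv S]] nat_transD(4)[OF sX S x]] by simp
    also have "\<dots> = (\<lambda>b. if b then x else \<one>\<^bsub>on_obj Y S\<^esub>)"
      using S x by (subst nt_single_apply) (auto simp: single_def fun_eq_iff)
    finally show ?thesis .
  qed
  have jy: "\<beta> S (j S y) = (\<lambda>b. if b then \<one>\<^bsub>on_obj X S\<^esub> else y)" if S: "S \<in> Mods" and y: "y \<in> el Y S" for S y
  proof -
    have "\<beta> S (j S y) = nt_single UNIV ?G False S y"
      unfolding j_def using S y bspec[OF conjunct1[OF bspec[OF inv S]] nat_transD(4)[OF sY S y]] by simp
    also have "\<dots> = (\<lambda>b. if b then \<one>\<^bsub>on_obj X S\<^esub> else y)"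
      using S y by (subst nt_single_apply) (auto simp: single_def fun_eq_iff)
    finally show ?thesis .
  qed
  have px: "p S b = \<beta> S b True" and qx: "q S b = \<beta> S b False" if S: "S \<in> Mods" and b: "b \<in> el B S" for S b
    using S b nat_transD(4)[OF \<beta> S b] by (simp_all add: p_def q_def)
  have e1: "mk_nt X (\<lambda>S x. p S (i S x)) = mk_nt X (\<lambda>S x. x)"
    by (rule mk_nt_cong) (simp add: px ix nat_transD(4)[OF i])
  have e2: "mk_nt Y (\<lambda>S x. q S (j S x)) = mk_nt Y (\<lambda>S x. x)"
    by (rule mk_nt_cong) (simp add: qx jy nat_transD(4)[OF j])
  have e3: "mk_nt X (\<lambda>S x. q S (i S x)) = mk_nt X (\<lambda>S x. \<one>\<^bsub>on_obj Y S\<^esub>)"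
    by (rule mk_nt_cong) (simp add: qx ix nat_transD(4)[OF i])
  have e4: "mk_nt Y (\<lambda>S x. p S (j S x)) = mk_nt Y (\<lambda>S x. \<one>\<^bsub>on_obj X S\<^esub>)"
    by (rule mk_nt_cong) (simp add: px jy nat_transD(4)[OF j])
  have e5: "mk_nt B (\<lambda>S x. mk_nt B (\<lambda>S x. i S (p S x)) S x \<otimes>\<^bsub>on_obj B S\<^esub> mk_nt B (\<lambda>S x. j S (q S x)) S x) = mk_nt B (\<lambda>S x. x)"
  proof (rule mk_nt_cong)
    fix S b assume S: "S \<in> Mods" and b: "b \<in> el B S"
    have pb: "p S b \<in> el X S" and qb: "q S b \<in> el Y S" using nat_transD(4)[OF p S b] nat_transD(4)[OF q S b] .
    have ip: "i S (p S b) \<in> el B S" and jq: "j S (q S b) \<in> el B S" using nat_transD(4)[OF i S pb] nat_transD(4)[OF j S qb] .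
    interpret BS: comm_group "on_obj B S" by (rule grp_ftrD(1)[OF gB S])
    interpret XS: comm_group "on_obj X S" by (rule grp_ftrD(1)[OF gX S])
    interpret YS: comm_group "on_obj Y S" by (rule grp_ftrD(1)[OF gY S])
    have "\<beta> S (i S (p S b) \<otimes>\<^bsub>on_obj B S\<^esub> j S (q S b)) = \<beta> S (i S (p S b)) \<otimes>\<^bsub>on_obj ?F S\<^esub> \<beta> S (j S (q S b))"
      by (rule nat_transD(5)[OF \<beta> S ip jq])
    also have "\<dots> = \<beta> S b"
      unfolding ix[OF S pb] jy[OF S qb] direct_sum_simps mult_sum_group
      using pb qb px[OF S b] qx[OF S b] by (auto simp: fun_eq_iff)
    finally have "\<beta> S (i S (p S b) \<otimes>\<^bsub>on_obj B S\<^esub> j S (q S b)) = \<beta> S b" .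
    moreover have "\<alpha> S (\<beta> S c) = c" if "c \<in> el B S" for c using inv S that by blast
    ultimately have "i S (p S b) \<otimes>\<^bsub>on_obj B S\<^esub> j S (q S b) = b" using b BS.m_closed[OF ip jq] by metis
    then show "mk_nt B (\<lambda>S x. i S (p S x)) S b \<otimes>\<^bsub>on_obj B S\<^esub> mk_nt B (\<lambda>S x. j S (q S x)) S b = b" using S b by simp
  qed
  show ?thesis
    unfolding has_biproduct_def ModSch_simps
    by (rule bexI[OF _ B], rule bexI[OF _ i], rule bexI[OF _ j], rule bexI[OF _ p], rule bexI[OF _ q])
       (use e1 e2 e3 e4 e5 in \<open>simp add: nt_group_def\<close>)
qed

lemma abelian_category_ModSch: "abelian_category MS"
  unfolding abelian_category_def additive_category_def
proof (intro conjI ballI allI impI category_ModSch)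
  show "\<exists>Z. zero_object MS Z" using zero_ftr_ex zero_objectI by blast
  show "\<exists>A. preadditive MS A \<and> (\<forall>X\<in>objs MS. \<forall>Y\<in>objs MS. has_biproduct MS A X Y)"
    using preadditive_ModSch biproduct_ModSch by blast
  fix X Y assume X: "X \<in> objs MS" and Y: "Y \<in> objs MS"
  {
    fix f assume "f \<in> homs MS X Y"
    then have f: "f \<in> nat_trans R X Y" by (simp add: ModSch_simps)
    obtain K k where K: "K \<in> objs MS" "k \<in> nat_trans R K X"
      and ex: "\<forall>S\<in>Mods. inj_on (k S) (el K S) \<and> k S ` el K S = kernel (on_obj X S) (on_obj Y S) (f S)"
      using ModSch_kernel_ex[OF X Y f] by (elim exE conjE)
    have "is_kernel MS X Y f K k" by (rule ModSch_kernelI[OF X Y K]) (use ex in blast)+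
    then show "\<exists>K k. is_kernel MS X Y f K k" by blast
    obtain Q q where Q: "Q \<in> objs MS" "q \<in> nat_trans R Y Q"
      and ex: "\<forall>S\<in>Mods. q S ` el Y S = el Q S \<and> kernel (on_obj Y S) (on_obj Q S) (q S) = f S ` el X S"
      using ModSch_cokernel_ex[OF X Y f] by (elim exE conjE)
    have "is_cokernel MS X Y f Q q" by (rule ModSch_cokernelI[OF X Y Q(1) f Q(2)]) (use ex in blast)+
    then show "\<exists>Q q. is_cokernel MS X Y f Q q" by blast
  }
  {
    fix f assume mono: "is_mono MS X Y f"
    then have f: "f \<in> nat_trans R X Y" by (simp add: is_mono_def ModSch_simps)
    obtain Q q where Q: "Q \<in> objs MS" and q: "q \<in> nat_trans R Y Q"
      and ex: "\<forall>S\<in>Mods. q S ` el Y S = el Q S \<and> kernel (on_obj Y S) (on_obj Q S) (q S) = f S ` el X S"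
      using ModSch_cokernel_ex[OF X Y f] by (elim exE conjE)
    have "is_kernel MS Y Q q X f"
      by (rule ModSch_kernelI[OF Y Q X f mono_objectwise_inj[OF X Y mono]]) (use ex in simp_all)
    then show "\<exists>Z\<in>objs MS. \<exists>g\<in>homs MS Y Z. is_kernel MS Y Z g X f"
      using Q q unfolding ModSch_simps by blast
  }
  {
    fix f assume epi: "is_epi MS X Y f"
    then have f: "f \<in> nat_trans R X Y" by (simp add: is_epi_iff ModSch_simps)
    obtain K k where K: "K \<in> objs MS" and k: "k \<in> nat_trans R K X"
      and ex: "\<forall>S\<in>Mods. inj_on (k S) (el K S) \<and> k S ` el K S = kernel (on_obj X S) (on_obj Y S) (f S)"
      using ModSch_kernel_ex[OF X Y f] by (elim exE conjE)
    have "is_cokernel MS K X k Y f"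
      by (rule ModSch_cokernelI[OF K X Y k f epi_objectwise_surj[OF X Y epi]]) (use ex in simp_all)
    then show "\<exists>W\<in>objs MS. \<exists>g\<in>homs MS W X. is_cokernel MS W X g Y f"
      using K k unfolding ModSch_simps by blast
  }
qed

lemma ModSch_limitI:
  assumes D: "ftr_diagram J D" and L: "L \<in> objs MS" and lim: "limit_ftr J D L \<pi>"
  shows "is_limit MS J D L \<pi>"
  unfolding is_limit_def
proof (intro conjI allI impI)
  have \<pi>: "\<And>j. j \<in> objs J \<Longrightarrow> \<pi> j \<in> nat_trans R L (on_obj D j)"
    and lg: "\<And>S. S \<in> Mods \<Longrightarrow> limit_group J (eval_at S D) (on_obj L S) (\<lambda>j. \<pi> j S)"
    using lim by (auto simp: limit_ftr_def)
  have comp: "compatible J (eval_at S D) (\<lambda>j. \<pi> j S g)" if "S \<in> Mods" "g \<in> el L S" for S g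
    using lg[OF that(1)] that(2) by (simp add: limit_group_def)
  show "is_cone MS J D L \<pi>"
    unfolding is_cone_def ModSch_simps
  proof (intro conjI ballI L \<pi>)
    fix i j f assume ij: "i \<in> objs J" "j \<in> objs J" "f \<in> homs J i j"
    show "mk_nt L (\<lambda>S x. on_mor D i j f S (\<pi> i S x)) = \<pi> j"
      unfolding compose_nt_eq_iff[OF \<pi>[OF ij(2)]] using comp ij by (simp add: compatible_def)
  qed
  fix X \<xi> assume cone: "is_cone MS J D X \<xi>"
  have X: "X \<in> objs MS" and \<xi>: "\<And>j. j \<in> objs J \<Longrightarrow> \<xi> j \<in> nat_trans R X (on_obj D j)"
    and c: "\<And>i j f. i \<in> objs J \<Longrightarrow> j \<in> objs J \<Longrightarrow> f \<in> homs J i j \<Longrightarrow> mk_nt X (\<lambda>S x. on_mor D i j f S (\<xi> i S x)) = \<xi> j"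
    using cone unfolding is_cone_def ModSch_simps by auto
  have "\<exists>!v. v \<in> nat_trans R X L \<and> (\<forall>j\<in>objs J. \<forall>S\<in>Mods. \<forall>x\<in>el X S. \<pi> j S (v S x) = \<xi> j S x)"
  proof (rule nt_jointly_mono_factor[OF ModSchD(1)[OF L] ModSchD(1)[OF X] \<pi> \<xi>])
    fix S x assume S: "S \<in> Mods" and x: "x \<in> el X S"
    have "compatible J (eval_at S D) (\<lambda>j. \<xi> j S x)"
      unfolding compatible_def eval_at_simps
    proof (intro conjI ballI)
      show "\<xi> j S x \<in> el (on_obj D j) S" if "j \<in> objs J" for j by (rule nat_transD(4)[OF \<xi>[OF that] S x])
      fix i j f assume ij: "i \<in> objs J" "j \<in> objs J" "f \<in> homs J i j"
      show "on_mor D i j f S (\<xi> i S x) = \<xi> j S x"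
        using iffD1[OF compose_nt_eq_iff[OF \<xi>[OF ij(2)]] c[OF ij]] S x by blast
    qed
    then show "\<exists>!g. g \<in> el L S \<and> (\<forall>j\<in>objs J. \<pi> j S g = \<xi> j S x)"
      using lg[OF S] by (simp add: limit_group_def)
  qed
  then show "\<exists>!v. v \<in> homs MS X L \<and> (\<forall>j\<in>objs J. cmp MS X L (on_obj D j) (\<pi> j) v = \<xi> j)"
    unfolding ModSch_simps by (simp add: compose_nt_eq_iff[OF \<xi>])
qed

text \<open>Maps out of \<open>L\<close> are maps out of the direct sum of the diagram that kill the relations, and
  these are the cocones.\<close>

lemma ModSch_colimitI:
  assumes D: "ftr_diagram J D" and L: "L \<in> objs MS" and colim: "colimit_ftr J D L \<iota>"
  shows "is_colimit MS J D L \<iota>"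
  unfolding is_colimit_iff
proof (intro conjI allI impI)
  note DD = ftr_diagramD[OF D]
  note gL = ModSchD(1)[OF L]
  have \<iota>: "\<And>j. j \<in> objs J \<Longrightarrow> \<iota> j \<in> nat_trans R (on_obj D j) L"
    and cg: "\<And>S. S \<in> Mods \<Longrightarrow> colimit_group J (eval_at S D) (on_obj L S) (\<lambda>j. \<iota> j S)"
    using colim by (auto simp: colimit_ftr_def)
  show "is_cocone MS J D L \<iota>"
    unfolding is_cocone_iff ModSch_simps
  proof (intro conjI ballI L \<iota>)
    fix i j f assume ij: "i \<in> objs J" "j \<in> objs J" "f \<in> homs J i j"
    show "mk_nt (on_obj D i) (\<lambda>S x. \<iota> j S (on_mor D i j f S x)) = \<iota> i"
      unfolding compose_nt_eq_iff[OF \<iota>[OF ij(1)]]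
    proof (intro ballI)
      fix S x assume S: "S \<in> Mods" and x: "x \<in> el (on_obj D i) S"
      show "\<iota> j S (on_mor D i j f S x) = \<iota> i S x"
        using colimit_group_compat[OF eval_diagram[OF D S] grp_ftrD(1)[OF gL S] cg[OF S] ij, of x] x by simp
    qed
  qed
  fix X \<xi> assume cocone: "is_cocone MS J D X \<xi>"
  have X: "X \<in> objs MS" and \<xi>: "\<And>j. j \<in> objs J \<Longrightarrow> \<xi> j \<in> nat_trans R (on_obj D j) X"
    and c: "\<And>i j f. i \<in> objs J \<Longrightarrow> j \<in> objs J \<Longrightarrow> f \<in> homs J i j \<Longrightarrow>
      mk_nt (on_obj D i) (\<lambda>S x. \<xi> j S (on_mor D i j f S x)) = \<xi> i"
    using cocone unfolding is_cocone_iff ModSch_simps by auto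
  note gX = ModSchD(1)[OF X]
  have cS: "\<xi> j S (on_mor D i j f S y) = \<xi> i S y"
    if ij: "i \<in> objs J" "j \<in> objs J" "f \<in> homs J i j" and S: "S \<in> Mods" and y: "y \<in> el (on_obj D i) S" for i j f S y
    using iffD1[OF compose_nt_eq_iff[OF \<xi>[OF ij(1)]] c[OF ij]] S y by blast
  let ?A = "direct_sum (objs J) (on_obj D)"
  note exact = colimit_ftr_exact[OF D gL colim]
  let ?q = "nt_copair (objs J) (on_obj D) L \<iota>" and ?t = "nt_copair (objs J) (on_obj D) X \<xi>"
  have A: "grp_ftr ?A" by (rule grp_ftr_direct_sum[OF DD(1)])
  have t: "?t \<in> nat_trans R ?A X" by (rule nt_copair_nat_trans[OF DD(1) gX \<xi>])
  have "\<exists>!v. v \<in> nat_trans R L X \<and> (\<forall>S\<in>Mods. \<forall>y\<in>el ?A S. v S (?q S y) = ?t S y)"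
  proof (rule nt_epi_factor[OF A gL gX exact(1,2) t])
    fix S y assume S: "S \<in> Mods" and y: "y \<in> el ?A S" "?q S y = \<one>\<^bsub>on_obj L S\<^esub>"
    then have "y \<in> kernel (on_obj ?A S) (on_obj L S) (?q S)" by (simp add: kernel_def)
    then obtain z where z: "z \<in> el (direct_sum (arrows J) (\<lambda>a. on_obj D (fst a))) S" "y = nt_rels J D S z"
      unfolding exact(3)[OF S] by blast
    have "?t S y = copair (objs J) (on_obj X S) (\<lambda>j. \<xi> j S) (copair (arrows J) (sum_group (objs J) (on_obj (eval_at S D))) (rel J (eval_at S D)) z)"
      using nt_copair_apply[OF S y(1), where H = X and \<phi> = \<xi>] z(2) nt_rels_apply[OF D S z(1)] by simp
    also have "\<dots> = \<one>\<^bsub>on_obj X S\<^esub>"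
      by (rule copair_rel[OF eval_diagram[OF D S] grp_ftrD(1)[OF gX S]])
         (use nat_transD(1)[OF \<xi> S] cS[OF _ _ _ S] z(1) in \<open>simp_all add: el_objsum\<close>)
    finally show "?t S y = \<one>\<^bsub>on_obj X S\<^esub>" .
  qed
  moreover have "(\<forall>S\<in>Mods. \<forall>y\<in>el ?A S. v S (?q S y) = ?t S y) \<longleftrightarrow>
      (\<forall>j\<in>objs J. \<forall>S\<in>Mods. \<forall>y\<in>el (on_obj D j) S. v S (\<iota> j S y) = \<xi> j S y)" if v: "v \<in> nat_trans R L X" for v
  proof
    assume a: "\<forall>S\<in>Mods. \<forall>y\<in>el ?A S. v S (?q S y) = ?t S y"
    show "\<forall>j\<in>objs J. \<forall>S\<in>Mods. \<forall>y\<in>el (on_obj D j) S. v S (\<iota> j S y) = \<xi> j S y"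
    proof (intro ballI)
      fix j S y assume j: "j \<in> objs J" and S: "S \<in> Mods" and y: "y \<in> el (on_obj D j) S"
      let ?s = "single (objs J) (\<lambda>j. on_obj (on_obj D j) S) j y"
      have s: "?s \<in> el ?A S"
        unfolding direct_sum_simps by (rule single_closed[where G = "\<lambda>j. on_obj (on_obj D j) S", OF grp_ftrD(1)[OF DD(1) S] j y])
      have cs: "nt_copair (objs J) (on_obj D) Z \<zeta> S ?s = \<zeta> j S y"
        if gZ: "grp_ftr Z" and \<zeta>: "\<And>j. j \<in> objs J \<Longrightarrow> \<zeta> j \<in> nat_trans R (on_obj D j) Z" for Z :: "('r, 'u, 'u) group_ftr" and \<zeta>
        unfolding nt_copair_apply[OF S s]
        by (rule copair_single[where G = "\<lambda>j. on_obj (on_obj D j) S", OF grp_ftrD(1)[OF DD(1) S] grp_ftrD(1)[OF gZ S]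
              group_homsD(1)[OF nat_transD(1)[OF \<zeta> S]] j y])
      show "v S (\<iota> j S y) = \<xi> j S y" using a S s cs[OF gL \<iota>] cs[OF gX \<xi>] by metis
    qed
  next
    assume a: "\<forall>j\<in>objs J. \<forall>S\<in>Mods. \<forall>y\<in>el (on_obj D j) S. v S (\<iota> j S y) = \<xi> j S y"
    show "\<forall>S\<in>Mods. \<forall>y\<in>el ?A S. v S (?q S y) = ?t S y"
    proof (intro ballI)
      fix S y assume S: "S \<in> Mods" and y: "y \<in> el ?A S"
      have "v S (copair (objs J) (on_obj L S) (\<lambda>j. \<iota> j S) y) = copair (objs J) (on_obj X S) (\<lambda>j z. v S (\<iota> j S z)) y"
        by (rule hom_copair[where G = "\<lambda>j. on_obj (on_obj D j) S", OF grp_ftrD(1)[OF DD(1) S] grp_ftrD(1)[OF gL S]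
              group_homsD(1)[OF nat_transD(1)[OF \<iota> S]] grp_ftrD(1)[OF gX S] group_homsD(1)[OF nat_transD(1)[OF v S]]
              y[unfolded direct_sum_simps]])
      also have "\<dots> = copair (objs J) (on_obj X S) (\<lambda>j. \<xi> j S) y"
      proof (rule copair_cong[where G = "\<lambda>j. on_obj (on_obj D j) S", OF grp_ftrD(1)[OF DD(1) S] grp_ftrD(1)[OF gX S]])
        fix j assume j: "j \<in> objs J"
        have yj: "y j \<in> el (on_obj D j) S" using y j el_direct_sum[of "objs J" "on_obj D", OF DD(1) S] by auto
        show "\<xi> j S (y j) \<in> el X S" by (rule nat_transD(4)[OF \<xi>[OF j] S yj])
        show "v S (\<iota> j S (y j)) = \<xi> j S (y j)" using a j S yj by blast
      qed
      finally show "v S (?q S y) = ?t S y" unfolding nt_copair_apply[OF S y] .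
    qed
  qed
  ultimately have ex: "\<exists>!v. v \<in> nat_trans R L X \<and> (\<forall>j\<in>objs J. \<forall>S\<in>Mods. \<forall>y\<in>el (on_obj D j) S. v S (\<iota> j S y) = \<xi> j S y)"
    by (simp cong: conj_cong)
  show "\<exists>!v. v \<in> homs MS L X \<and> (\<forall>j\<in>objs J. cmp MS (on_obj D j) L X v (\<iota> j) = \<xi> j)"
    using ex unfolding ModSch_simps by (simp add: compose_nt_eq_iff[OF \<xi>])
qed

lemma bicomplete_ModSch: "bicomplete TYPE('u) MS"
  unfolding bicomplete_def
proof (intro allI impI, elim conjE)
  fix J :: "('u, 'u) cat" and D
  assume J: "small_category J" and "is_functor J MS D"
  then have "is_functor J (full_subcat (RR_Mod R) (objs MS)) D" by (simp add: ModSch_def full_subcat_def)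
  note dia = functor_diagram[OF MS_sub this]
  have aD: "accessible (on_obj D j)" if "j \<in> objs J" for j using dia(2)[OF that] by (simp add: ModSch_objs_iff)
  have sJ: "small TYPE('u) (objs J)" using J by (simp add: small_category_def)
  show "(\<exists>L \<pi>. is_limit MS J D L \<pi>) \<and> (\<exists>L \<iota>. is_colimit MS J D L \<iota>)"
  proof
    obtain L \<pi> where L: "L \<in> objs (RR_Mod R :: ('r, 'u) ftr_cat)" and lim: "limit_ftr J D L \<pi>"
      using limit_ftr_ex[OF sJ dia(1)] by (elim exE conjE)
    have "grp_ftr L" using L by (simp add: RR_Mod_iff)
    then have "L \<in> objs MS" using L accessible_limit[OF J dia(1) _ lim aD] by (simp add: ModSch_objs_iff)
    from ModSch_limitI[OF dia(1) this lim] show "\<exists>L \<pi>. is_limit MS J D L \<pi>" by blast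
    obtain L' \<iota> where L': "L' \<in> objs (RR_Mod R :: ('r, 'u) ftr_cat)" and colim: "colimit_ftr J D L' \<iota>"
      using colimit_ftr_ex[OF J dia(1)] by (elim exE conjE)
    have "grp_ftr L'" using L' by (simp add: RR_Mod_iff)
    then have "L' \<in> objs MS" using L' accessible_colimit[OF J dia(1) _ colim aD] by (simp add: ModSch_objs_iff)
    from ModSch_colimitI[OF dia(1) this colim] show "\<exists>L \<iota>. is_colimit MS J D L \<iota>" by blast
  qed
qed

end

section \<open>Minimality\<close>

definition discrete :: "'u set \<Rightarrow> ('u, 'u) cat" where
  "discrete I = \<lparr>objs = I, homs = (\<lambda>i j. if i = j then {i} else {}), ident = (\<lambda>i. i), cmp = (\<lambda>_ _ _ g f. f)\<rparr>"

context small_ring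
begin

lemma small_category_discrete: "small TYPE('u) (I :: 'u set) \<Longrightarrow> small_category (discrete I)"
  by (auto simp: small_category_def category_def locally_small_def discrete_def small_finite split: if_splits)

definition family :: "('u \<Rightarrow> ('r, 'u, 'u) group_ftr) \<Rightarrow> ('u, 'u, ('r, 'u, 'u) group_ftr, ('r, 'u) module \<Rightarrow> 'u \<Rightarrow> 'u) ftr" where
  "family F = \<lparr>on_obj = F, on_mor = (\<lambda>i j f. mk_nt (F i) (\<lambda>S x. x))\<rparr>"

lemma family_functor:
  assumes P: "P \<subseteq> objs (RR_Mod R)" and F: "\<And>i. i \<in> I \<Longrightarrow> F i \<in> P"
  shows "is_functor (discrete I) (full_subcat (RR_Mod R) P) (family F)"
proof -
  have "mk_nt (F i) (\<lambda>S x. x) \<in> nat_trans R (F i) (F i)" if "i \<in> I" for i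
    by (rule nt_id) (use F[OF that] P in \<open>auto simp: RR_Mod_iff\<close>)
  moreover have "mk_nt (F i) (\<lambda>S x. mk_nt (F i) (\<lambda>S x. x) S (mk_nt (F i) (\<lambda>S x. x) S x)) = mk_nt (F i) (\<lambda>S x. x)" for i
    by (rule mk_nt_cong) simp
  ultimately show ?thesis
    using F by (auto simp: is_functor_def discrete_def full_subcat_def family_def RR_Mod_simps(1) ident_RR_Mod cmp_RR_Mod
        split: if_splits)
qed

lemma family_compatible:
  "S \<in> Mods \<Longrightarrow> compatible (discrete I) (eval_at S (family F)) x \<longleftrightarrow> (\<forall>i\<in>I. x i \<in> el (F i) S)"
  by (auto simp: compatible_def discrete_def family_def)

text \<open>Stability under limits is phrased with universal properties; this is its elementwise form.\<close>

lemma limit_in: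
  assumes P: "stable_containing_RR R P" and J: "small_category (J :: ('u, 'u) cat)"
    and D: "is_functor J (full_subcat (RR_Mod R) P) D"
    and L: "L \<in> objs (RR_Mod R)" and lim: "limit_ftr J D L \<pi>"
  shows "L \<in> P"
proof -
  have sub: "P \<subseteq> objs (RR_Mod R)" and st: "stable_limits R P" using P by (simp_all add: stable_containing_RR_def)
  have \<pi>: "\<And>j. j \<in> objs J \<Longrightarrow> \<pi> j \<in> nat_trans R L (on_obj D j)"
    and lg: "\<And>S. S \<in> Mods \<Longrightarrow> limit_group J (eval_at S D) (on_obj L S) (\<lambda>j. \<pi> j S)"
    using lim by (auto simp: limit_ftr_def)
  have "is_cone (RR_Mod R) J D L \<pi>"
    unfolding is_cone_def RR_Mod_simps(1) cmp_RR_Mod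
  proof (intro conjI ballI L \<pi>)
    fix i j f assume ij: "i \<in> objs J" "j \<in> objs J" "f \<in> homs J i j"
    have "on_mor D i j f S (\<pi> i S g) = \<pi> j S g" if "S \<in> Mods" "g \<in> el L S" for S g
      using lg[OF that(1)] that(2) ij by (simp add: limit_group_def compatible_def)
    then show "mk_nt L (\<lambda>S x. on_mor D i j f S (\<pi> i S x)) = \<pi> j"
      unfolding compose_nt_eq_iff[OF \<pi>[OF ij(2)]] by blast
  qed
  moreover have "\<forall>S\<in>Mods. is_limit Ab J (eval_at S D) (on_obj L S) (\<lambda>j. \<pi> j S)"
    using Ab_limitI[OF RR_Mod_Ab[OF L] lg] by blast
  ultimately show ?thesis using st J D unfolding stable_limits_def by blast
qed

lemma colimit_in:
  assumes P: "stable_containing_RR R P" and J: "small_category (J :: ('u, 'u) cat)"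
    and D: "is_functor J (full_subcat (RR_Mod R) P) D"
    and L: "L \<in> objs (RR_Mod R)" and colim: "colimit_ftr J D L \<iota>"
  shows "L \<in> P"
proof -
  have sub: "P \<subseteq> objs (RR_Mod R)" and st: "stable_colimits R P" using P by (simp_all add: stable_containing_RR_def)
  note dia = functor_diagram[OF sub D]
  have gL: "grp_ftr L" using L by (simp add: RR_Mod_iff)
  have \<iota>: "\<And>j. j \<in> objs J \<Longrightarrow> \<iota> j \<in> nat_trans R (on_obj D j) L"
    and cg: "\<And>S. S \<in> Mods \<Longrightarrow> colimit_group J (eval_at S D) (on_obj L S) (\<lambda>j. \<iota> j S)"
    using colim by (auto simp: colimit_ftr_def)
  have "is_cocone (RR_Mod R) J D L \<iota>"
    unfolding is_cocone_iff RR_Mod_simps(1) cmp_RR_Mod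
  proof (intro conjI ballI L \<iota>)
    fix i j f assume ij: "i \<in> objs J" "j \<in> objs J" "f \<in> homs J i j"
    have "\<iota> j S (on_mor D i j f S x) = \<iota> i S x" if S: "S \<in> Mods" and x: "x \<in> el (on_obj D i) S" for S x
      using colimit_group_compat[OF eval_diagram[OF dia(1) S] grp_ftrD(1)[OF gL S] cg[OF S] ij, of x] x by simp
    then show "mk_nt (on_obj D i) (\<lambda>S x. \<iota> j S (on_mor D i j f S x)) = \<iota> i"
      unfolding compose_nt_eq_iff[OF \<iota>[OF ij(1)]] by blast
  qed
  moreover have "\<forall>S\<in>Mods. is_colimit Ab J (eval_at S D) (on_obj L S) (\<lambda>j. \<iota> j S)"
    using Ab_colimitI[OF eval_diagram[OF dia(1)] RR_Mod_Ab[OF L] cg] by blast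
  ultimately show ?thesis using st J D unfolding stable_colimits_def by blast
qed

text \<open>The power of \<open>RR\<close> with exponent \<open>I\<close>, as the limit of a constant discrete diagram.\<close>

lemma RR_power_ex:
  assumes P: "stable_containing_RR R P" and I: "small TYPE('u) (I :: 'u set)"
  shows "\<exists>L \<pi>. L \<in> P \<and> (\<forall>i\<in>I. \<pi> i \<in> nat_trans R L RR) \<and>
    (\<forall>S\<in>Mods. \<forall>x. (\<forall>i\<in>I. x i \<in> carrier S) \<longrightarrow> (\<exists>!g. g \<in> el L S \<and> (\<forall>i\<in>I. \<pi> i S g = x i)))"
proof -
  let ?D = "family (\<lambda>_. RR)"
  have sub: "P \<subseteq> objs (RR_Mod R)" and RRP: "RR \<in> P" using P by (simp_all add: stable_containing_RR_def)
  have D: "is_functor (discrete I) (full_subcat (RR_Mod R) P) ?D" by (rule family_functor[OF sub RRP])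
  note J = small_category_discrete[OF I]
  have sJ: "small TYPE('u) (objs (discrete I))" using I by (simp add: discrete_def)
  obtain L \<pi> where L: "L \<in> objs (RR_Mod R :: ('r, 'u) ftr_cat)" and lim: "limit_ftr (discrete I) ?D L \<pi>"
    using limit_ftr_ex[OF sJ functor_diagram(1)[OF sub D]] by (elim exE conjE)
  have LP: "L \<in> P" by (rule limit_in[OF P J D L lim])
  have \<pi>: "\<forall>i\<in>I. \<pi> i \<in> nat_trans R L RR"
    using lim by (simp add: limit_ftr_def discrete_def family_def)
  have "\<exists>!g. g \<in> el L S \<and> (\<forall>i\<in>I. \<pi> i S g = x i)" if S: "S \<in> Mods" and x: "\<forall>i\<in>I. x i \<in> carrier S" for S x
  proof -
    have "limit_group (discrete I) (eval_at S ?D) (on_obj L S) (\<lambda>j. \<pi> j S)" using lim S by (simp add: limit_ftr_def)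
    then have "\<forall>x. compatible (discrete I) (eval_at S ?D) x \<longrightarrow> (\<exists>!g. g \<in> el L S \<and> (\<forall>j\<in>objs (discrete I). \<pi> j S g = x j))"
      by (simp add: limit_group_def)
    moreover have "compatible (discrete I) (eval_at S ?D) x" unfolding family_compatible[OF S] using x by simp
    moreover have "objs (discrete I) = I" by (simp add: discrete_def)
    ultimately show ?thesis by simp
  qed
  with LP \<pi> show ?thesis by (intro exI[of _ L] exI[of _ \<pi>]) simp
qed

text \<open>Multiplication by \<open>a\<close> on \<open>S\<close> is additive, and it is natural because morphisms are linear.  It
  is not linear in general, as \<open>R\<close> may be noncommutative.\<close>

lemma nt_smult: "a \<in> carrier R \<Longrightarrow> mk_nt RR (\<lambda>S x. a \<odot>\<^bsub>S\<^esub> x) \<in> nat_trans R RR RR"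
proof (rule mk_nt_nat_trans[OF grp_ftr_RR])
  fix S assume a: "a \<in> carrier R" and "S \<in> Mods"
  then interpret left_module R S by (simp add: Mods_iff)
  show "(\<lambda>x. a \<odot>\<^bsub>S\<^esub> x) \<in> hom (on_obj RR S) (on_obj RR S)"
    by (rule homI) (simp_all add: a smult_closed smult_r_distr)
qed (simp add: module_homsD(3))

text \<open>A module scheme is the kernel of a map between powers of \<open>RR\<close>: a map between modules is
  linear if it satisfies one equation for each sum and one for each scalar multiple.\<close>

lemma mod_scheme_in:
  assumes P: "stable_containing_RR R P" and N: "N \<in> Mods"
  shows "\<exists>F \<alpha> \<beta>. F \<in> P \<and> F \<in> objs MS \<and> \<alpha> \<in> nat_trans R (mod_scheme R N) F \<and> \<beta> \<in> nat_trans R F (mod_scheme R N) \<and>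
    (\<forall>S\<in>Mods. (\<forall>x\<in>el (mod_scheme R N) S. \<beta> S (\<alpha> S x) = x) \<and> (\<forall>y\<in>el F S. \<alpha> S (\<beta> S y) = y))"
proof -
  interpret N: left_module R N using N by (simp add: Mods_iff)
  have sub: "P \<subseteq> objs (RR_Mod R)" using P by (simp add: stable_containing_RR_def)
  have sN: "small TYPE('u) (carrier N)" using N by (simp add: Mods_iff)
  obtain L \<pi> where LP: "L \<in> P" and \<pi>: "\<forall>x\<in>carrier N. \<pi> x \<in> nat_trans R L RR"
    and Lu: "\<forall>S\<in>Mods. \<forall>x. (\<forall>i\<in>carrier N. x i \<in> carrier S) \<longrightarrow> (\<exists>!g. g \<in> el L S \<and> (\<forall>i\<in>carrier N. \<pi> i S g = x i))"
    using RR_power_ex[OF P sN] by (elim exE conjE)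
  \<comment> \<open>The equations that make a map on \<open>carrier N\<close> linear: one for each sum and each scalar multiple.\<close>
  define E where "E = (carrier N \<times> carrier N) <+> (carrier R \<times> carrier N)"
  have "E = Inl ` (carrier N \<times> carrier N) \<union> Inr ` (carrier R \<times> carrier N)" by (auto simp: E_def)
  then have "E = (\<Union>b\<in>(UNIV :: bool set). if b then Inl ` (carrier N \<times> carrier N) else Inr ` (carrier R \<times> carrier N))"
    by (auto split: if_splits)
  moreover have "small TYPE('u) \<dots>"
  proof (rule small_UN)
    show "small TYPE('u) (UNIV :: bool set)" by (simp add: small_finite)
    show "small TYPE('u) (if b then Inl ` (carrier N \<times> carrier N) else Inr ` (carrier R \<times> carrier N))" for b
      using sN small_R by (simp add: small_image small_Times)
  qed
  ultimately have "small TYPE('u) E" by simp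
  then obtain I :: "'u set" and c where I: "small TYPE('u) I" and c: "bij_betw c E I" using small_copy by blast
  obtain M \<rho> where MP: "M \<in> P" and \<rho>: "\<forall>i\<in>I. \<rho> i \<in> nat_trans R M RR"
    and Mu: "\<forall>S\<in>Mods. \<forall>x. (\<forall>i\<in>I. x i \<in> carrier S) \<longrightarrow> (\<exists>!g. g \<in> el M S \<and> (\<forall>i\<in>I. \<rho> i S g = x i))"
    using RR_power_ex[OF P I] by (elim exE conjE)
  have LR: "L \<in> objs (RR_Mod R)" and MR: "M \<in> objs (RR_Mod R)" using LP MP sub by auto
  have gL: "grp_ftr L" and gM: "grp_ftr M" using LR MR by (simp_all add: RR_Mod_iff)
  \<comment> \<open>The component of the map \<open>L \<rightarrow> M\<close> at an equation: the difference of its two sides.\<close>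
  define t where "t e = (case e of
      Inl (x, y) \<Rightarrow> mk_nt L (\<lambda>S g. \<pi> (x \<oplus>\<^bsub>N\<^esub> y) S g \<otimes>\<^bsub>on_obj RR S\<^esub>
         mk_nt L (\<lambda>S g. inv\<^bsub>on_obj RR S\<^esub> mk_nt L (\<lambda>S g. \<pi> x S g \<otimes>\<^bsub>on_obj RR S\<^esub> \<pi> y S g) S g) S g)
    | Inr (a, x) \<Rightarrow> mk_nt L (\<lambda>S g. \<pi> (a \<odot>\<^bsub>N\<^esub> x) S g \<otimes>\<^bsub>on_obj RR S\<^esub>
         mk_nt L (\<lambda>S g. inv\<^bsub>on_obj RR S\<^esub> mk_nt L (\<lambda>S g. mk_nt RR (\<lambda>S s. a \<odot>\<^bsub>S\<^esub> s) S (\<pi> x S g)) S g) S g))" for e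
  have t: "t e \<in> nat_trans R L RR" if "e \<in> E" for e
  proof (cases e)
    case (Inl p)
    then obtain x y where xy: "e = Inl (x, y)" "x \<in> carrier N" "y \<in> carrier N" using \<open>e \<in> E\<close> by (auto simp: E_def)
    show ?thesis unfolding xy t_def sum.case prod.case
      by (rule nt_mult[OF gL grp_ftr_RR _ nt_inverse[OF gL grp_ftr_RR nt_mult[OF gL grp_ftr_RR]]]) (use \<pi> xy in simp_all)
  next
    case (Inr p)
    then obtain a x where ax: "e = Inr (a, x)" "a \<in> carrier R" "x \<in> carrier N" using \<open>e \<in> E\<close> by (auto simp: E_def)
    show ?thesis unfolding ax t_def sum.case prod.case
      by (rule nt_mult[OF gL grp_ftr_RR _ nt_inverse[OF gL grp_ftr_RR nt_compose[OF gL _ nt_smult]]])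
         (use \<pi> ax N.smult_closed in simp_all)
  qed
  have \<pi>c: "\<pi> x S g \<in> carrier S" if "S \<in> Mods" "g \<in> el L S" "x \<in> carrier N" for S g x
    using nat_transD(4)[OF bspec[OF \<pi> that(3)] that(1,2)] by simp
  have RRinv: "x \<otimes>\<^bsub>on_obj RR S\<^esub> inv\<^bsub>on_obj RR S\<^esub> y = \<one>\<^bsub>on_obj RR S\<^esub> \<longleftrightarrow> x = y"
    if "S \<in> Mods" "x \<in> carrier S" "y \<in> carrier S" for S x y
    using comm_group_eq_iff[OF comm_group_RR[OF that(1)], of x y] that(2,3) by simp
  have tInl: "t (Inl (x, y)) S g = \<zero>\<^bsub>S\<^esub> \<longleftrightarrow> \<pi> (x \<oplus>\<^bsub>N\<^esub> y) S g = \<pi> x S g \<oplus>\<^bsub>S\<^esub> \<pi> y S g"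
    if S: "S \<in> Mods" and g: "g \<in> el L S" and xy: "x \<in> carrier N" "y \<in> carrier N" for S g x y
  proof -
    interpret S: left_module R S using S by (simp add: Mods_iff)
    have "\<pi> x S g \<oplus>\<^bsub>S\<^esub> \<pi> y S g \<in> carrier S" using \<pi>c[OF S g] xy by simp
    from RRinv[OF S \<pi>c[OF S g N.M.add.m_closed[OF xy]] this] show ?thesis
      using S g by (simp add: t_def)
  qed
  have tInr: "t (Inr (a, x)) S g = \<zero>\<^bsub>S\<^esub> \<longleftrightarrow> \<pi> (a \<odot>\<^bsub>N\<^esub> x) S g = a \<odot>\<^bsub>S\<^esub> \<pi> x S g"
    if S: "S \<in> Mods" and g: "g \<in> el L S" and ax: "a \<in> carrier R" "x \<in> carrier N" for S g a x
  proof -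
    interpret S: left_module R S using S by (simp add: Mods_iff)
    have "a \<odot>\<^bsub>S\<^esub> \<pi> x S g \<in> carrier S" using \<pi>c[OF S g] ax S.smult_closed by simp
    from RRinv[OF S \<pi>c[OF S g N.smult_closed[OF ax]] this] show ?thesis
      using S g \<pi>c[OF S g ax(2)] by (simp add: t_def)
  qed
  let ?t = "\<lambda>i. t (inv_into E c i)"
  have invE: "inv_into E c i \<in> E" if "i \<in> I" for i using that c by (metis bij_betw_imp_surj_on inv_into_into)
  have "\<exists>!f. f \<in> nat_trans R L M \<and> (\<forall>i\<in>I. \<forall>S\<in>Mods. \<forall>g\<in>el L S. \<rho> i S (f S g) = ?t i S g)"
  proof (rule nt_jointly_mono_factor[OF gM gL])
    show "\<rho> i \<in> nat_trans R M RR" "?t i \<in> nat_trans R L RR" if "i \<in> I" for i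
      using \<rho> that t[OF invE[OF that]] by auto
    show "\<exists>!g. g \<in> el M S \<and> (\<forall>i\<in>I. \<rho> i S g = ?t i S x)" if "S \<in> Mods" "x \<in> el L S" for S x
    proof -
      have "\<forall>i\<in>I. ?t i S x \<in> carrier S" using nat_transD(4)[OF t[OF invE] that] by simp
      from mp[OF spec[OF bspec[OF Mu that(1)]] this] show ?thesis .
    qed
  qed
  then obtain f where f: "f \<in> nat_trans R L M" and \<rho>f: "\<forall>i\<in>I. \<forall>S\<in>Mods. \<forall>g\<in>el L S. \<rho> i S (f S g) = ?t i S g" by (elim ex1E conjE)
  have ker_f: "f S g = \<one>\<^bsub>on_obj M S\<^esub> \<longleftrightarrow> (\<forall>e\<in>E. t e S g = \<zero>\<^bsub>S\<^esub>)" if S: "S \<in> Mods" and g: "g \<in> el L S" for S g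
  proof
    assume a: "f S g = \<one>\<^bsub>on_obj M S\<^esub>"
    show "\<forall>e\<in>E. t e S g = \<zero>\<^bsub>S\<^esub>"
    proof
      fix e assume e: "e \<in> E"
      then have ce: "c e \<in> I" "inv_into E c (c e) = e" using c by (auto simp: bij_betw_def)
      have "t e S g = \<rho> (c e) S \<one>\<^bsub>on_obj M S\<^esub>"
        using bspec[OF bspec[OF bspec[OF \<rho>f ce(1)] S] g] unfolding a ce(2) by simp
      also have "\<dots> = \<zero>\<^bsub>S\<^esub>" using nat_trans_one[OF bspec[OF \<rho> ce(1)] gM grp_ftr_RR S] by simp
      finally show "t e S g = \<zero>\<^bsub>S\<^esub>" .
    qed
  next
    assume a: "\<forall>e\<in>E. t e S g = \<zero>\<^bsub>S\<^esub>"
    interpret S: left_module R S using S by (simp add: Mods_iff)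
    have "\<exists>!g. g \<in> el M S \<and> (\<forall>i\<in>I. \<rho> i S g = \<zero>\<^bsub>S\<^esub>)"
      by (rule mp[OF spec[OF bspec[OF Mu S]]]) simp
    moreover have "\<forall>i\<in>I. \<rho> i S (f S g) = \<zero>\<^bsub>S\<^esub>" using \<rho>f S g a invE by simp
    moreover have "\<forall>i\<in>I. \<rho> i S \<one>\<^bsub>on_obj M S\<^esub> = \<zero>\<^bsub>S\<^esub>"
      using nat_trans_one[OF bspec[OF \<rho>] gM grp_ftr_RR S] by simp
    ultimately show "f S g = \<one>\<^bsub>on_obj M S\<^esub>" using nat_transD(4)[OF f S g] grp_ftr_one[OF gM S] by blast
  qed
  obtain F \<alpha> \<beta> where F: "F \<in> objs MS" and \<alpha>: "\<alpha> \<in> nat_trans R (mod_scheme R N) F" and \<beta>: "\<beta> \<in> nat_trans R F (mod_scheme R N)"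
    and inv: "\<forall>S\<in>Mods. (\<forall>x\<in>el (mod_scheme R N) S. \<beta> S (\<alpha> S x) = x) \<and> (\<forall>y\<in>el F S. \<alpha> S (\<beta> S y) = y)"
    using transport_ModSch[OF grp_ftr_mod_scheme[OF N] small_valued_mod_scheme[OF N] accessible_mod_scheme[OF N]]
    by (elim exE conjE)
  note gF = ModSchD(1)[OF F]
  have \<beta>h: "\<beta> S y \<in> module_homs R N S" if "S \<in> Mods" "y \<in> el F S" for S y
    using nat_transD(4)[OF \<beta> that] by (simp add: mod_scheme_simps)
  \<comment> \<open>The embedding of \<open>F\<close> into the power \<open>L\<close> takes a homomorphism to the family of its values.\<close>
  define s where "s x = mk_nt F (\<lambda>S y. \<beta> S y x)" for x
  have s: "s x \<in> nat_trans R F RR" if x: "x \<in> carrier N" for x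
    unfolding s_def
  proof (rule mk_nt_nat_trans[OF gF])
    fix S assume S: "S \<in> Mods"
    show "(\<lambda>y. \<beta> S y x) \<in> hom (on_obj F S) (on_obj RR S)"
    proof (rule homI)
      show "\<beta> S y x \<in> carrier (on_obj RR S)" if "y \<in> el F S" for y using module_homsD(1)[OF \<beta>h[OF S that] x] by simp
      show "\<beta> S (y \<otimes>\<^bsub>on_obj F S\<^esub> z) x = \<beta> S y x \<otimes>\<^bsub>on_obj RR S\<^esub> \<beta> S z x" if "y \<in> el F S" "z \<in> el F S" for y z
        using nat_transD(5)[OF \<beta> S that] x by (simp add: mod_scheme_simps)
    qed
    fix T h y assume T: "T \<in> Mods" and h: "h \<in> module_homs R S T" and y: "y \<in> el F S"
    show "\<beta> T (on_mor F S T h y) x = on_mor RR S T h (\<beta> S y x)"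
      using nat_transD(2)[OF \<beta> S T h y] \<beta>h[OF S y] x by (simp add: mod_scheme_simps compose_def)
  qed
  have "\<exists>!k. k \<in> nat_trans R F L \<and> (\<forall>x\<in>carrier N. \<forall>S\<in>Mods. \<forall>y\<in>el F S. \<pi> x S (k S y) = s x S y)"
  proof (rule nt_jointly_mono_factor[OF gL gF])
    show "\<pi> x \<in> nat_trans R L RR" "s x \<in> nat_trans R F RR" if "x \<in> carrier N" for x using \<pi> s that by auto
    show "\<exists>!g. g \<in> el L S \<and> (\<forall>x\<in>carrier N. \<pi> x S g = s x S y)" if "S \<in> Mods" "y \<in> el F S" for S y
    proof -
      have "\<forall>x\<in>carrier N. s x S y \<in> carrier S" using nat_transD(4)[OF s that] by simp
      from mp[OF spec[OF bspec[OF Lu that(1)]] this] show ?thesis .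
    qed
  qed
  then obtain k where k: "k \<in> nat_trans R F L" and "\<forall>x\<in>carrier N. \<forall>S\<in>Mods. \<forall>y\<in>el F S. \<pi> x S (k S y) = s x S y" by (elim ex1E conjE)
  then have \<pi>k: "\<pi> x S (k S y) = \<beta> S y x" if "x \<in> carrier N" "S \<in> Mods" "y \<in> el F S" for x S y
    using that by (simp add: s_def)
  have "is_kernel Ab (on_obj L S) (on_obj M S) (f S) (on_obj F S) (k S)" if S: "S \<in> Mods" for S
  proof (rule Ab_kernelI[OF RR_Mod_Ab[OF LR S] RR_Mod_Ab[OF MR S] ModSchD(5)[OF F S] nat_transD(1)[OF f S] nat_transD(1)[OF k S]])
    show "inj_on (k S) (el F S)"
    proof (rule inj_onI)
      fix y z assume y: "y \<in> el F S" and z: "z \<in> el F S" and e: "k S y = k S z"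
      have "\<beta> S y = \<beta> S z"
      proof (rule extensionalityI[where A = "carrier N"])
        show "\<beta> S y x = \<beta> S z x" if "x \<in> carrier N" for x
          using \<pi>k[OF that S y] \<pi>k[OF that S z] e by simp
      qed (use module_homsD(4)[OF \<beta>h[OF S]] y z in auto)
      moreover have "\<alpha> S (\<beta> S y) = y" "\<alpha> S (\<beta> S z) = z" using inv S y z by auto
      ultimately show "y = z" by metis
    qed
    show "k S ` el F S = kernel (on_obj L S) (on_obj M S) (f S)"
    proof (intro equalityI subsetI)
      fix g assume "g \<in> k S ` el F S"
      then obtain y where y: "y \<in> el F S" "g = k S y" by blast
      have g: "g \<in> el L S" using nat_transD(4)[OF k S y(1)] y(2) by simp
      note hD = module_homsD[OF \<beta>h[OF S y(1)]]
      have "t e S g = \<zero>\<^bsub>S\<^esub>" if "e \<in> E" for e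
        using that unfolding E_def
      proof (elim PlusE SigmaE; hypsubst)
        fix x z assume xz: "x \<in> carrier N" "z \<in> carrier N"
        show "t (Inl (x, z)) S g = \<zero>\<^bsub>S\<^esub>"
          unfolding tInl[OF S g xz] unfolding y(2) \<pi>k[OF xz(1) S y(1)] \<pi>k[OF xz(2) S y(1)]
            \<pi>k[OF N.M.add.m_closed[OF xz] S y(1)] by (rule hD(2)[OF xz])
      next
        fix a x assume ax: "a \<in> carrier R" "x \<in> carrier N"
        show "t (Inr (a, x)) S g = \<zero>\<^bsub>S\<^esub>"
          unfolding tInr[OF S g ax] unfolding y(2) \<pi>k[OF ax(2) S y(1)] \<pi>k[OF N.smult_closed[OF ax] S y(1)]
          by (rule hD(3)[OF ax])
      qed
      then show "g \<in> kernel (on_obj L S) (on_obj M S) (f S)" using ker_f[OF S g] g by (simp add: kernel_def)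
    next
      fix g assume "g \<in> kernel (on_obj L S) (on_obj M S) (f S)"
      then have g: "g \<in> el L S" and te: "\<forall>e\<in>E. t e S g = \<zero>\<^bsub>S\<^esub>" using ker_f[OF S] by (auto simp: kernel_def)
      define h where "h = (\<lambda>x\<in>carrier N. \<pi> x S g)"
      have h: "h \<in> module_homs R N S"
      proof (rule module_homsI)
        show "h x \<in> carrier S" if "x \<in> carrier N" for x using \<pi>c[OF S g that] that by (simp add: h_def)
        show "h (x \<oplus>\<^bsub>N\<^esub> y) = h x \<oplus>\<^bsub>S\<^esub> h y" if "x \<in> carrier N" "y \<in> carrier N" for x y
        proof -
          have "t (Inl (x, y)) S g = \<zero>\<^bsub>S\<^esub>" using te that by (auto simp: E_def)
          then show ?thesis using tInl[OF S g that] that by (simp add: h_def)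
        qed
        show "h (a \<odot>\<^bsub>N\<^esub> x) = a \<odot>\<^bsub>S\<^esub> h x" if "a \<in> carrier R" "x \<in> carrier N" for a x
        proof -
          have "t (Inr (a, x)) S g = \<zero>\<^bsub>S\<^esub>" using te that by (auto simp: E_def)
          then show ?thesis using tInr[OF S g that] that N.smult_closed by (simp add: h_def)
        qed
      qed (simp add: h_def)
      then have hm: "h \<in> el (mod_scheme R N) S" by (simp add: mod_scheme_simps)
      have ah: "\<alpha> S h \<in> el F S" by (rule nat_transD(4)[OF \<alpha> S hm])
      have ba: "\<beta> S (\<alpha> S h) = h" using inv S hm by blast
      have "\<pi> x S (k S (\<alpha> S h)) = \<pi> x S g" if "x \<in> carrier N" for x
        unfolding \<pi>k[OF that S ah] ba using that by (simp add: h_def)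
      moreover have "\<exists>!g'. g' \<in> el L S \<and> (\<forall>x\<in>carrier N. \<pi> x S g' = \<pi> x S g)" 
        by (rule mp[OF spec[OF bspec[OF Lu S]]]) (simp add: \<pi>c[OF S g])
      ultimately have "k S (\<alpha> S h) = g" using g nat_transD(4)[OF k S ah] by blast
      then show "g \<in> k S ` el F S" using ah by blast
    qed
  qed
  moreover have "stable_kernels R P" using P by (simp add: stable_containing_RR_def)
  ultimately have "F \<in> P"
    using LP MP f k ModSchD(4)[OF F] unfolding stable_kernels_def RR_Mod_simps(1) by blast
  with F \<alpha> \<beta> inv show ?thesis by (intro exI[of _ F] exI[of _ \<alpha>] exI[of _ \<beta>]) simp
qed

text \<open>The direct sum of module schemes that covers \<open>F\<close> is replaced by a direct sum of isomorphic
  functors in \<open>P\<close>.  It is formed as the colimit of a discrete diagram, which belongs to \<open>P\<close> and to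
  \<open>ModSch\<close>.\<close>

lemma cover_in:
  assumes P: "stable_containing_RR R P" and F: "F \<in> objs MS"
  shows "\<exists>L q. L \<in> P \<and> L \<in> objs MS \<and> q \<in> nat_trans R L F \<and> (\<forall>S\<in>Mods. q S ` el L S = el F S)"
proof -
  have sub: "P \<subseteq> objs (RR_Mod R)" using P by (simp add: stable_containing_RR_def)
  note gF = ModSchD(1)[OF F]
  have gen: "generated F" using ModSchD(3)[OF F] by (simp add: accessible_def)
  obtain I :: "'u set" and N m where I: "small TYPE('u) I" and Nm: "\<forall>i\<in>I. N i \<in> Mods \<and> m i \<in> el F (N i)"
    and cov: "\<forall>S\<in>Mods. \<forall>x\<in>el F S. \<exists>i\<in>I. \<exists>h\<in>module_homs R (N i) S. on_mor F (N i) S h (m i) = x"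
    using cover_ex[OF gF ModSchD(2)[OF F] gen] by (elim exE conjE)
  have "\<forall>i\<in>I. \<exists>G \<alpha> \<beta>. G \<in> P \<and> G \<in> objs MS \<and> \<alpha> \<in> nat_trans R (mod_scheme R (N i)) G \<and> \<beta> \<in> nat_trans R G (mod_scheme R (N i)) \<and>
    (\<forall>S\<in>Mods. (\<forall>x\<in>el (mod_scheme R (N i)) S. \<beta> S (\<alpha> S x) = x) \<and> (\<forall>y\<in>el G S. \<alpha> S (\<beta> S y) = y))"
    using mod_scheme_in[OF P] Nm by blast
  from bchoice[OF this] obtain G where
    "\<forall>i\<in>I. \<exists>\<alpha> \<beta>. G i \<in> P \<and> G i \<in> objs MS \<and> \<alpha> \<in> nat_trans R (mod_scheme R (N i)) (G i) \<and> \<beta> \<in> nat_trans R (G i) (mod_scheme R (N i)) \<and>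
    (\<forall>S\<in>Mods. (\<forall>x\<in>el (mod_scheme R (N i)) S. \<beta> S (\<alpha> S x) = x) \<and> (\<forall>y\<in>el (G i) S. \<alpha> S (\<beta> S y) = y))" by (elim exE)
  from bchoice[OF this] obtain \<alpha> where
    "\<forall>i\<in>I. \<exists>\<beta>. G i \<in> P \<and> G i \<in> objs MS \<and> \<alpha> i \<in> nat_trans R (mod_scheme R (N i)) (G i) \<and> \<beta> \<in> nat_trans R (G i) (mod_scheme R (N i)) \<and>
    (\<forall>S\<in>Mods. (\<forall>x\<in>el (mod_scheme R (N i)) S. \<beta> S (\<alpha> i S x) = x) \<and> (\<forall>y\<in>el (G i) S. \<alpha> i S (\<beta> S y) = y))" by (elim exE)
  from bchoice[OF this] obtain \<beta> where
    G: "\<forall>i\<in>I. G i \<in> P \<and> G i \<in> objs MS \<and> \<alpha> i \<in> nat_trans R (mod_scheme R (N i)) (G i) \<and> \<beta> i \<in> nat_trans R (G i) (mod_scheme R (N i)) \<and>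
    (\<forall>S\<in>Mods. (\<forall>x\<in>el (mod_scheme R (N i)) S. \<beta> i S (\<alpha> i S x) = x) \<and> (\<forall>y\<in>el (G i) S. \<alpha> i S (\<beta> i S y) = y))" by (elim exE)
  let ?D = "family G"
  note J = small_category_discrete[OF I]
  have DP: "is_functor (discrete I) (full_subcat (RR_Mod R) P) ?D" by (rule family_functor[OF sub]) (use G in blast)
  have DM: "is_functor (discrete I) (full_subcat (RR_Mod R) (objs MS)) ?D" by (rule family_functor[OF MS_sub]) (use G in blast)
  note dia = functor_diagram(1)[OF sub DP]
  obtain L \<iota> where L: "L \<in> objs (RR_Mod R :: ('r, 'u) ftr_cat)" and colim: "colimit_ftr (discrete I) ?D L \<iota>"
    using colimit_ftr_ex[OF J dia] by (elim exE conjE)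
  have LP: "L \<in> P" by (rule colimit_in[OF P J DP L colim])
  have LM: "L \<in> objs MS" by (rule colimit_in[OF stable_containing_RR_ModSch J DM L colim])
  have \<iota>: "\<And>i. i \<in> I \<Longrightarrow> \<iota> i \<in> nat_trans R (G i) L"
    using colim by (simp add: colimit_ftr_def discrete_def family_def)
  define \<phi> where "\<phi> i = mk_nt (G i) (\<lambda>S y. mk_nt (mod_scheme R (N i)) (\<lambda>S h. on_mor F (N i) S h (m i)) S (\<beta> i S y))" for i
  have \<phi>: "\<phi> i \<in> nat_trans R (G i) F" if i: "i \<in> I" for i
    unfolding \<phi>_def by (rule nt_compose[OF _ _ yoneda_nat_trans[OF gF]]) (use G Nm i in \<open>auto intro: ModSchD(1)\<close>)
  have "is_cocone MS (discrete I) ?D F \<phi>"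
    unfolding is_cocone_iff ModSch_simps
  proof (intro conjI ballI F)
    show "\<phi> i \<in> nat_trans R (on_obj ?D i) F" if "i \<in> objs (discrete I)" for i
      using \<phi> that by (simp add: family_def discrete_def)
    fix i j f assume ij: "i \<in> objs (discrete I)" "f \<in> homs (discrete I) i j"
    then have e: "j = i" and i: "i \<in> I" by (auto simp: discrete_def split: if_splits)
    have "mk_nt (G i) (\<lambda>S x. \<phi> i S (mk_nt (G i) (\<lambda>S x. x) S x)) = \<phi> i"
      unfolding compose_nt_eq_iff[OF \<phi>[OF i]] by simp
    then show "mk_nt (on_obj ?D i) (\<lambda>S x. \<phi> j S (on_mor ?D i j f S x)) = \<phi> i" by (simp add: e family_def)
  qed
  moreover have "is_colimit MS (discrete I) ?D L \<iota>" by (rule ModSch_colimitI[OF dia LM colim])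
  ultimately have "\<exists>!q. q \<in> homs MS L F \<and> (\<forall>j\<in>objs (discrete I). cmp MS (on_obj ?D j) L F q (\<iota> j) = \<phi> j)"
    unfolding is_colimit_iff by blast
  then obtain q where q: "q \<in> nat_trans R L F" and q\<iota>: "\<forall>i\<in>I. mk_nt (G i) (\<lambda>S x. q S (\<iota> i S x)) = \<phi> i"
    unfolding ModSch_simps by (auto simp: discrete_def family_def)
  have "q S ` el L S = el F S" if S: "S \<in> Mods" for S
  proof
    show "q S ` el L S \<subseteq> el F S" using nat_transD(4)[OF q S] by blast
    show "el F S \<subseteq> q S ` el L S"
    proof
      fix x assume "x \<in> el F S"
      then obtain i h where i: "i \<in> I" and h: "h \<in> module_homs R (N i) S" "on_mor F (N i) S h (m i) = x"
        using cov S by blast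
      have hm: "h \<in> el (mod_scheme R (N i)) S" using h(1) by (simp add: mod_scheme_simps)
      have \<alpha>i: "\<alpha> i \<in> nat_trans R (mod_scheme R (N i)) (G i)" and ba: "\<beta> i S (\<alpha> i S h) = h" using G i S hm by auto
      have ah: "\<alpha> i S h \<in> el (G i) S" by (rule nat_transD(4)[OF \<alpha>i S hm])
      have "q S (\<iota> i S (\<alpha> i S h)) = \<phi> i S (\<alpha> i S h)"
        using iffD1[OF compose_nt_eq_iff[OF \<phi>[OF i]] bspec[OF q\<iota> i]] S ah by blast
      also have "\<dots> = x" using S ah ba hm h(2) by (simp add: \<phi>_def)
      finally show "x \<in> q S ` el L S" using nat_transD(4)[OF \<iota>[OF i] S ah] by blast
    qed
  qed
  with LP LM q show ?thesis by (intro exI[of _ L] exI[of _ q]) simp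
qed

text \<open>Covers in \<open>P\<close> of \<open>F\<close> and of the kernel of the first cover present \<open>F\<close> as a cokernel of a
  map in \<open>P\<close>.\<close>

lemma ModSch_minimal:
  assumes P: "stable_containing_RR R P" shows "objs MS \<subseteq> P"
proof
  fix F assume F: "F \<in> objs MS"
  obtain L q where LP: "L \<in> P" and L: "L \<in> objs MS" and q: "q \<in> nat_trans R L F" and qs: "\<forall>S\<in>Mods. q S ` el L S = el F S"
    using cover_in[OF P F] by (elim exE conjE)
  obtain K k where K: "K \<in> objs MS" and k: "k \<in> nat_trans R K L"
    and ker: "\<forall>S\<in>Mods. inj_on (k S) (el K S) \<and> k S ` el K S = kernel (on_obj L S) (on_obj F S) (q S)"
    using ModSch_kernel_ex[OF L F q] by (elim exE conjE)
  obtain L' p where L'P: "L' \<in> P" and L': "L' \<in> objs MS" and p: "p \<in> nat_trans R L' K" and ps: "\<forall>S\<in>Mods. p S ` el L' S = el K S"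
    using cover_in[OF P K] by (elim exE conjE)
  let ?f = "mk_nt L' (\<lambda>S x. k S (p S x))"
  have f: "?f \<in> nat_trans R L' L" by (rule nt_compose[OF ModSchD(1)[OF L'] p k])
  have "is_cokernel Ab (on_obj L' S) (on_obj L S) (?f S) (on_obj F S) (q S)" if S: "S \<in> Mods" for S
  proof (rule Ab_cokernelI[OF ModSchD(5)[OF L' S] ModSchD(5)[OF L S] ModSchD(5)[OF F S] nat_transD(1)[OF q S] bspec[OF qs S]])
    have "?f S ` el L' S = k S ` p S ` el L' S" using S by (simp add: image_image)
    then show "kernel (on_obj L S) (on_obj F S) (q S) = ?f S ` el L' S" using ps ker S by simp
  qed
  moreover have "stable_cokernels R P" using P by (simp add: stable_containing_RR_def)
  ultimately show "F \<in> P"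
    using LP L'P f q ModSchD(4)[OF F] unfolding stable_cokernels_def RR_Mod_simps(1) by blast
qed

end

theorem theorem6p11:
  fixes R :: "('r, 'b) ring_scheme"
  assumes "universe TYPE('u)"
    and "ring R"
    and "small TYPE('u) (carrier R)"
  shows "category (ModSch R :: ('r, 'u) ftr_cat) \<and>
         bicomplete TYPE('u) (ModSch R :: ('r, 'u) ftr_cat) \<and>
         locally_small TYPE('u) (ModSch R :: ('r, 'u) ftr_cat) \<and>
         abelian_category (ModSch R :: ('r, 'u) ftr_cat) \<and>
         stable_containing_RR R (objs (ModSch R :: ('r, 'u) ftr_cat)) \<and>
         (\<forall>P :: ('r, 'u, 'u) group_ftr set.
            stable_containing_RR R P \<longrightarrow> objs (ModSch R) \<subseteq> P)"
proof -
  interpret small_ring "TYPE('u)" R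
    by (intro small_ring.intro universe_type.intro small_ring_axioms.intro assms)
  show ?thesis
    using category_ModSch bicomplete_ModSch locally_small_ModSch abelian_category_ModSch
      stable_containing_RR_ModSch ModSch_minimal by blast
qed

end
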